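(* Let $d\in\{-4,8\}$. For a quadratic discriminant $D$ let $\mathrm{Cl}(D)$ denote the narrow class group of $\mathbb{Q}(\sqrt{D})$. Let $p$ and $q$ denote distinct prime numbers with $p\equiv q\equiv 1 \pmod 4$. Then $$\liminf_{X\to\infty}\frac{\#\{pq\le X:\ \mathrm{rk}_4\,\mathrm{Cl}(dpq)=2,\ \mathrm{rk}_8\,\mathrm{Cl}(dpq)\ge 1\}}{\#\{pq\le X:\ \mathrm{rk}_4\,\mathrm{Cl}(dpq)=2\}}\ \ge\ \frac{1}{|d|},$$ where both sets count integers $pq\le X$ that are products of two distinct primes $p,q\equiv 1\pmod 4$.
   Context: For a finite abelian group $G$, a prime $\ell$ and an integer $k\ge1$, the $\ell^k$-rank is $\mathrm{rk}_{\ell^k}G=\dim_{\mathbb{F}_\ell}\big(G^{\ell^{k-1}}/G^{\ell^k}\big)$. *)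

theory Defs
  imports
    Complex_Main
    "HOL-Library.Extended_Real"
    "HOL-Computational_Algebra.Primes"
    "HOL-Computational_Algebra.Polynomial"
    "HOL-Number_Theory.Residues"
    "HOL-Algebra.Coset"
    "Jordan_Normal_Form.Missing_VectorSpace"
begin

definition quadratic_field :: "int \<Rightarrow> complex set" where
  "quadratic_field D =
     {of_rat a + of_rat b * csqrt (of_int D) | a b :: rat. True}"

text \<open>In the following definitions \<open>K\<close> is meant to be a number field, given as a subfield
  of the complex numbers.\<close>

definition ring_of_integers :: "complex set \<Rightarrow> complex set" where
  "ring_of_integers K = {x \<in> K. algebraic_int x}"

definition fractional_ideal :: "complex set \<Rightarrow> complex set \<Rightarrow> bool" where
  "fractional_ideal K I \<longleftrightarrow>
     I \<subseteq> K \<and> 0 \<in> I \<and> I \<noteq> {0} \<and>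
     (\<forall>x\<in>I. \<forall>y\<in>I. x + y \<in> I) \<and>
     (\<forall>r\<in>ring_of_integers K. \<forall>x\<in>I. r * x \<in> I) \<and>
     (\<exists>c\<in>ring_of_integers K. c \<noteq> 0 \<and> (\<forall>x\<in>I. c * x \<in> ring_of_integers K))"

definition ideal_mult :: "complex set \<Rightarrow> complex set \<Rightarrow> complex set" where
  "ideal_mult I J =
     {\<Sum>i<n. a i * b i | (n :: nat) a b. \<forall>i<n. a i \<in> I \<and> b i \<in> J}"

definition fractional_ideal_group :: "complex set \<Rightarrow> complex set monoid" where
  "fractional_ideal_group K =
     \<lparr>carrier = {I. fractional_ideal K I},
      monoid.mult = ideal_mult,
      one = ring_of_integers K\<rparr>"

text \<open>The real embeddings of \<open>K\<close> are the unital ring homomorphisms from \<open>K\<close> to the reals;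
  only the values on \<open>K\<close> matter. If there are none, every nonzero element is totally positive.\<close>

definition real_embedding :: "complex set \<Rightarrow> (complex \<Rightarrow> real) \<Rightarrow> bool" where
  "real_embedding K \<sigma> \<longleftrightarrow>
     \<sigma> 1 = 1 \<and>
     (\<forall>x\<in>K. \<forall>y\<in>K. \<sigma> (x + y) = \<sigma> x + \<sigma> y \<and> \<sigma> (x * y) = \<sigma> x * \<sigma> y)"

definition totally_positive :: "complex set \<Rightarrow> complex \<Rightarrow> bool" where
  "totally_positive K x \<longleftrightarrow>
     x \<in> K \<and> x \<noteq> 0 \<and> (\<forall>\<sigma>. real_embedding K \<sigma> \<longrightarrow> \<sigma> x > 0)"

definition narrow_principal_ideals :: "complex set \<Rightarrow> complex set set" where
  "narrow_principal_ideals K =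
     {(\<lambda>x. \<alpha> * x) ` ring_of_integers K | \<alpha>. totally_positive K \<alpha>}"

definition narrow_class_group :: "int \<Rightarrow> complex set set monoid" where
  "narrow_class_group D =
     fractional_ideal_group (quadratic_field D) Mod
     narrow_principal_ideals (quadratic_field D)"

definition power_subgroup :: "('a, 'b) monoid_scheme \<Rightarrow> nat \<Rightarrow> 'a set" where
  "power_subgroup G m = {x [^]\<^bsub>G\<^esub> m | x. x \<in> carrier G}"

text \<open>A multiplicatively written abelian group of exponent dividing a prime \<open>l\<close>, viewed as a
  vector space over \<open>residue_ring l\<close>. The ring multiplication fields of the record play
  no role.\<close>

definition elementary_abelian_module :: "('a, 'b) monoid_scheme \<Rightarrow> (int, 'a) module" where
  "elementary_abelian_module G =
     \<lparr>carrier = carrier G, monoid.mult = undefined, one = undefined,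
      zero = \<one>\<^bsub>G\<^esub>, add = monoid.mult G,
      smult = (\<lambda>a x. x [^]\<^bsub>G\<^esub> a)\<rparr>"

text \<open>The \<open>l^k\<close>-rank, for \<open>l\<close> prime and \<open>k \<ge> 1\<close>.\<close>

definition prime_power_rank :: "nat \<Rightarrow> nat \<Rightarrow> ('a, 'b) monoid_scheme \<Rightarrow> nat" where
  "prime_power_rank l k G =
     vectorspace.dim (residue_ring (int l))
       (elementary_abelian_module
          (G\<lparr>carrier := power_subgroup G (l ^ (k - 1))\<rparr> Mod power_subgroup G (l ^ k)))"

definition products_two_primes_1_mod_4 :: "nat set" where
  "products_two_primes_1_mod_4 =
     {p * q | p q. prime p \<and> prime q \<and> p \<noteq> q \<and> [p = 1] (mod 4) \<and> [q = 1] (mod 4)}"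

end

theory Submission
  imports Defs
    "HOL-Computational_Algebra.Squarefree"
    "HOL-Number_Theory.Number_Theory"
    "HOL-Analysis.Analysis"
    "HOL-Real_Asymp.Real_Asymp"
    "HOL-Library.Discrete_Functions"
begin

text \<open>Let \<open>m = - p q\<close> or \<open>m = 2 p q\<close>. By genus theory the kernel of the two genus characters at \<open>p\<close>
  and \<open>q\<close> is the group of squares and the 2-torsion is generated by ramified ideals; hence the 4-rank
  is 2 exactly if \<open>p\<close> and \<open>q\<close> are 1 modulo 8 and \<open>q\<close> is a square modulo \<open>p\<close>, and the 8-rank is
  positive as soon as the character at \<open>p\<close> is trivial on the 4-torsion. A class whose square is the
  ramified class of norm \<open>b\<close> gives \<open>x\<^sup>2 - m y\<^sup>2 = b a\<^sup>2\<close>, and descent expresses its character value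
  \<open>(a/p)\<close> by a quartic symbol of \<open>q\<close> modulo \<open>p\<close> and by symbols \<open>((C + D r)/p)\<close> with
  \<open>q = C\<^sup>2 - M D\<^sup>2\<close> (\<open>2 q\<close> if \<open>M = - 1\<close>) and \<open>r\<^sup>2 = M\<close> modulo \<open>p\<close>, for \<open>M = 2, -2, -1\<close>. Two such
  conditions suffice for \<open>d = - 4\<close>, three for \<open>d = 8\<close>. Detecting them by characters, all nontrivial
  terms are bilinear sums over \<open>p\<close> and \<open>(C, D)\<close>; for \<open>p\<close> small compared to \<open>q\<close> the Cauchy-Schwarz
  inequality and the boundedness of the complete sums over \<open>C\<close> modulo \<open>p\<close> show that they are
  negligible, because almost all \<open>p q \<le> X\<close> have \<open>(log X)\<^sup>2 < p < X\<^bsup>1/7\<^esup>\<close>.\<close>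

section \<open>Legendre and quartic symbols\<close>

lemma Legendre_values: "Legendre a p \<in> {-1, 0, 1}"
  by (auto simp: Legendre_def)

lemma Legendre_eq_0_iff: "Legendre a p = 0 \<longleftrightarrow> p dvd a"
  by (auto simp: Legendre_def cong_0_iff)

lemma Legendre_sign: "\<not> p dvd a \<Longrightarrow> Legendre a p \<in> {-1, 1}"
  using Legendre_values[of a p] Legendre_eq_0_iff[of a p] by auto

lemma Legendre_cong: "[a = b] (mod p) \<Longrightarrow> Legendre a p = Legendre b p"
  unfolding Legendre_def QuadRes_def by (simp add: Cong.cong_def)

lemma cong_imp_eq_sign:
  fixes p :: nat and x y :: int
  assumes "[x = y] (mod int p)" "2 < p" "x \<in> {-1, 0, 1}" "y \<in> {-1, 0, 1}"
  shows "x = y"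
proof (rule ccontr)
  assume "x \<noteq> y"
  have "int p dvd x - y" using assms(1) by (simp add: cong_iff_dvd_diff)
  hence "\<bar>int p\<bar> \<le> \<bar>x - y\<bar>"
    using dvd_imp_le_int[of "x - y" "int p"] \<open>x \<noteq> y\<close> by simp
  moreover have "\<bar>x - y\<bar> \<le> 2" using assms(3,4) by auto
  ultimately show False using assms(2) by simp
qed

lemma Legendre_eqI:
  fixes p :: nat
  assumes "prime p" "2 < p" "[a^((p - 1) div 2) = s] (mod int p)" "s \<in> {-1, 0, 1}"
  shows "Legendre a p = s"
  by (rule cong_imp_eq_sign[OF cong_trans[OF euler_criterion[OF assms(1,2)] assms(3)] assms(2) Legendre_values
    assms(4)])

lemma Legendre_mult:
  fixes p :: nat
  assumes "prime p" "2 < p"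
  shows "Legendre (a * b) p = Legendre a p * Legendre b p"
proof (rule Legendre_eqI[OF assms])
  show "[(a * b)^((p - 1) div 2) = Legendre a p * Legendre b p] (mod int p)"
    unfolding power_mult_distrib by (intro cong_mult cong_sym[OF euler_criterion[OF assms]])
  show "Legendre a (int p) * Legendre b (int p) \<in> {-1, 0, 1}"
    using Legendre_values[of a p] Legendre_values[of b p] by auto
qed

lemma Legendre_square:
  assumes "\<not> p dvd a" "prime p" shows "Legendre (a * a) p = 1"
  using assms unfolding Legendre_def QuadRes_def cong_0_iff
  by (auto simp: prime_dvd_mult_iff power2_eq_square intro: exI[of _ a])

lemma Legendre_1 [simp]: "prime p \<Longrightarrow> Legendre 1 p = 1"
  using Legendre_square[of p 1] by auto

lemma Legendre_power:
  fixes p :: nat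
  assumes "prime p" "2 < p"
  shows "Legendre (a^k) p = Legendre a p^k"
  using assms by (induction k) (simp_all add: Legendre_mult)

lemma Legendre_prod:
  fixes p :: nat
  assumes "prime p" "2 < p"
  shows "Legendre (prod f A) p = (\<Prod>x\<in>A. Legendre (f x) p)"
  using assms by (induction A rule: infinite_finite_induct) (simp_all add: Legendre_mult)

lemma prime_1_mod_4_gt_2: "prime p \<Longrightarrow> [p = 1] (mod 4) \<Longrightarrow> 2 < (p::nat)"
  using prime_ge_2_nat[of p] by (cases "p = 2") (auto simp: Cong.cong_def)

lemma Legendre_minus_1:
  fixes p :: nat
  assumes "prime p" "[p = 1] (mod 4)"
  shows "Legendre (- 1) p = 1"
proof (rule Legendre_eqI[OF assms(1) prime_1_mod_4_gt_2[OF assms]])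
  have "even ((p - 1) div 2)" using assms(2) by (simp add: Cong.cong_def) presburger
  thus "[(- 1)^((p - 1) div 2) = 1] (mod int p)" by simp
qed simp

lemma Legendre_reciprocity:
  fixes p l :: nat
  assumes "prime p" "2 < p" "prime l" "2 < l" "[p = 1] (mod 4)"
  shows "Legendre p l = Legendre l p"
proof (cases "p = l")
  case False
  have "even ((p - 1) div 2)" using assms(5) by (simp add: Cong.cong_def) presburger
  hence "Legendre p l * Legendre l p = 1"
    using Quadratic_Reciprocity[OF assms(1-4) False] by simp
  thus ?thesis using Legendre_values[of p l] Legendre_values[of l p] by auto
qed auto

definition chi8 :: "int \<Rightarrow> int" where
  "chi8 n = (if even n then 0 else if n mod 8 \<in> {1, 7} then 1 else -1)"

lemma chi8_mod: "chi8 (n mod 8) = chi8 n"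
  by (auto simp: chi8_def) presburger+

lemma chi8_mult: "chi8 (a * b) = chi8 a * chi8 b"
proof -
  have residues: "n mod 8 \<in> {0, 1, 2, 3, 4, 5, 6, 7}" for n :: int by simp presburger
  hence "chi8 ((a mod 8) * (b mod 8) mod 8) = chi8 (a mod 8) * chi8 (b mod 8)"
    using residues[of a] residues[of b]
    unfolding insert_iff empty_iff by (elim disjE) (simp_all add: chi8_def)
  thus ?thesis by (simp add: mod_mult_eq chi8_mod)
qed

lemma Legendre_2:
  fixes p :: nat
  assumes "prime p" "2 < p"
  shows "Legendre 2 p = chi8 p"
proof -
  have "\<not> int p dvd 2" using assms(2) by (auto dest: zdvd_imp_le)
  then interpret GAUSS p 2 using assms by unfold_locales (auto simp: cong_0_iff)
  define h where "h = (int p - 1) div 2"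
  have p_eq: "int p = 2 * h + 1" using p_eq2 unfolding h_def .
  have "C = B" unfolding C_def B_def A_def h_def[symmetric] using p_eq by (force simp: image_image)
  hence "E = (\<lambda>x. x * 2) ` {h div 2<..h}"
    unfolding E_def B_def A_def h_def[symmetric] using p_eq by auto
  hence "card E = nat (h - h div 2)" by (simp add: card_image inj_on_def)
  moreover have "even (nat (h - h div 2)) \<longleftrightarrow> int p mod 8 \<in> {1, 7}" "odd (int p)"
    using p_eq assms(2) by (simp_all add: even_nat_iff) presburger
  ultimately show ?thesis unfolding gauss_lemma chi8_def by (simp add: minus_one_power_iff)
qed

lemma multiplicative_eqI:
  fixes f g :: "int \<Rightarrow> int"
  assumes "\<And>a b. f (a * b) = f a * f b" "\<And>a b. g (a * b) = g a * g b" "f 1 = g 1" "f (- 1) = g (- 1)"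
    and "n \<noteq> 0" "\<And>l::nat. prime l \<Longrightarrow> int l dvd n \<Longrightarrow> f l = g l"
  shows "f n = g n"
  using assms(5,6)
proof (induction n rule: prime_divisors_induct)
  case (unit n)
  hence "n = 1 \<or> n = -1" by auto
  thus ?case using assms(3,4) by auto
next
  case (factor l n)
  have "f l = g l" using factor.prems(2)[of "nat l"] factor.hyps by (simp add: prime_ge_0_int)
  moreover have "f n = g n" using factor by auto
  ultimately show ?case by (simp add: assms(1,2))
qed simp

definition quartic :: "nat \<Rightarrow> int \<Rightarrow> int" where
  "quartic p a = (if Legendre a p = 1 then (if \<exists>y. [y^4 = a] (mod int p) then 1 else -1) else 0)"

lemma quartic_cong: "[a = b] (mod int p) \<Longrightarrow> quartic p a = quartic p b"
  unfolding quartic_def using Legendre_cong[of a b p] by (simp add: Cong.cong_def)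

lemma quartic_values: "quartic p a \<in> {-1, 0, 1}"
  by (auto simp: quartic_def)

lemma quartic_sign: "Legendre a p = 1 \<Longrightarrow> quartic p a \<in> {-1, 1}"
  by (auto simp: quartic_def)

lemma quartic_square:
  fixes p :: nat
  assumes p: "prime p" "[p = 1] (mod 4)" and u: "\<not> int p dvd u"
  shows "quartic p (u * u) = Legendre u p"
proof -
  note mult = Legendre_mult[OF p(1) prime_1_mod_4_gt_2[OF p]] and minus_1 = Legendre_minus_1[OF p]
  have "(\<exists>y. [y^4 = u * u] (mod int p)) \<longleftrightarrow> Legendre u p = 1"
  proof
    assume "Legendre u p = 1"
    then obtain y where "[y^2 = u] (mod int p)" by (auto simp: Legendre_def QuadRes_def split: if_splits)
    hence "[y^2 * y^2 = u * u] (mod int p)" by (intro cong_mult)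
    hence "[y^4 = u * u] (mod int p)" by (simp flip: power_add)
    thus "\<exists>y. [y^4 = u * u] (mod int p)" ..
  next
    assume "\<exists>y. [y^4 = u * u] (mod int p)"
    then obtain y where "int p dvd y^4 - u * u" by (auto simp: cong_iff_dvd_diff)
    moreover have "y^4 - u * u = (y * y - u) * (y * y - - 1 * u)"
      by (simp add: algebra_simps power4_eq_xxxx)
    ultimately have "[y * y = u] (mod int p) \<or> [y * y = - 1 * u] (mod int p)"
      using p(1) by (simp add: cong_iff_dvd_diff prime_dvd_mult_iff)
    hence "Legendre (y * y) p = Legendre u p"
      using Legendre_cong[of "y * y" _ p] mult[of "-1" u] minus_1 by auto
    moreover have "Legendre (y * y) p \<noteq> -1"
      using mult[of y y] Legendre_values[of y p] by auto
    ultimately show "Legendre u p = 1" using Legendre_sign[OF u] by auto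
  qed
  moreover have "Legendre (u * u) p = 1" using u p by (simp add: Legendre_square)
  ultimately show ?thesis unfolding quartic_def using Legendre_sign[OF u] by auto
qed

lemma Legendre_eq_1E:
  assumes "Legendre a p = 1" "prime p"
  obtains u where "[u * u = a] (mod p)" "\<not> p dvd u"
proof -
  obtain u where root: "[u * u = a] (mod p)"
    using assms by (auto simp: Legendre_def QuadRes_def power2_eq_square split: if_splits)
  have "\<not> p dvd a" using assms Legendre_eq_0_iff[of a p] by auto
  hence "\<not> p dvd u" using root cong_dvd_iff dvd_mult by blast
  thus ?thesis using root that by blast
qed

lemma quartic_square_mult:
  fixes p :: nat
  assumes p: "prime p" "[p = 1] (mod 4)" and a: "\<not> int p dvd a"
  shows "quartic p ((a * a) * x) = Legendre a (int p) * quartic p x"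
proof -
  have gt_2: "2 < p" by (rule prime_1_mod_4_gt_2[OF p])
  have pi: "prime (int p)" using p by simp
  have square: "Legendre (a * a) (int p) = 1" by (rule Legendre_square[OF a pi])
  show ?thesis
  proof (cases "Legendre x (int p) = 1")
    case True
    then obtain u where u: "[u * u = x] (mod int p)" "\<not> int p dvd u" using Legendre_eq_1E pi by blast
    have "[(a * u) * (a * u) = (a * a) * x] (mod int p)"
      using cong_mult[OF cong_refl[of "a * a"] u(1)] by (simp add: ac_simps)
    hence "quartic p ((a * a) * x) = quartic p ((a * u) * (a * u))" using quartic_cong by metis
    also have "... = Legendre a p * Legendre u p"
      using quartic_square[OF p] a u(2) pi by (simp add: prime_dvd_mult_iff Legendre_mult[OF p(1) gt_2])
    finally show ?thesis using quartic_square[OF p u(2)] quartic_cong[OF u(1)] by simp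
  next
    case False
    hence "Legendre ((a * a) * x) (int p) \<noteq> 1"
      unfolding Legendre_mult[OF p(1) gt_2, of "a * a" x] square by simp
    thus ?thesis using False unfolding quartic_def by simp
  qed
qed

lemma quartic_mult:
  fixes p :: nat
  assumes p: "prime p" "[p = 1] (mod 4)" and a: "Legendre a p = 1"
  shows "quartic p (a * b) = quartic p a * quartic p b"
proof -
  obtain u where u: "[u * u = a] (mod int p)" "\<not> int p dvd u" using Legendre_eq_1E[OF a] p(1) by auto
  have "quartic p (a * b) = quartic p ((u * u) * b)"
    using quartic_cong[OF cong_mult[OF u(1) cong_refl]] by simp
  also have "... = quartic p a * quartic p b"
    using quartic_square_mult[OF p u(2)] quartic_square[OF p u(2)] quartic_cong[OF u(1)] by simp
  finally show ?thesis .
qed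

lemma cong_1_mod_8_imp_mod_4: "[p = 1] (mod 8) \<Longrightarrow> [p = (1::nat)] (mod 4)"
  by (rule cong_dvd_modulus_nat) auto

lemma Legendre_1_mod_8:
  fixes p :: nat
  assumes "prime p" "[p = 1] (mod 8)"
  shows "Legendre 2 p = 1" "Legendre (- 1) p = 1" "2 < p"
proof -
  show "2 < p" using assms prime_1_mod_4_gt_2 cong_1_mod_8_imp_mod_4 by blast
  thus "Legendre (- 1) p = 1" using assms Legendre_minus_1 cong_1_mod_8_imp_mod_4 by blast
  have "int p mod 8 = 1" using assms(2) zmod_int[of p 8] by (simp add: Cong.cong_def)
  moreover from this have "odd (int p)" by presburger
  ultimately show "Legendre 2 p = 1" using Legendre_2[OF assms(1) \<open>2 < p\<close>] by (simp add: chi8_def)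
qed

lemma quartic_minus_1:
  fixes p :: nat
  assumes p: "prime p" "[p = 1] (mod 8)"
  shows "quartic p (- 1) = 1"
proof -
  have mod_4: "[p = 1] (mod 4)" using p(2) by (rule cong_1_mod_8_imp_mod_4)
  obtain u where u: "[u * u = - 1] (mod int p)" "\<not> int p dvd u"
    using Legendre_eq_1E[OF Legendre_1_mod_8(2)[OF p]] p by auto
  have "Legendre u p = 1"
  proof (rule Legendre_eqI[OF p(1) Legendre_1_mod_8(3)[OF p]])
    have "8 dvd p - 1" using p(2) by (simp add: Cong.cong_def) presburger
    then obtain k where "p - 1 = 8 * k" by (elim dvdE)
    hence "u^((p - 1) div 2) = (u * u)^(2 * k)" by (simp add: power_mult_distrib flip: power_add)
    moreover have "[(u * u)^(2 * k) = (- 1)^(2 * k)] (mod int p)" using u(1) by (rule cong_pow)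
    ultimately show "[u^((p - 1) div 2) = 1] (mod int p)" by simp
  qed simp
  thus ?thesis using quartic_cong[OF u(1)] quartic_square[OF p(1) mod_4 u(2)] by simp
qed

lemma Legendre_eq_1_if_inert_even:
  fixes p :: nat and n :: int
  assumes p: "prime p" "[p = 1] (mod 8)" and n: "n \<noteq> 0" "\<not> int p dvd n"
    and inert: "\<And>l::nat. prime l \<Longrightarrow> 2 < l \<Longrightarrow> Legendre p l = -1 \<Longrightarrow> even (multiplicity (int l) n)"
  shows "Legendre n p = 1"
proof -
  note mod_8 = Legendre_1_mod_8[OF p]
  have factor: "Legendre l p^multiplicity l n = 1" if "l \<in> prime_factors n" for l
  proof -
    have "prime l" "l dvd n" using that by auto
    then obtain l' where l: "l = int l'" "prime l'" by (metis prime_int_nat_transfer prime_ge_0_int nat_0_le)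
    have "\<not> int p dvd l" using n(2) \<open>l dvd n\<close> dvd_trans by blast
    from Legendre_sign[OF this] consider "Legendre l p = 1" | "Legendre l p = -1" by blast
    thus ?thesis
    proof cases
      case 2
      hence "2 < l'" using mod_8(1) prime_ge_2_nat[OF l(2)] l(1) by (cases "l' = 2") auto
      hence "even (multiplicity l n)"
        using inert[OF l(2)] Legendre_reciprocity[OF p(1) mod_8(3) l(2) _ cong_1_mod_8_imp_mod_4[OF p(2)]] 2
          l(1) by simp
      thus ?thesis using 2 by simp
    qed simp
  qed
  have "Legendre (unit_factor n) p = 1" using n(1) p mod_8(2) by (cases "n > 0") (auto simp: sgn_if)
  moreover have "Legendre (normalize n) p = 1"
    unfolding prod_prime_factors[OF n(1), symmetric] Legendre_prod[OF p(1) mod_8(3)]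
      Legendre_power[OF p(1) mod_8(3)]
    by (rule prod.neutral) (use factor in blast)
  ultimately show ?thesis
    using Legendre_mult[OF p(1) mod_8(3), of "unit_factor n" "normalize n"]
    by (simp only: unit_factor_mult_normalize)
qed

lemma Legendre_eq_1_if_square_cong:
  fixes l :: int
  assumes "prime l" "l dvd a * (x * x) - y * y" "\<not> l dvd x" "\<not> l dvd a"
  shows "Legendre a l = 1"
proof -
  have "coprime x l" using assms by (simp add: prime_imp_coprime coprime_commute)
  then obtain t where t: "[x * t = 1] (mod l)" using cong_solve_coprime_int by blast
  have "[a * (x * x) = y * y] (mod l)" using assms(2) by (simp add: cong_iff_dvd_diff)
  hence "[a * (x * x) * (t * t) = y * y * (t * t)] (mod l)" by (rule cong_mult) simp
  moreover have "[a * ((x * t) * (x * t)) = a * (1 * 1)] (mod l)" by (intro cong_mult t) auto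
  ultimately have "[(y * t)^2 = a] (mod l)"
    by (simp add: power2_eq_square algebra_simps) (meson cong_sym cong_trans)
  thus ?thesis using assms(4) by (auto simp: Legendre_def QuadRes_def cong_0_iff)
qed

lemma even_multiplicity_norm_form_inert:
  fixes l p :: nat and U V :: int
  assumes l: "prime l" "Legendre p l = -1" and nonzero: "U * U - p * (V * V) \<noteq> 0"
  shows "even (multiplicity (int l) (U * U - p * (V * V)))"
  using nonzero
proof (induction "nat (\<bar>U\<bar>+\<bar>V\<bar>)" arbitrary: U V rule: less_induct)
  case less
  show ?case
  proof (cases "int l dvd U * U - p * (V * V)")
    case False
    thus ?thesis by (simp add: not_dvd_imp_multiplicity_0)
  next
    case True
    have prime_l: "prime (int l)" using l by simp
    have "\<not> int l dvd int p" using l Legendre_eq_0_iff[of "int p" l] by auto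
    moreover have "int l dvd p * (V * V) - U * U" using True by (metis dvd_minus_iff minus_diff_eq)
    ultimately have V: "int l dvd V"
      using Legendre_eq_1_if_square_cong[OF prime_l, of p V U] l(2) by auto
    hence "int l dvd U * U" using dvd_add[OF True, of "p * (V * V)"] by simp
    hence U: "int l dvd U" using prime_l by (simp add: prime_dvd_mult_iff)
    obtain U' V' where UV: "U = int l * U'" "V = int l * V'" using U V by (auto elim!: dvdE)
    have norm_eq: "U * U - p * (V * V) = int l * (int l * (U' * U' - p * (V' * V')))"
      unfolding UV by (simp add: algebra_simps)
    have nonzero': "U' * U' - p * (V' * V') \<noteq> 0" using less.prems norm_eq by auto
    have "l \<ge> 2" using l prime_ge_2_nat by blast
    hence "\<bar>U\<bar> \<ge> 2 * \<bar>U'\<bar>" "\<bar>V\<bar> \<ge> 2 * \<bar>V'\<bar>"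
      unfolding UV abs_mult by (auto intro: mult_right_mono)
    moreover have "U' \<noteq> 0 \<or> V' \<noteq> 0" using nonzero' by auto
    ultimately have "even (multiplicity (int l) (U' * U' - p * (V' * V')))"
      by (intro less.hyps nonzero') linarith
    thus ?thesis unfolding norm_eq using nonzero' l \<open>l \<ge> 2\<close>
      by (simp add: multiplicity_times_same)
  qed
qed

definition sign16 :: "nat \<Rightarrow> int" where
  "sign16 p = (if [p = 1] (mod 16) then 1 else -1)"

lemma odd_square_mod_16:
  fixes n :: int
  assumes "odd n"
  shows "n * n mod 16 = (if chi8 n = 1 then 1 else 9)"
proof -
  define r where "r = n mod 8"
  obtain j where "n = 8 * j + r" using r_def by (metis mult_div_mod_eq)
  hence "n * n = r * r + 16 * (4 * j * j + j * r)" by (simp add: algebra_simps)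
  hence "n * n mod 16 = r * r mod 16" by (simp only: mod_mult_self2)
  moreover have "r = 1 \<or> r = 3 \<or> r = 5 \<or> r = 7" using assms unfolding r_def by presburger
  ultimately show ?thesis using assms unfolding chi8_def r_def[symmetric] by auto
qed

lemma odd_square_mod_8: "odd (n::int) \<Longrightarrow> n * n mod 8 = 1"
  using odd_square_mod_16[of n] by (simp split: if_splits) presburger+

text \<open>The solutions of \<open>z\<^sup>2 - 2 x\<^sup>2 = - p y\<^sup>2\<close>: Jacobi reciprocity makes \<open>(z/p)\<close> depend on \<open>z\<close> modulo 8 only, and
  the equation modulo 16 determines \<open>z\<close> modulo 8 up to sign.\<close>

context
  fixes p :: nat and z x y :: int
  assumes p: "prime p" "[p = 1] (mod 8)" and norm_eq: "z * z - 2 * (x * x) = - (int p * (y * y))"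
    and coprime: "coprime z x"
begin

lemma odd_if_norm_sqrt2: "odd z" "odd x" "odd y"
proof -
  have p_mod_8: "int p mod 8 = 1" using p(2) zmod_int[of p 8] by (simp add: Cong.cong_def)
  hence "odd (int p)" by presburger
  have sum_eq: "z * z + int p * (y * y) = 2 * (x * x)" using norm_eq by simp
  hence "even (z * z + int p * (y * y))" by simp
  hence parity: "even z \<longleftrightarrow> even y" using \<open>odd (int p)\<close> by simp
  show "odd z"
  proof
    assume "even z"
    then obtain a b where ab: "z = 2 * a" "y = 2 * b" using parity by (auto elim!: evenE)
    have "x * x = 2 * (a * a + int p * (b * b))" using sum_eq unfolding ab by (simp add: algebra_simps)
    hence "even x" by (metis dvd_triv_left even_mult_iff)
    thus False using coprime \<open>even z\<close> by (metis coprime_common_divisor odd_one)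
  qed
  thus "odd y" using parity by simp
  have "(z * z + int p * (y * y)) mod 8 = (z * z mod 8 + (int p mod 8) * (y * y mod 8) mod 8) mod 8"
    by (simp only: mod_add_eq mod_mult_eq)
  also have "... = 2" using odd_square_mod_8 p_mod_8 \<open>odd z\<close> \<open>odd y\<close> by simp
  finally have "2 * (x * x) mod 8 = 2" unfolding sum_eq .
  moreover have "odd t" if "2 * t mod 8 = 2" for t :: int using that by presburger
  ultimately show "odd x" by fastforce
qed

lemma odd_prime_not_dvd_norm_sqrt2:
  fixes l :: nat
  assumes l: "prime l" "int l dvd z \<or> int l dvd y"
  shows "2 < l" "\<not> int l dvd 2" "\<not> int l dvd x"
proof -
  have "l \<noteq> 2" using odd_if_norm_sqrt2 l(2) by auto
  thus "2 < l" using prime_ge_2_nat[OF l(1)] by simp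
  thus not_dvd_2: "\<not> int l dvd 2" by (auto dest: zdvd_imp_le)
  have prime_l: "prime (int l)" using l by simp
  show "\<not> int l dvd x"
  proof
    assume dvd_x: "int l dvd x"
    hence "\<not> int l dvd z" using coprime prime_l by (meson coprime_common_divisor not_prime_unit)
    hence "int l dvd y" using l(2) by blast
    hence "int l dvd 2 * (x * x) - int p * (y * y)" using dvd_x by (intro dvd_diff) auto
    moreover have "2 * (x * x) - int p * (y * y) = z * z" using norm_eq by simp
    ultimately have "int l dvd z * z" by simp
    thus False using prime_l \<open>\<not> int l dvd z\<close> by (simp add: prime_dvd_mult_iff)
  qed
qed

lemma chi8_norm_sqrt2: "chi8 y = 1"
proof (rule multiplicative_eqI[where f = chi8 and g = "\<lambda>_. 1"])
  show "y \<noteq> 0" using odd_if_norm_sqrt2(3) by auto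
  fix l :: nat assume l: "prime l" "int l dvd y"
  note ndvd = odd_prime_not_dvd_norm_sqrt2[OF l(1) disjI2[OF l(2)]]
  have "2 * (x * x) - z * z = int p * (y * y)" using norm_eq by simp
  hence "int l dvd 2 * (x * x) - z * z" using l(2) by simp
  hence "Legendre 2 l = 1" using Legendre_eq_1_if_square_cong ndvd l(1) by auto
  thus "chi8 l = 1" using Legendre_2[OF l(1) ndvd(1)] by simp
qed (simp_all add: chi8_mult, simp_all add: chi8_def)

lemma Legendre_norm_sqrt2_eq_chi8:
  assumes z: "\<not> int p dvd z"
  shows "Legendre z p = chi8 z"
proof (rule multiplicative_eqI[where f = "\<lambda>n. Legendre n p" and g = chi8])
  note mod_8 = Legendre_1_mod_8[OF p]
  show "z \<noteq> 0" using z by auto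
  show "Legendre (a * b) p = Legendre a p * Legendre b p" for a b by (rule Legendre_mult[OF p(1) mod_8(3)])
  show "Legendre 1 p = chi8 1" "Legendre (- 1) p = chi8 (- 1)" using p(1) mod_8(2) by (simp_all add: chi8_def)
  fix l :: nat assume l: "prime l" "int l dvd z"
  note ndvd = odd_prime_not_dvd_norm_sqrt2[OF l(1) disjI1[OF l(2)]]
  have prime_l: "prime (int l)" using l by simp
  have "\<not> int l dvd int p" using z l by (metis p(1) primes_dvd_imp_eq int_dvd_int_iff)
  have sum_eq: "int p * (y * y) + z * z = 2 * (x * x)" using norm_eq by simp
  have "\<not> int l dvd y"
  proof
    assume "int l dvd y"
    hence "int l dvd 2 * (x * x)" unfolding sum_eq[symmetric] using l(2) by (intro dvd_add) auto
    thus False using prime_l ndvd by (simp add: prime_dvd_mult_iff)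
  qed
  moreover have "(2 * int p) * (y * y) - (2 * x) * (2 * x) = -2 * (z * z)"
    using sum_eq by (simp add: algebra_simps)
  hence "int l dvd (2 * int p) * (y * y) - (2 * x) * (2 * x)" using l(2) by simp
  ultimately have "Legendre (2 * int p) l = 1"
    using Legendre_eq_1_if_square_cong[OF prime_l, of "2 * int p" y "2 * x"] prime_l ndvd \<open>\<not> int l dvd int p\<close>
    by (simp add: prime_dvd_mult_iff)
  hence "Legendre 2 l = Legendre p l"
    using Legendre_mult[OF l(1) ndvd(1)] Legendre_values[of 2 l] Legendre_values[of p l] by auto
  thus "Legendre l p = chi8 l"
    using Legendre_2[OF l(1) ndvd(1)] Legendre_reciprocity[OF p(1) mod_8(3) l(1) ndvd(1)
      cong_1_mod_8_imp_mod_4[OF p(2)]]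
    by simp
qed (rule chi8_mult)

lemma chi8_norm_sqrt2_eq_sign16: "chi8 z = sign16 p"
proof -
  note odd = odd_if_norm_sqrt2
  have "int p mod 8 = 1" using p(2) zmod_int[of p 8] by (simp add: Cong.cong_def)
  hence p_mod_16: "int p mod 16 = 1 \<or> int p mod 16 = 9" by presburger
  have y_mod_16: "y * y mod 16 = 1" using odd_square_mod_16[OF odd(3)] chi8_norm_sqrt2 by simp
  have "2 * (x * x) mod 16 = 2" using odd_square_mod_8[OF odd(2)] mod_mult_mult1[of 2 "x * x" 8] by simp
  moreover have "z * z = 2 * (x * x) - int p * (y * y)" using norm_eq by simp
  hence "z * z mod 16 = (2 * (x * x) mod 16 - (int p mod 16) * (y * y mod 16) mod 16) mod 16"
    by (simp only: mod_diff_eq mod_mult_eq)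
  ultimately have "z * z mod 16 = (2 - int p mod 16) mod 16" using y_mod_16 by simp
  hence "z * z mod 16 = 1 \<longleftrightarrow> int p mod 16 = 1" using p_mod_16 by auto
  moreover have "int p mod 16 = 1 \<longleftrightarrow> [p = 1] (mod 16)"
    using cong_int_iff[of p 1 16] by (simp add: Cong.cong_def)
  moreover have "chi8 z \<in> {-1, 1}" using odd(1) by (simp add: chi8_def)
  ultimately show ?thesis using odd_square_mod_16[OF odd(1)] by (auto simp: sign16_def split: if_splits)
qed

lemma Legendre_norm_sqrt2: "\<not> int p dvd z \<Longrightarrow> Legendre z p = sign16 p"
  using Legendre_norm_sqrt2_eq_chi8 chi8_norm_sqrt2_eq_sign16 by simp

end

text \<open>Multiplying by \<open>C + D \<surd>2\<close> of norm \<open>q\<close> removes the factor \<open>q\<close> from the norm, up to a square.\<close>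
lemma Legendre_composed_norm_sqrt2:
  fixes p q :: nat and z x y C D :: int
  assumes p: "prime p" "[p = 1] (mod 8)" and q: "prime q" "Legendre q p = 1"
    and norm_eq: "z * z - 2 * (x * x) = - (int p * int q * (y * y))" and coprime: "coprime z x"
    and rep: "int q = C * C - 2 * (D * D)" and Z: "\<not> int p dvd C * z + 2 * D * x"
  shows "Legendre (C * z + 2 * D * x) p = sign16 p"
proof -
  define Z X where "Z = C * z + 2 * D * x" and "X = C * x + D * z"
  have composed: "Z * Z - 2 * (X * X) = - (int p * (int q * y * (int q * y)))"
  proof -
    have "Z * Z - 2 * (X * X) = int q * (z * z - 2 * (x * x))"
      unfolding Z_def X_def rep by (simp add: algebra_simps)
    thus ?thesis unfolding norm_eq by (simp add: algebra_simps)
  qed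
  define g where "g = gcd Z X"
  have "Z \<noteq> 0" using Z unfolding Z_def by auto
  hence "g > 0" unfolding g_def by simp
  obtain Z' X' where ZX: "Z = g * Z'" "X = g * X'" "coprime Z' X'"
    using gcd_coprime_exists[of Z X] \<open>Z \<noteq> 0\<close> unfolding g_def by (auto simp: mult.commute)
  have "int q * z = C * Z - 2 * D * X" "int q * x = C * X - D * Z"
    unfolding Z_def X_def rep by (simp_all add: algebra_simps)
  hence "g dvd int q * z" "g dvd int q * x" unfolding ZX by simp_all
  hence "g dvd gcd (int q * z) (int q * x)" by simp
  hence "g dvd int q" using coprime by (simp add: gcd_mult_distrib_int[symmetric])
  hence g_cases: "g = 1 \<or> g = int q"
    using q(1) \<open>g > 0\<close> by (metis prime_int_iff prime_nat_int_transfer order_less_imp_le)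
  have Z': "\<not> int p dvd Z'" using Z unfolding Z_def[symmetric] ZX by auto
  have "Legendre Z p = Legendre Z' p"
    unfolding ZX Legendre_mult[OF p(1) Legendre_1_mod_8(3)[OF p]] using g_cases q(2) p by auto
  also have "Legendre Z' p = sign16 p"
  proof (cases "g = 1")
    case True
    thus ?thesis using Legendre_norm_sqrt2[OF p composed] ZX Z' by auto
  next
    case False
    hence "int q * int q * (Z' * Z' - 2 * (X' * X')) = int q * int q * (- (int p * (y * y)))"
      using composed g_cases unfolding ZX by (simp add: algebra_simps)
    moreover have "int q * int q \<noteq> 0" using prime_gt_0_nat[OF q(1)] by simp
    ultimately have "Z' * Z' - 2 * (X' * X') = - (int p * (y * y))" using mult_left_cancel by blast
    thus ?thesis using Legendre_norm_sqrt2[OF p _ ZX(3) Z'] by blast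
  qed
  finally show ?thesis unfolding Z_def .
qed

lemma norm_form_factors_cong:
  fixes M r C D :: int
  assumes "[r * r = M] (mod n)"
  shows "[(C + D * r) * (C - D * r) = C * C - M * (D * D)] (mod n)"
proof -
  have "(C + D * r) * (C - D * r) = C * C - (r * r) * (D * D)" by (simp add: algebra_simps)
  thus ?thesis using assms by (simp add: cong_diff cong_mult)
qed

lemma Legendre_norm_form_factors:
  fixes p :: nat and M r C D :: int
  assumes p: "prime p" "2 < p" and "[r * r = M] (mod int p)" "Legendre (C * C - M * (D * D)) p = 1"
  shows "Legendre (C + D * r) p \<in> {-1, 1}" "Legendre (C - D * r) p = Legendre (C + D * r) p"
    "\<not> int p dvd C + D * r"
proof -
  have "Legendre (C + D * r) p * Legendre (C - D * r) p = 1"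
    using Legendre_cong[OF norm_form_factors_cong[OF assms(3)]] assms(4) by (simp add: Legendre_mult[OF p])
  thus "Legendre (C + D * r) p \<in> {-1, 1}" "Legendre (C - D * r) p = Legendre (C + D * r) p"
    "\<not> int p dvd C + D * r"
    using Legendre_values[of "C + D * r" p] Legendre_values[of "C - D * r" p] Legendre_eq_0_iff[of "C
      + D * r" p] by auto
qed

lemma Legendre_eq_sign16_split:
  fixes p q :: nat and z x y C D r :: int
  assumes p: "prime p" "[p = 1] (mod 8)" and q: "prime q" "Legendre q p = 1"
    and norm_eq: "z * z - 2 * (x * x) = - (int p * int q * (y * y))" and coprime: "coprime z x"
      and z: "\<not> int p dvd z"
    and rep: "int q = C * C - 2 * (D * D)" and r: "[r * r = 2] (mod int p)"
  shows "Legendre z p = sign16 p * Legendre (C + D * r) p"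
proof -
  have pi: "prime (int p)" using p by simp
  note mult = Legendre_mult[OF p(1) Legendre_1_mod_8(3)[OF p]]
  have aligned: "Legendre z p = sign16 p * Legendre (C + D * s) p"
    if s: "[s * s = 2] (mod int p)" and zs: "[z = x * s] (mod int p)" for s
  proof -
    note factors = Legendre_norm_form_factors[OF p(1) Legendre_1_mod_8(3)[OF p] s, of C D, folded rep, OF
      q(2)]
    have "[(C + D * s) * (x * s) = C * (x * s) + D * x * (s * s)] (mod int p)" by (simp add: algebra_simps)
    also have "[C * (x * s) + D * x * (s * s) = C * (x * s) + D * x * 2] (mod int p)"
      by (intro cong_add cong_mult cong_refl s)
    also have "[C * (x * s) + D * x * 2 = C * z + 2 * D * x] (mod int p)"
      using cong_mult[OF cong_refl cong_sym[OF zs], of C] cong_add[OF _ cong_refl] by (simp add: ac_simps)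
    finally have composed: "[(C + D * s) * z = C * z + 2 * D * x] (mod int p)"
      using cong_mult[OF cong_refl zs] cong_trans by blast
    hence "\<not> int p dvd C * z + 2 * D * x" using factors(3) z pi by (metis cong_dvd_iff prime_dvd_mult_iff)
    hence "Legendre (C + D * s) p * Legendre z p = sign16 p"
      using Legendre_composed_norm_sqrt2[OF p q norm_eq coprime rep] Legendre_cong[OF composed] mult by simp
    thus ?thesis using factors(1) by auto
  qed
  have "int p dvd z * z - 2 * (x * x)" unfolding norm_eq by simp
  moreover have "int p dvd (x * x) * (r * r - 2)" using r by (simp add: cong_iff_dvd_diff)
  ultimately have "int p dvd (z * z - 2 * (x * x)) - (x * x) * (r * r - 2)" by (rule dvd_diff)
  moreover have "(z * z - 2 * (x * x)) - (x * x) * (r * r - 2) = (z - x * r) * (z - x * (- r))"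
    by (simp add: algebra_simps)
  ultimately consider "[z = x * r] (mod int p)" | "[z = x * (- r)] (mod int p)"
    using pi by (metis cong_iff_dvd_diff prime_dvd_mult_iff)
  thus ?thesis
  proof cases
    case 1
    thus ?thesis using aligned r by blast
  next
    case 2
    hence "Legendre z p = sign16 p * Legendre (C - D * r) p" using aligned[of "- r"] r by simp
    thus ?thesis
      using Legendre_norm_form_factors(2)[OF p(1) Legendre_1_mod_8(3)[OF p] r, of C D, folded rep, OF q(2)]
      by simp
  qed
qed

lemma Legendre_eq_quartic:
  fixes p :: nat and x y z k :: int
  assumes p: "prime p" "[p = 1] (mod 8)" and norm_eq: "int p * (x * x) - k * (y * y) = z * z"
    and coprime: "coprime (int p * x) y" and z: "\<not> int p dvd z" and k: "Legendre (- k) p = 1"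
  shows "Legendre z p = quartic p (- k)"
proof -
  have mod_4: "[p = 1] (mod 4)" using p(2) by (rule cong_1_mod_8_imp_mod_4)
  have nonunit: "\<not> is_unit (int p)" using p by (metis not_prime_unit prime_nat_int_transfer)
  have y: "y \<noteq> 0" "\<not> int p dvd y" using coprime nonunit by (auto dest: coprime_common_divisor)
  have "Legendre y p = 1"
  proof (rule Legendre_eq_1_if_inert_even[OF p y])
    fix l :: nat assume l: "prime l" "2 < l" "Legendre p l = -1"
    have prime_l: "prime (int l)" using l by simp
    have "\<not> int l dvd y"
    proof
      assume dvd_y: "int l dvd y"
      have "\<not> int l dvd int p * x"
        using dvd_y coprime prime_l by (metis coprime_common_divisor not_prime_unit)
      moreover have "int p * (x * x) - z * z = k * (y * y)" using norm_eq by simp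
      hence "int l dvd int p * (x * x) - z * z" using dvd_y by simp
      ultimately have "Legendre p l = 1"
        using Legendre_eq_1_if_square_cong[OF prime_l, of "int p" x z] dvd_mult dvd_mult2 by blast
      thus False using l by simp
    qed
    thus "even (multiplicity (int l) y)" by (simp add: not_dvd_imp_multiplicity_0)
  qed
  moreover have "z * z - (y * y) * (- k) = int p * (x * x)" using norm_eq by (simp add: algebra_simps)
  hence "[z * z = (y * y) * (- k)] (mod int p)" by (simp add: cong_iff_dvd_diff)
  hence "quartic p (z * z) = quartic p ((y * y) * (- k))" by (rule quartic_cong)
  ultimately show ?thesis using quartic_square[OF p(1) mod_4 z] quartic_square_mult[OF p(1) mod_4 y(2), of
    "- k"] by simp
qed

text \<open>With \<open>w = z + C x\<close> one has \<open>(w + s D x)\<^sup>2 = 2 x w (C + D s)\<close> modulo \<open>p\<close>, and \<open>(w/p) = 1\<close> because \<open>w\<close> divides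
  \<open>k ((D x)\<^sup>2 - p y\<^sup>2)\<close> with a cofactor prime to the primes inert in \<open>\<rat>(\<surd>p)\<close>.\<close>

context
  fixes p :: nat and x y z k s Q D :: int
  assumes p: "prime p" "[p = 1] (mod 8)" and norm_eq: "z * z = Q * (x * x) - k * int p * (y * y)"
    and k: "k = 1 \<or> k = 2" and Q: "Legendre Q p = 1" "\<And>l::nat. prime l \<Longrightarrow> 2 < l \<Longrightarrow> \<not> (int l * int l) dvd Q"
    and coprime: "coprime x y" and z: "\<not> int p dvd z" and s: "[s * s = - k] (mod int p)"
begin

lemma inert_not_dvd_conjugate:
  fixes l :: nat
  assumes rep: "Q = C * C + k * (D * D)" and l: "prime l" "2 < l" "Legendre p l = -1"
    and dvd: "int l dvd z + C * x"
  shows "\<not> int l dvd z - C * x"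
proof
  assume "int l dvd z - C * x"
  have prime_l: "prime (int l)" using l by simp
  have not_dvd: "\<not> int l dvd 2" "\<not> int l dvd k" "\<not> int l dvd int p"
    using l k prime_l not_prime_unit Legendre_eq_0_iff[of "int p" l] by (auto dest: zdvd_imp_le)
  have "int l dvd (z + C * x) + (z - C * x)" using dvd \<open>int l dvd z - C * x\<close> by (rule dvd_add)
  hence dvd_z: "int l dvd z" using not_dvd prime_l by (simp add: prime_dvd_mult_iff)
  hence "int l dvd C * x" using dvd by (simp add: dvd_add_right_iff)
  then consider "int l dvd x" | "int l dvd C" "\<not> int l dvd x" using prime_l by (auto simp: prime_dvd_mult_iff)
  thus False
  proof cases
    case 1
    hence "int l * int l dvd Q * (x * x) - z * z" using dvd_z by (intro dvd_diff dvd_mult mult_dvd_mono)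
    hence "int l * int l dvd k * int p * (y * y)" using norm_eq by simp
    hence "int l dvd k * int p * (y * y)" using dvd_mult_left by blast
    hence "int l dvd y" using not_dvd prime_l by (simp add: prime_dvd_mult_iff)
    thus False using 1 coprime prime_l by (metis coprime_common_divisor not_prime_unit)
  next
    case 2
    have "(z + C * x) * (z - C * x) = k * ((D * x) * (D * x) - int p * (y * y))"
      using norm_eq unfolding rep by (simp add: algebra_simps)
    hence "int l dvd k * ((D * x) * (D * x) - int p * (y * y))" using dvd by (metis dvd_mult2)
    hence dvd_diff: "int l dvd (D * x) * (D * x) - int p * (y * y)"
      using not_dvd prime_l by (simp add: prime_dvd_mult_iff)
    hence "int l dvd int p * (y * y) - (D * x) * (D * x)" by (metis dvd_minus_iff minus_diff_eq)
    hence "int l dvd y" using Legendre_eq_1_if_square_cong[OF prime_l, of "int p" y "D * x"] l(3) not_dvd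
      by auto
    hence "int l dvd (D * x) * (D * x)" using dvd_add[OF dvd_diff, of "int p * (y * y)"] by simp
    hence "int l dvd D" using prime_l 2 by (simp add: prime_dvd_mult_iff)
    hence "int l * int l dvd Q" unfolding rep using 2 by (intro dvd_add dvd_mult mult_dvd_mono)
    thus False using Q(2) l by blast
  qed
qed

lemma Legendre_factor_eq_1:
  assumes rep: "Q = C * C + k * (D * D)" and w: "\<not> int p dvd z + C * x"
  shows "Legendre (z + C * x) p = 1"
proof (rule Legendre_eq_1_if_inert_even[OF p _ w])
  show "z + C * x \<noteq> 0" using w by auto
  fix l :: nat assume l: "prime l" "2 < l" "Legendre p l = -1"
  show "even (multiplicity (int l) (z + C * x))"
  proof (cases "int l dvd z + C * x")
    case False
    thus ?thesis by (simp add: not_dvd_imp_multiplicity_0)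
  next
    case True
    have prime_l: "prime (int l)" using l by simp
    have not_dvd_k: "\<not> int l dvd k" using l k prime_l not_prime_unit by (auto dest: zdvd_imp_le)
    have cofactor: "\<not> int l dvd z - C * x" by (rule inert_not_dvd_conjugate[OF rep l True])
    hence "z - C * x \<noteq> 0" by auto
    have product: "(z + C * x) * (z - C * x) = k * ((D * x) * (D * x) - int p * (y * y))"
      using norm_eq unfolding rep by (simp add: algebra_simps)
    hence nonzero: "(D * x) * (D * x) - int p * (y * y) \<noteq> 0" using \<open>z + C * x \<noteq> 0\<close> \<open>z - C * x \<noteq> 0\<close> by auto
    have "multiplicity (int l) (z + C * x) = multiplicity (int l) ((z + C * x) * (z - C * x))"
      using prime_l \<open>z + C * x \<noteq> 0\<close> \<open>z - C * x \<noteq> 0\<close> cofactor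
      by (subst prime_elem_multiplicity_mult_distrib) (auto simp: not_dvd_imp_multiplicity_0)
    also have "... = multiplicity (int l) ((D * x) * (D * x) - int p * (y * y))"
      unfolding product using prime_l k nonzero not_dvd_k
      by (subst prime_elem_multiplicity_mult_distrib) (auto simp: not_dvd_imp_multiplicity_0)
    finally show ?thesis using even_multiplicity_norm_form_inert[OF l(1,3) nonzero] by simp
  qed
qed

lemma Legendre_eq_Legendre_factor:
  assumes rep: "Q = C * C + k * (D * D)" and w: "\<not> int p dvd z + C * x" and x: "\<not> int p dvd x"
  shows "Legendre x p = Legendre (C + D * s) p"
proof -
  have pi: "prime (int p)" using p by simp
  note mod_8 = Legendre_1_mod_8[OF p]
  define w where "w = z + C * x"
  have "(w + s * D * x) * (w + s * D * x) - 2 * x * w * (C + D * s)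
    = z * z - C * C * (x * x) + s * s * (D * D * (x * x))"
    unfolding w_def by (simp add: algebra_simps)
  also have "... = (s * s + k) * (D * x * (D * x)) - k * int p * (y * y)"
    unfolding norm_eq rep by (simp add: algebra_simps)
  finally have square_cong: "[(w + s * D * x) * (w + s * D * x) = 2 * x * w * (C + D * s)] (mod int p)"
    using s by (simp add: cong_iff_dvd_diff dvd_diff)
  have "Legendre (C * C - (- k) * (D * D)) p = 1" using Q(1) unfolding rep by simp
  note factors = Legendre_norm_form_factors[OF p(1) mod_8(3) s this]
  have "\<not> int p dvd 2" using mod_8(3) by (auto dest: zdvd_imp_le)
  hence "\<not> int p dvd 2 * x * w * (C + D * s)"
    using x w factors(3) pi unfolding w_def by (simp add: prime_dvd_mult_iff)
  hence "\<not> int p dvd w + s * D * x" using square_cong by (meson cong_dvd_iff dvd_mult2)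
  hence "Legendre (2 * x * w * (C + D * s)) p = 1"
    using Legendre_cong[OF square_cong] Legendre_square[OF _ pi] by metis
  hence "Legendre x p * Legendre (C + D * s) p = 1"
    using mod_8(1) Legendre_factor_eq_1[OF rep w]
    unfolding w_def by (simp add: Legendre_mult[OF p(1) mod_8(3)])
  thus ?thesis using Legendre_values[of x p] factors(1) by auto
qed

lemma Legendre_eq_quartic_split:
  assumes rep: "Q = C * C + k * (D * D)"
  shows "Legendre z p = quartic p Q * Legendre (C + D * s) p"
proof -
  have pi: "prime (int p)" using p by simp
  have mod_4: "[p = 1] (mod 4)" using p(2) by (rule cong_1_mod_8_imp_mod_4)
  note mod_8 = Legendre_1_mod_8[OF p]
  have square_cong: "[z * z = (x * x) * Q] (mod int p)" unfolding norm_eq by (simp add: cong_iff_dvd_diff)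
  hence x: "\<not> int p dvd x" using z pi by (metis cong_dvd_iff dvd_mult2 prime_dvd_mult_iff)
  have "Legendre x p = Legendre (C + D * s) p"
  proof (cases "int p dvd z + C * x")
    case False
    thus ?thesis by (rule Legendre_eq_Legendre_factor[OF rep _ x])
  next
    case True
    have "\<not> int p dvd 2 * z" using mod_8(3) z pi by (auto simp: prime_dvd_mult_iff dest: zdvd_imp_le)
    hence "\<not> int p dvd z + (- C) * x" using dvd_add[OF True, of "z + (- C) * x"] by auto
    hence "Legendre x p = Legendre (- C + D * s) p" using Legendre_eq_Legendre_factor[of "- C"] rep x by simp
    also have "... = Legendre ((- 1) * (C - D * s)) p" by simp
    also have "... = Legendre (C - D * s) p"
      unfolding Legendre_mult[OF p(1) mod_8(3), of "- 1"] using mod_8(2) by simp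
    also have "... = Legendre (C + D * s) p"
      by (rule Legendre_norm_form_factors(2)[OF p(1) mod_8(3) s]) (use Q(1) rep in simp)
    finally show ?thesis .
  qed
  thus ?thesis
    using quartic_square[OF p(1) mod_4 z] quartic_cong[OF square_cong] quartic_square_mult[OF p(1) mod_4 x, of
      Q] by (simp add: mult.commute)
qed

end

section \<open>Ranks of finite abelian groups\<close>

context comm_group
begin

lemma nat_pow_2: "x \<in> carrier G \<Longrightarrow> x [^] (2::nat) = x \<otimes> x"
  by (simp add: numeral_2_eq_2)

lemma power_subgroup_eq_image: "power_subgroup G m = (\<lambda>x. x [^] m) ` carrier G"
  by (auto simp: power_subgroup_def)

lemma power_subgroup_mult: "power_subgroup G (m * n) = (\<lambda>x. x [^] n) ` power_subgroup G m"
  unfolding power_subgroup_eq_image by (auto simp: image_image nat_pow_pow intro!: image_cong)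

lemma group_hom_nat_pow: "group_hom G G (\<lambda>x. x [^] (n::nat))"
  by unfold_locales (auto simp: hom_def nat_pow_distrib)

lemma subgroup_power_subgroup: "subgroup (power_subgroup G m) G"
  unfolding power_subgroup_eq_image by (rule group_hom.img_is_subgroup[OF group_hom_nat_pow])

lemma nat_pow_mem_subgroup:
  assumes "subgroup S G" "x \<in> S"
  shows "x [^] (n::nat) \<in> S"
  using assms by (induction n) (auto intro: subgroup.one_closed subgroup.m_closed)

lemma int_pow_mod:
  fixes n :: int and m :: nat
  assumes x: "x \<in> carrier G" "x [^] m = \<one>"
  shows "x [^] (n mod int m) = x [^] n"
proof -
  have "x [^] n = x [^] (int m * (n div int m) + n mod int m)" by simp
  also have "... = (x [^] int m) [^] (n div int m) \<otimes> x [^] (n mod int m)"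
    using x(1) by (simp only: int_pow_mult int_pow_pow)
  finally show ?thesis using x by (simp add: int_pow_int)
qed

end

lemma (in group_hom) card_eq_image_mult_kernel:
  assumes "finite (carrier G)"
  shows "card (carrier G) = card (h ` carrier G) * card (kernel G H h)"
proof -
  have "card {x \<in> carrier G. h x = y} = card (kernel G H h)" if image: "y \<in> h ` carrier G" for y
  proof -
    obtain s where s: "s \<in> carrier G" "y = h s" using image by auto
    have "{x \<in> carrier G. h x = y} = (\<lambda>x. s \<otimes>\<^bsub>G\<^esub> x) ` kernel G H h"
    proof (intro equalityI subsetI)
      fix x assume "x \<in> {x \<in> carrier G. h x = y}"
      hence x: "x \<in> carrier G" "h x = h s" using s by auto
      hence "inv\<^bsub>G\<^esub> s \<otimes>\<^bsub>G\<^esub> x \<in> kernel G H h" using s by (simp add: kernel_def)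
      moreover have "x = s \<otimes>\<^bsub>G\<^esub> (inv\<^bsub>G\<^esub> s \<otimes>\<^bsub>G\<^esub> x)" using x s by (simp add: G.m_assoc[symmetric])
      ultimately show "x \<in> (\<lambda>x. s \<otimes>\<^bsub>G\<^esub> x) ` kernel G H h" by blast
    qed (use s in \<open>auto simp: kernel_def\<close>)
    moreover have "inj_on (\<lambda>x. s \<otimes>\<^bsub>G\<^esub> x) (kernel G H h)" using s by (auto simp: kernel_def intro!: inj_onI)
    ultimately show ?thesis by (simp add: card_image)
  qed
  moreover have "card (carrier G) = (\<Sum>y\<in>h ` carrier G. card {x \<in> carrier G. h x = y})"
    using sum.image_gen[OF assms, of "\<lambda>_. 1" h] by (simp only: card_eq_sum)
  ultimately show ?thesis by simp
qed

lemma (in comm_group) card_eq_powers_mult_torsion: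
  assumes "finite (carrier G)" and S: "subgroup S G"
  shows "card S = card ((\<lambda>x. x [^] (n::nat)) ` S) * card {x \<in> S. x [^] n = \<one>}"
proof -
  interpret S: subgroup S G by (rule S)
  have "group_hom (G\<lparr>carrier := S\<rparr>) G (\<lambda>x. x [^] n)"
    using subgroup.subgroup_is_group[OF S is_group]
    by (intro group_hom.intro group_hom_axioms.intro) (auto simp: hom_def nat_pow_distrib is_group)
  from group_hom.card_eq_image_mult_kernel[OF this] show ?thesis
    using finite_subset[OF S.subset assms(1)] by (simp add: kernel_def)
qed

lemma (in vectorspace) card_eq_power_dim:
  assumes "finite (carrier V)"
  shows "card (carrier V) = card (carrier K)^dim"
proof -
  have "gen_set (carrier V)" using span_is_subset2[of "carrier V"] in_own_span[of "carrier V"] by blast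
  hence fin_dim unfolding fin_dim_def using assms by blast
  then obtain B where B: "finite B" "basis B" using finite_basis_exists by blast
  hence "B \<subseteq> carrier V" unfolding basis_def by blast
  note unique = iffD1[OF basis_criterion[OF B(1) this] B(2), rule_format]
  have closed: "lincomb a B \<in> carrier V" if "a \<in> B \<rightarrow>\<^sub>E carrier K" for a
    by (rule lincomb_closed[OF \<open>B \<subseteq> carrier V\<close>]) (use that in \<open>simp add: PiE_def\<close>)
  have "bij_betw (\<lambda>a. lincomb a B) (B \<rightarrow>\<^sub>E carrier K) (carrier V)"
  proof (rule bij_betw_imageI)
    show "inj_on (\<lambda>a. lincomb a B) (B \<rightarrow>\<^sub>E carrier K)"
      by (rule inj_onI) (use unique closed in metis)
    show "(\<lambda>a. lincomb a B) ` (B \<rightarrow>\<^sub>E carrier K) = carrier V"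
      using closed by (auto simp: image_iff dest!: unique)
  qed
  hence "card (carrier V) = card (B \<rightarrow>\<^sub>E carrier K)" by (rule bij_betw_same_card[symmetric])
  also have "... = card (carrier K)^card B" using B(1) by (simp add: card_PiE)
  finally show ?thesis using dim_basis[OF B] by simp
qed

lemma vectorspace_elementary_abelian_module:
  fixes Q :: "('a, 'b) monoid_scheme" and l :: nat
  assumes "comm_group Q" "prime l" and exponent: "\<And>x. x \<in> carrier Q \<Longrightarrow> x [^]\<^bsub>Q\<^esub> l = \<one>\<^bsub>Q\<^esub>"
  shows "vectorspace (residue_ring (int l)) (elementary_abelian_module Q)"
proof -
  interpret Q: comm_group Q by fact
  interpret K: residues_prime l "residue_ring (int l)" using assms(2) by unfold_locales simp
  let ?V = "elementary_abelian_module Q"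
  have "abelian_group ?V"
    by (rule abelian_groupI) (auto simp: elementary_abelian_module_def Q.m_ac intro!: bexI[of _ "inv\<^bsub>Q\<^esub> _"])
  note moduleI = moduleI[OF K.is_cring this]
  have "module (residue_ring (int l)) ?V"
  proof (rule moduleI)
    show "\<one>\<^bsub>residue_ring (int l)\<^esub> \<odot>\<^bsub>?V\<^esub> x = x" if "x \<in> carrier ?V" for x
      using that Q.int_pow_mod[OF _ exponent, of x 1]
      by (simp add: elementary_abelian_module_def residue_ring_def)
  qed (auto simp: elementary_abelian_module_def residue_ring_def Q.int_pow_mod[OF _ exponent]
      Q.int_pow_mult Q.int_pow_pow Q.int_pow_distrib mult.commute)
  thus ?thesis by (intro vectorspace.intro K.field_axioms)
qed

lemma (in comm_group) card_torsion_power_subgroup: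
  fixes l k :: nat
  assumes finite: "finite (carrier G)" and l: "prime l" and k: "k \<ge> 1"
  shows "l^prime_power_rank l k G = card {x \<in> power_subgroup G (l^(k - 1)). x [^] l = \<one>}"
proof -
  define m where "m = l^(k - 1)"
  have "l^k = m * l" unfolding m_def using k by (cases k) auto
  let ?S = "power_subgroup G m" and ?T = "power_subgroup G (m * l)"
  let ?H = "G\<lparr>carrier := ?S\<rparr>" let ?Q = "?H Mod ?T"
  have S: "subgroup ?S G" and T: "subgroup ?T G" by (rule subgroup_power_subgroup)+
  interpret S: subgroup ?S G by (rule S)
  have T_eq: "?T = (\<lambda>x. x [^] l) ` ?S" by (rule power_subgroup_mult)
  have "?T \<subseteq> ?S" unfolding T_eq using nat_pow_mem_subgroup[OF S] by blast
  interpret H: group ?H using subgroup.subgroup_is_group[OF S is_group] .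
  interpret H: comm_group ?H by (rule H.group_comm_groupI) (simp add: m_comm)
  have T_H: "subgroup ?T ?H" using subgroup_incl[OF T S \<open>?T \<subseteq> ?S\<close>] .
  interpret quotient: normal ?T ?H using H.subgroup_imp_normal[OF T_H] .
  have finite_S: "finite ?S" using finite S.subset finite_subset by blast
  have card_Q: "card (carrier ?Q) * card ?T = card ?S"
    using H.lagrange[OF T_H] unfolding FactGroup_def order_def by simp
  have finite_Q: "finite (carrier ?Q)" unfolding carrier_FactGroup using finite_S by simp
  have "X [^]\<^bsub>?Q\<^esub> l = \<one>\<^bsub>?Q\<^esub>" if "X \<in> carrier ?Q" for X
  proof -
    from that obtain x where x: "x \<in> carrier ?H" "X = ?T #>\<^bsub>?H\<^esub> x"
      unfolding carrier_FactGroup by (elim imageE)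
    have "X [^]\<^bsub>?Q\<^esub> l = ?T #>\<^bsub>?H\<^esub> (x [^]\<^bsub>?H\<^esub> l)"
      unfolding x(2) by (rule quotient.FactGroup_pow[OF x(1)])
    moreover have "x [^]\<^bsub>?H\<^esub> l \<in> ?T"
      unfolding T_eq using x(1) by (simp add: nat_pow_consistent[symmetric])
    moreover have "?T #>\<^bsub>?H\<^esub> (x [^]\<^bsub>?H\<^esub> l) = ?T"
      by (rule H.coset_join2[OF H.nat_pow_closed[OF x(1)] T_H calculation(2)])
    ultimately show ?thesis by simp
  qed
  from vectorspace_elementary_abelian_module[OF H.abelian_FactGroup[OF T_H] l this]
  interpret V: vectorspace "residue_ring (int l)" "elementary_abelian_module ?Q" .
  have "card (carrier ?Q) = l^prime_power_rank l k G"
    using V.card_eq_power_dim finite_Q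
    unfolding prime_power_rank_def \<open>l ^ k = m * l\<close> m_def[symmetric]
    by (simp add: elementary_abelian_module_def residue_ring_def)
  moreover have "card ?S = card ?T * card {x \<in> ?S. x [^] l = \<one>}"
    unfolding T_eq by (rule card_eq_powers_mult_torsion[OF finite S])
  moreover have "card ?T > 0"
    using finite_subset[OF \<open>?T \<subseteq> ?S\<close> finite_S] subgroup.one_closed[OF T] card_gt_0_iff by blast
  ultimately show ?thesis using card_Q unfolding m_def by simp
qed

context comm_group
begin

lemma card_torsion_squares:
  assumes "finite (carrier G)"
  shows "2^prime_power_rank 2 2 G = card {x \<in> (\<lambda>x. x \<otimes> x) ` carrier G. x \<otimes> x = \<one>}"
proof -
  have squares: "power_subgroup G 2 = (\<lambda>x. x \<otimes> x) ` carrier G"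
    unfolding power_subgroup_eq_image by (rule image_cong) (simp_all add: nat_pow_2)
  have "{x \<in> power_subgroup G 2. x [^] (2::nat) = \<one>} = {x \<in> (\<lambda>x. x \<otimes> x) ` carrier G. x \<otimes> x = \<one>}"
    unfolding squares by (auto simp: nat_pow_2)
  thus ?thesis using card_torsion_power_subgroup[OF assms two_is_prime_nat, of 2] by simp
qed

lemma character_trivial_on_four_torsion_imp_rank_8:
  fixes chi :: "'a \<Rightarrow> int"
  assumes finite: "finite (carrier G)"
    and mult: "\<And>x y. x \<in> carrier G \<Longrightarrow> y \<in> carrier G \<Longrightarrow> chi (x \<otimes> y) = chi x * chi y"
    and sign: "\<And>x. x \<in> carrier G \<Longrightarrow> chi x \<in> {-1, 1}"
    and four_torsion: "\<And>c. c \<in> carrier G \<Longrightarrow> (c \<otimes> c) \<otimes> (c \<otimes> c) = \<one> \<Longrightarrow> chi c = 1"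
    and g: "g \<in> carrier G" "chi g \<noteq> 1"
  shows "prime_power_rank 2 3 G \<ge> 1"
proof (rule ccontr)
  assume "\<not> prime_power_rank 2 3 G \<ge> 1"
  hence rank: "prime_power_rank 2 3 G = 0" by simp
  let ?F = "power_subgroup G 4" let ?squares = "(\<lambda>x. x [^] (2::nat)) ` ?F"
  have F: "subgroup ?F G" by (rule subgroup_power_subgroup)
  have "card {x \<in> ?F. x [^] (2::nat) = \<one>} = 1"
    using card_torsion_power_subgroup[OF finite two_is_prime_nat, of 3] rank by simp
  hence "card ?F = card ?squares" using card_eq_powers_mult_torsion[OF finite F, of 2] by simp
  moreover have "?squares \<subseteq> ?F" using nat_pow_mem_subgroup[OF F] by blast
  moreover have "finite ?F" using finite subgroup.subset[OF F] finite_subset by blast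
  ultimately have "?squares = ?F" by (intro card_seteq) auto
  moreover have "g [^] (4::nat) \<in> ?F" unfolding power_subgroup_eq_image using g(1) by blast
  ultimately obtain k where k: "k \<in> carrier G" "g [^] (4::nat) = (k [^] (4::nat)) [^] (2::nat)"
    unfolding power_subgroup_eq_image by blast
  define h where "h = k \<otimes> k"
  have h: "h \<in> carrier G" "chi h = 1" using k(1) mult[OF k(1) k(1)] sign[OF k(1)] by (auto simp: h_def)
  define c where "c = g \<otimes> inv h"
  have c: "c \<in> carrier G" using g h c_def by simp
  have fourth: "x [^] (4::nat) = (x \<otimes> x) \<otimes> (x \<otimes> x)" if "x \<in> carrier G" for x
    using nat_pow_pow[OF that, of 2 2] that by (simp add: nat_pow_2)
  have "g [^] (4::nat) = h [^] (4::nat)"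
    unfolding k(2) h_def using k(1) by (simp add: nat_pow_2[symmetric] nat_pow_pow)
  hence "c [^] (4::nat) = \<one>" using g(1) h(1) unfolding c_def by (simp add: nat_pow_distrib nat_pow_inv)
  hence "chi c = 1" using four_torsion[OF c] fourth[OF c] by simp
  moreover have "c \<otimes> h = g" unfolding c_def using g h by (simp add: m_assoc)
  ultimately show False using g(2) mult[OF c h(1)] h(2) by simp
qed

end

locale two_genus_characters = comm_group G for G (structure) +
  fixes chi psi :: "'a \<Rightarrow> int"
  assumes finite_carrier: "finite (carrier G)"
    and chi_mult: "\<And>x y. x \<in> carrier G \<Longrightarrow> y \<in> carrier G \<Longrightarrow> chi (x \<otimes> y) = chi x * chi y"
    and psi_mult: "\<And>x y. x \<in> carrier G \<Longrightarrow> y \<in> carrier G \<Longrightarrow> psi (x \<otimes> y) = psi x * psi y"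
    and chi_sign: "\<And>x. x \<in> carrier G \<Longrightarrow> chi x \<in> {-1, 1}"
    and psi_sign: "\<And>x. x \<in> carrier G \<Longrightarrow> psi x \<in> {-1, 1}"
    and kernel_square: "\<And>x. x \<in> carrier G \<Longrightarrow> chi x = 1 \<Longrightarrow> psi x = 1 \<Longrightarrow> \<exists>y\<in>carrier G. x = y \<otimes> y"
begin

definition two_torsion :: "'a set" where "two_torsion = {x \<in> carrier G. x \<otimes> x = \<one>}"

lemma finite_two_torsion: "finite two_torsion"
  unfolding two_torsion_def using finite_carrier by simp

lemma characters_square:
  assumes "y \<in> carrier G" shows "chi (y \<otimes> y) = 1" "psi (y \<otimes> y) = 1"
  using assms chi_mult[of y y] psi_mult[of y y] chi_sign[of y] psi_sign[of y] by auto

lemma card_two_torsion_le: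
  assumes "finite A" and characters: "\<And>x. x \<in> carrier G \<Longrightarrow> (chi x, psi x) \<in> A"
  shows "card two_torsion \<le> card A"
proof -
  let ?squares = "(\<lambda>x. x [^] (2::nat)) ` carrier G" and ?fibre = "\<lambda>t. {x \<in> carrier G. (chi x, psi x) = t}"
  have finite_squares: "finite ?squares" using finite_carrier by simp
  have "card (?fibre t) \<le> card ?squares" for t
  proof (cases "?fibre t = {}")
    case False
    then obtain s where s: "s \<in> carrier G" "(chi s, psi s) = t" by blast
    have "(\<lambda>x. s \<otimes> x) ` ?fibre t \<subseteq> ?squares"
    proof
      fix z assume "z \<in> (\<lambda>x. s \<otimes> x) ` ?fibre t"
      then obtain x where x: "x \<in> carrier G" "chi x = chi s" "psi x = psi s" "z = s \<otimes> x" using s by auto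
      hence "chi z = 1" "psi z = 1" using s chi_mult psi_mult chi_sign[of s] psi_sign[of s] by auto
      thus "z \<in> ?squares" using kernel_square[of z] x s by (auto simp: nat_pow_2)
    qed
    thus ?thesis using s by (intro card_inj_on_le[OF _ _ finite_squares]) (auto intro!: inj_onI)
  next
    case True
    thus ?thesis by (simp only: card.empty)
  qed
  hence "(\<Sum>t\<in>A. card (?fibre t)) \<le> card A * card ?squares"
    using sum_bounded_above[of A "\<lambda>t. card (?fibre t)"] by simp
  moreover have "carrier G \<subseteq> (\<Union>t\<in>A. ?fibre t)" using characters by auto
  hence "card (carrier G) \<le> (\<Sum>t\<in>A. card (?fibre t))"
    using card_UN_le[OF \<open>finite A\<close>, of ?fibre] card_mono[of "\<Union>t\<in>A. ?fibre t" "carrier G"] assms(1)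
      finite_carrier by fastforce
  moreover have "card (carrier G) = card ?squares * card two_torsion"
    using card_eq_powers_mult_torsion[OF finite_carrier subgroup_self, of 2]
    by (simp add: two_torsion_def nat_pow_2 cong: conj_cong)
  ultimately have "card ?squares * card two_torsion \<le> card ?squares * card A" by (simp only: mult.commute)
  moreover have "card ?squares > 0" using finite_squares by (auto simp: card_gt_0_iff)
  ultimately show ?thesis by simp
qed

lemma card_two_torsion_le_4: "card two_torsion \<le> 4"
proof -
  have "card two_torsion \<le> card ({-1, 1} \<times> {-1, 1} :: (int \<times> int) set)"
    by (intro card_two_torsion_le SigmaI chi_sign psi_sign) auto
  thus ?thesis by (simp add: card_cartesian_product)
qed

lemma characters_two_torsion:
  assumes rank: "prime_power_rank 2 2 G = 2" and x: "x \<in> two_torsion"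
  shows "chi x = 1" "psi x = 1"
proof -
  let ?B = "{x \<in> (\<lambda>x. x \<otimes> x) ` carrier G. x \<otimes> x = \<one>}"
  have "?B \<subseteq> two_torsion" unfolding two_torsion_def by auto
  moreover have "card ?B = 4" using card_torsion_squares[OF finite_carrier] rank by simp
  ultimately have "?B = two_torsion"
    using finite_two_torsion card_two_torsion_le_4 by (intro card_seteq) auto
  then obtain y where "y \<in> carrier G" "x = y \<otimes> y" using x by blast
  thus "chi x = 1" "psi x = 1" using characters_square by auto
qed

lemma rank_8_if_lifted_two_torsion:
  assumes "card two_torsion = 4" and lift: "\<And>z. z \<in> two_torsion \<Longrightarrow> \<exists>e\<in>carrier G. chi e = 1 \<and> z = e \<otimes> e"
  shows "prime_power_rank 2 2 G = 2 \<and> prime_power_rank 2 3 G \<ge> 1"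
proof
  have "{x \<in> (\<lambda>x. x \<otimes> x) ` carrier G. x \<otimes> x = \<one>} = two_torsion"
    using lift unfolding two_torsion_def by fastforce
  hence "2^prime_power_rank 2 2 G = (2::nat)^2"
    using card_torsion_squares[OF finite_carrier] assms(1) by simp
  thus "prime_power_rank 2 2 G = 2" by (subst (asm) power_inject_exp) auto
  have trivial: "chi c = 1" if c: "c \<in> carrier G" "(c \<otimes> c) \<otimes> (c \<otimes> c) = \<one>" for c
  proof -
    have "c \<otimes> c \<in> two_torsion" using c by (simp add: two_torsion_def)
    then obtain e where e: "e \<in> carrier G" "chi e = 1" "c \<otimes> c = e \<otimes> e" using lift by blast
    define t where "t = c \<otimes> inv e"
    have t: "t \<in> carrier G" "t \<otimes> e = c" unfolding t_def using c e by (simp_all add: m_assoc)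
    have "t \<otimes> t = (c \<otimes> c) \<otimes> inv (e \<otimes> e)" unfolding t_def using c(1) e(1) by (simp add: inv_mult m_ac)
    hence "t \<in> two_torsion" using e(1,3) t(1) by (simp add: two_torsion_def)
    then obtain f where "f \<in> carrier G" "t = f \<otimes> f" using lift by blast
    hence "chi t = 1" using characters_square(1) by simp
    thus ?thesis using chi_mult[OF t(1) e(1)] e(2) t(2) by simp
  qed
  have "\<exists>g\<in>carrier G. chi g \<noteq> 1"
  proof (rule ccontr)
    assume "\<not> (\<exists>g\<in>carrier G. chi g \<noteq> 1)"
    hence "card two_torsion \<le> card ({1} \<times> {-1, 1} :: (int \<times> int) set)"
      using psi_sign by (intro card_two_torsion_le) auto
    thus False using assms(1) by (simp add: card_cartesian_product)
  qed
  thus "prime_power_rank 2 3 G \<ge> 1"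
    using character_trivial_on_four_torsion_imp_rank_8[of chi, OF finite_carrier chi_mult chi_sign trivial]
    by blast
qed

lemma rank_8_criterion:
  assumes u: "u \<in> carrier G" "chi u = 1" and v: "v \<in> carrier G" "chi v = 1"
    and x: "x = u \<otimes> u" "x \<otimes> x = \<one>" "x \<noteq> \<one>" and y: "y = v \<otimes> v" "y \<otimes> y = \<one>" "y \<noteq> \<one>" and "x \<noteq> y"
  shows "prime_power_rank 2 2 G = 2 \<and> prime_power_rank 2 3 G \<ge> 1"
proof -
  have xy: "x \<in> carrier G" "y \<in> carrier G" using u v x y by auto
  have product: "(u \<otimes> v) \<otimes> (u \<otimes> v) = x \<otimes> y" using u v unfolding x(1) y(1) by (simp add: m_ac)
  have "x \<otimes> y \<noteq> \<one>"
  proof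
    assume "x \<otimes> y = \<one>"
    moreover have "x \<otimes> (x \<otimes> y) = y" using xy x(2) by (simp add: m_assoc[symmetric])
    ultimately show False using xy \<open>x \<noteq> y\<close> by simp
  qed
  moreover have "x \<otimes> y \<noteq> x" "x \<otimes> y \<noteq> y" using xy x(3) y(3) by simp_all
  ultimately have card: "card {\<one>, x, y, x \<otimes> y} = 4" using x(3) y(3) \<open>x \<noteq> y\<close> by auto
  have "(x \<otimes> y) \<otimes> (x \<otimes> y) = (x \<otimes> x) \<otimes> (y \<otimes> y)" using xy by (simp add: m_ac)
  hence "{\<one>, x, y, x \<otimes> y} \<subseteq> two_torsion" unfolding two_torsion_def using xy x(2) y(2) by auto
  hence all: "{\<one>, x, y, x \<otimes> y} = two_torsion"
    using card card_two_torsion_le_4 finite_two_torsion by (intro card_seteq) auto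
  have "chi \<one> = 1" using characters_square(1)[of \<one>] by simp
  moreover have "chi (u \<otimes> v) = 1" using u v chi_mult by simp
  ultimately have "\<exists>e\<in>carrier G. chi e = 1 \<and> z = e \<otimes> e" if "z \<in> {\<one>, x, y, x \<otimes> y}" for z
    using that u v x(1) y(1) product by (elim insertE) (auto intro: bexI[of _ \<one>] bexI[of _ "u \<otimes> v"])
  thus ?thesis using rank_8_if_lifted_two_torsion card unfolding all by blast
qed

end

section \<open>Ideals of quadratic fields\<close>

lemma ideal_mult_memI: "a \<in> I \<Longrightarrow> b \<in> J \<Longrightarrow> a * b \<in> ideal_mult I J"
  unfolding ideal_mult_def
  by (rule CollectI, rule exI[of _ 1], rule exI[of _ "\<lambda>_. a"], rule exI[of _ "\<lambda>_. b"]) simp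

lemma ideal_mult_zero: "0 \<in> ideal_mult I J"
  unfolding ideal_mult_def
  by (rule CollectI, rule exI[of _ 0], rule exI[of _ "\<lambda>_. 0"], rule exI[of _ "\<lambda>_. 0"]) simp

lemma ideal_mult_add:
  assumes "x \<in> ideal_mult I J" "y \<in> ideal_mult I J"
  shows "x + y \<in> ideal_mult I J"
proof -
  obtain n :: nat and a b where x: "x = (\<Sum>i<n. a i * b i)" and ab: "\<forall>i<n. a i \<in> I \<and> b i \<in> J"
    using assms(1) unfolding ideal_mult_def by blast
  obtain n' :: nat and a' b' where y: "y = (\<Sum>i<n'. a' i * b' i)" and ab': "\<forall>i<n'. a' i \<in> I \<and> b' i \<in> J"
    using assms(2) unfolding ideal_mult_def by blast
  define a'' where "a'' = (\<lambda>i. if i < n then a i else a' (i - n))"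
  define b'' where "b'' = (\<lambda>i. if i < n then b i else b' (i - n))"
  have "(\<Sum>i<n + n'. a'' i * b'' i) = (\<Sum>i<n. a'' i * b'' i) + (\<Sum>i<n'. a'' (n + i) * b'' (n + i))"
    by (simp add: lessThan_atLeast0 sum.atLeastLessThan_concat[symmetric, of 0 n "n + n'"]
      sum.atLeastLessThan_shift_0[of _ n "n + n'"])
  also have "... = x + y" unfolding x y a''_def b''_def by simp
  finally have "x + y = (\<Sum>i<n + n'. a'' i * b'' i)" ..
  moreover have "\<forall>i<n + n'. a'' i \<in> I \<and> b'' i \<in> J" using ab ab' unfolding a''_def b''_def by auto
  ultimately show ?thesis unfolding ideal_mult_def by blast
qed

lemma ideal_mult_induct [consumes 1, case_names mult zero add]:
  assumes "x \<in> ideal_mult I J" and "\<And>a b. a \<in> I \<Longrightarrow> b \<in> J \<Longrightarrow> P (a * b)" "P 0" "\<And>x y. P x \<Longrightarrow> P y \<Longrightarrow> P (x + y)"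
  shows "P x"
proof -
  obtain n :: nat and a b where x: "x = (\<Sum>i<n. a i * b i)" and ab: "\<forall>i<n. a i \<in> I \<and> b i \<in> J"
    using assms(1) unfolding ideal_mult_def by blast
  have "k \<le> n \<Longrightarrow> P (\<Sum>i<k. a i * b i)" for k
    using assms(2-4) ab by (induction k) auto
  thus ?thesis unfolding x by blast
qed

lemma ideal_mult_subsetI:
  assumes "\<And>a b. a \<in> I \<Longrightarrow> b \<in> J \<Longrightarrow> a * b \<in> S" "0 \<in> S" "\<And>x y. x \<in> S \<Longrightarrow> y \<in> S \<Longrightarrow> x + y \<in> S"
  shows "ideal_mult I J \<subseteq> S"
  by (rule subsetI, erule ideal_mult_induct) (use assms in auto)

lemma ideal_mult_comm: "ideal_mult I J = ideal_mult J I"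
proof -
  have "ideal_mult I J \<subseteq> ideal_mult J I" for I J
    by (rule ideal_mult_subsetI) (subst mult.commute, auto intro: ideal_mult_memI ideal_mult_zero
      ideal_mult_add)
  thus ?thesis by blast
qed

lemma ideal_mult_mono: "I \<subseteq> I' \<Longrightarrow> J \<subseteq> J' \<Longrightarrow> ideal_mult I J \<subseteq> ideal_mult I' J'"
  unfolding ideal_mult_def by blast

lemma ideal_mult_assoc: "ideal_mult (ideal_mult I J) L = ideal_mult I (ideal_mult J L)"
proof -
  have subset: "ideal_mult (ideal_mult I J) L \<subseteq> ideal_mult I (ideal_mult J L)" for I J L
  proof (rule ideal_mult_subsetI)
    fix a c assume "a \<in> ideal_mult I J" "c \<in> L"
    thus "a * c \<in> ideal_mult I (ideal_mult J L)"
    proof (induction rule: ideal_mult_induct)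
      case (mult u v)
      thus ?case by (subst mult.assoc) (intro ideal_mult_memI)
    qed (auto simp: ideal_mult_zero distrib_right intro: ideal_mult_add)
  qed (auto intro: ideal_mult_zero ideal_mult_add)
  have "ideal_mult I (ideal_mult J L) \<subseteq> ideal_mult (ideal_mult I J) L"
    using subset[of L J I] by (simp add: ideal_mult_comm)
  thus ?thesis using subset by blast
qed

lemma ideal_mult_interchange:
  "ideal_mult (ideal_mult I J) (ideal_mult I' J') = ideal_mult (ideal_mult I I') (ideal_mult J J')"
proof -
  have "ideal_mult J (ideal_mult I' J') = ideal_mult I' (ideal_mult J J')"
    by (simp only: ideal_mult_assoc[symmetric] ideal_mult_comm[of J I'])
  thus ?thesis by (simp only: ideal_mult_assoc)
qed

lemma ideal_mult_scale: "ideal_mult ((*) c ` I) J = (*) c ` ideal_mult I J"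
proof
  show "ideal_mult ((*) c ` I) J \<subseteq> (*) c ` ideal_mult I J"
  proof (rule ideal_mult_subsetI)
    show "a * b \<in> (*) c ` ideal_mult I J" if "a \<in> (*) c ` I" "b \<in> J" for a b
      using that by (auto simp: mult.assoc intro!: imageI ideal_mult_memI)
    show "0 \<in> (*) c ` ideal_mult I J" using imageI[OF ideal_mult_zero, of "(*) c"] by simp
  qed (auto simp: distrib_left[symmetric] intro!: imageI ideal_mult_add)
  have "c * x \<in> ideal_mult ((*) c ` I) J" if "x \<in> ideal_mult I J" for x
    using that
  proof (induction rule: ideal_mult_induct)
    case (mult a b)
    thus ?case by (subst mult.assoc[symmetric]) (intro ideal_mult_memI imageI)
  qed (auto simp: ideal_mult_zero distrib_left intro: ideal_mult_add)
  thus "(*) c ` ideal_mult I J \<subseteq> ideal_mult ((*) c ` I) J" by blast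
qed

lemma scale_scale: "(*) a ` ((*) b ` S) = (*) (a * b) ` (S :: complex set)"
  by (auto simp: image_image mult.assoc)

lemma int_subgroup_principal:
  fixes S :: "int set"
  assumes add: "\<And>x y. x \<in> S \<Longrightarrow> y \<in> S \<Longrightarrow> x + y \<in> S" and minus: "\<And>x. x \<in> S \<Longrightarrow> -x \<in> S"
    and "x0 \<in> S" "x0 \<noteq> 0"
  obtains g where "g > 0" "g \<in> S" "\<And>x. x \<in> S \<Longrightarrow> g dvd x"
proof -
  have "\<bar>x0\<bar> \<in> S" using assms(3) minus by (cases "x0 \<ge> 0") auto
  hence "\<exists>n::nat. n > 0 \<and> int n \<in> S" using assms(4) by (intro exI[of _ "nat \<bar>x0\<bar>"]) auto
  moreover define g where "g = (LEAST n. n > 0 \<and> int n \<in> S)"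
  ultimately have g: "g > 0" "int g \<in> S" and least: "\<And>n. n > 0 \<Longrightarrow> int n \<in> S \<Longrightarrow> g \<le> n"
    using LeastI_ex[of "\<lambda>n. n > 0 \<and> int n \<in> S"] Least_le[of "\<lambda>n. n > 0 \<and> int n \<in> S"] by auto
  have multiple: "k * int g \<in> S" for k
  proof (induction k rule: int_induct[where k = 0])
    case base show ?case using add[OF g(2) minus[OF g(2)]] by simp
  next
    case (step1 i) thus ?case using add[OF _ g(2)] by (simp add: distrib_right)
  next
    case (step2 i) thus ?case using add[OF _ minus[OF g(2)]] by (simp add: left_diff_distrib)
  qed
  have "int g dvd x" if "x \<in> S" for x
  proof (rule ccontr)
    assume "\<not> int g dvd x"
    hence "x mod int g > 0" using g
      by (metis dvd_eq_mod_eq_0 of_nat_0_less_iff order_neq_le_trans pos_mod_sign)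
    moreover have "x + (- (x div int g)) * int g = x mod int g"
      by (simp add: minus_mult_div_eq_mod[symmetric] mult.commute)
    hence "x mod int g \<in> S" using add[OF that multiple] by metis
    ultimately have "int g \<le> x mod int g" using least[of "nat (x mod int g)"] by auto
    moreover have "x mod int g < int g" using g by simp
    ultimately show False by linarith
  qed
  thus ?thesis using that[of "int g"] g by auto
qed

lemma rat_fraction:
  fixes q :: rat
  obtains a b where "b > 0" "coprime a b" "q = of_int a / of_int b"
proof -
  obtain a b where ab: "quotient_of q = (a, b)" by (cases "quotient_of q")
  show ?thesis
    using that quotient_of_denom_pos[OF ab] quotient_of_coprime[OF ab] quotient_of_div[OF ab] by blast
qed

lemma rat_pair_common_denominator:
  fixes x y :: rat
  obtains a b d where "d > 0" "x = of_int a / of_int d" "y = of_int b / of_int d"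
proof -
  obtain a c where a: "c > 0" "x = of_int a / of_int c" using rat_fraction[of x] by metis
  obtain b d where b: "d > 0" "y = of_int b / of_int d" using rat_fraction[of y] by metis
  show ?thesis using that[of "c * d" "a * d" "b * c"] a b by simp
qed

lemma squarefree_mult_rat_square_int:
  fixes t :: rat
  assumes "squarefree (m::int)" "of_int m * (t * t) \<in> \<int>"
  shows "t \<in> \<int>"
proof -
  obtain c d where cd: "d > 0" "coprime c d" "t = of_int c / of_int d" by (rule rat_fraction)
  obtain j where "of_int m * (t * t) = (of_int j :: rat)" using assms(2) by (elim Ints_cases)
  hence "(of_int (m * (c * c)) :: rat) = of_int (j * (d * d))"
    using cd(1) unfolding cd(3) by (simp add: field_simps)
  hence "m * (c * c) = j * (d * d)" by (simp only: of_int_eq_iff)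
  hence "d * d dvd m * (c * c)" by simp
  moreover have "coprime (d * d) (c * c)" using cd(2) by (simp add: coprime_commute)
  ultimately have "d * d dvd m" by (simp add: coprime_dvd_mult_left_iff)
  hence "is_unit d" using squarefreeD[OF assms(1), of d] by (simp add: power2_eq_square)
  thus ?thesis using cd by simp
qed

lemma rat_bounded_powers_int:
  fixes q :: rat and N :: int
  assumes N: "N \<noteq> 0" and bounded: "\<And>k::nat. of_int N * q^k \<in> \<int>"
  shows "q \<in> \<int>"
proof -
  obtain a b where ab: "b > 0" "coprime a b" "q = of_int a / of_int b" by (rule rat_fraction)
  have power_dvd: "b^k dvd N" for k
  proof -
    obtain j where "of_int N * q^k = (of_int j :: rat)" using bounded[of k] by (elim Ints_cases)
    hence "(of_int (N * a^k) :: rat) = of_int (j * b^k)" using ab(1) unfolding ab(3)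
      by (simp add: power_divide field_simps)
    hence "N * a^k = j * b^k" by (simp only: of_int_eq_iff)
    hence "b^k dvd N * a^k" by simp
    moreover have "coprime (b^k) (a^k)" using ab(2) by (simp add: coprime_commute)
    ultimately show ?thesis by (simp add: coprime_dvd_mult_left_iff)
  qed
  have "b = 1"
  proof (rule ccontr)
    assume "b \<noteq> 1"
    hence "2^nat \<bar>N\<bar> \<le> b^nat \<bar>N\<bar>" using ab(1) by (intro power_mono) auto
    moreover have "b^nat \<bar>N\<bar> \<le> \<bar>N\<bar>" using power_dvd[of "nat \<bar>N\<bar>"] N ab(1)
      by (metis abs_of_pos dvd_imp_le_int zero_less_power)
    moreover have "\<bar>N\<bar> < 2^nat \<bar>N\<bar>" using of_nat_less_two_power[of "nat \<bar>N\<bar>", where 'a = int] by simp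
    ultimately show False by linarith
  qed
  thus ?thesis using ab by simp
qed

lemma square_mod_4: "(n::int) * n mod 4 = (if even n then 0 else 1)"
proof (cases "even n")
  case True
  then obtain k where "n = 2 * k" by (elim evenE)
  thus ?thesis by simp
next
  case False
  then obtain k where "n = 2 * k + 1" by (elim oddE)
  hence "n * n = 1 + 4 * (k * k + k)" by (simp add: algebra_simps)
  thus ?thesis using False by (simp only: mod_mult_self2) simp
qed

locale quad =
  fixes m :: int
  assumes sqf: "squarefree m" and m_mod_4: "m mod 4 = 2 \<or> m mod 4 = 3"
begin

lemma m_nonzero: "m \<noteq> 0" using m_mod_4 by auto

definition w :: complex where "w = csqrt (of_int (4 * m)) / 2"

lemma w_square: "w * w = of_int m"
  using power2_csqrt[of "of_int (4 * m)"] by (simp add: w_def power2_eq_square)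

definition elt :: "rat \<Rightarrow> rat \<Rightarrow> complex" where "elt x y = of_rat x + of_rat y * w"

abbreviation K :: "complex set" where "K \<equiv> quadratic_field (4 * m)"

abbreviation OK :: "complex set" where "OK \<equiv> ring_of_integers K"

lemma K_eq: "K = {elt x y | x y. True}"
proof -
  have field_elem: "of_rat a + of_rat b * csqrt (of_int (4 * m)) = elt a (2 * b)" for a b
    unfolding elt_def w_def by (simp add: of_rat_mult)
  have "\<exists>a b. elt x y = elt a (2 * b)" for x y by (rule exI[of _ x], rule exI[of _ "y / 2"]) simp
  thus ?thesis unfolding quadratic_field_def field_elem by blast
qed

lemma K_eltI [simp, intro]: "elt x y \<in> K" unfolding K_eq by blast

lemma K_cases: assumes "z \<in> K" obtains x y where "z = elt x y" using assms unfolding K_eq by blast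

lemma not_rat_square: "x * x \<noteq> of_int m" for x :: rat
proof
  assume square: "x * x = of_int m"
  hence "of_int 1 * (x * x) \<in> \<int>" by simp
  hence "x \<in> \<int>" using squarefree_mult_rat_square_int[of 1 x] by simp
  then obtain a where "x = of_int a" by (elim Ints_cases)
  hence "m = a * a" using square by (simp flip: of_int_mult)
  moreover from this have "\<bar>a\<bar> = 1" using squarefreeD[OF sqf, of a] by (simp add: power2_eq_square)
  hence "a * a = 1" by (auto simp: abs_if split: if_splits)
  ultimately show False using m_mod_4 by auto
qed

lemma elt_diff: "elt x y - elt x' y' = elt (x - x') (y - y')"
  unfolding elt_def by (simp add: of_rat_diff algebra_simps)

lemma elt_add: "elt x y + elt x' y' = elt (x + x') (y + y')"
  unfolding elt_def by (simp add: of_rat_add algebra_simps)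

lemma elt_minus: "- elt x y = elt (- x) (- y)"
  unfolding elt_def by (simp add: of_rat_minus algebra_simps)

lemma elt_mult: "elt x y * elt x' y' = elt (x * x' + of_int m * (y * y')) (x * y' + y * x')"
proof -
  have "elt x y * elt x' y' = of_rat x * of_rat x' + (w * w) * (of_rat y * of_rat y')
    + (of_rat x * of_rat y' + of_rat y * of_rat x') * w"
    unfolding elt_def by (simp add: algebra_simps)
  thus ?thesis unfolding w_square elt_def by (simp add: of_rat_add of_rat_mult algebra_simps)
qed

lemma elt_of_rat: "elt x 0 = of_rat x" by (simp add: elt_def)

lemma elt_of_int: "elt (of_int x) 0 = of_int x" by (simp add: elt_def)

lemma elt_1: "elt 1 0 = 1" by (simp add: elt_def)

lemma elt_w: "elt 0 1 = w" by (simp add: elt_def)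

definition norm_form :: "rat \<Rightarrow> rat \<Rightarrow> rat" where "norm_form x y = x * x - of_int m * (y * y)"

lemma norm_form_eq_0_iff: "norm_form x y = 0 \<longleftrightarrow> x = 0 \<and> y = 0"
proof
  assume norm_0: "norm_form x y = 0"
  show "x = 0 \<and> y = 0"
  proof (cases "y = 0")
    case False
    hence "(x / y) * (x / y) = of_int m" using norm_0 unfolding norm_form_def by (simp add: field_simps)
    thus ?thesis using not_rat_square by blast
  qed (use norm_0 in \<open>simp add: norm_form_def\<close>)
qed (simp add: norm_form_def)

lemma norm_form_mult: "norm_form (x * x' + of_int m * (y * y')) (x * y' + y * x')
  = norm_form x y * norm_form x' y'"
  by (simp add: norm_form_def algebra_simps)

lemma elt_mult_conj: "elt x y * elt x (- y) = of_rat (norm_form x y)"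
  unfolding elt_mult norm_form_def by (simp add: elt_of_rat[symmetric] algebra_simps)

lemma elt_eq_0_iff [simp]: "elt x y = 0 \<longleftrightarrow> x = 0 \<and> y = 0"
proof
  assume "elt x y = 0"
  hence "norm_form x y = 0" using elt_mult_conj[of x y] by simp
  thus "x = 0 \<and> y = 0" using norm_form_eq_0_iff by simp
qed (simp add: elt_def)

lemma elt_inject [simp]: "elt x y = elt x' y' \<longleftrightarrow> x = x' \<and> y = y'"
  using elt_eq_0_iff[of "x - x'" "y - y'"] elt_diff[of x y x' y'] by (metis eq_iff_diff_eq_0)

definition \<sigma> :: "complex \<Rightarrow> complex" where
  "\<sigma> z = (THE z'. \<exists>x y. z = elt x y \<and> z' = elt x (- y))"

lemma sigma_elt [simp]: "\<sigma> (elt x y) = elt x (- y)"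
  unfolding \<sigma>_def by (rule the_equality) auto

lemma sigma_add: "a \<in> K \<Longrightarrow> b \<in> K \<Longrightarrow> \<sigma> (a + b) = \<sigma> a + \<sigma> b"
  by (elim K_cases) (simp add: elt_add)

lemma sigma_mult: "a \<in> K \<Longrightarrow> b \<in> K \<Longrightarrow> \<sigma> (a * b) = \<sigma> a * \<sigma> b"
  by (elim K_cases) (simp add: elt_mult)

lemma K_add: "a \<in> K \<Longrightarrow> b \<in> K \<Longrightarrow> a + b \<in> K"
  by (elim K_cases) (auto simp: elt_add)

lemma K_mult: "a \<in> K \<Longrightarrow> b \<in> K \<Longrightarrow> a * b \<in> K"
  by (elim K_cases) (auto simp: elt_mult)

lemma K_rat: "of_rat x \<in> K" using K_eltI[of x 0] by (simp add: elt_of_rat del: K_eltI)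

lemma K_int: "of_int x \<in> K" using K_rat[of "of_int x"] by simp

lemma K_w: "w \<in> K" using K_eltI[of 0 1] by (simp add: elt_w del: K_eltI)

lemma K_sigma: "a \<in> K \<Longrightarrow> \<sigma> a \<in> K" by (elim K_cases) auto

lemma sigma_sigma: "a \<in> K \<Longrightarrow> \<sigma> (\<sigma> a) = a" by (elim K_cases) auto

lemma sigma_rat: "\<sigma> (of_rat x) = of_rat x" using sigma_elt[of x 0] by (simp add: elt_of_rat del: sigma_elt)

lemma sigma_image_eqI:
  assumes "\<sigma> ` I \<subseteq> J" "\<sigma> ` J \<subseteq> I" "J \<subseteq> K"
  shows "\<sigma> ` I = J"
proof (rule equalityI[OF assms(1)], rule subsetI)
  fix z assume "z \<in> J"
  hence "\<sigma> (\<sigma> z) \<in> \<sigma> ` I" using assms(2) by blast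
  thus "z \<in> \<sigma> ` I" using sigma_sigma[of z] \<open>z \<in> J\<close> assms(3) by (metis subsetD)
qed

lemma elt_inverse: assumes "elt x y \<noteq> 0"
  shows "inverse (elt x y) = elt (x / norm_form x y) (- y / norm_form x y)"
proof (rule inverse_unique)
  have "norm_form x y \<noteq> 0" using assms norm_form_eq_0_iff by auto
  thus "elt x y * elt (x / norm_form x y) (- y / norm_form x y) = 1"
    unfolding elt_mult elt_1[symmetric] by (simp add: norm_form_def diff_divide_distrib[symmetric])
qed

lemma K_inverse: "a \<in> K \<Longrightarrow> inverse a \<in> K"
  using elt_inverse K_int[of 0] by (cases "a = 0") (auto elim!: K_cases)

subsection \<open>The ring of integers\<close>

definition elt_int :: "int \<Rightarrow> int \<Rightarrow> complex" where "elt_int x y = elt (of_int x) (of_int y)"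

lemma elt_int_mult: "elt_int x y * elt_int x' y' = elt_int (x * x' + m * (y * y')) (x * y' + y * x')"
  unfolding elt_int_def elt_mult by simp

lemma elt_int_add: "elt_int x y + elt_int x' y' = elt_int (x + x') (y + y')"
  unfolding elt_int_def elt_add by simp

lemma elt_int_minus: "- elt_int x y = elt_int (- x) (- y)"
  unfolding elt_int_def elt_minus by simp

lemma elt_int_int: "elt_int x 0 = of_int x" unfolding elt_int_def by (simp add: elt_of_int)

lemma elt_int_one: "elt_int 1 0 = 1" using elt_int_int[of 1] by simp

lemma elt_int_inject [simp]: "elt_int x y = elt_int x' y' \<longleftrightarrow> x = x' \<and> y = y'" unfolding elt_int_def by simp

lemma elt_int_K [simp]: "elt_int x y \<in> K" unfolding elt_int_def by simp

lemma elt_int_scale: "of_rat r * elt_int x y = elt (r * of_int x) (r * of_int y)"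
  unfolding elt_int_def elt_of_rat[symmetric] elt_mult by simp

lemma elt_int_eq_0_iff [simp]: "elt_int x y = 0 \<longleftrightarrow> x = 0 \<and> y = 0" unfolding elt_int_def by simp

lemma K_denominator:
  assumes "z \<in> K"
  obtains a b d where "d > 0" "z = elt (of_int a / of_int d) (of_int b / of_int d)"
    "of_int d * z = elt_int a b"
proof -
  obtain x y where z: "z = elt x y" using assms by (elim K_cases)
  obtain a b d where d: "d > 0" "x = of_int a / of_int d" "y = of_int b / of_int d"
    by (rule rat_pair_common_denominator)
  have "of_int d * z = elt_int a b" unfolding z elt_int_def elt_of_int[symmetric] elt_mult using d by simp
  thus ?thesis using that d z by simp
qed

definition quad_ints :: "complex set" where "quad_ints = {elt_int x y | x y. True}"

lemma quad_ints_I [simp, intro]: "elt_int x y \<in> quad_ints" unfolding quad_ints_def by blast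

lemma quad_ints_cases: assumes "z \<in> quad_ints" obtains x y where "z = elt_int x y"
  using assms unfolding quad_ints_def by blast

lemma quad_ints_add: "a \<in> quad_ints \<Longrightarrow> b \<in> quad_ints \<Longrightarrow> a + b \<in> quad_ints"
  by (elim quad_ints_cases) (auto simp: elt_int_add)

lemma quad_ints_mult: "a \<in> quad_ints \<Longrightarrow> b \<in> quad_ints \<Longrightarrow> a * b \<in> quad_ints"
  by (elim quad_ints_cases) (auto simp: elt_int_mult)

lemma quad_ints_int: "of_int x \<in> quad_ints"
  using quad_ints_I[of x 0] by (simp add: elt_int_int del: quad_ints_I)

lemma quad_ints_sum: "(\<And>i. i \<in> S \<Longrightarrow> f i \<in> quad_ints) \<Longrightarrow> sum f S \<in> quad_ints"
  by (induction S rule: infinite_finite_induct) (auto intro: quad_ints_add simp: quad_ints_int[of 0,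
    simplified])

lemma quad_ints_power: "a \<in> quad_ints \<Longrightarrow> a^n \<in> quad_ints"
  by (induction n) (auto intro: quad_ints_mult simp: quad_ints_int[of 1, simplified])

lemma elt_power: "\<exists>x' y'. elt x y^k = elt x' y' \<and> norm_form x' y' = norm_form x y^k"
proof (induction k)
  case 0
  have "elt x y^0 = elt 1 0 \<and> norm_form 1 0 = norm_form x y^0" by (simp add: elt_1 norm_form_def)
  thus ?case by blast
next
  case (Suc k)
  then obtain x' y' where "elt x y^k = elt x' y'" "norm_form x' y' = norm_form x y^k" by blast
  hence "elt x y^Suc k = elt (x * x' + of_int m * (y * y')) (x * y' + y * x')"
    "norm_form (x * x' + of_int m * (y * y')) (x * y' + y * x') = norm_form x y^Suc k"
    by (simp_all only: power_Suc elt_mult norm_form_mult)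
  thus ?case by blast
qed

text \<open>The powers of an integral element have bounded denominators, hence so do the powers of its norm.\<close>

lemma norm_form_int_of_bounded_powers:
  assumes N: "N \<noteq> 0" and bounded: "\<And>k. of_int N * elt x y^k \<in> quad_ints"
  shows "norm_form x y \<in> \<int>"
proof (rule rat_bounded_powers_int[of "N * N"])
  fix k :: nat
  obtain x' y' where power: "elt x y^k = elt x' y'" "norm_form x' y' = norm_form x y^k"
    using elt_power by blast
  obtain u v where "of_int N * elt x' y' = elt_int u v"
    using bounded[of k] unfolding power by (elim quad_ints_cases)
  moreover have "of_int N * elt x' y' = elt (of_int N * x') (of_int N * y')"
    unfolding elt_of_int[symmetric] elt_mult by simp
  ultimately have uv: "of_int N * x' = of_int u" "of_int N * y' = of_int v" by (simp_all add: elt_int_def)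
  have "of_int (N * N) * norm_form x y^k
    = (of_int N * x') * (of_int N * x') - of_int m * ((of_int N * y') * (of_int N * y'))"
    unfolding power(2)[symmetric] norm_form_def[of x' y'] by (simp add: algebra_simps)
  also have "... = of_int (u * u - m * (v * v))" unfolding uv by simp
  finally show "of_int (N * N) * norm_form x y^k \<in> \<int>" by simp
qed (use N in simp)

lemma algebraic_int_bounded_powers:
  assumes z: "z \<in> K" "algebraic_int z"
  obtains N where "N \<noteq> 0" "\<And>k. of_int N * z^k \<in> quad_ints"
proof -
  obtain p :: "int poly" where p: "poly (map_poly of_int p) z = 0" "lead_coeff p = 1"
    using z(2) unfolding algebraic_int_altdef_ipoly by auto
  define n where "n = degree p"
  define c where "c i = Polynomial.coeff p i" for i
  have "poly (map_poly of_int p) z = (\<Sum>i\<le>n. of_int (c i) * z^i)"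
    unfolding poly_altdef n_def c_def by (rule sum.cong) (auto simp: coeff_map_poly degree_map_poly)
  hence relation: "z^n = - (\<Sum>i<n. of_int (c i) * z^i)"
    using p unfolding n_def c_def lessThan_Suc_atMost[symmetric] by (simp add: add_eq_0_iff)
  obtain a b d where d: "d > 0" "of_int d * z = elt_int a b" using K_denominator[OF z(1)] by metis
  define N where "N = d^n"
  have "of_int N * z^k \<in> quad_ints" for k
  proof (induction k rule: less_induct)
    case (less k)
    show ?case
    proof (cases "k \<le> n")
      case True
      hence "of_int N * z^k = of_int (d^(n - k)) * (of_int d * z)^k"
        unfolding N_def by (simp add: power_mult_distrib flip: power_add)
      thus ?thesis unfolding d(2)
        by (simp only:) (intro quad_ints_mult quad_ints_int quad_ints_power quad_ints_I)
    next
      case False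
      hence "of_int N * z^k = of_int N * (z^(k - n) * z^n)" by (simp flip: power_add)
      also have "... = of_int (- 1) * (\<Sum>i<n. of_int (c i) * (of_int N * z^(k - n + i)))"
        unfolding relation by (simp add: sum_distrib_left power_add algebra_simps sum_negf)
      also have "... \<in> quad_ints"
        by (intro quad_ints_mult quad_ints_int quad_ints_sum less.IH) (use False in auto)
      finally show ?thesis .
    qed
  qed
  thus ?thesis using that[of N] d(1) N_def by auto
qed

lemma even_of_norm_form:
  assumes "a * a - m * (b * b) = 4 * n" shows "even a \<and> even b"
proof -
  have "(a * a - m * (b * b)) mod 4 = 0" unfolding assms by simp
  hence "((a * a mod 4) - (m mod 4) * (b * b mod 4) mod 4) mod 4 = 0"
    by (simp only: mod_diff_eq mod_mult_eq)
  thus ?thesis using m_mod_4 unfolding square_mod_4 by (auto split: if_splits)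
qed

lemma OK_subset_quad_ints: "OK \<subseteq> quad_ints"
proof
  fix z assume "z \<in> OK"
  hence z: "z \<in> K" "algebraic_int z" by (auto simp: ring_of_integers_def)
  obtain x y where xy: "z = elt x y" using z(1) by (elim K_cases)
  obtain N where N: "N \<noteq> 0" "\<And>k. of_int N * z^k \<in> quad_ints" using algebraic_int_bounded_powers[OF z] by blast
  have norm_int: "norm_form x y \<in> \<int>" using norm_form_int_of_bounded_powers[OF N(1)] N(2) xy by blast
  have "of_int N * elt (x + 1) y^k \<in> quad_ints" for k
  proof -
    have "elt (x + 1) y = z + 1" unfolding xy elt_1[symmetric] elt_add by simp
    hence "of_int N * elt (x + 1) y^k = (\<Sum>j\<le>k. of_int (int (k choose j)) * (of_int N * z^j))"
      by (simp add: binomial_ring sum_distrib_left mult_ac)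
    also have "... \<in> quad_ints" by (intro quad_ints_sum quad_ints_mult quad_ints_int N(2))
    finally show ?thesis .
  qed
  hence "norm_form (x + 1) y \<in> \<int>" using norm_form_int_of_bounded_powers[OF N(1)] by blast
  hence "norm_form (x + 1) y - norm_form x y - 1 \<in> \<int>" using norm_int by (intro Ints_diff) auto
  moreover have "norm_form (x + 1) y - norm_form x y - 1 = 2 * x"
    unfolding norm_form_def by (simp add: algebra_simps)
  ultimately obtain a where a: "2 * x = of_int a" by (metis Ints_cases)
  obtain n where n: "norm_form x y = of_int n" using norm_int by (elim Ints_cases)
  have norm_eq: "of_int m * ((2 * y) * (2 * y)) = of_int (a * a - 4 * n)"
    by (simp add: a[symmetric] n[symmetric] norm_form_def algebra_simps)
  hence "2 * y \<in> \<int>" using squarefree_mult_rat_square_int[OF sqf, of "2 * y"] by simp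
  then obtain b where b: "2 * y = of_int b" by (elim Ints_cases)
  have "(of_int (m * (b * b)) :: rat) = of_int (a * a - 4 * n)" using norm_eq unfolding b by simp
  hence "m * (b * b) = a * a - 4 * n" by (simp only: of_int_eq_iff)
  hence "even a \<and> even b" using even_of_norm_form[of a b n] by simp
  then obtain a' b' where "a = 2 * a'" "b = 2 * b'" by (auto elim!: evenE)
  hence "x = of_int a'" "y = of_int b'" using a b by auto
  thus "z \<in> quad_ints" unfolding xy by (simp flip: elt_int_def)
qed

lemma OK_eq: "OK = quad_ints"
proof (rule equalityI[OF OK_subset_quad_ints], rule subsetI)
  fix z assume "z \<in> quad_ints"
  then obtain a b where z: "z = elt_int a b" by (elim quad_ints_cases)
  define p :: "int poly" where "p = [:a * a - m * (b * b), - 2 * a, 1:]"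
  have "poly (map_poly of_int p) z = of_int (a * a - m * (b * b)) + z * (of_int (- 2 * a) + z)"
    unfolding p_def by (simp add: map_poly_pCons)
  also have "... = 0" unfolding z elt_int_int[symmetric] elt_int_mult elt_int_add by (simp add: algebra_simps)
  finally have "poly (map_poly of_int p) z = 0" .
  moreover have "lead_coeff p = 1" unfolding p_def by simp
  ultimately have "algebraic_int z" unfolding algebraic_int_altdef_ipoly by blast
  thus "z \<in> OK" using z by (simp add: ring_of_integers_def)
qed

lemma OK_1: "1 \<in> OK" using quad_ints_int[of 1] by (simp add: OK_eq)

subsection \<open>Fractional ideals and their norms\<close>

text \<open>For \<open>a dvd b\<^sup>2 - m\<close> this is the ideal \<open>a \<int> + (b + \<surd>m) \<int>\<close>.\<close>

definition L :: "int \<Rightarrow> int \<Rightarrow> complex set" where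
  "L a b = {elt_int u y | u y. a dvd u - y * b}"

lemma L_mem [simp]: "elt_int u y \<in> L a b \<longleftrightarrow> a dvd u - y * b"
  unfolding L_def by auto

lemma L_cases: assumes "z \<in> L a b" obtains u y where "z = elt_int u y" "a dvd u - y * b"
  using assms unfolding L_def by blast

lemma L_1: "L 1 b = OK" unfolding L_def OK_eq quad_ints_def by auto

lemma L_subset_quad_ints: "L a b \<subseteq> quad_ints" by (auto elim!: L_cases)

lemma L_uminus: "L (- a) b = L a b" unfolding L_def by simp

lemma L_shift: "L a (b + a * k) = L a b"
proof -
  have "u - y * (b + a * k) = (u - y * b) + a * (- (y * k))" for u y by (simp add: algebra_simps)
  hence "a dvd u - y * (b + a * k) \<longleftrightarrow> a dvd u - y * b" for u y
    by (simp only: dvd_add_times_triv_left_iff dvd_add_left_iff dvd_triv_left)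
  thus ?thesis unfolding L_def by simp
qed

lemma L_add: "x \<in> L a b \<Longrightarrow> y \<in> L a b \<Longrightarrow> x + y \<in> L a b"
proof (elim L_cases)
  fix u v u' v' assume "x = elt_int u v" "a dvd u - v * b" "y = elt_int u' v'" "a dvd u' - v' * b"
  moreover from this have "a dvd (u - v * b) + (u' - v' * b)" by (intro dvd_add)
  ultimately show ?thesis by (simp add: elt_int_add algebra_simps)
qed

lemma L_smult:
  assumes a: "a dvd b * b - m" and r: "r \<in> quad_ints" and x: "x \<in> L a b" shows "r * x \<in> L a b"
proof -
  obtain s t where r: "r = elt_int s t" using r by (elim quad_ints_cases)
  obtain u y where x: "x = elt_int u y" "a dvd u - y * b" using x by (elim L_cases)
  have "(s * u + m * (t * y)) - (s * y + t * u) * b = s * (u - y * b) - t * b * (u - y * b)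
    - t * y * (b * b - m)"
    by (simp add: algebra_simps)
  also have "a dvd ..."
    by (rule dvd_diff[OF dvd_diff[OF dvd_mult[OF x(2)] dvd_mult[OF x(2)]] dvd_mult[OF a]])
  finally show ?thesis unfolding r x(1) elt_int_mult by simp
qed

abbreviation FI :: "complex set \<Rightarrow> bool" where "FI I \<equiv> fractional_ideal K I"

lemma FI_D:
  assumes "FI I"
  shows "I \<subseteq> K" "0 \<in> I" "I \<noteq> {0}" "\<And>x y. x \<in> I \<Longrightarrow> y \<in> I \<Longrightarrow> x + y \<in> I"
    "\<And>r x. r \<in> OK \<Longrightarrow> x \<in> I \<Longrightarrow> r * x \<in> I"
  using assms unfolding fractional_ideal_def by simp_all

lemma FI_nonzero: assumes "FI I" obtains x where "x \<in> I" "x \<noteq> 0"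
  using FI_D(2,3)[OF assms] by blast

lemma FI_denominator: assumes "FI I" obtains c where "c \<in> OK" "c \<noteq> 0" "\<And>x. x \<in> I \<Longrightarrow> c * x \<in> OK"
  using assms unfolding fractional_ideal_def by blast

lemma FI_intro:
  assumes "I \<subseteq> K" "0 \<in> I" "x \<in> I" "x \<noteq> 0" "\<And>x y. x \<in> I \<Longrightarrow> y \<in> I \<Longrightarrow> x + y \<in> I" "\<And>r x. r \<in> OK \<Longrightarrow> x \<in> I \<Longrightarrow> r * x \<in> I"
    "c \<in> OK" "c \<noteq> 0" "\<And>x. x \<in> I \<Longrightarrow> c * x \<in> OK"
  shows "FI I"
proof -
  have "I \<noteq> {0}" using assms(3,4) by blast
  thus ?thesis unfolding fractional_ideal_def
    using assms(1,2,5,6) assms(7,8,9) by (intro conjI ballI bexI[of _ c]) simp_all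
qed

lemma FI_uminus: "FI I \<Longrightarrow> x \<in> I \<Longrightarrow> -x \<in> I"
  using FI_D(5)[of I "of_int (- 1)" x] quad_ints_int[of "- 1"] by (simp add: OK_eq)

lemma scale_uminus: assumes "FI I" shows "(*) (- c) ` I = (*) c ` I"
proof -
  have "(*) (- c) ` I \<subseteq> (*) c ` I" for c
    using FI_uminus[OF assms] by (auto simp: image_iff intro!: bexI[of _ "- x" for x])
  from this[of c] this[of "- c"] show ?thesis by auto
qed

lemma FI_mult:
  assumes I: "FI I" and J: "FI J"
  shows "FI (ideal_mult I J)"
proof -
  obtain x y where xy: "x \<in> I" "x \<noteq> 0" "y \<in> J" "y \<noteq> 0" using FI_nonzero[OF I] FI_nonzero[OF J] by metis
  obtain c where c: "c \<in> OK" "c \<noteq> 0" "\<And>x. x \<in> I \<Longrightarrow> c * x \<in> OK" using FI_denominator[OF I] by blast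
  obtain d where d: "d \<in> OK" "d \<noteq> 0" "\<And>x. x \<in> J \<Longrightarrow> d * x \<in> OK" using FI_denominator[OF J] by blast
  show ?thesis
  proof (rule FI_intro[of _ "x * y" "c * d"])
    show "ideal_mult I J \<subseteq> K"
      using FI_D(1)[OF I] FI_D(1)[OF J] K_int[of 0] by (intro ideal_mult_subsetI) (auto intro: K_mult K_add)
    show "r * z \<in> ideal_mult I J" if "r \<in> OK" "z \<in> ideal_mult I J" for r z
      using that(2)
    proof (induction rule: ideal_mult_induct)
      case (mult a b)
      hence "r * a * b \<in> ideal_mult I J" using FI_D(5)[OF I that(1)] by (intro ideal_mult_memI)
      thus ?case by (simp add: mult.assoc)
    qed (auto simp: ideal_mult_zero distrib_left intro: ideal_mult_add)
    show "c * d * z \<in> OK" if "z \<in> ideal_mult I J" for z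
      using that
    proof (induction rule: ideal_mult_induct)
      case (mult a b)
      hence "(c * a) * (d * b) \<in> OK" using c d by (simp add: OK_eq quad_ints_mult)
      thus ?case by (simp add: mult_ac)
    qed (use quad_ints_int[of 0] in \<open>auto simp: distrib_left OK_eq intro: quad_ints_add\<close>)
  qed (use xy c d in \<open>auto simp: OK_eq intro: quad_ints_mult ideal_mult_memI ideal_mult_zero ideal_mult_add\<close>)
qed

lemma FI_unit_mult:
  assumes I: "FI I" shows "ideal_mult OK I = I"
proof (intro equalityI subsetI)
  show "x \<in> I" if "x \<in> ideal_mult OK I" for x
    using that by (induction rule: ideal_mult_induct) (use FI_D[OF I] in auto)
  show "x \<in> ideal_mult OK I" if "x \<in> I" for x
    using ideal_mult_memI[OF OK_1 that] by simp
qed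

lemma FI_scale:
  assumes c: "c \<in> K" "c \<noteq> 0" and I: "FI I"
  shows "FI ((*) c ` I)"
proof -
  obtain x where x: "x \<in> I" "x \<noteq> 0" using FI_nonzero[OF I] .
  obtain d where d: "d \<in> OK" "d \<noteq> 0" "\<And>x. x \<in> I \<Longrightarrow> d * x \<in> OK" using FI_denominator[OF I] by blast
  obtain a b n where n: "n > 0" "of_int n * inverse c = elt_int a b"
    using K_denominator[OF K_inverse[OF c(1)]] by metis
  show ?thesis
  proof (rule FI_intro[of _ "c * x" "d * (of_int n * inverse c)"])
    show "d * (of_int n * inverse c) \<in> OK" using d unfolding n(2) OK_eq by (intro quad_ints_mult) auto
    show "d * (of_int n * inverse c) * z \<in> OK" if "z \<in> (*) c ` I" for z
    proof -
      obtain y where y: "y \<in> I" "z = c * y" using \<open>z\<in>(*) c ` I\<close> by auto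
      have "d * (of_int n * inverse c) * z = of_int n * (d * y)" unfolding y(2) using c by simp
      also have "... \<in> OK" unfolding OK_eq
        by (rule quad_ints_mult[OF quad_ints_int]) (use d y in \<open>auto simp: OK_eq\<close>)
      finally show ?thesis .
    qed
  qed (use FI_D[OF I] c d x n(1) in
    \<open>auto simp: distrib_left[symmetric] mult.left_commute[of _ c] image_iff intro: K_mult\<close>)
qed

lemma FI_L:
  assumes a: "a > 0" "a dvd b * b - m"
  shows "FI (L a b)"
proof (rule FI_intro[of _ "of_int a" 1])
  show "0 \<in> L a b" "of_int a \<in> L a b" using L_mem[of 0 0 a b] L_mem[of a 0 a b] by (simp_all add: elt_int_int)
qed (use a L_subset_quad_ints[of a b] OK_1 in \<open>auto simp: OK_eq intro: L_add L_smult elim!: L_cases\<close>)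

lemma FI_OK: "FI OK"
  using FI_L[of 1 0] by (simp add: L_1)

lemma FI_principal: "c \<in> K \<Longrightarrow> c \<noteq> 0 \<Longrightarrow> FI ((*) c ` OK)"
  by (rule FI_scale[OF _ _ FI_OK])

lemma integral_ideal_basis:
  assumes J: "FI J" and integral: "J \<subseteq> quad_ints"
  obtains a b g where "a > 0" "g > 0" "elt_int a 0 \<in> J" "elt_int b g \<in> J"
    "\<And>x. elt_int x 0 \<in> J \<Longrightarrow> a dvd x" "\<And>x y. elt_int x y \<in> J \<Longrightarrow> g dvd y"
proof -
  have smult: "elt_int s t * z \<in> J" if "z \<in> J" for s t z using FI_D(5)[OF J _ that] by (simp add: OK_eq)
  obtain z where z: "z \<in> J" "z \<noteq> 0" using FI_nonzero[OF J] .
  then obtain s t where st: "z = elt_int s t" using integral by (meson quad_ints_cases subsetD)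
  define k where "k = s * s - m * (t * t)"
  have conj_mult: "elt_int s (- t) * z = elt_int k 0"
    unfolding st elt_int_mult k_def by (simp add: algebra_simps)
  hence k_mem: "elt_int k 0 \<in> J" using smult[OF z(1)] by metis
  have "elt_int s (- t) \<noteq> 0" using z(2) st by auto
  hence "elt_int k 0 \<noteq> 0" using z(2) conj_mult by (metis mult_eq_0_iff)
  hence k: "k \<noteq> 0" by auto
  define Y where "Y = {y. \<exists>x. elt_int x y \<in> J}"
  have "elt_int 0 1 * elt_int k 0 = elt_int 0 k" unfolding elt_int_mult by simp
  hence "k \<in> Y" using smult[OF k_mem] unfolding Y_def by (metis mem_Collect_eq)
  moreover have "x + y \<in> Y" if "x \<in> Y" "y \<in> Y" for x y
    using that FI_D(4)[OF J] unfolding Y_def mem_Collect_eq by (metis elt_int_add)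
  moreover have "- y \<in> Y" if "y \<in> Y" for y
    using that FI_uminus[OF J] unfolding Y_def mem_Collect_eq by (metis elt_int_minus)
  ultimately obtain g where g: "g > 0" "g \<in> Y" "\<And>y. y \<in> Y \<Longrightarrow> g dvd y"
    using int_subgroup_principal[of Y k] k by metis
  define X where "X = {x. elt_int x 0 \<in> J}"
  have "k \<in> X" using k_mem unfolding X_def by simp
  moreover have "x + y \<in> X" if "x \<in> X" "y \<in> X" for x y
    using FI_D(4)[OF J, of "elt_int x 0" "elt_int y 0"] that unfolding X_def by (simp add: elt_int_add)
  moreover have "- x \<in> X" if "x \<in> X" for x
    using FI_uminus[OF J, of "elt_int x 0"] that unfolding X_def by (simp add: elt_int_minus)
  ultimately obtain a where a: "a > 0" "a \<in> X" "\<And>x. x \<in> X \<Longrightarrow> a dvd x"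
    using int_subgroup_principal[of X k] k by metis
  obtain b where "elt_int b g \<in> J" using g(2) unfolding Y_def by blast
  thus ?thesis using that[OF a(1) g(1)] a g unfolding X_def Y_def by blast
qed

lemma integral_ideal_cases:
  assumes J: "FI J" and integral: "J \<subseteq> quad_ints"
  obtains g a b where "g > 0" "a > 0" "a dvd b * b - m" "J = (*) (of_int g) ` L a b"
proof -
  have smult: "elt_int s t * z \<in> J" if "z \<in> J" for s t z using FI_D(5)[OF J _ that] by (simp add: OK_eq)
  obtain A B g where A: "A > 0" "elt_int A 0 \<in> J" "\<And>x. elt_int x 0 \<in> J \<Longrightarrow> A dvd x"
    and g: "g > 0" "elt_int B g \<in> J" "\<And>x y. elt_int x y \<in> J \<Longrightarrow> g dvd y"
      using integral_ideal_basis[OF J integral] by metis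
  have "elt_int 0 1 * elt_int A 0 \<in> J" "elt_int 0 1 * elt_int B g \<in> J" using smult A(2) g(2) by blast+
  hence "g dvd A" "g dvd B" unfolding elt_int_mult using g(3) by auto
  then obtain a b where ab: "A = g * a" "B = g * b" by (auto elim!: dvdE)
  have "elt_int b (- 1) * elt_int B g = elt_int (g * (b * b - m)) 0"
    unfolding elt_int_mult ab by (simp add: algebra_simps)
  hence "A dvd g * (b * b - m)" using A(3) smult[OF g(2)] by metis
  hence "a dvd b * b - m" unfolding ab using g(1) by simp
  moreover have "a > 0" using A(1) g(1) ab by (simp add: zero_less_mult_iff)
  moreover have "J = (*) (of_int g) ` L a b"
  proof (intro equalityI subsetI)
    fix z assume z: "z \<in> J"
    obtain x y where xy: "z = elt_int x y" using z integral by (metis quad_ints_cases subsetD)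
    obtain y' where y': "y = g * y'" using g(3)[OF z[unfolded xy]] by (elim dvdE)
    have "elt_int x y + elt_int (- y') 0 * elt_int B g \<in> J"
      using FI_D(4)[OF J] z smult[OF g(2)] unfolding xy by blast
    moreover have "elt_int x y + elt_int (- y') 0 * elt_int B g = elt_int (x - y' * B) 0"
      unfolding elt_int_mult elt_int_add y' by simp
    ultimately obtain j where "x - y' * B = A * j" using A(3) by (metis dvdE)
    hence "x = g * (a * j + y' * b)" unfolding ab by (simp add: algebra_simps)
    hence "z = elt_int g 0 * elt_int (a * j + y' * b) y'" unfolding xy elt_int_mult y' by simp
    moreover have "elt_int (a * j + y' * b) y' \<in> L a b" by simp
    ultimately show "z \<in> (*) (of_int g) ` L a b" unfolding elt_int_int by blast
  next
    fix z assume "z \<in> (*) (of_int g) ` L a b"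
    then obtain u y where uy: "z = elt_int g 0 * elt_int u y" "a dvd u - y * b"
      by (auto simp: elt_int_int elim!: L_cases)
    then obtain j where "u - y * b = a * j" by (auto elim: dvdE)
    hence "z = elt_int j 0 * elt_int A 0 + elt_int y 0 * elt_int B g"
      unfolding uy(1) elt_int_mult elt_int_add ab by (simp add: algebra_simps)
    thus "z \<in> J" using FI_D(4)[OF J] smult A(2) g(2) by simp
  qed
  ultimately show ?thesis using that[OF g(1)] by blast
qed

lemma fractional_ideal_cases:
  assumes I: "FI I"
  obtains r a b where "r > 0" "a > 0" "a dvd b * b - m" "I = (*) (of_rat r) ` L a b"
proof -
  obtain c where c: "c \<in> OK" "c \<noteq> 0" "\<And>x. x \<in> I \<Longrightarrow> c * x \<in> OK" using FI_denominator[OF I] by blast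
  obtain x y where xy: "c = elt_int x y" using c(1) unfolding OK_eq by (elim quad_ints_cases)
  define n where "n = x * x - m * (y * y)"
  have n: "elt_int x (- y) * c = of_int n"
    unfolding xy elt_int_mult n_def elt_int_int[symmetric] by (simp add: algebra_simps)
  have "elt_int x (- y) \<noteq> 0" using c(2) xy by auto
  hence "n \<noteq> 0" using n c(2) by auto
  define J where "J = (*) (of_int n) ` I"
  have "J \<subseteq> quad_ints" unfolding J_def n[symmetric]
    using c(3) by (auto simp: mult.assoc OK_eq intro: quad_ints_mult)
  moreover have "FI J" unfolding J_def by (rule FI_scale[OF K_int _ I]) (use \<open>n \<noteq> 0\<close> in simp)
  ultimately obtain g a b where g: "g > 0" and a: "a > 0" "a dvd b * b - m"
    and J: "J = (*) (of_int g) ` L a b"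
    using integral_ideal_cases by metis
  have I_eq: "I = (*) (of_rat (of_int g / of_int n)) ` L a b"
  proof -
    have "I = (*) (inverse (of_int n)) ` J" unfolding J_def scale_scale using \<open>n \<noteq> 0\<close> by simp
    thus ?thesis unfolding J scale_scale by (simp add: of_rat_divide) (simp add: divide_inverse mult_ac)
  qed
  show ?thesis
  proof (cases "n > 0")
    case True
    thus ?thesis using that[OF _ a I_eq] g by simp
  next
    case False
    hence "(0::rat) < of_int g / of_int (- n)" using g \<open>n \<noteq> 0\<close> by (simp add: divide_less_0_iff)
    moreover have "I = (*) (of_rat (of_int g / of_int (- n))) ` L a b"
      unfolding I_eq using scale_uminus[OF FI_L[OF a]] by (simp add: of_rat_minus)
    ultimately show ?thesis using that a by blast
  qed
qed

text \<open>This is where \<open>m mod 4 \<noteq> 1\<close> is used: the form \<open>a x\<^sup>2 + 2 b x y + c y\<^sup>2\<close> of discriminant \<open>4 m\<close> is primitive.\<close>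

lemma primitive_form:
  assumes a: "a > 0" and c: "b * b - m = a * c"
  obtains u v t where "u * a + v * (2 * b) + t * c = 1"
proof -
  have "is_unit (gcd a (gcd (2 * b) c))"
  proof (rule ccontr)
    assume "\<not> is_unit (gcd a (gcd (2 * b) c))"
    moreover have "gcd a (gcd (2 * b) c) \<noteq> 0" using a by simp
    ultimately obtain l where l: "prime l" "l dvd a" "l dvd 2 * b" "l dvd c"
      using prime_divisor_exists by (metis gcd_greatest_iff)
    have square_dvd: "l * l dvd b * b - m" unfolding c using l(2,4) by (rule mult_dvd_mono)
    show False
    proof (cases "l = 2")
      case True
      then obtain j where "b * b - m * (1 * 1) = 4 * j" using square_dvd by (auto elim: dvdE)
      thus False using even_of_norm_form[of b 1 j] by simp
    next
      case False
      hence "\<not> l dvd 2" using l(1) by (metis two_is_prime primes_dvd_imp_eq)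
      hence "l dvd b" using l by (simp add: prime_dvd_mult_iff)
      hence "l * l dvd m" using dvd_diff[OF mult_dvd_mono square_dvd, of b b] by simp
      hence "is_unit l" using squarefreeD[OF sqf, of l] by (simp add: power2_eq_square)
      thus False using l(1) not_prime_unit by blast
    qed
  qed
  then obtain u s where us: "u * a + s * gcd (2 * b) c = 1" using bezout_int[of a "gcd (2 * b) c"] by auto
  obtain v t where "v * (2 * b) + t * c = gcd (2 * b) c" using bezout_int[of "2 * b" c] by blast
  hence "u * a + (s * v) * (2 * b) + (s * t) * c = 1"
    using us by (metis (no_types, opaque_lifting) add.assoc distrib_left mult.assoc)
  thus ?thesis using that by blast
qed

lemma L_mult_conj:
  assumes a: "a > 0" "a dvd b * b - m"
  shows "ideal_mult (L a b) (L a (- b)) = (*) (of_int a) ` OK"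
proof
  let ?P = "ideal_mult (L a b) (L a (- b))"
  obtain c where c: "b * b - m = a * c" using a(2) by (elim dvdE)
  hence m: "m = b * b - a * c" by simp
  have FI_L': "FI (L a b)" "FI (L a (- b))" using FI_L a by simp_all
  have "x * y \<in> (*) (of_int a) ` OK" if xy: "x \<in> L a b" "y \<in> L a (- b)" for x y
  proof -
    obtain u s u' s' where x: "x = elt_int u s" "a dvd u - s * b"
      and y: "y = elt_int u' s'" "a dvd u' - s' * - b"
      using xy by (elim L_cases) blast
    obtain i j where "u - s * b = a * i" "u' - s' * - b = a * j" using x(2) y(2) by (elim dvdE)
    hence ij: "u = a * i + s * b" "u' = a * j - s' * b" by simp_all
    have "x * y = elt_int (a * (a * i * j - i * s' * b + s * b * j - s * s' * c)) (a * (i * s' + s * j))"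
      unfolding x(1) y(1) elt_int_mult ij by (simp add: m algebra_simps)
    also have "... = of_int a * elt_int (a * i * j - i * s' * b + s * b * j - s * s' * c) (i * s' + s * j)"
      unfolding elt_int_int[symmetric] elt_int_mult by simp
    finally show ?thesis unfolding OK_eq by blast
  qed
  thus "?P \<subseteq> (*) (of_int a) ` OK"
    using FI_D(2,4)[OF FI_principal[OF K_int[of a]]] a(1) by (intro ideal_mult_subsetI) auto
  obtain u v t where uvt: "u * a + v * (2 * b) + t * c = 1" using primitive_form[OF a(1) c] .
  note FI_P = FI_D(4,5)[OF FI_mult[OF FI_L']]
  have "elt_int a 0 * elt_int a 0 \<in> ?P" "elt_int b 1 * elt_int a 0 \<in> ?P" "elt_int a 0 * elt_int (- b) 1 \<in> ?P"
    "elt_int b 1 * elt_int (- b) 1 \<in> ?P"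
    by (intro ideal_mult_memI; simp)+
  hence "elt_int u 0 * (elt_int a 0 * elt_int a 0) + (elt_int v 0 * (elt_int b 1 * elt_int a 0)
    + (elt_int (- v) 0 * (elt_int a 0 * elt_int (- b) 1)
    + elt_int (- t) 0 * (elt_int b 1 * elt_int (- b) 1))) \<in> ?P"
    using FI_P(2)[of "elt_int _ 0"] by (intro FI_P(1)) (simp_all add: OK_eq)
  moreover have "elt_int u 0 * (elt_int a 0 * elt_int a 0) + (elt_int v 0 * (elt_int b 1 * elt_int a 0)
    + (elt_int (- v) 0 * (elt_int a 0 * elt_int (- b) 1)
    + elt_int (- t) 0 * (elt_int b 1 * elt_int (- b) 1))) = elt_int (a * (u * a + v * (2 * b) + t * c)) 0"
    unfolding elt_int_mult elt_int_add using c by (simp add: algebra_simps)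
  ultimately have "of_int a \<in> ?P" unfolding uvt by (simp add: elt_int_int)
  thus "(*) (of_int a) ` OK \<subseteq> ?P" using FI_P(2)[of _ "of_int a"] by (auto simp: mult.commute)
qed

lemma sigma_L: "\<sigma> ` ((*) (of_rat r) ` L a b) = (*) (of_rat r) ` L a (- b)"
proof (rule sigma_image_eqI)
  have subset: "\<sigma> ` ((*) (of_rat r) ` L a b) \<subseteq> (*) (of_rat r) ` L a (- b)" for b
  proof
    fix z assume "z \<in> \<sigma> ` ((*) (of_rat r) ` L a b)"
    then obtain u y where uy: "z = \<sigma> (of_rat r * elt_int u y)" "a dvd u - y * b" by (auto elim!: L_cases)
    have "z = of_rat r * elt_int u (- y)" unfolding uy(1) elt_int_scale by simp
    moreover have "elt_int u (- y) \<in> L a (- b)" using uy by simp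
    ultimately show "z \<in> (*) (of_rat r) ` L a (- b)" by blast
  qed
  show "\<sigma> ` ((*) (of_rat r) ` L a b) \<subseteq> (*) (of_rat r) ` L a (- b)" by (rule subset)
  show "\<sigma> ` ((*) (of_rat r) ` L a (- b)) \<subseteq> (*) (of_rat r) ` L a b" using subset[of "- b"] by simp
  show "(*) (of_rat r) ` L a (- b) \<subseteq> K" by (auto elim!: L_cases intro!: K_mult K_rat)
qed

lemma sigma_OK: "\<sigma> ` OK = OK"
  using sigma_L[of 1 1 0] by (simp add: L_1)

lemma FI_sigma: assumes "FI I" shows "FI (\<sigma> ` I)"
proof -
  obtain r a b where r: "r > 0" and a: "a > 0" "a dvd b * b - m" and I: "I = (*) (of_rat r) ` L a b"
    using fractional_ideal_cases[OF assms] .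
  have "FI (L a (- b))" using FI_L a by simp
  thus ?thesis unfolding I sigma_L using FI_scale[OF K_rat] r by simp
qed

lemma sigma_ideal_mult:
  assumes "FI I" "FI J"
  shows "\<sigma> ` ideal_mult I J = ideal_mult (\<sigma> ` I) (\<sigma> ` J)"
proof (rule sigma_image_eqI)
  have subset: "\<sigma> ` ideal_mult I J \<subseteq> ideal_mult (\<sigma> ` I) (\<sigma> ` J)" if IJ: "I \<subseteq> K" "J \<subseteq> K" for I J
  proof -
    have "z \<in> K \<and> \<sigma> z \<in> ideal_mult (\<sigma> ` I) (\<sigma> ` J)" if "z \<in> ideal_mult I J" for z
      using that
    proof (induction rule: ideal_mult_induct)
      case (mult a b)
      hence "a \<in> K" "b \<in> K" using IJ by auto
      moreover have "\<sigma> a * \<sigma> b \<in> ideal_mult (\<sigma> ` I) (\<sigma> ` J)" using mult by (intro ideal_mult_memI imageI)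
      ultimately show ?case by (simp add: sigma_mult K_mult)
    qed (use K_int[of 0] sigma_rat[of 0] in
      \<open>auto simp: sigma_add ideal_mult_zero intro: K_add ideal_mult_add\<close>)
    thus ?thesis by blast
  qed
  note I = FI_D(1)[OF assms(1)] FI_D(1)[OF FI_sigma[OF assms(1)]]
    and J = FI_D(1)[OF assms(2)] FI_D(1)[OF FI_sigma[OF assms(2)]]
  show "\<sigma> ` ideal_mult I J \<subseteq> ideal_mult (\<sigma> ` I) (\<sigma> ` J)" by (rule subset[OF I(1) J(1)])
  have "\<sigma> ` (\<sigma> ` I) = I" "\<sigma> ` (\<sigma> ` J) = J" using I(1) J(1) by (auto simp: sigma_sigma image_image subset_iff)
  thus "\<sigma> ` ideal_mult (\<sigma> ` I) (\<sigma> ` J) \<subseteq> ideal_mult I J" using subset[OF I(2) J(2)] by simp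
  show "ideal_mult (\<sigma> ` I) (\<sigma> ` J) \<subseteq> K" by (intro FI_D(1) FI_mult FI_sigma assms)
qed

lemma L_mult_sigma:
  assumes "a > 0" "a dvd b * b - m"
  shows "ideal_mult ((*) (of_rat r) ` L a b) (\<sigma> ` ((*) (of_rat r) ` L a b))
    = (*) (of_rat (r * r * of_int a)) ` OK"
proof -
  have "ideal_mult ((*) (of_rat r) ` L a b) ((*) (of_rat r) ` L a (- b))
    = (*) (of_rat r) ` ((*) (of_rat r) ` ideal_mult (L a b) (L a (- b)))"
    by (simp only: ideal_mult_scale ideal_mult_comm[of "L a b" "(*) _ ` _"] ideal_mult_comm[of "L a (- b)"
      "L a b"])
  thus ?thesis unfolding sigma_L L_mult_conj[OF assms] scale_scale by (simp add: of_rat_mult mult_ac)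
qed

definition ideal_norm :: "complex set \<Rightarrow> rat" where
  "ideal_norm I = (THE n. n > 0 \<and> ideal_mult I (\<sigma> ` I) = (*) (of_rat n) ` OK)"

lemma rat_scale_unique:
  assumes "(*) (of_rat n) ` OK = (*) (of_rat n') ` OK" "n > 0" "n' > 0"
  shows "n = n'"
proof -
  have multiple: "\<exists>k::int. n = n' * of_int k" if subset: "(*) (of_rat n) ` OK \<subseteq> (*) (of_rat n') ` OK" for n n'
  proof -
    have "of_rat n * 1 \<in> (*) (of_rat n') ` OK" using subset OK_1 by blast
    then obtain x y where "of_rat n = of_rat n' * elt_int x y"
      unfolding OK_eq by (auto elim!: quad_ints_cases)
    hence "elt n 0 = elt (n' * of_int x) (n' * of_int y)" by (simp add: elt_int_scale elt_of_rat)
    thus ?thesis by auto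
  qed
  obtain k j where kj: "n = n' * of_int k" "n' = n * of_int j"
    using multiple[of n n'] multiple[of n' n] assms(1) by blast
  hence "k > 0" using assms(2)[unfolded kj(1)] assms(3) by (simp add: zero_less_mult_iff)
  have "n * 1 = n * of_int (j * k)" using kj by simp
  hence "j * k = 1" using assms(2) by (metis less_irrefl mult_left_cancel of_int_eq_1_iff)
  thus ?thesis using kj(1) \<open>k > 0\<close> zmult_eq_1_iff[of j k] by auto
qed

lemma ideal_norm_eqI:
  assumes "n > 0" "ideal_mult I (\<sigma> ` I) = (*) (of_rat n) ` OK"
  shows "ideal_norm I = n"
  unfolding ideal_norm_def by (rule the_equality) (use assms rat_scale_unique in auto)

lemma ideal_norm_scale_L:
  assumes "r > 0" "a > 0" "a dvd b * b - m"
  shows "ideal_norm ((*) (of_rat r) ` L a b) = r * r * of_int a"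
  using assms by (intro ideal_norm_eqI L_mult_sigma) auto

lemma ideal_norm_L: "a > 0 \<Longrightarrow> a dvd b * b - m \<Longrightarrow> ideal_norm (L a b) = of_int a"
  using ideal_norm_scale_L[of 1 a b] by simp

lemma ideal_norm_OK: "ideal_norm OK = 1"
  using ideal_norm_L[of 1 0] by (simp add: L_1)

lemma ideal_norm_FI:
  assumes "FI I"
  shows "ideal_norm I > 0" "ideal_mult I (\<sigma> ` I) = (*) (of_rat (ideal_norm I)) ` OK"
proof -
  obtain r a b where r: "r > 0" and a: "a > 0" "a dvd b * b - m" and I: "I = (*) (of_rat r) ` L a b"
    using fractional_ideal_cases[OF assms] .
  show "ideal_norm I > 0" unfolding I ideal_norm_scale_L[OF r a] using r a by simp
  show "ideal_mult I (\<sigma> ` I) = (*) (of_rat (ideal_norm I)) ` OK"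
    unfolding I ideal_norm_scale_L[OF r a] by (rule L_mult_sigma[OF a])
qed

lemma ideal_norm_mult:
  assumes I: "FI I" and J: "FI J"
  shows "ideal_norm (ideal_mult I J) = ideal_norm I * ideal_norm J"
proof (rule ideal_norm_eqI)
  show "ideal_norm I * ideal_norm J > 0" using ideal_norm_FI(1)[OF I] ideal_norm_FI(1)[OF J] by simp
  have "ideal_mult (ideal_mult I J) (\<sigma> ` ideal_mult I J)
    = ideal_mult (ideal_mult I (\<sigma> ` I)) (ideal_mult J (\<sigma> ` J))"
    unfolding sigma_ideal_mult[OF I J] by (rule ideal_mult_interchange)
  also have "... = (*) (of_rat (ideal_norm I)) ` ideal_mult OK ((*) (of_rat (ideal_norm J)) ` OK)"
    unfolding ideal_norm_FI(2)[OF I] ideal_norm_FI(2)[OF J] by (rule ideal_mult_scale)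
  also have "ideal_mult OK ((*) (of_rat (ideal_norm J)) ` OK) = (*) (of_rat (ideal_norm J)) ` OK"
    using ideal_norm_FI(1)[OF J] by (intro FI_unit_mult FI_principal K_rat) auto
  finally show "ideal_mult (ideal_mult I J) (\<sigma> ` ideal_mult I J)
    = (*) (of_rat (ideal_norm I * ideal_norm J)) ` OK"
    unfolding scale_scale by (simp add: of_rat_mult)
qed

lemma ideal_mult_principal: "ideal_mult ((*) a ` OK) ((*) b ` OK) = (*) (a * b) ` OK"
proof -
  have "ideal_mult ((*) a ` OK) ((*) b ` OK) = (*) a ` ((*) b ` ideal_mult OK OK)"
    by (simp only: ideal_mult_scale ideal_mult_comm[of OK "(*) b ` OK"])
  thus ?thesis by (simp add: FI_unit_mult[OF FI_OK] scale_scale)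
qed

lemma ideal_norm_scale:
  assumes xy: "elt x y \<noteq> 0" and I: "FI I"
  shows "ideal_norm ((*) (elt x y) ` I) = \<bar>norm_form x y\<bar> * ideal_norm I"
proof (rule ideal_norm_eqI)
  have "norm_form x y \<noteq> 0" using xy norm_form_eq_0_iff by auto
  thus "0 < \<bar>norm_form x y\<bar> * ideal_norm I" using ideal_norm_FI(1)[OF I] by simp
  have "\<sigma> ` (*) (elt x y) ` I = (*) (elt x (- y)) ` (\<sigma> ` I)"
    using FI_D(1)[OF I] by (auto simp: image_image sigma_mult subset_iff image_iff)
  hence "ideal_mult ((*) (elt x y) ` I) (\<sigma> ` (*) (elt x y) ` I)
    = (*) (elt x y) ` (*) (elt x (- y)) ` ideal_mult I (\<sigma> ` I)"
    by (simp only: ideal_mult_scale ideal_mult_comm[of I "(*) _ ` _"] ideal_mult_comm[of "\<sigma> ` I" I])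
  also have "... = (*) (of_rat (norm_form x y * ideal_norm I)) ` OK"
    unfolding scale_scale ideal_norm_FI(2)[OF I]
    by (simp add: of_rat_mult elt_mult_conj[symmetric] mult.assoc)
  also have "... = (*) (of_rat (\<bar>norm_form x y\<bar> * ideal_norm I)) ` OK"
    using scale_uminus[OF FI_OK, of "of_rat (norm_form x y * ideal_norm I)"]
    by (cases "norm_form x y \<ge> 0") (simp_all add: of_rat_minus)
  finally show "ideal_mult ((*) (elt x y) ` I) (\<sigma> ` (*) (elt x y) ` I)
    = (*) (of_rat (\<bar>norm_form x y\<bar> * ideal_norm I)) ` OK" .
qed

lemma FI_inverse:
  assumes I: "FI I"
  shows "\<exists>J. FI J \<and> ideal_mult J I = OK"
proof -
  let ?J = "(*) (of_rat (1 / ideal_norm I)) ` (\<sigma> ` I)"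
  have norm_pos: "ideal_norm I > 0" using ideal_norm_FI(1)[OF I] .
  have "ideal_mult ?J I = (*) (of_rat (1 / ideal_norm I)) ` ((*) (of_rat (ideal_norm I)) ` OK)"
    unfolding ideal_mult_scale ideal_mult_comm[of "\<sigma> ` I"] ideal_norm_FI(2)[OF I] ..
  also have "... = OK" unfolding scale_scale using norm_pos by (simp flip: of_rat_mult)
  finally show ?thesis using FI_scale[OF K_rat _ FI_sigma[OF I]] norm_pos by (intro exI[of _ ?J]) auto
qed

end

section \<open>The narrow class group\<close>

context quad
begin

subsection \<open>Total positivity\<close>

lemma real_embedding_int:
  assumes sig: "real_embedding K sig"
  shows "sig (of_int n) = of_int n"
proof (induction n rule: int_induct[where k = 0])
  case base
  have "sig (0 + 0) = sig 0 + sig 0" using sig K_int[of 0] unfolding real_embedding_def of_int_0 by blast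
  thus ?case by simp
next
  case (step1 n)
  have "sig (of_int n + 1) = sig (of_int n) + sig 1" "sig 1 = 1"
    using sig K_int[of n] K_int[of 1] unfolding real_embedding_def by simp_all
  thus ?case using step1 by simp
next
  case (step2 n)
  have "sig (of_int (n - 1) + 1) = sig (of_int (n - 1)) + sig 1" "sig 1 = 1"
    using sig K_int[of "n - 1"] K_int[of 1] unfolding real_embedding_def by (metis of_int_1)+
  thus ?case using step2 by simp
qed

lemma real_embedding_rat:
  assumes sig: "real_embedding K sig"
  shows "sig (of_rat r) = of_rat r"
proof -
  obtain a b where b: "b > 0" and r: "r = of_int a / of_int b" using rat_fraction by metis
  have "sig (of_rat r * of_int b) = sig (of_rat r) * sig (of_int b)"
    using sig K_rat[of r] K_int[of b] unfolding real_embedding_def by blast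
  moreover have "of_rat r * of_int b = (of_int a :: complex)" using b unfolding r by (simp add: of_rat_divide)
  ultimately have "sig (of_rat r) * of_int b = of_int a" using real_embedding_int[OF sig] by simp
  thus ?thesis using b unfolding r by (simp add: of_rat_divide field_simps)
qed

lemma real_embedding_elt:
  assumes sig: "real_embedding K sig"
  shows "sig w * sig w = of_int m" "sig (elt x y) = of_rat x + of_rat y * sig w"
proof -
  have add: "\<And>x y. x \<in> K \<Longrightarrow> y \<in> K \<Longrightarrow> sig (x + y) = sig x + sig y"
    and mult: "\<And>x y. x \<in> K \<Longrightarrow> y \<in> K \<Longrightarrow> sig (x * y) = sig x * sig y"
    using sig unfolding real_embedding_def by auto
  show "sig w * sig w = of_int m" using mult[OF K_w K_w] real_embedding_int[OF sig] by (simp add: w_square)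
  show "sig (elt x y) = of_rat x + of_rat y * sig w" unfolding elt_def
    using add[OF K_rat K_mult[OF K_rat K_w]] mult[OF K_rat K_w] real_embedding_rat[OF sig] by simp
qed

lemma Im_rat [simp]: "Im (of_rat q) = 0"
proof -
  obtain a b where "q = of_int a / of_int b" using rat_fraction by metis
  hence "(of_rat q :: complex) = of_real (of_int a / of_int b)" by (simp add: of_rat_divide)
  thus ?thesis by (simp only: Im_complex_of_real)
qed

lemma real_embedding_Re:
  assumes "m > 0"
  shows "real_embedding K Re" "real_embedding K (\<lambda>z. Re (\<sigma> z))"
proof -
  have "csqrt (of_int (4 * m)) = of_real (sqrt (of_int (4 * m)))"
    using csqrt_of_real_nonneg[of "of_int (4 * m)"] assms by simp
  hence "Im w = 0" unfolding w_def by simp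
  hence Im: "Im z = 0" if "z \<in> K" for z using that by (elim K_cases) (simp add: elt_def)
  show "real_embedding K Re" unfolding real_embedding_def using Im by simp
  show "real_embedding K (\<lambda>z. Re (\<sigma> z))" unfolding real_embedding_def
    using Im[OF K_sigma] sigma_add sigma_mult sigma_rat[of 1] by simp
qed

lemma real_embedding_norm:
  assumes sig: "real_embedding K sig"
  shows "sig (elt x y) * sig (elt x (- y)) = of_rat (norm_form x y)"
    "sig (elt x y) + sig (elt x (- y)) = of_rat (2 * x)"
  unfolding real_embedding_elt(2)[OF sig] norm_form_def using real_embedding_elt(1)[OF sig]
  by (simp_all add: of_rat_diff of_rat_mult of_rat_minus algebra_simps)

lemma totally_positive_elt:
  "totally_positive K (elt x y) \<longleftrightarrow> elt x y \<noteq> 0 \<and> (m > 0 \<longrightarrow> norm_form x y > 0 \<and> x > 0)"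
proof (intro iffI conjI impI)
  assume positive: "totally_positive K (elt x y)"
  show "elt x y \<noteq> 0" using positive unfolding totally_positive_def by blast
  assume "m > 0"
  note embeddings = real_embedding_Re[OF this]
  have pos: "Re (elt x y) > 0" "Re (elt x (- y)) > 0"
    using positive embeddings unfolding totally_positive_def by fastforce+
  have "(of_rat (norm_form x y) :: real) > 0"
    using mult_pos_pos[OF pos] unfolding real_embedding_norm[OF embeddings(1)] .
  moreover have "(of_rat (2 * x) :: real) > 0"
    using add_pos_pos[OF pos] unfolding real_embedding_norm[OF embeddings(1)] .
  ultimately show "norm_form x y > 0" "x > 0" by (simp_all add: zero_less_of_rat_iff)
next
  assume sign: "elt x y \<noteq> 0 \<and> (m > 0 \<longrightarrow> norm_form x y > 0 \<and> x > 0)"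
  have "sig (elt x y) > 0" if sig: "real_embedding K sig" for sig
  proof -
    have "(of_int m :: real) \<ge> 0" using real_embedding_elt(1)[OF sig] by (metis zero_le_square)
    hence "m > 0" using m_nonzero by simp
    hence "sig (elt x y) * sig (elt x (- y)) > 0" "sig (elt x y) + sig (elt x (- y)) > 0"
      using sign unfolding real_embedding_norm[OF sig] by (simp_all add: zero_less_of_rat_iff)
    thus ?thesis unfolding zero_less_mult_iff by linarith
  qed
  thus "totally_positive K (elt x y)" using sign unfolding totally_positive_def by auto
qed

lemma totally_positive_norm_form:
  assumes "totally_positive K (elt x y)" shows "norm_form x y > 0"
proof (cases "m > 0")
  case True
  thus ?thesis using assms totally_positive_elt by blast
next
  case False
  have "norm_form x y \<noteq> 0" using assms norm_form_eq_0_iff unfolding totally_positive_def by auto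
  moreover have "of_int m * (y * y) \<le> 0" using False by (intro mult_nonpos_nonneg) auto
  ultimately show ?thesis unfolding norm_form_def using zero_le_square[of x] by linarith
qed

lemma totally_positive_or_minus:
  assumes norm: "norm_form x y > 0" shows "totally_positive K (elt x y) \<or> totally_positive K (- elt x y)"
proof (cases "m > 0 \<and> x \<le> 0")
  case True
  hence "x \<noteq> 0" using norm by (auto simp: norm_form_def mult_less_0_iff not_less)
  thus ?thesis using True norm unfolding elt_minus totally_positive_elt by (simp add: norm_form_def)
next
  case False
  have "elt x y \<noteq> 0" using norm norm_form_eq_0_iff[of x y] by auto
  thus ?thesis using False norm totally_positive_elt[of x y] by auto
qed

lemma totally_positive_K: "totally_positive K a \<Longrightarrow> a \<in> K" "totally_positive K a \<Longrightarrow> a \<noteq> 0"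
  unfolding totally_positive_def by auto

lemma totally_positive_mult:
  assumes "totally_positive K a" "totally_positive K b" shows "totally_positive K (a * b)"
  using assms unfolding totally_positive_def real_embedding_def by (auto intro: K_mult)

lemma totally_positive_inverse:
  assumes a: "totally_positive K a" shows "totally_positive K (inverse a)"
proof -
  note a_K = totally_positive_K[OF a]
  have "sig (inverse a) > 0" if sig: "real_embedding K sig" for sig
  proof -
    have "sig a * sig (inverse a) = 1" using sig a_K K_inverse[OF a_K(1)] unfolding real_embedding_def
      by (metis right_inverse)
    moreover have "sig a > 0" using a sig unfolding totally_positive_def by blast
    ultimately show ?thesis using zero_less_mult_pos[of "sig a" "sig (inverse a)"] by simp
  qed
  thus ?thesis using a_K K_inverse unfolding totally_positive_def by simp
qed

lemma totally_positive_rat: "r > 0 \<Longrightarrow> totally_positive K (of_rat r)"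
  using totally_positive_elt[of r 0] by (simp add: elt_of_rat[symmetric] norm_form_def)

subsection \<open>Classes of fractional ideals\<close>

abbreviation A where "A \<equiv> fractional_ideal_group K"
abbreviation H where "H \<equiv> narrow_principal_ideals K"
abbreviation G where "G \<equiv> narrow_class_group (4 * m)"

lemma A_simps [simp]: "carrier A = {I. FI I}" "I \<otimes>\<^bsub>A\<^esub> J = ideal_mult I J" "\<one>\<^bsub>A\<^esub> = OK"
  unfolding fractional_ideal_group_def by auto

lemma A_comm_group: "comm_group A"
proof (rule comm_groupI)
  fix x y z assume "x \<in> carrier A" "y \<in> carrier A" "z \<in> carrier A"
  show "(x \<otimes>\<^bsub>A\<^esub> y) \<otimes>\<^bsub>A\<^esub> z = x \<otimes>\<^bsub>A\<^esub> (y \<otimes>\<^bsub>A\<^esub> z)" by (simp add: ideal_mult_assoc)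
next
  fix x y assume "x \<in> carrier A" "y \<in> carrier A"
  thus "x \<otimes>\<^bsub>A\<^esub> y \<in> carrier A" by (simp add: FI_mult)
  show "x \<otimes>\<^bsub>A\<^esub> y = y \<otimes>\<^bsub>A\<^esub> x" unfolding A_simps by (rule ideal_mult_comm)
next
  show "\<one>\<^bsub>A\<^esub> \<in> carrier A" by (simp add: FI_OK)
next
  fix x assume "x \<in> carrier A"
  thus "\<one>\<^bsub>A\<^esub> \<otimes>\<^bsub>A\<^esub> x = x" "\<exists>y\<in>carrier A. y \<otimes>\<^bsub>A\<^esub> x = \<one>\<^bsub>A\<^esub>"
    using FI_unit_mult FI_inverse by auto
qed

lemma H_I: "totally_positive K a \<Longrightarrow> (*) a ` OK \<in> H"
  unfolding narrow_principal_ideals_def by blast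

lemma H_cases: assumes "I \<in> H" obtains a where "totally_positive K a" "I = (*) a ` OK"
  using assms unfolding narrow_principal_ideals_def by blast

lemma H_subgroup: "subgroup H A"
proof -
  interpret A: comm_group A by (rule A_comm_group)
  show ?thesis
  proof (rule A.subgroupI)
    show "H \<subseteq> carrier A" by (auto elim!: H_cases dest: totally_positive_K intro: FI_principal)
    have "(*) (of_rat 1) ` OK \<in> H" by (rule H_I[OF totally_positive_rat]) simp
    thus "H \<noteq> {}" by blast
    fix x assume "x \<in> H"
    then obtain a where a: "totally_positive K a" "x = (*) a ` OK" by (elim H_cases)
    have "ideal_mult ((*) (inverse a) ` OK) x = OK"
      unfolding a ideal_mult_principal using totally_positive_K[OF a(1)] by simp
    hence "inv\<^bsub>A\<^esub> x = (*) (inverse a) ` OK"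
      using totally_positive_K[OF a(1)] totally_positive_K[OF totally_positive_inverse[OF a(1)]] FI_principal
      by (intro A.inv_equality) (auto simp: a)
    thus "inv\<^bsub>A\<^esub> x \<in> H" using H_I[OF totally_positive_inverse[OF a(1)]] by simp
    fix y assume "y \<in> H"
    then obtain b where b: "totally_positive K b" "y = (*) b ` OK" by (elim H_cases)
    show "x \<otimes>\<^bsub>A\<^esub> y \<in> H" unfolding a b A_simps ideal_mult_principal
      by (rule H_I[OF totally_positive_mult[OF a(1) b(1)]])
  qed
qed

abbreviation G_mult (infixl "\<star>" 70) where "x \<star> y \<equiv> x \<otimes>\<^bsub>G\<^esub> y"
abbreviation G_one where "G_one \<equiv> \<one>\<^bsub>G\<^esub>"

definition ideal_class :: "complex set \<Rightarrow> complex set set" where "ideal_class I = H #>\<^bsub>A\<^esub> I"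

lemma G_eq: "G = A Mod H" unfolding narrow_class_group_def ..

lemma G_comm_group: "comm_group G"
proof -
  interpret A: comm_group A by (rule A_comm_group)
  show ?thesis unfolding G_eq by (rule A.abelian_FactGroup[OF H_subgroup])
qed

lemma carrier_G: "carrier G = ideal_class ` {I. FI I}"
  unfolding G_eq carrier_FactGroup ideal_class_def by simp

lemma ideal_class_mult:
  assumes "FI I" "FI J"
  shows "ideal_class I \<star> ideal_class J = ideal_class (ideal_mult I J)"
proof -
  interpret A: comm_group A by (rule A_comm_group)
  interpret N: normal H A using A.subgroup_imp_normal[OF H_subgroup] .
  show ?thesis unfolding G_eq ideal_class_def using N.rcos_sum[of I J] assms by simp
qed

lemma ideal_class_one: "G_one = ideal_class OK"
proof -
  interpret A: comm_group A by (rule A_comm_group)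
  have "H #>\<^bsub>A\<^esub> \<one>\<^bsub>A\<^esub> = H" using A.coset_mult_one subgroup.subset[OF H_subgroup] by blast
  thus ?thesis unfolding G_eq ideal_class_def by simp
qed

lemma ideal_class_mem: "FI I \<Longrightarrow> ideal_class I \<in> carrier G" unfolding carrier_G by blast

lemma mem_ideal_class_iff:
  assumes "FI J"
  shows "X \<in> ideal_class J \<longleftrightarrow> (\<exists>a. totally_positive K a \<and> X = (*) a ` J)"
proof -
  have "X \<in> ideal_class J \<longleftrightarrow> (\<exists>h\<in>H. X = ideal_mult h J)" unfolding ideal_class_def r_coset_def by auto
  also have "... \<longleftrightarrow> (\<exists>a. totally_positive K a \<and> X = ideal_mult ((*) a ` OK) J)"
    unfolding narrow_principal_ideals_def by auto
  finally show ?thesis unfolding ideal_mult_scale FI_unit_mult[OF assms] .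
qed

lemma ideal_class_eq_iff:
  assumes I: "FI I" and J: "FI J"
  shows "ideal_class I = ideal_class J \<longleftrightarrow> (\<exists>a. totally_positive K a \<and> I = (*) a ` J)"
proof -
  interpret A: comm_group A by (rule A_comm_group)
  have "I \<in> ideal_class I" unfolding ideal_class_def using I by (intro A.rcos_self[OF _ H_subgroup]) simp
  moreover have "ideal_class I = ideal_class J" if "I \<in> ideal_class J"
    using A.repr_independence[OF _ _ H_subgroup, of I J] that J unfolding ideal_class_def by simp
  ultimately show ?thesis unfolding mem_ideal_class_iff[OF J, symmetric] by blast
qed

lemma ideal_class_scale:
  assumes "FI I" "totally_positive K a"
  shows "ideal_class ((*) a ` I) = ideal_class I"
  using assms by (subst ideal_class_eq_iff) (auto intro: FI_scale dest: totally_positive_K)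

lemma ideal_class_rat_scale: "FI I \<Longrightarrow> r > 0 \<Longrightarrow> ideal_class ((*) (of_rat r) ` I) = ideal_class I"
  by (rule ideal_class_scale[OF _ totally_positive_rat])

lemma FI_ideal_class_L:
  assumes "FI I"
  obtains a b where "a > 0" "a dvd b * b - m" "ideal_class I = ideal_class (L a b)"
  using fractional_ideal_cases[OF assms] ideal_class_rat_scale FI_L by metis

lemma ideal_class_conj: assumes "FI I" shows "ideal_class I \<star> ideal_class (\<sigma> ` I) = G_one"
  unfolding ideal_class_mult[OF assms FI_sigma[OF assms]] ideal_norm_FI(2)[OF assms] ideal_class_one
  by (rule ideal_class_rat_scale[OF FI_OK ideal_norm_FI(1)[OF assms]])

lemma ideal_class_scale_pos_norm:
  assumes I: "FI I" and norm: "norm_form x y > 0"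
  shows "ideal_class ((*) (elt x y) ` I) = ideal_class I"
  using totally_positive_or_minus[OF norm] ideal_class_scale[OF I] scale_uminus[OF I] by metis

end

subsection \<open>Ideals of norm coprime to the discriminant\<close>

lemma prime_dvd_prod_primes_iff:
  fixes l :: int
  assumes "prime l" "finite S" "\<And>k. k \<in> S \<Longrightarrow> prime k"
  shows "l dvd \<Prod>S \<longleftrightarrow> l\<in>S"
  using assms prime_dvd_prod_iff[of S l "\<lambda>x. x"] primes_dvd_imp_eq by auto

lemma coprimeI_prime:
  fixes x y :: int
  assumes "x \<noteq> 0 \<or> y \<noteq> 0" "\<And>l. prime l \<Longrightarrow> l dvd x \<Longrightarrow> l dvd y \<Longrightarrow> False"
  shows "coprime x y"
proof (rule ccontr)
  assume "\<not> coprime x y"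
  hence "\<not> is_unit (gcd x y)" by (simp only: is_unit_gcd not_False_eq_True)
  moreover have "gcd x y \<noteq> 0" using assms(1) by simp
  ultimately obtain l where "prime l" "l dvd gcd x y" using prime_divisor_exists by blast
  thus False using assms(2)[of l] by simp
qed

lemma primitive_form_coprime_value:
  fixes a b c N :: int
  assumes N: "N \<noteq> 0" and primitive: "u * a + v * b + s * c = 1"
  obtains x y where "coprime (a * (x * x) + b * (x * y) + c * (y * y)) N"
proof -
  define S where "S = prime_factors N"
  define x where "x = \<Prod>{l\<in>S. l dvd a \<and> \<not> l dvd c}"
  define y where "y = \<Prod>{l\<in>S. \<not> l dvd a}"
  have S: "finite S" "\<And>l. l \<in> S \<Longrightarrow> prime l" unfolding S_def by auto
  have "False" if l: "prime l" "l dvd a * (x * x) + b * (x * y) + c * (y * y)" "l dvd N" for l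
  proof -
    have "l \<in> S" unfolding S_def using l(1,3) N by (simp add: prime_factors_dvd)
    hence x: "l dvd x \<longleftrightarrow> l dvd a \<and> \<not> l dvd c" and y: "l dvd y \<longleftrightarrow> \<not> l dvd a"
      unfolding x_def y_def using S prime_dvd_prod_primes_iff[OF l(1), of "{l \<in> S. l dvd a \<and> \<not> l dvd c}"]
        prime_dvd_prod_primes_iff[OF l(1), of "{l \<in> S. \<not> l dvd a}"] by simp_all
    consider "\<not> l dvd a" | "l dvd a" "\<not> l dvd c" | "l dvd a" "l dvd c" by blast
    thus False
    proof cases
      case 1
      hence "l dvd y" "\<not> l dvd x" using x y by auto
      hence "l dvd b * (x * y) + c * (y * y)" by simp
      hence "l dvd a * (x * x)" using l(2) by (metis add.assoc dvd_add_left_iff)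
      thus False using 1 \<open>\<not> l dvd x\<close> l(1) by (simp add: prime_dvd_mult_iff)
    next
      case 2
      hence "l dvd x" "\<not> l dvd y" using x y by auto
      hence "l dvd c * (y * y)" using l(2) by (metis dvd_add_right_iff dvd_add dvd_mult dvd_mult2)
      thus False using 2 \<open>\<not> l dvd y\<close> l(1) by (simp add: prime_dvd_mult_iff)
    next
      case 3
      hence "l dvd b * (x * y)" using l(2) by (metis dvd_add_left_iff dvd_add_right_iff dvd_mult2)
      hence "l dvd b" using 3 x y l(1) by (simp add: prime_dvd_mult_iff)
      hence "l dvd u * a + v * b + s * c" using 3 by simp
      thus False using l(1) unfolding primitive by (simp add: not_prime_unit)
    qed
  qed
  hence "coprime (a * (x * x) + b * (x * y) + c * (y * y)) N" using N by (intro coprimeI_prime) auto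
  thus ?thesis by (rule that)
qed

lemma quadratic_form_pos:
  fixes a b c x y :: int
  assumes a: "a > 0" and x: "x > \<bar>b * y\<bar>+\<bar>c * (y * y)\<bar>"
  shows "a * (x * x) + b * (x * y) + c * (y * y) > 0"
proof -
  have "x > 0" using x by linarith
  have "x * (1 + \<bar>b * y\<bar>+\<bar>c * (y * y)\<bar>) \<le> 1 * (x * x)" using x by (simp add: mult_left_mono)
  also have "... \<le> a * (x * x)" using a by (intro mult_right_mono) auto
  finally have "x + x * \<bar>b * y\<bar>+x * \<bar>c * (y * y)\<bar> \<le> a * (x * x)" by (simp add: distrib_left)
  moreover have "x * \<bar>b * y\<bar> = \<bar>b * (x * y)\<bar>" using \<open>x > 0\<close> by (simp add: abs_mult)
  moreover have "x * \<bar>c * (y * y)\<bar> \<ge> 1 * \<bar>c * (y * y)\<bar>" using x by (intro mult_right_mono) auto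
  ultimately show ?thesis using x by linarith
qed

lemma represents_pos_coprime:
  fixes a b c N :: int
  assumes a: "a > 0" and N: "N \<noteq> 0" and primitive: "u * a + v * b + s * c = 1"
  obtains x y where "a * (x * x) + b * (x * y) + c * (y * y) > 0"
    "coprime (a * (x * x) + b * (x * y) + c * (y * y)) N"
proof -
  obtain x y where coprime: "coprime (a * (x * x) + b * (x * y) + c * (y * y)) N"
    using primitive_form_coprime_value[OF N primitive] .
  define t where "t = 1 + \<bar>x\<bar>+\<bar>b * y\<bar>+\<bar>c * (y * y)\<bar>"
  have "1 * t \<le> \<bar>N\<bar> * t" using N unfolding t_def by (intro mult_right_mono) auto
  moreover have "x + t > \<bar>b * y\<bar>+\<bar>c * (y * y)\<bar>" unfolding t_def by linarith
  ultimately have "a * ((x + \<bar>N\<bar> * t) * (x + \<bar>N\<bar> * t)) + b * ((x + \<bar>N\<bar> * t) * y) + c * (y * y) > 0"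
    by (intro quadratic_form_pos[OF a]) linarith
  moreover have "a * ((x + \<bar>N\<bar> * t) * (x + \<bar>N\<bar> * t)) + b * ((x + \<bar>N\<bar> * t) * y) + c * (y * y)
    = (a * (x * x) + b * (x * y) + c * (y * y)) + N * ((sgn N) * t * (2 * a * x + a * \<bar>N\<bar> * t + b * y))"
    unfolding abs_sgn[of N] by (simp add: algebra_simps)
  hence "coprime (a * ((x + \<bar>N\<bar> * t) * (x + \<bar>N\<bar> * t)) + b * ((x + \<bar>N\<bar> * t) * y) + c * (y * y)) N"
    using coprime by (metis coprime_iff_gcd_eq_1 add.commute gcd.commute gcd_add_mult mult.commute)
  ultimately show ?thesis by (rule that)
qed

context quad
begin

lemma scale_conj_L_subset_quad_ints:
  assumes a: "a > 0" "a dvd b * b - m" and mem: "elt_int u y \<in> L a (- b)"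
  shows "(*) (elt (of_int u / of_int a) (of_int y / of_int a)) ` L a b \<subseteq> quad_ints"
proof
  fix z assume "z \<in> (*) (elt (of_int u / of_int a) (of_int y / of_int a)) ` L a b"
  then obtain v where v: "v \<in> L a b" "z = elt (of_int u / of_int a) (of_int y / of_int a) * v" by auto
  have "of_int a * elt (of_int u / of_int a) (of_int y / of_int a) = elt_int u y"
    using a(1) by (simp add: elt_int_def elt_mult flip: elt_of_int)
  hence "of_int a * z = v * elt_int u y" unfolding v(2) by (simp add: mult_ac flip: mult.assoc)
  also have "... \<in> (*) (of_int a) ` OK" using ideal_mult_memI[OF v(1) mem] unfolding L_mult_conj[OF a] .
  finally show "z \<in> quad_ints" using a(1) by (auto simp: OK_eq)
qed

lemma coprime_rep:
  assumes I: "FI I"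
  obtains a b where "a > 0" "a dvd b * b - m" "coprime a (2 * m)" "ideal_class I = ideal_class (L a b)"
proof -
  obtain a b where a: "a > 0" "a dvd b * b - m" and ideal_class_I: "ideal_class I = ideal_class (L a b)"
    using FI_ideal_class_L[OF I] .
  obtain c where c: "b * b - m = a * c" using a(2) by (elim dvdE)
  obtain u v s where "u * a + v * (2 * b) + s * c = 1" using primitive_form[OF a(1) c] .
  hence "u * a + (- v) * (- (2 * b)) + s * c = 1" by simp
  from represents_pos_coprime[OF a(1) _ this, of "2 * m"] obtain x y where
      pos: "a * (x * x) + - (2 * b) * (x * y) + c * (y * y) > 0"
        and coprime: "coprime (a * (x * x) + - (2 * b) * (x * y) + c * (y * y)) (2 * m)"
    using m_nonzero by auto
  define Q where "Q = a * (x * x) + - (2 * b) * (x * y) + c * (y * y)"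
  define X Y :: rat where "X = of_int (x * a - y * b) / of_int a" and "Y = of_int y / of_int a"
  have "norm_form X Y = of_int ((x * a - y * b) * (x * a - y * b) - m * (y * y)) / of_int (a * a)"
    unfolding norm_form_def X_def Y_def using a(1) by (simp add: field_simps)
  also have "(x * a - y * b) * (x * a - y * b) - m * (y * y) = a * a * (x * x) - 2 * a * b * (x * y)
    + (b * b - m) * (y * y)" by (simp add: algebra_simps)
  also have "... = a * Q" unfolding c Q_def by (simp add: algebra_simps)
  finally have norm: "norm_form X Y = of_int Q / of_int a" using a(1) by simp
  hence norm_pos: "norm_form X Y > 0" using pos[folded Q_def] a(1) by simp
  hence nonzero: "elt X Y \<noteq> 0" using norm_form_eq_0_iff[of X Y] by auto
  note FI_a = FI_L[OF a]
  have subset: "(*) (elt X Y) ` L a b \<subseteq> quad_ints"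
    unfolding X_def Y_def by (rule scale_conj_L_subset_quad_ints[OF a]) simp
  have "FI ((*) (elt X Y) ` L a b)" by (rule FI_scale[OF _ nonzero FI_a]) simp
  from integral_ideal_cases[OF this subset] obtain g a' b' where g: "g > 0"
    and a': "a' > 0" "a' dvd b' * b' - m" and eq: "(*) (elt X Y) ` L a b = (*) (of_int g) ` L a' b'" .
  have "of_int (g * g * a') = ideal_norm ((*) (of_rat (of_int g)) ` L a' b')"
    using ideal_norm_scale_L[OF _ a', of "of_int g"] g by simp
  also have "... = of_int Q"
    using ideal_norm_scale[OF nonzero FI_a] ideal_norm_L[OF a] norm pos[folded Q_def] a(1) eq by simp
  finally have "a' dvd Q" by (metis dvd_triv_right of_int_eq_iff)
  hence "coprime a' (2 * m)" using coprime unfolding Q_def by (meson coprime_divisors dvd_refl)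
  moreover have "ideal_class (L a b) = ideal_class ((*) (of_rat (of_int g)) ` L a' b')"
    using ideal_class_scale_pos_norm[OF FI_a norm_pos] eq by simp
  hence "ideal_class I = ideal_class (L a' b')"
    using ideal_class_I ideal_class_rat_scale[OF FI_L[OF a'], of "of_int g"] g by simp
  ultimately show ?thesis using that a' by blast
qed

subsection \<open>Finiteness of the class group\<close>

lemma L_swap:
  assumes a: "a > 0" and c: "b * b - m = a * c"
  shows "(*) (elt (of_int b / of_int a) (- 1 / of_int a)) ` L a b = L c (- b)"
proof -
  define g where "g = elt (of_int b / of_int a) (- 1 / of_int a)"
  have ag: "of_int a * g = elt_int b (- 1)"
    unfolding g_def elt_int_def elt_of_int[symmetric] elt_mult using a by simp
  have multiply: "g * elt_int (i * a + y * b) y = elt_int (i * b + y * c) (- i)" for i y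
  proof -
    have "of_int a * (g * elt_int (i * a + y * b) y) = elt_int b (- 1) * elt_int (i * a + y * b) y"
      unfolding mult.assoc[symmetric] ag ..
    also have "... = elt_int (a * (i * b) + y * (b * b - m)) (a * (- i))"
      unfolding elt_int_mult by (simp add: algebra_simps)
    also have "... = of_int a * elt_int (i * b + y * c) (- i)"
      unfolding c elt_int_int[symmetric] elt_int_mult by (simp add: algebra_simps)
    finally show ?thesis using a by simp
  qed
  show ?thesis unfolding g_def[symmetric]
  proof (intro equalityI subsetI)
    fix z assume "z \<in> (*) g ` L a b"
    then obtain v where v: "v \<in> L a b" "z = g * v" by auto
    obtain u y where uy: "v = elt_int u y" "a dvd u - y * b" using v(1) by (elim L_cases)
    obtain i where "u - y * b = a * i" using uy(2) by (elim dvdE)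
    hence "u = i * a + y * b" by (simp add: algebra_simps)
    hence "z = elt_int (i * b + y * c) (- i)" using v uy multiply by simp
    thus "z \<in> L c (- b)" by simp
  next
    fix z assume "z \<in> L c (- b)"
    then obtain u i where ui: "z = elt_int u i" "c dvd u - i * (- b)" by (elim L_cases)
    obtain y where "u - i * (- b) = c * y" using ui(2) by (elim dvdE)
    hence "u = (- i) * b + y * c" by (simp add: algebra_simps)
    hence "z = g * elt_int (- i * a + y * b) y" using multiply[of "- i" y] ui by simp
    moreover have "elt_int (- i * a + y * b) y \<in> L a b" by simp
    ultimately show "z \<in> (*) g ` L a b" by blast
  qed
qed

lemma L_balanced:
  assumes a: "a > 0" "a dvd b * b - m"
  obtains b' where "2 * \<bar>b'\<bar> \<le> a" "a dvd b' * b' - m" "L a b = L a b'"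
proof
  define h k where "h = a div 2" and "k = - ((b + h) div a)"
  have eq: "b + a * k = (b + h) mod a - h"
    unfolding k_def using mult_div_mod_eq[of a "b + h"] by (simp add: algebra_simps)
  have "0 \<le> (b + h) mod a" "(b + h) mod a < a" using a(1) by simp_all
  moreover have "2 * h \<le> a" "a \<le> 2 * h + 1" unfolding h_def by simp_all
  ultimately show "2 * \<bar>b + a * k\<bar> \<le> a" unfolding eq by (simp add: abs_if)
  have "(b + a * k) * (b + a * k) - m = (b * b - m) + a * (k * (2 * b + a * k))" by (simp add: algebra_simps)
  thus "a dvd (b + a * k) * (b + a * k) - m" using a(2) by (simp only: dvd_add dvd_triv_left)
  show "L a b = L a (b + a * k)" by (rule L_shift[symmetric])
qed

lemma balanced_quotient_less:
  fixes a b c :: int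
  assumes "a > 2 * \<bar>m\<bar>" "2 * \<bar>b\<bar> \<le> a" and c: "b * b - m = a * c"
  shows "\<bar>c\<bar> < a"
proof -
  have a: "a > 0" using assms(1) by linarith
  have "(2 * \<bar>b\<bar>) * (2 * \<bar>b\<bar>) \<le> a * a" using assms(2) a by (intro mult_mono) auto
  hence "4 * (b * b) \<le> a * a" by (simp add: abs_mult_self_eq algebra_simps)
  moreover have "a * \<bar>c\<bar> = \<bar>b * b - m\<bar>" using a unfolding c by (simp add: abs_mult)
  moreover have "\<bar>b * b - m\<bar> \<le> b * b + \<bar>m\<bar>" using zero_le_square[of b] by linarith
  moreover have "a * 1 \<le> a * a" using a by (intro mult_left_mono) auto
  ultimately have "a * \<bar>c\<bar> < a * a" using assms(1) by linarith
  thus ?thesis using a by simp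
qed

definition reduced_ideals :: "complex set set" where
  "reduced_ideals = {L a b | a b. a > 0 \<and> a \<le> 2 * \<bar>m\<bar> \<and> 2 * \<bar>b\<bar> \<le> a \<and> a dvd b * b - m}"

lemma finite_reduced_ideals: "finite reduced_ideals"
proof (rule finite_subset)
  show "reduced_ideals \<subseteq> (\<lambda>(a, b). L a b) ` ({0..2 * \<bar>m\<bar>} \<times> {- (2 * \<bar>m\<bar>)..2 * \<bar>m\<bar>})"
    unfolding reduced_ideals_def by force
qed simp

text \<open>Gauss reduction, with an arbitrary multiplier in place of a totally positive one.\<close>

lemma L_reduction:
  assumes "a > 0" "a dvd b * b - m"
  shows "\<exists>z\<in>K. z \<noteq> 0 \<and> (\<exists>J\<in>reduced_ideals. L a b = (*) z ` J)"
  using assms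
proof (induction "nat a" arbitrary: a b rule: less_induct)
  case less
  obtain b' where b': "2 * \<bar>b'\<bar> \<le> a" "a dvd b' * b' - m" and L_b': "L a b = L a b'"
    using L_balanced[OF less.prems] .
  show ?case
  proof (cases "a \<le> 2 * \<bar>m\<bar>")
    case True
    hence "L a b \<in> reduced_ideals" unfolding L_b' reduced_ideals_def using less.prems(1) b' by blast
    moreover have "L a b = (*) 1 ` L a b" by simp
    ultimately show ?thesis using K_int[of 1] by (intro bexI[of _ 1]) auto
  next
    case False
    obtain c where c: "b' * b' - m = a * c" using b'(2) by (elim dvdE)
    have "of_int b' * of_int b' \<noteq> (of_int m :: rat)" by (rule not_rat_square)
    hence "c \<noteq> 0" using c by (auto simp flip: of_int_mult)
    have "\<bar>c\<bar> < a" by (rule balanced_quotient_less[OF _ b'(1) c]) (use False in simp)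
    moreover have "\<bar>c\<bar> dvd (- b') * (- b') - m" using c by simp
    ultimately obtain z J where z: "z \<in> K" "z \<noteq> 0" and J: "J \<in> reduced_ideals" "L \<bar>c\<bar> (- b') = (*) z ` J"
      using less.hyps[of "\<bar>c\<bar>" "- b'"] \<open>c \<noteq> 0\<close> less.prems(1) by auto
    define g where "g = elt (of_int b' / of_int a) (- 1 / of_int a)"
    have g: "g \<in> K" "g \<noteq> 0" unfolding g_def using less.prems(1) by simp_all
    have "(*) g ` L a b = L \<bar>c\<bar> (- b')"
      using L_swap[OF less.prems(1) c] L_uminus[of c] unfolding g_def L_b' by (cases "c \<ge> 0") auto
    hence "(*) (inverse g) ` (*) g ` L a b = (*) (inverse g) ` (*) z ` J" unfolding J(2) by simp
    hence "L a b = (*) (inverse g * z) ` J" unfolding scale_scale using g(2) by simp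
    thus ?thesis using z g J(1) K_inverse K_mult by (intro bexI[of _ "inverse g * z"]) auto
  qed
qed

lemma elt_divide:
  assumes "elt x' y' \<noteq> 0"
  obtains r s where "elt x y = elt r s * elt x' y'" "norm_form x y = norm_form r s * norm_form x' y'"
proof -
  obtain r s where "elt x y * inverse (elt x' y') = elt r s" by (metis K_cases K_inverse K_mult K_eltI)
  hence quotient: "elt x y = elt r s * elt x' y'" using assms by (simp add: field_simps)
  moreover from this have "norm_form x y = norm_form r s * norm_form x' y'"
    unfolding elt_mult norm_form_mult[symmetric] by simp
  ultimately show ?thesis by (rule that)
qed

lemma ideal_class_scale_eq_if_same_sign:
  assumes I: "FI I" and nonzero: "elt x y \<noteq> 0" "elt x' y' \<noteq> 0"
    and sign: "norm_form x y > 0 \<longleftrightarrow> norm_form x' y' > 0"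
  shows "ideal_class ((*) (elt x y) ` I) = ideal_class ((*) (elt x' y') ` I)"
proof -
  obtain r s where quotient: "elt x y = elt r s * elt x' y'"
    and norm: "norm_form x y = norm_form r s * norm_form x' y'"
    using elt_divide[OF nonzero(2)] .
  have "norm_form x y \<noteq> 0" using nonzero(1) norm_form_eq_0_iff by auto
  hence "norm_form r s > 0" using sign less_linear[of "norm_form r s" 0] less_linear[of "norm_form x' y'" 0]
    unfolding norm zero_less_mult_iff by auto
  moreover have "(*) (elt x y) ` I = (*) (elt r s) ` ((*) (elt x' y') ` I)" unfolding scale_scale quotient ..
  ultimately show ?thesis using ideal_class_scale_pos_norm[OF FI_scale[OF _ nonzero(2) I]] by simp
qed

lemma finite_scaled_classes:
  assumes I: "FI I"
  shows "finite {ideal_class ((*) z ` I) | z. z \<in> K \<and> z \<noteq> 0}"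
proof -
  let ?scaled = "\<lambda>s. {ideal_class ((*) (elt x y) ` I) | x y. elt x y \<noteq> 0 \<and> (norm_form x y > 0) = s}"
  have subset: "?scaled s \<subseteq> {ideal_class ((*) (elt x y) ` I)}" if "elt x y \<noteq> 0" "(norm_form x y > 0) = s"
    for s x y
    using ideal_class_scale_eq_if_same_sign[OF I _ that(1)] that(2)
    by (intro subsetI) (elim CollectE exE conjE, simp)
  have "finite (?scaled s)" for s
  proof (cases "?scaled s = {}")
    case False
    then obtain x y where "elt x y \<noteq> 0" "(norm_form x y > 0) = s" by blast
    thus ?thesis using finite_subset[OF subset[of x y s]] by simp
  qed (simp only: finite.emptyI)
  hence "finite (?scaled True \<union> ?scaled False)" by blast
  moreover have "{ideal_class ((*) z ` I) | z. z \<in> K \<and> z \<noteq> 0} \<subseteq> ?scaled True \<union> ?scaled False"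
  proof
    fix X assume "X \<in> {ideal_class ((*) z ` I) | z. z \<in> K \<and> z \<noteq> 0}"
    then obtain x y where "X = ideal_class ((*) (elt x y) ` I)" "elt x y \<noteq> 0" by (blast elim: K_cases)
    thus "X \<in> ?scaled True \<union> ?scaled False" by (cases "norm_form x y > 0") blast+
  qed
  ultimately show ?thesis by (rule finite_subset[rotated])
qed

lemma G_finite: "finite (carrier G)"
proof (rule finite_subset)
  show "finite (\<Union>J\<in>reduced_ideals. {ideal_class ((*) z ` J) | z. z \<in> K \<and> z \<noteq> 0})"
    using finite_reduced_ideals finite_scaled_classes FI_L unfolding reduced_ideals_def by blast
  show "carrier G \<subseteq> (\<Union>J\<in>reduced_ideals. {ideal_class ((*) z ` J) | z. z \<in> K \<and> z \<noteq> 0})"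
  proof
    fix X assume "X \<in> carrier G"
    then obtain I where "FI I" "X = ideal_class I" unfolding carrier_G by auto
    then obtain a b where "a > 0" "a dvd b * b - m" "X = ideal_class (L a b)" using FI_ideal_class_L by metis
    thus "X \<in> (\<Union>J\<in>reduced_ideals. {ideal_class ((*) z ` J) | z. z \<in> K \<and> z \<noteq> 0})"
      using L_reduction[of a b] by fastforce
  qed
qed

end

section \<open>Ambiguous classes and genus theory\<close>

context quad
begin

lemma ideal_mult_subset_quad_ints:
  assumes "I \<subseteq> quad_ints" "J \<subseteq> quad_ints" shows "ideal_mult I J \<subseteq> quad_ints"
  using assms quad_ints_int[of 0] by (intro ideal_mult_subsetI) (auto intro: quad_ints_mult quad_ints_add)

lemma principal_norm:
  assumes I: "FI I" and integral: "I \<subseteq> quad_ints" and trivial: "ideal_class I = G_one"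
    and norm: "ideal_norm I = of_int n"
  obtains X Y where "X * X - m * (Y * Y) = n" "totally_positive K (elt_int X Y)" "I = (*) (elt_int X Y) ` OK"
proof -
  obtain z where z: "totally_positive K z" "I = (*) z ` OK"
    using ideal_class_eq_iff[OF I FI_OK] trivial ideal_class_one by auto
  have "z * 1 \<in> I" unfolding z(2) using OK_1 by blast
  hence "z \<in> quad_ints" using integral by auto
  then obtain X Y where XY: "z = elt_int X Y" by (elim quad_ints_cases)
  have "norm_form (of_int X) (of_int Y) > 0"
    using totally_positive_norm_form z(1) unfolding XY elt_int_def by blast
  moreover have "ideal_norm I = \<bar>norm_form (of_int X) (of_int Y)\<bar> * ideal_norm OK"
    unfolding z(2) XY elt_int_def
    by (rule ideal_norm_scale[OF _ FI_OK]) (use totally_positive_K(2)[OF z(1)] XY elt_int_def in simp)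
  ultimately have "(of_int (X * X - m * (Y * Y)) :: rat) = of_int n"
    unfolding norm norm_form_def by (simp add: ideal_norm_OK)
  hence "X * X - m * (Y * Y) = n" by (simp only: of_int_eq_iff)
  thus ?thesis using that z unfolding XY by blast
qed

text \<open>The ideals \<open>L \<beta> b\<close> with \<open>ambiguous \<beta> b\<close> are the products of distinct ramified primes, up to rational factors.\<close>

definition ambiguous :: "int \<Rightarrow> int \<Rightarrow> bool" where
  "ambiguous \<beta> b \<longleftrightarrow> \<beta> > 0 \<and> ((b = 0 \<and> \<beta> dvd m) \<or> (odd m \<and> b > 0 \<and> b dvd m \<and> \<beta> = 2 * b))"

lemma ambiguous_dvd: assumes "ambiguous \<beta> b" shows "\<beta> > 0" "\<beta> dvd b * b - m" "\<beta> dvd 2 * m"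
proof -
  show "\<beta> > 0" "\<beta> dvd 2 * m" using assms unfolding ambiguous_def by auto
  show "\<beta> dvd b * b - m"
  proof (cases "b = 0")
    case False
    hence b: "odd m" "b dvd m" "\<beta> = 2 * b" using assms unfolding ambiguous_def by auto
    hence "odd b" using dvd_trans by blast
    hence "2 dvd b * b - m" using b(1) by simp
    moreover have "b dvd b * b - m" using b(2) by (intro dvd_diff) auto
    ultimately show ?thesis unfolding b(3) using \<open>odd b\<close> by (intro divides_mult) auto
  qed (use assms in \<open>auto simp: ambiguous_def\<close>)
qed

lemma ambiguous_squarefree: assumes "ambiguous \<beta> b" shows "squarefree \<beta>"
proof -
  consider "\<beta> dvd m" | "odd m" "b dvd m" "\<beta> = 2 * b" using assms unfolding ambiguous_def by blast
  thus ?thesis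
  proof cases
    case 1
    thus ?thesis using sqf squarefree_mono by blast
  next
    case 2
    hence "odd b" using dvd_trans by blast
    moreover have "squarefree b" using sqf 2(2) squarefree_mono by blast
    ultimately show ?thesis unfolding 2(3) using squarefree_prime[of "2::int"]
      by (intro squarefree_mult_coprime) auto
  qed
qed

lemma FI_ambiguous: "ambiguous \<beta> b \<Longrightarrow> FI (L \<beta> b)"
  using ambiguous_dvd FI_L by blast

lemma ideal_norm_ambiguous: "ambiguous \<beta> b \<Longrightarrow> ideal_norm (L \<beta> b) = of_int \<beta>"
  using ambiguous_dvd ideal_norm_L by blast

lemma ambiguous_two_torsion:
  assumes "ambiguous \<beta> b" shows "ideal_class (L \<beta> b) \<star> ideal_class (L \<beta> b) = G_one"
    "ideal_class (L \<beta> b) \<in> carrier G"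
proof -
  have "b = 0 \<or> \<beta> = 2 * b" using assms unfolding ambiguous_def by blast
  hence "L \<beta> (- b) = L \<beta> b" using L_shift[of \<beta> "- b" 1] by (elim disjE) simp_all
  hence "\<sigma> ` L \<beta> b = L \<beta> b" using sigma_L[of 1 \<beta> b] by simp
  thus "ideal_class (L \<beta> b) \<star> ideal_class (L \<beta> b) = G_one"
    using ideal_class_conj[OF FI_ambiguous[OF assms]] by simp
  show "ideal_class (L \<beta> b) \<in> carrier G" by (rule ideal_class_mem[OF FI_ambiguous[OF assms]])
qed

lemma coprime_generator:
  assumes a: "a dvd b * b - m" "coprime a (2 * m)" and \<beta>: "ambiguous \<beta> b'"
    and generator: "ideal_mult (ideal_mult (L a b) (L a b)) (L \<beta> b') = (*) (elt_int X Y) ` OK"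
    and norm: "X * X - m * (Y * Y) = \<beta> * (a * a)" and nonzero: "elt_int X Y \<noteq> 0"
  shows "coprime X Y"
proof (rule coprimeI_prime)
  fix l assume l: "prime l" "l dvd X" "l dvd Y"
  have "l^2 dvd X * X - m * (Y * Y)" unfolding power2_eq_square
    by (rule dvd_diff[OF mult_dvd_mono[OF l(2,2)] dvd_mult[OF mult_dvd_mono[OF l(3,3)]]])
  hence square_dvd: "l^2 dvd \<beta> * (a * a)" unfolding norm .
  have "l dvd a"
  proof (rule ccontr)
    assume "\<not> l dvd a"
    hence "coprime l a" using l(1) prime_imp_coprime by blast
    hence "l^2 dvd \<beta>" using square_dvd by (simp add: coprime_dvd_mult_left_iff)
    thus False using squarefreeD[OF ambiguous_squarefree[OF \<beta>]] l(1) not_prime_unit by blast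
  qed
  hence not_dvd: "\<not> l dvd 2 * m" using a(2) l(1) coprime_common_divisor not_prime_unit by blast
  have "elt_int b 1 * elt_int b 1 * elt_int \<beta> 0 \<in> (*) (elt_int X Y) ` OK"
    unfolding generator[symmetric] by (intro ideal_mult_memI) auto
  then obtain i j where "elt_int b 1 * elt_int b 1 * elt_int \<beta> 0 = elt_int X Y * elt_int i j"
    unfolding OK_eq quad_ints_def by blast
  hence "2 * b * \<beta> = X * j + Y * i" unfolding elt_int_mult by simp
  hence "l dvd 2 * b * \<beta>" using l by simp
  moreover have "\<not> l dvd \<beta>" using not_dvd ambiguous_dvd(3)[OF \<beta>] dvd_trans by blast
  moreover have "\<not> l dvd 2" using not_dvd by auto
  ultimately have "l dvd b" using l(1) by (simp add: prime_dvd_mult_iff)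
  hence "l dvd m" using dvd_diff[of l "b * b" "b * b - m"] dvd_trans[OF \<open>l dvd a\<close> a(1)] by simp
  thus False using not_dvd by simp
qed (use nonzero in auto)

lemma four_torsion:
  assumes c: "c \<in> carrier G" and \<beta>: "ambiguous \<beta> b'" "c \<star> c = ideal_class (L \<beta> b')"
  obtains a b X Y where "a > 0" "a dvd b * b - m" "coprime a (2 * m)" "c = ideal_class (L a b)"
    "X * X - m * (Y * Y) = \<beta> * (a * a)" "coprime X Y"
proof -
  obtain I where I: "FI I" "c = ideal_class I" using c unfolding carrier_G by auto
  obtain a b where a: "a > 0" "a dvd b * b - m" "coprime a (2 * m)" and c_eq: "c = ideal_class (L a b)"
    using coprime_rep[OF I(1)] I(2) by metis
  have FI_a: "FI (L a b)" by (rule FI_L[OF a(1,2)])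
  note FI_beta = FI_ambiguous[OF \<beta>(1)]
  let ?P = "ideal_mult (ideal_mult (L a b) (L a b)) (L \<beta> b')"
  have "ideal_class ?P = (c \<star> c) \<star> ideal_class (L \<beta> b')"
    using FI_a FI_beta by (simp add: c_eq ideal_class_mult FI_mult)
  hence trivial: "ideal_class ?P = G_one" using ambiguous_two_torsion(1)[OF \<beta>(1)] \<beta>(2) by simp
  have norm: "ideal_norm ?P = of_int (\<beta> * (a * a))"
    using FI_a FI_beta ideal_norm_L[OF a(1,2)] ideal_norm_ambiguous[OF \<beta>(1)]
    by (simp add: ideal_norm_mult FI_mult)
  have "?P \<subseteq> quad_ints" by (intro ideal_mult_subset_quad_ints L_subset_quad_ints)
  from principal_norm[OF FI_mult[OF FI_mult[OF FI_a FI_a] FI_beta] this trivial norm] obtain X Y where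
      XY: "X * X - m * (Y * Y) = \<beta> * (a * a)" "totally_positive K (elt_int X Y)" "?P = (*) (elt_int X Y) ` OK"
        .
  have "coprime X Y"
    by (rule coprime_generator[OF a(2,3) \<beta>(1) XY(3,1) totally_positive_K(2)[OF XY(2)]])
  thus ?thesis using that a c_eq XY(1) by blast
qed

end

subsection \<open>Legendre's theorem\<close>

lemma floor_sqrt_box:
  fixes a M :: nat
  assumes "a > 0" "M > 0"
  shows "a * M < (floor_sqrt (a * M) + 1) * ((floor_sqrt a + 1) * (floor_sqrt M + 1))"
proof (rule power2_less_imp_less)
  have root: "n < (floor_sqrt n + 1)^2" for n using Suc_floor_sqrt_power2_gt[of n] by simp
  have "(a * M)^2 = (a * M) * (a * M)" by (simp only: power2_eq_square)
  also have "... < (floor_sqrt (a * M) + 1)^2 * ((floor_sqrt a + 1)^2 * (floor_sqrt M + 1)^2)"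
    using assms by (intro mult_strict_mono root) auto
  finally show "(a * M)^2 < ((floor_sqrt (a * M) + 1) * ((floor_sqrt a + 1) * (floor_sqrt M + 1)))^2"
    by (simp only: power_mult_distrib)
qed simp

lemma square_le_if_abs_le_floor_sqrt:
  fixes u n :: int
  assumes "\<bar>u\<bar> \<le> int (floor_sqrt (nat n))" "n > 0"
  shows "u * u \<le> n"
proof -
  have "u * u \<le> int (floor_sqrt (nat n)) * int (floor_sqrt (nat n))"
    using mult_mono[OF assms(1) assms(1)] by (simp add: abs_mult_self_eq)
  also have "... = int ((floor_sqrt (nat n))^2)" by (simp add: power2_eq_square)
  also have "... \<le> n" using assms(2) floor_sqrt_power2_le[of "nat n"] by linarith
  finally show ?thesis .
qed

lemma simultaneous_congruences_small:
  fixes a M b t :: int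
  assumes pos: "a > 0" "M > 0"
  obtains x y z where "x \<noteq> 0 \<or> y \<noteq> 0 \<or> z \<noteq> 0" "a dvd x - b * y" "M dvd x - t * z" "x * x \<le> a * M" "y * y \<le> a"
    "z * z \<le> M"
proof -
  let ?root = "\<lambda>n. int (floor_sqrt (nat n))"
  define D where "D = {0..?root (a * M)} \<times> {0..?root a} \<times> {0..?root M}"
  define f where "f = (\<lambda>(x, y, z). ((x - b * y) mod a, (x - t * z) mod M))"
  have "card (f ` D) \<le> card ({0..<a} \<times> {0..<M})" unfolding f_def using pos by (intro card_mono) auto
  also have "... = nat a * nat M" by (simp add: card_cartesian_product)
  also have "... < card D" unfolding D_def using floor_sqrt_box[of "nat a" "nat M"] pos
    by (simp add: card_cartesian_product nat_mult_distrib nat_add_distrib)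
  finally have "\<not> inj_on f D" using pigeonhole by blast
  then obtain x1 y1 z1 x2 y2 z2 where mem: "(x1, y1, z1) \<in> D" "(x2, y2, z2) \<in> D"
    and neq: "(x1, y1, z1) \<noteq> (x2, y2, z2)" and eq: "f (x1, y1, z1) = f (x2, y2, z2)"
    unfolding inj_on_def by (metis prod_cases3)
  show ?thesis
  proof (rule that[of "x1 - x2" "y1 - y2" "z1 - z2"])
    show "x1 - x2 \<noteq> 0 \<or> y1 - y2 \<noteq> 0 \<or> z1 - z2 \<noteq> 0" using neq by auto
    have "(x1 - b * y1) mod a = (x2 - b * y2) mod a" "(x1 - t * z1) mod M = (x2 - t * z2) mod M"
      using eq unfolding f_def by auto
    hence "a dvd (x1 - b * y1) - (x2 - b * y2)" "M dvd (x1 - t * z1) - (x2 - t * z2)"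
      by (simp_all only: mod_eq_dvd_iff)
    thus "a dvd (x1 - x2) - b * (y1 - y2)" "M dvd (x1 - x2) - t * (z1 - z2)" by (simp_all add: algebra_simps)
    have "\<bar>x1 - x2\<bar> \<le> ?root (a * M)" "\<bar>y1 - y2\<bar> \<le> ?root a" "\<bar>z1 - z2\<bar> \<le> ?root M"
      using mem unfolding D_def by auto
    thus "(x1 - x2) * (x1 - x2) \<le> a * M" "(y1 - y2) * (y1 - y2) \<le> a" "(z1 - z2) * (z1 - z2) \<le> M"
      using pos by (auto intro: square_le_if_abs_le_floor_sqrt)
  qed
qed

lemma ternary_form_small:
  fixes m a x y z k :: int
  assumes pos: "a > 0" "m \<noteq> 0" and bounds: "x * x \<le> a * \<bar>m\<bar>" "y * y \<le> a" "z * z < \<bar>m\<bar>"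
    and not_extremal: "z = 0 \<Longrightarrow> x * x \<noteq> a * \<bar>m\<bar>" and eq: "x * x - m * (y * y) - a * (z * z) = a * m * k"
  shows "k = 0 \<or> k = -1"
proof -
  define M where "M = \<bar>m\<bar>"
  have "a * M > 0" using pos unfolding M_def by simp
  have y: "M * (y * y) \<le> M * a" "0 \<le> M * (y * y)"
    using bounds(2) unfolding M_def by (auto intro: mult_left_mono)
  have z: "a * (z * z) < a * M" "0 \<le> a * (z * z)" using bounds(3) pos unfolding M_def by auto
  have x: "x * x \<le> a * M" "0 \<le> x * x" using bounds(1) unfolding M_def by auto
  have strict: "x * x - a * (z * z) < a * M"
  proof (cases "z = 0")
    case True
    thus ?thesis using x(1) not_extremal unfolding M_def by simp
  next
    case False
    hence "a * (z * z) > 0" using pos by (auto simp: zero_less_mult_iff linorder_neq_iff)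
    thus ?thesis using x(1) by linarith
  qed
  have "(a * M) * (- 2) < (a * M) * k \<and> (a * M) * k < (a * M) * 1"
  proof (cases "m > 0")
    case True
    hence "x * x - M * (y * y) - a * (z * z) = (a * M) * k" using eq unfolding M_def by simp
    thus ?thesis using y z x strict mult.commute[of M a] by linarith
  next
    case False
    hence "x * x + M * (y * y) - a * (z * z) = - ((a * M) * k)" using eq unfolding M_def by simp
    thus ?thesis using y z x strict mult.commute[of M a] by linarith
  qed
  thus ?thesis using \<open>a * M > 0\<close> by (simp only: mult_less_cancel_left_pos) linarith
qed

context quad
begin

lemma not_square_if_squarefree: assumes "\<bar>m\<bar> > 1" shows "z * z \<noteq> \<bar>m\<bar>"
proof
  assume square: "z * z = \<bar>m\<bar>"
  hence "z^2 dvd m" by (simp add: power2_eq_square)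
  hence "\<bar>z\<bar> = 1" using squarefreeD[OF sqf] by simp
  hence "z * z = 1" using abs_mult_self_eq[of z] by simp
  thus False using square assms by simp
qed

lemma square_neq_coprime_mult:
  assumes "coprime a m" "\<bar>m\<bar> > 1" "\<bar>m\<bar> dvd x"
  shows "x * x \<noteq> a * \<bar>m\<bar>"
proof
  assume "x * x = a * \<bar>m\<bar>"
  obtain j where "x = \<bar>m\<bar> * j" using assms(3) by (elim dvdE)
  hence "\<bar>m\<bar> * (\<bar>m\<bar> * (j * j)) = \<bar>m\<bar> * a" using \<open>x * x = a * \<bar>m\<bar>\<close> by (simp add: algebra_simps)
  hence "\<bar>m\<bar> * (j * j) = a" using m_nonzero by simp
  hence "m dvd a" by (metis abs_dvd_iff dvd_triv_left)
  hence "is_unit m" using assms(1) by (metis coprime_absorb_right)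
  thus False using assms(2) by simp
qed

text \<open>Legendre's theorem for \<open>x\<^sup>2 - m y\<^sup>2 = a z\<^sup>2\<close> by the pigeonhole principle: a small nonzero
  solution of the congruence modulo \<open>m a\<close> has \<open>x\<^sup>2 - m y\<^sup>2 - a z\<^sup>2 \<in> {0, - m a}\<close>, so that
  \<open>x\<^sup>2 - m y\<^sup>2\<close> is \<open>a\<close> times the norm of \<open>z\<close> or of \<open>z + \<surd>m\<close>.\<close>

lemma norm_form_represents:
  assumes a: "a > 0" "coprime a m" "a dvd b * b - m" and t: "m dvd t * t - a" and m: "\<bar>m\<bar> > 1"
  shows "\<exists>X Y. norm_form X Y = of_int a"
proof -
  have "\<bar>m\<bar> > 0" using m by simp
  from simultaneous_congruences_small[OF a(1) this, where b = b and t = t] obtain x y z where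
      nonzero: "x \<noteq> 0 \<or> y \<noteq> 0 \<or> z \<noteq> 0" and dvd: "a dvd x - b * y" "\<bar>m\<bar> dvd x - t * z"
    and bounds: "x * x \<le> a * \<bar>m\<bar>" "y * y \<le> a" "z * z \<le> \<bar>m\<bar>" .
  have "x * x - m * (y * y) - a * (z * z) = (x - b * y) * (x + b * y) + (b * b - m) * (y * y) - a * (z * z)"
    by (simp add: algebra_simps)
  hence "a dvd x * x - m * (y * y) - a * (z * z)"
    by (simp only:) (intro dvd_diff dvd_add dvd_mult2 dvd(1) a(3) dvd_triv_left)
  moreover have "x * x - m * (y * y) - a * (z * z) = (x - t * z) * (x + t * z) + (t * t - a) * (z * z)
    - m * (y * y)" by (simp add: algebra_simps)
  hence "m dvd x * x - m * (y * y) - a * (z * z)"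
    using dvd(2) t by (simp only: abs_dvd_iff dvd_diff dvd_add dvd_mult2 dvd_triv_left)
  ultimately have "a * m dvd x * x - m * (y * y) - a * (z * z)" using a(2) by (rule divides_mult)
  then obtain k where k: "x * x - m * (y * y) - a * (z * z) = a * m * k" by (elim dvdE)
  have "x * x \<noteq> a * \<bar>m\<bar>" if "z = 0" using square_neq_coprime_mult[OF a(2) m, of x] dvd(2) that by simp
  moreover have "z * z < \<bar>m\<bar>" using bounds(3) not_square_if_squarefree[OF m, of z] by linarith
  ultimately have "k = 0 \<or> k = -1"
    by (intro ternary_form_small[OF a(1) m_nonzero bounds(1,2) _ _ k])
  hence "x * x - m * (y * y) = a * (z * z - m * (k * k))" using k by (auto simp: algebra_simps)
  hence norm: "norm_form (of_int x) (of_int y) = of_int a * norm_form (of_int z) (of_int k)"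
    unfolding norm_form_def by (simp flip: of_int_mult of_int_diff)
  have "elt (of_int z) (of_int k) \<noteq> 0"
  proof
    assume "elt (of_int z) (of_int k) = 0"
    hence "z = 0" "norm_form (of_int x) (of_int y) = 0" using norm norm_form_eq_0_iff by auto
    thus False using nonzero norm_form_eq_0_iff by auto
  qed
  moreover from this have "norm_form (of_int z) (of_int k) \<noteq> 0" using norm_form_eq_0_iff by auto
  ultimately show ?thesis using elt_divide[of "of_int z" "of_int k" "of_int x" "of_int y"] norm
    by (metis mult_right_cancel)
qed

subsection \<open>The principal genus\<close>

definition ideal_sum :: "complex set \<Rightarrow> complex set \<Rightarrow> complex set" where
  "ideal_sum I J = {x + y | x y. x \<in> I \<and> y \<in> J}"

lemma ideal_sum_memI: "x \<in> I \<Longrightarrow> y \<in> J \<Longrightarrow> x + y \<in> ideal_sum I J"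
  unfolding ideal_sum_def by blast

lemma ideal_sum_comm: "ideal_sum I J = ideal_sum J I"
  unfolding ideal_sum_def by (intro Collect_cong) (metis add.commute)

lemma subset_ideal_sum: assumes "0 \<in> J" shows "I \<subseteq> ideal_sum I J"
  using ideal_sum_memI[OF _ assms] by force

lemma FI_sum:
  assumes I: "FI I" and J: "FI J"
  shows "FI (ideal_sum I J)"
proof -
  note closed = FI_D[OF I] FI_D[OF J]
  obtain x where x: "x \<in> I" "x \<noteq> 0" using FI_nonzero[OF I] .
  obtain c where c: "c \<in> OK" "c \<noteq> 0" "\<And>x. x \<in> I \<Longrightarrow> c * x \<in> OK" using FI_denominator[OF I] by blast
  obtain d where d: "d \<in> OK" "d \<noteq> 0" "\<And>x. x \<in> J \<Longrightarrow> d * x \<in> OK" using FI_denominator[OF J] by blast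
  show ?thesis
  proof (rule FI_intro)
    show "ideal_sum I J \<subseteq> K" unfolding ideal_sum_def using closed(1,6) by (auto intro: K_add)
    show "0 \<in> ideal_sum I J" using ideal_sum_memI[OF closed(2,7)] by simp
    show "x \<in> ideal_sum I J" "x \<noteq> 0" using subset_ideal_sum[OF closed(7)] x by auto
    show "u + v \<in> ideal_sum I J" if uv: "u \<in> ideal_sum I J" "v \<in> ideal_sum I J" for u v
    proof -
      obtain x y x' y' where "x \<in> I" "y \<in> J" "x' \<in> I" "y' \<in> J" "u = x + y" "v = x' + y'"
        using uv unfolding ideal_sum_def by blast
      thus ?thesis using ideal_sum_memI[OF closed(4,9), of x x' y y'] by (simp add: ac_simps)
    qed
    show "r * u \<in> ideal_sum I J" if "r \<in> OK" "u \<in> ideal_sum I J" for r u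
      using that unfolding ideal_sum_def by (clarsimp simp: distrib_left) (metis closed(5,10))
    show "c * d \<in> OK" "c * d \<noteq> 0" using c(1,2) d(1,2) by (auto simp: OK_eq quad_ints_mult)
    show "c * d * u \<in> OK" if u: "u \<in> ideal_sum I J" for u
    proof -
      obtain x y where xy: "x \<in> I" "y \<in> J" "u = x + y" using u unfolding ideal_sum_def by blast
      hence "d * (c * x) + c * (d * y) \<in> OK" using c d by (simp add: OK_eq quad_ints_add quad_ints_mult)
      thus ?thesis unfolding xy(3) by (simp add: algebra_simps)
    qed
  qed
qed

lemma ideal_mult_sum_distrib:
  assumes "0 \<in> I" "0 \<in> J"
  shows "ideal_mult (ideal_sum I J) N = ideal_sum (ideal_mult I N) (ideal_mult J N)"
proof (rule equalityI[OF ideal_mult_subsetI subsetI])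
  show "a * b \<in> ideal_sum (ideal_mult I N) (ideal_mult J N)" if "a \<in> ideal_sum I J" "b \<in> N" for a b
    using that unfolding ideal_sum_def by (clarsimp simp: distrib_right) (metis ideal_mult_memI)
  show "0 \<in> ideal_sum (ideal_mult I N) (ideal_mult J N)"
    using ideal_sum_memI[OF ideal_mult_zero ideal_mult_zero] by simp
  show "x + y \<in> ideal_sum (ideal_mult I N) (ideal_mult J N)"
    if xy: "x \<in> ideal_sum (ideal_mult I N) (ideal_mult J N)" "y \<in> ideal_sum (ideal_mult I N) (ideal_mult J N)"
      for x y
  proof -
    obtain u v u' v' where "u \<in> ideal_mult I N" "v \<in> ideal_mult J N" "u' \<in> ideal_mult I N"
      "v' \<in> ideal_mult J N"
      and "x = u + v" "y = u' + v'" using xy unfolding ideal_sum_def by blast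
    thus ?thesis using ideal_sum_memI[OF ideal_mult_add ideal_mult_add, of u I N u' v J N v']
      by (simp add: ac_simps)
  qed
  fix z assume "z \<in> ideal_sum (ideal_mult I N) (ideal_mult J N)"
  moreover have "ideal_mult I N \<subseteq> ideal_mult (ideal_sum I J) N"
    by (intro ideal_mult_mono subset_ideal_sum assms order_refl)
  moreover have "ideal_mult J N \<subseteq> ideal_mult (ideal_sum I J) N"
    unfolding ideal_sum_comm[of I J] by (intro ideal_mult_mono subset_ideal_sum assms order_refl)
  ultimately show "z \<in> ideal_mult (ideal_sum I J) N" unfolding ideal_sum_def by (auto intro: ideal_mult_add)
qed

lemma sigma_ideal_sum:
  assumes "I \<subseteq> K" "J \<subseteq> K"
  shows "\<sigma> ` ideal_sum I J = ideal_sum (\<sigma> ` I) (\<sigma> ` J)"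
  unfolding ideal_sum_def using assms sigma_add by (auto simp: image_iff subset_iff) metis+

text \<open>Hilbert's Theorem 90 for ideals: \<open>J = M / M'\<close> with \<open>M = (1) + J\<close> and \<open>M'\<close> its conjugate.\<close>

lemma norm_one_class_is_square:
  assumes J: "FI J" and norm: "ideal_norm J = 1"
  shows "\<exists>Y\<in>carrier G. ideal_class J = Y \<star> Y"
proof -
  interpret G: comm_group G by (rule G_comm_group)
  note closed = FI_D(1,2)[OF J] FI_D(1,2)[OF FI_OK] FI_D(2)[OF FI_sigma[OF J]]
  define M where "M = ideal_sum OK J"
  have M: "FI M" unfolding M_def by (rule FI_sum[OF FI_OK J])
  have "ideal_mult (\<sigma> ` J) J = OK" using ideal_norm_FI(2)[OF J] norm ideal_mult_comm by simp
  hence "ideal_mult (\<sigma> ` M) J = M" unfolding M_def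
    by (simp add: sigma_ideal_sum closed sigma_OK ideal_mult_sum_distrib FI_unit_mult[OF J] ideal_sum_comm)
  hence "ideal_class (\<sigma> ` M) \<star> ideal_class J = ideal_class M"
    using ideal_class_mult[OF FI_sigma[OF M] J] by simp
  moreover have "ideal_class M \<in> carrier G" "ideal_class (\<sigma> ` M) \<in> carrier G" "ideal_class J \<in> carrier G"
    using ideal_class_mem M FI_sigma J by auto
  ultimately have "ideal_class J = ideal_class M \<star> ideal_class M"
    using ideal_class_conj[OF M] by (metis G.l_one G.m_assoc)
  thus ?thesis using \<open>ideal_class M \<in> carrier G\<close> by blast
qed

lemma principal_genus:
  assumes a: "a > 0" "a dvd b * b - m" "coprime a (2 * m)" and t: "m dvd t * t - a" and m: "\<bar>m\<bar> > 1"
  shows "\<exists>Y\<in>carrier G. ideal_class (L a b) = Y \<star> Y"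
proof -
  obtain X Y where norm: "norm_form X Y = of_int a"
    using norm_form_represents[OF a(1) _ a(2) t m] a(3) by auto
  hence norm_pos: "norm_form X Y > 0" using a(1) by simp
  hence nonzero: "elt X Y \<noteq> 0" using norm_form_eq_0_iff[of X Y] by auto
  define J where "J = (*) (inverse (elt X Y)) ` L a b"
  have J: "FI J" unfolding J_def
    by (rule FI_scale[OF K_inverse _ FI_L[OF a(1,2)]]) (use nonzero in auto)
  have L_eq: "L a b = (*) (elt X Y) ` J" unfolding J_def scale_scale using nonzero by simp
  have "ideal_class (L a b) = ideal_class J"
    unfolding L_eq by (rule ideal_class_scale_pos_norm[OF J norm_pos])
  moreover have "of_int a = \<bar>norm_form X Y\<bar> * ideal_norm J"
    using ideal_norm_scale[OF nonzero J] ideal_norm_L[OF a(1,2)] unfolding L_eq by simp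
  hence "ideal_norm J = 1" using norm a(1) by simp
  ultimately show ?thesis using norm_one_class_is_square[OF J] by simp
qed

end

subsection \<open>Genus characters\<close>

text \<open>The tame Hilbert symbol at \<open>p\<close> of a norm from \<open>\<rat>(\<surd>m)\<close> is trivial when \<open>p\<close> divides \<open>m\<close>.\<close>

context
  fixes p :: nat and m m' :: int
  assumes p: "prime p" "[p = 1] (mod 4)" and m: "m = int p * m'" "\<not> int p dvd m'"
begin

lemma prime_dvd_square_mult_iff: "\<not> int p dvd a \<Longrightarrow> int p dvd a * (D * D) \<longleftrightarrow> int p dvd D"
  using p(1) by (simp add: prime_dvd_mult_iff)

lemma norm_equation_primitive:
  assumes "a * (D * D) = c * (A * A - m * (B * B))" "D \<noteq> 0"
  obtains A' B' D' where "a * (D' * D') = c * (A' * A' - m * (B' * B'))"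
    "\<not> (int p dvd A' \<and> int p dvd B' \<and> int p dvd D')"
  using assms
proof (induction "nat \<bar>D\<bar>" arbitrary: A B D thesis rule: less_induct)
  case less
  show ?case
  proof (cases "int p dvd A \<and> int p dvd B \<and> int p dvd D")
    case True
    then obtain A' B' D' where dvd: "A = int p * A'" "B = int p * B'" "D = int p * D'" by (auto elim!: dvdE)
    have p_gt: "int p > 1" using prime_gt_1_nat[OF p(1)] by simp
    have "(int p * int p) * (a * (D' * D')) = (int p * int p) * (c * (A' * A' - m * (B' * B')))"
      using less.prems(2) unfolding dvd by (simp add: algebra_simps)
    hence "a * (D' * D') = c * (A' * A' - m * (B' * B'))" using p_gt by simp
    moreover have "D' \<noteq> 0" using less.prems(3) dvd(3) by simp
    moreover have "1 * \<bar>D'\<bar> < int p * \<bar>D'\<bar>" using p_gt \<open>D' \<noteq> 0\<close> by (intro mult_strict_right_mono) auto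
    hence "nat \<bar>D'\<bar> < nat \<bar>D\<bar>" unfolding dvd(3) by (simp add: abs_mult)
    ultimately show ?thesis using less.hyps less.prems(1) by blast
  next
    case False
    thus ?thesis using less.prems by blast
  qed
qed

lemma Legendre_eq_if_norm_multiple:
  assumes norm: "a * (D * D) = c * (A * A - m * (B * B))" "D \<noteq> 0" and a: "\<not> int p dvd a"
    and c: "\<not> int p dvd c"
  shows "Legendre a p = Legendre c p"
proof -
  note p_gt = prime_1_mod_4_gt_2[OF p]
  have prime_p: "prime (int p)" using p(1) by simp
  obtain A B D where norm: "a * (D * D) = c * (A * A - m * (B * B))"
    and primitive: "\<not> (int p dvd A \<and> int p dvd B \<and> int p dvd D)"
    using norm_equation_primitive[OF norm] .
  have cong: "[a * (D * D) = c * (A * A)] (mod int p)"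
    unfolding cong_iff_dvd_diff norm m(1) by (simp add: algebra_simps)
  have "\<not> int p dvd A"
  proof
    assume A: "int p dvd A"
    hence "int p dvd a * (D * D)" using cong cong_dvd_iff by (metis dvd_mult dvd_mult2)
    hence D: "int p dvd D" using a prime_dvd_square_mult_iff by blast
    have "int p * int p dvd c * (A * A) - a * (D * D)" using A D by (intro dvd_diff dvd_mult mult_dvd_mono)
    also have "c * (A * A) - a * (D * D) = int p * (c * (m' * (B * B)))"
      unfolding norm m(1) by (simp add: algebra_simps)
    finally have "int p dvd c * (m' * (B * B))" using p_gt by simp
    hence "int p dvd B" using c m(2) prime_p by (simp add: prime_dvd_mult_iff)
    thus False using primitive A D by blast
  qed
  moreover from this have "\<not> int p dvd D" using cong c a prime_dvd_square_mult_iff cong_dvd_iff by metis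
  ultimately show ?thesis
    using Legendre_cong[OF cong] Legendre_square[OF _ prime_p, of A] Legendre_square[OF _ prime_p, of D]
      Legendre_mult[OF p(1) p_gt, of a "D * D"] Legendre_mult[OF p(1) p_gt, of c "A * A"] by simp
qed

lemma Legendre_eq_if_ramified_norm_multiple:
  assumes norm: "a * (D * D) = int p * (A * A - m * (B * B))" "D \<noteq> 0" and a: "\<not> int p dvd a"
  shows "Legendre a p = Legendre m' p"
proof -
  note p_gt = prime_1_mod_4_gt_2[OF p]
  have prime_p: "prime (int p)" using p(1) by simp
  obtain A B D where norm: "a * (D * D) = int p * (A * A - m * (B * B))"
    and primitive: "\<not> (int p dvd A \<and> int p dvd B \<and> int p dvd D)"
    using norm_equation_primitive[OF norm] .
  have "int p dvd D" using norm prime_dvd_square_mult_iff[OF a] by (metis dvd_triv_left)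
  then obtain d where d: "D = int p * d" by (elim dvdE)
  have "int p * (int p * (a * (d * d))) = int p * (A * A - m * (B * B))"
    using norm unfolding d by (simp add: algebra_simps)
  hence "int p * (a * (d * d)) = A * A - m * (B * B)" using p_gt by simp
  hence square: "A * A = int p * (a * (d * d) + m' * (B * B))" unfolding m(1) by (simp add: algebra_simps)
  hence "int p dvd A" using prime_p by (metis dvd_triv_left prime_dvd_mult_iff)
  then obtain \<alpha> where \<alpha>: "A = int p * \<alpha>" by (elim dvdE)
  hence "int p * (int p * (\<alpha> * \<alpha>)) = int p * (a * (d * d) + m' * (B * B))"
    using square by (simp add: algebra_simps)
  hence "a * (d * d) - (- 1) * (m' * (B * B)) = int p * (\<alpha> * \<alpha>)" using p_gt by simp
  hence cong: "[a * (d * d) = (- 1) * (m' * (B * B))] (mod int p)" unfolding cong_iff_dvd_diff by simp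
  have B: "\<not> int p dvd B" using primitive \<alpha> d by auto
  hence "\<not> int p dvd (- 1) * (m' * (B * B))" using m(2) prime_p by (simp add: prime_dvd_mult_iff)
  hence "\<not> int p dvd d" using cong cong_dvd_iff prime_dvd_square_mult_iff[OF a] by metis
  hence "Legendre a p = Legendre (- 1) p * Legendre m' p"
    using Legendre_cong[OF cong] Legendre_square[OF B prime_p] Legendre_square[OF _ prime_p, of d]
      Legendre_mult[OF p(1) p_gt, of a "d * d"] Legendre_mult[OF p(1) p_gt, of "- 1" "m' * (B * B)"]
      Legendre_mult[OF p(1) p_gt, of m' "B * B"] by simp
  thus ?thesis using Legendre_minus_1[OF p] by simp
qed

end

context quad
begin

definition genus_char :: "nat \<Rightarrow> complex set set \<Rightarrow> int" where
  "genus_char p X = Legendre (SOME n. \<not> int p dvd n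
    \<and> (\<exists>I. FI I \<and> ideal_class I = X \<and> ideal_norm I = of_int n)) p"

lemma ideal_class_eq_imp_norm_multiple:
  assumes I: "FI I" "ideal_norm I = of_int a" and J: "FI J" "ideal_norm J = of_int c"
    and eq: "ideal_class I = ideal_class J"
  obtains A B D where "a * (D * D) = c * (A * A - m * (B * B))" "D \<noteq> 0"
proof -
  obtain z where z: "totally_positive K z" "I = (*) z ` J" using ideal_class_eq_iff[OF I(1) J(1)] eq by blast
  obtain x y where xy: "z = elt x y" using totally_positive_K(1)[OF z(1)] by (elim K_cases)
  have norm_pos: "norm_form x y > 0" and nonzero: "elt x y \<noteq> 0"
    using totally_positive_norm_form[of x y] totally_positive_K(2)[OF z(1)] z(1) unfolding xy by simp_all
  obtain A B D where D: "D > 0" "x = of_int A / of_int D" "y = of_int B / of_int D"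
    using rat_pair_common_denominator .
  have "of_int a = norm_form x y * of_int c"
    using ideal_norm_scale[OF nonzero J(1)] norm_pos I(2) J(2) unfolding z(2) xy by simp
  hence "(of_int (a * (D * D)) :: rat) = of_int (c * (A * A - m * (B * B)))"
    using D(1) unfolding norm_form_def D(2,3) by (simp add: field_simps)
  hence "a * (D * D) = c * (A * A - m * (B * B))" by (simp only: of_int_eq_iff)
  thus ?thesis using that D(1) by auto
qed

context
  fixes p :: nat
  assumes p: "prime p" "[p = 1] (mod 4)" "int p dvd m"
begin

lemma prime_not_dvd_cofactor: "m = int p * (m div int p)" "\<not> int p dvd m div int p"
proof -
  show m_eq: "m = int p * (m div int p)" using p(3) by simp
  show "\<not> int p dvd m div int p"
  proof
    assume "int p dvd m div int p"
    hence "int p^2 dvd m" using mult_dvd_mono[of "int p" "int p" "int p" "m div int p"] m_eq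
      by (simp add: power2_eq_square)
    hence "is_unit (int p)" using squarefreeD[OF sqf] by blast
    thus False using prime_1_mod_4_gt_2[OF p(1,2)] by simp
  qed
qed

lemma genus_char_ideal_class:
  assumes I: "FI I" and norm: "ideal_norm I = of_int n" and n: "\<not> int p dvd n"
  shows "genus_char p (ideal_class I) = Legendre n p"
proof -
  define k where "k = (SOME n. \<not> int p dvd n \<and> (\<exists>J. FI J \<and> ideal_class J = ideal_class I
    \<and> ideal_norm J = of_int n))"
  have "\<not> int p dvd k \<and> (\<exists>J. FI J \<and> ideal_class J = ideal_class I \<and> ideal_norm J = of_int k)" unfolding k_def
    by (rule someI[of _ n]) (use I norm n in blast)
  then obtain J where J: "\<not> int p dvd k" "FI J" "ideal_class J = ideal_class I" "ideal_norm J = of_int k"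
    by blast
  obtain A B D where "k * (D * D) = n * (A * A - m * (B * B))" "D \<noteq> 0"
    using ideal_class_eq_imp_norm_multiple[OF J(2,4) I norm J(3)] .
  hence "Legendre k p = Legendre n p"
    by (rule Legendre_eq_if_norm_multiple[OF p(1,2) prime_not_dvd_cofactor _ _ J(1) n])
  thus ?thesis unfolding genus_char_def k_def .
qed

lemma genus_char_L: "a > 0 \<Longrightarrow> a dvd b * b - m \<Longrightarrow> \<not> int p dvd a \<Longrightarrow> genus_char p (ideal_class (L a b))
  = Legendre a p"
  using genus_char_ideal_class FI_L ideal_norm_L by blast

lemma coprime_representative:
  assumes "X \<in> carrier G"
  obtains a b where "a > 0" "a dvd b * b - m" "X = ideal_class (L a b)" "\<not> int p dvd a"
proof -
  obtain I where "FI I" "X = ideal_class I" using assms unfolding carrier_G by auto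
  then obtain a b where a: "a > 0" "a dvd b * b - m" "coprime a (2 * m)" "X = ideal_class (L a b)"
    using coprime_rep by metis
  have "int p dvd 2 * m" using p(3) by simp
  hence "\<not> int p dvd a" using a(3) p(1)
    by (metis coprime_common_divisor not_prime_unit prime_nat_int_transfer)
  thus ?thesis using that a by blast
qed

lemma genus_char_sign: assumes "X \<in> carrier G" shows "genus_char p X \<in> {-1, 1}"
proof -
  obtain a b where a: "a > 0" "a dvd b * b - m" "X = ideal_class (L a b)" "\<not> int p dvd a"
    using coprime_representative[OF assms] .
  show ?thesis using Legendre_sign[OF a(4)] unfolding a(3) genus_char_L[OF a(1,2,4)] .
qed

lemma genus_char_mult:
  assumes "X \<in> carrier G" "Y \<in> carrier G"
  shows "genus_char p (X \<star> Y) = genus_char p X * genus_char p Y"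
proof -
  obtain a b where a: "a > 0" "a dvd b * b - m" "X = ideal_class (L a b)" "\<not> int p dvd a"
    using coprime_representative[OF assms(1)] .
  obtain c d where c: "c > 0" "c dvd d * d - m" "Y = ideal_class (L c d)" "\<not> int p dvd c"
    using coprime_representative[OF assms(2)] .
  note F = FI_L[OF a(1,2)] FI_L[OF c(1,2)]
  have "ideal_norm (ideal_mult (L a b) (L c d)) = of_int (a * c)"
    using ideal_norm_mult[OF F] ideal_norm_L[OF a(1,2)] ideal_norm_L[OF c(1,2)] by simp
  moreover have "\<not> int p dvd a * c" using a(4) c(4) p(1) by (simp add: prime_dvd_mult_iff)
  ultimately have "genus_char p (X \<star> Y) = Legendre (a * c) p"
    unfolding a(3) c(3) ideal_class_mult[OF F] by (rule genus_char_ideal_class[OF FI_mult[OF F]])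
  also have "... = Legendre a p * Legendre c p" by (rule Legendre_mult[OF p(1) prime_1_mod_4_gt_2[OF p(1,2)]])
  finally show ?thesis unfolding a(3) c(3) genus_char_L[OF a(1,2,4)] genus_char_L[OF c(1,2,4)] .
qed

lemma genus_char_L_ramified: "genus_char p (ideal_class (L (int p) 0)) = Legendre (m div int p) p"
proof -
  have P: "int p > 0" "int p dvd 0 * 0 - m" using p(1,3) prime_gt_0_nat by auto
  have "ideal_class (L (int p) 0) \<in> carrier G" by (rule ideal_class_mem[OF FI_L[OF P]])
  then obtain a b where a: "a > 0" "a dvd b * b - m" "ideal_class (L (int p) 0) = ideal_class (L a b)"
    "\<not> int p dvd a" by (rule coprime_representative)
  obtain A B D where "a * (D * D) = int p * (A * A - m * (B * B))" "D \<noteq> 0"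
    using ideal_class_eq_imp_norm_multiple[OF FI_L[OF a(1,2)] ideal_norm_L[OF a(1,2)] FI_L[OF P]
      ideal_norm_L[OF P] a(3)[symmetric]] .
  hence "Legendre a p = Legendre (m div int p) p"
    by (rule Legendre_eq_if_ramified_norm_multiple[OF p(1,2) prime_not_dvd_cofactor _ _ a(4)])
  thus ?thesis unfolding a(3) genus_char_L[OF a(1,2,4)] .
qed

end

end

section \<open>Principal ideals of ramified norm\<close>

lemma squarefree_dvd_if_dvd_square:
  fixes a c :: int
  assumes a: "squarefree a" "a \<noteq> 0" and c: "c \<noteq> 0" and dvd: "a dvd c * c"
  shows "a dvd c"
proof (rule multiplicity_le_imp_dvd[OF a(2)])
  fix l :: int assume l: "prime l"
  show "multiplicity l a \<le> multiplicity l c"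
  proof (cases "l dvd a")
    case True
    hence "l dvd c" using dvd l by (meson dvd_trans prime_dvd_multD)
    hence "multiplicity l c > 0" using l c multiplicity_eq_zero_iff[of c l] not_prime_unit[of l] by auto
    moreover have "multiplicity l a \<le> 1" using a l by (auto simp: squarefree_factorial_semiring'')
    ultimately show ?thesis by linarith
  qed (simp add: not_dvd_imp_multiplicity_0)
qed

lemma squarefree_product_square:
  fixes a b c :: int
  assumes a: "squarefree a" "a > 0" and b: "squarefree b" "b > 0" and c: "c * c = a * b"
  shows "a = b"
proof -
  have dvd: "a dvd b" if a: "squarefree a" "a > 0" and b: "squarefree b" "b > 0" and c: "c * c = a * b"
    for a b
  proof -
    have "c \<noteq> 0" using a(2) b(2) c by auto
    hence "a dvd c" using a c squarefree_dvd_if_dvd_square[of a c] by simp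
    then obtain k where k: "c = a * k" by (elim dvdE)
    hence "a * (a * (k * k)) = a * b" using c by (simp add: algebra_simps)
    thus ?thesis using a(2) by (metis dvd_triv_left less_irrefl mult_cancel_left)
  qed
  show ?thesis using dvd[OF a b c] dvd[OF b a] c a(2) b(2) by (simp add: mult.commute zdvd_antisym_nonneg)
qed

context quad
begin

lemma L_mult_coprime:
  assumes coprime: "coprime \<beta> \<beta>'" and dvd: "\<beta> * \<beta>' dvd m"
  shows "ideal_mult (L \<beta> 0) (L \<beta>' 0) = L (\<beta> * \<beta>') 0"
proof (rule equalityI[OF ideal_mult_subsetI subsetI])
  show "a * b \<in> L (\<beta> * \<beta>') 0" if ab: "a \<in> L \<beta> 0" "b \<in> L \<beta>' 0" for a b
  proof -
    obtain u y u' y' where "a = elt_int u y" "\<beta> dvd u" "b = elt_int u' y'" "\<beta>' dvd u'"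
      using ab by (auto elim!: L_cases)
    moreover from this have "\<beta> * \<beta>' dvd u * u' + m * (y * y')"
      by (intro dvd_add[OF _ dvd_mult2[OF dvd]] mult_dvd_mono)
    ultimately show ?thesis by (simp add: elt_int_mult)
  qed
  fix z assume "z \<in> L (\<beta> * \<beta>') 0"
  then obtain k y where z: "z = elt_int (\<beta> * \<beta>' * k) y" by (auto simp: L_def dvd_def)
  obtain s t where "s * \<beta> + t * \<beta>' = 1" using bezout_int[of \<beta> \<beta>'] coprime by auto
  hence "y * (s * \<beta> + t * \<beta>') = y" by simp
  hence "z = elt_int \<beta> 0 * elt_int (\<beta>' * k) (y * s) + elt_int 0 (y * t) * elt_int \<beta>' 0"
    unfolding z elt_int_mult elt_int_add by (simp add: algebra_simps)
  also have "... \<in> ideal_mult (L \<beta> 0) (L \<beta>' 0)" by (intro ideal_mult_add ideal_mult_memI) auto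
  finally show "z \<in> ideal_mult (L \<beta> 0) (L \<beta>' 0)" .
qed (use L_add L_mem[of 0 0 "\<beta> * \<beta>'" 0] in \<open>auto simp: elt_int_int\<close>)

subsection \<open>Units of norm one\<close>

definition pos_units :: "complex set" where "pos_units = {elt_int x y | x y. x * x - m * (y * y) = 1 \<and> x > 0}"

lemma pos_units_cases:
  assumes "a \<in> pos_units"
  obtains x y where "a = elt_int x y" "x * x - m * (y * y) = 1" "x > 0"
  using assms unfolding pos_units_def by blast

lemma elt_int_pos_units: "x * x - m * (y * y) = 1 \<Longrightarrow> x > 0 \<Longrightarrow> elt_int x y \<in> pos_units"
  unfolding pos_units_def by blast

lemma norm_form_mult_int:
  "(x * x' + m * (y * y')) * (x * x' + m * (y * y')) - m * ((x * y' + y * x') * (x * y' + y * x'))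
    = (x * x - m * (y * y)) * (x' * x' - m * (y' * y'))"
  by (simp add: algebra_simps)

lemma one_pos_units: "1 \<in> pos_units"
  using elt_int_pos_units[of 1 0] by (simp add: elt_int_one)

lemma inverse_elt_int_unit: assumes "x * x - m * (y * y) = 1" shows "inverse (elt_int x y) = elt_int x (- y)"
proof (rule inverse_unique)
  have "x * x + m * (y * - y) = 1" "x * - y + y * x = 0" using assms by simp_all
  thus "elt_int x y * elt_int x (- y) = 1" unfolding elt_int_mult by (simp only: elt_int_one)
qed

lemma inverse_pos_units: "a \<in> pos_units \<Longrightarrow> inverse a \<in> pos_units"
  by (elim pos_units_cases) (simp add: inverse_elt_int_unit elt_int_pos_units)

lemma pos_units_nonzero: "a \<in> pos_units \<Longrightarrow> a \<noteq> 0"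
  by (elim pos_units_cases) auto

context
  assumes m: "m > 0"
begin

lemma mult_pos_units: assumes "a \<in> pos_units" "b \<in> pos_units" shows "a * b \<in> pos_units"
proof -
  obtain x y where a: "a = elt_int x y" "x * x - m * (y * y) = 1" "x > 0"
    using assms(1) by (rule pos_units_cases)
  obtain x' y' where b: "b = elt_int x' y'" "x' * x' - m * (y' * y') = 1" "x' > 0"
    using assms(2) by (rule pos_units_cases)
  have "(m * (y * y)) * (m * (y' * y')) < (x * x) * (x' * x')" by (rule mult_strict_mono) (use a b m in auto)
  hence "\<bar>m * (y * y')\<bar>^2 < (x * x')^2" by (simp add: power2_eq_square ac_simps abs_mult)
  hence "\<bar>m * (y * y')\<bar> < x * x'" by (rule power2_less_imp_less) (use a b in simp)
  hence "x * x' + m * (y * y') > 0" by linarith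
  thus ?thesis unfolding a(1) b(1) elt_int_mult
    by (intro elt_int_pos_units) (simp_all add: norm_form_mult_int a b)
qed

lemma power_pos_units: "a \<in> pos_units \<Longrightarrow> a^n \<in> pos_units"
  by (induction n) (simp_all add: one_pos_units mult_pos_units)

lemma pell_descent_bounds:
  fixes x y x0 y0 :: int
  assumes norm: "x * x = 1 + m * (y * y)" "x > 0" and norm0: "x0 * x0 = 1 + m * (y0 * y0)" "x0 > 0"
    and y: "0 < y0" "y0 \<le> y"
  shows "0 \<le> y * x0 - x * y0" "y * x0 - x * y0 < y"
proof -
  have "(y * x0)^2 - (x * y0)^2 = (y * y) * (x0 * x0) - (x * x) * (y0 * y0)"
    by (simp add: power2_eq_square ac_simps)
  also have "... = y * y - y0 * y0" unfolding norm norm0 by (simp add: algebra_simps)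
  finally have "(x * y0)^2 \<le> (y * x0)^2" using y mult_mono[of y0 y y0 y] by linarith
  hence "x * y0 \<le> y * x0" by (rule power2_le_imp_le) (use y norm0 in simp)
  thus "0 \<le> y * x0 - x * y0" by simp
  have "m * (y0 * y0) > 0" using m y by simp
  hence "x0 > 1" using norm0 by (cases "x0 = 1") auto
  have "(y * (x0 - 1))^2 = (y * y) * (x0 * x0 - 2 * x0 + 1)" by (simp add: power2_eq_square algebra_simps)
  also have "... \<le> (y * y) * (m * (y0 * y0))" using norm0(1) \<open>x0 > 1\<close> by (intro mult_left_mono) auto
  also have "... < (1 + m * (y * y)) * (y0 * y0)" using y by (simp add: algebra_simps)
  also have "... = (x * y0)^2" unfolding norm(1)[symmetric] by (simp add: power2_eq_square ac_simps)
  finally have "y * (x0 - 1) < x * y0" by (rule power2_less_imp_less) (use norm y in simp)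
  thus "y * x0 - x * y0 < y" by (simp add: algebra_simps)
qed

lemma pell_powers:
  assumes fundamental: "x0 * x0 - m * (y0 * y0) = 1" "x0 > 0" "y0 > 0"
    and least: "\<And>x y. x * x - m * (y * y) = 1 \<Longrightarrow> x > 0 \<Longrightarrow> y > 0 \<Longrightarrow> y0 \<le> y"
    and norm: "x * x - m * (y * y) = 1" "x > 0" "y \<ge> 0"
  shows "\<exists>n. elt_int x y = elt_int x0 y0^n"
  using norm
proof (induction "nat y" arbitrary: x y rule: less_induct)
  case less
  show ?case
  proof (cases "y = 0")
    case True
    hence "x = 1" using less.prems pos_zmult_eq_1_iff[of x x] by auto
    hence "elt_int x y = elt_int x0 y0^0" using True by (simp add: elt_int_one)
    thus ?thesis by blast
  next
    case False
    define x' y' where "x' = x * x0 - m * (y * y0)" and "y' = y * x0 - x * y0"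
    have quotient: "elt_int x y * inverse (elt_int x0 y0) = elt_int x' y'"
      unfolding inverse_elt_int_unit[OF fundamental(1)] elt_int_mult x'_def y'_def by simp
    have "elt_int x' y' \<in> pos_units"
      unfolding quotient[symmetric]
      using less.prems fundamental by (intro mult_pos_units inverse_pos_units elt_int_pos_units)
    hence "x' * x' - m * (y' * y') = 1" "x' > 0" by (auto elim: pos_units_cases)
    moreover have "0 \<le> y'" "y' < y" unfolding y'_def
      using pell_descent_bounds[of x y x0 y0] least[of x y] less.prems fundamental False by simp_all
    ultimately obtain n where "elt_int x' y' = elt_int x0 y0^n" using less.hyps[of y' x'] by auto
    moreover have "elt_int x0 y0 \<noteq> 0" using fundamental by simp
    ultimately have "elt_int x y = elt_int x0 y0^Suc n" using quotient by (simp add: field_simps)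
    thus ?thesis by blast
  qed
qed

lemma pos_units_generator: "\<exists>e\<in>pos_units. \<forall>a\<in>pos_units. \<exists>n. a = e^n \<or> inverse a = e^n"
proof -
  define P where "P n \<longleftrightarrow> n > 0 \<and> (\<exists>x>0. x * x - m * (int n * int n) = 1)" for n
  have P: "P (nat y)" if "x * x - m * (y * y) = 1" "x > 0" "y > 0" for x y using that unfolding P_def by auto
  have "\<exists>e\<in>pos_units. \<forall>x y. x * x - m * (y * y) = 1 \<longrightarrow> x > 0 \<longrightarrow> y \<ge> 0 \<longrightarrow> (\<exists>n. elt_int x y = e^n)"
  proof (cases "\<exists>n. P n")
    case False
    have "elt_int x y = 1^0" if norm: "x * x - m * (y * y) = 1" "x > 0" "y \<ge> 0" for x y
    proof -
      have "y = 0" using P[OF norm(1,2)] False norm(3) by force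
      moreover from this have "x = 1" using norm pos_zmult_eq_1_iff[of x x] by simp
      ultimately show ?thesis by (simp add: elt_int_one)
    qed
    thus ?thesis using one_pos_units by blast
  next
    case True
    define n where "n = (LEAST n. P n)"
    have "P n" unfolding n_def using True by (rule LeastI_ex)
    then obtain x0 where x0: "x0 * x0 - m * (int n * int n) = 1" "x0 > 0" and "n > 0" unfolding P_def by blast
    have "int n \<le> y" if "x * x - m * (y * y) = 1" "x > 0" "y > 0" for x y
      using Least_le[of P, OF P[OF that]] that(3) unfolding n_def by linarith
    hence "\<exists>k. elt_int x y = elt_int x0 (int n)^k" if "x * x - m * (y * y) = 1" "x > 0" "y \<ge> 0" for x y
      using pell_powers[OF x0 _ _ that] \<open>n > 0\<close> by simp
    thus ?thesis using elt_int_pos_units[OF x0] by blast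
  qed
  then obtain e where e: "e \<in> pos_units" "\<And>x y. x * x - m * (y * y) = 1 \<Longrightarrow> x > 0 \<Longrightarrow> y \<ge> 0 \<Longrightarrow>
    \<exists>n. elt_int x y = e^n" by blast
  have "\<exists>n. a = e^n \<or> inverse a = e^n" if unit: "a \<in> pos_units" for a
  proof -
    obtain x y where a: "a = elt_int x y" "x * x - m * (y * y) = 1" "x > 0"
      using unit by (rule pos_units_cases)
    show ?thesis unfolding a(1) inverse_elt_int_unit[OF a(2)]
      using e(2)[of x y] e(2)[of x "- y"] a by (cases "y \<ge> 0") auto
  qed
  thus ?thesis using e(1) by blast
qed

lemma pos_units_mod_squares: "\<exists>e\<in>pos_units. \<forall>a\<in>pos_units. \<exists>b\<in>pos_units. a = b * b \<or> a = e * (b * b)"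
proof -
  obtain e where e: "e \<in> pos_units" and generator: "\<And>a. a \<in> pos_units \<Longrightarrow> \<exists>n. a = e^n \<or> inverse a = e^n"
    using pos_units_generator by blast
  have power: "\<exists>b\<in>pos_units. e^n = b * b \<or> e^n = e * (b * b)" for n
  proof (rule bexI)
    show "e^(n div 2) \<in> pos_units" by (rule power_pos_units[OF e])
    show "e^n = e^(n div 2) * e^(n div 2) \<or> e^n = e * (e^(n div 2) * e^(n div 2))"
      by (cases "even n") (auto elim!: evenE oddE simp flip: power_add simp add: mult_2)
  qed
  have "\<exists>b\<in>pos_units. a = b * b \<or> a = e * (b * b)"
    if "b \<in> pos_units" "inverse a = b * b \<or> inverse a = e * (b * b)" for a b
    using that(2)
  proof
    assume "inverse a = b * b"
    hence "a = inverse b * inverse b" by (metis inverse_inverse_eq inverse_mult_distrib)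
    thus ?thesis using inverse_pos_units that(1) by blast
  next
    assume "inverse a = e * (b * b)"
    hence "a = inverse (e * (b * b))" by (metis inverse_inverse_eq)
    hence "a = e * (inverse (e * b) * inverse (e * b))"
      using pos_units_nonzero[OF e] by (simp add: field_simps)
    thus ?thesis using inverse_pos_units[OF mult_pos_units[OF e that(1)]] by blast
  qed
  thus ?thesis using e generator power by metis
qed

subsection \<open>Uniqueness of principal ramified ideals\<close>

lemma principal_unit:
  assumes g: "g > 0" "g dvd m" and trivial: "ideal_class (L g 0) = G_one"
  obtains X Y e where "X * X - m * (Y * Y) = g" "e \<in> pos_units" "elt_int X Y * elt_int X Y = of_int g * e"
proof -
  have dvd: "g dvd 0 * 0 - m" using g by simp
  obtain X Y where norm: "X * X - m * (Y * Y) = g" and generator: "L g 0 = (*) (elt_int X Y) ` OK"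
    using principal_norm[OF FI_L[OF g(1) dvd] L_subset_quad_ints trivial ideal_norm_L[OF g(1) dvd]] .
  have "elt_int X Y * 1 \<in> L g 0" unfolding generator using OK_1 by blast
  hence "elt_int X Y * elt_int X Y \<in> ideal_mult (L g 0) (L g (- 0))" by (intro ideal_mult_memI) simp_all
  then obtain s t where square: "elt_int X Y * elt_int X Y = of_int g * elt_int s t"
    unfolding L_mult_conj[OF g(1) dvd] OK_eq quad_ints_def by blast
  hence "elt_int X Y * elt_int X Y = elt_int g 0 * elt_int s t" by (simp add: elt_int_int)
  hence st: "X * X + m * (Y * Y) = g * s" "X * Y + Y * X = g * t" unfolding elt_int_mult by auto
  have "(g * s) * (g * s) - m * ((g * t) * (g * t)) = g * g"
    using norm_form_mult_int[of X X Y Y] unfolding st norm .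
  hence "g * g * (s * s - m * (t * t)) = g * g * 1" by (simp add: algebra_simps)
  hence "s * s - m * (t * t) = 1" using g(1) by simp
  moreover have "m * (Y * Y) \<ge> 0" using m by simp
  hence "g * s > 0" using norm g(1) st(1) by linarith
  hence "s > 0" using g(1) by (simp add: zero_less_mult_iff)
  ultimately show ?thesis using that norm square elt_int_pos_units by blast
qed

lemma square_if_square_times_unit:
  assumes norm: "X * X - m * (Y * Y) = n" and e: "e \<in> pos_units"
    and square: "elt_int X Y * elt_int X Y = of_int n * (e * e)"
  obtains c where "c * c = n"
proof -
  obtain x y where xy: "e = elt_int x y" "x * x - m * (y * y) = 1" using e by (rule pos_units_cases)
  obtain c d where cd: "c = X * x + m * (Y * - y)" "d = X * - y + Y * x" by blast
  have quotient: "elt_int X Y * inverse e = elt_int c d"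
    unfolding xy(1) inverse_elt_int_unit[OF xy(2)] elt_int_mult cd ..
  have "elt_int c d * elt_int c d = elt_int n 0"
    unfolding quotient[symmetric] using square pos_units_nonzero[OF e] by (simp add: elt_int_int field_simps)
  hence "c * c + m * (d * d) = n" unfolding elt_int_mult by simp
  moreover have "c * c - m * (d * d) = n"
    using norm_form_mult_int[of X x Y "- y"] norm xy(2) unfolding cd by simp
  ultimately show ?thesis using that[of c] by simp
qed

lemma unique_principal_ramified:
  assumes g: "g > 1" "g dvd m" "ideal_class (L g 0) = G_one"
    and h: "h > 1" "h dvd m" "ideal_class (L h 0) = G_one"
  shows "g = h"
proof -
  obtain e where e: "e \<in> pos_units"
    and mod_squares: "\<And>a. a \<in> pos_units \<Longrightarrow> \<exists>b\<in>pos_units. a = b * b \<or> a = e * (b * b)"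
    using pos_units_mod_squares by blast
  have sqf_dvd: "squarefree g" if "g dvd m" for g using sqf that squarefree_mono by blast
  have generator: "\<exists>X Y b. X * X - m * (Y * Y) = g \<and> b \<in> pos_units \<and> elt_int X Y * elt_int X Y
    = of_int g * (e * (b * b))"
    if g: "g > 1" "g dvd m" "ideal_class (L g 0) = G_one" for g
  proof -
    have "g > 0" using g(1) by simp
    obtain X Y a where a: "X * X - m * (Y * Y) = g" "a \<in> pos_units" "elt_int X Y * elt_int X Y = of_int g * a"
      using principal_unit[OF \<open>g > 0\<close> g(2,3)] .
    obtain b where b: "b \<in> pos_units" "a = b * b \<or> a = e * (b * b)" using mod_squares[OF a(2)] by blast
    have "a \<noteq> b * b"
    proof
      assume "a = b * b"
      then obtain c where "c * c = g * 1" using square_if_square_times_unit[OF a(1) b(1)] a(3) by auto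
      thus False using squarefree_product_square[OF sqf_dvd[OF g(2)] \<open>g > 0\<close>, of 1 c] g(1) by simp
    qed
    thus ?thesis using a b by blast
  qed
  obtain X Y a where a: "X * X - m * (Y * Y) = g" "a \<in> pos_units"
    "elt_int X Y * elt_int X Y = of_int g * (e * (a * a))" using generator[OF g] by blast
  obtain X' Y' b where b: "X' * X' - m * (Y' * Y') = h" "b \<in> pos_units"
    "elt_int X' Y' * elt_int X' Y' = of_int h * (e * (b * b))" using generator[OF h] by blast
  define P Q where "P = X * X' + m * (Y * Y')" and "Q = X * Y' + Y * X'"
  have "elt_int P Q * elt_int P Q = (elt_int X Y * elt_int X Y) * (elt_int X' Y' * elt_int X' Y')"
    unfolding P_def Q_def elt_int_mult[symmetric] by (simp only: ac_simps)
  also have "... = of_int (g * h) * ((e * (a * b)) * (e * (a * b)))"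
    unfolding a(3) b(3) by (simp add: ac_simps)
  finally have square: "elt_int P Q * elt_int P Q = of_int (g * h) * ((e * (a * b)) * (e * (a * b)))" .
  have "P * P - m * (Q * Q) = g * h" unfolding P_def Q_def norm_form_mult_int a(1) b(1) ..
  then obtain c where "c * c = g * h"
    using square_if_square_times_unit[OF _ mult_pos_units[OF e mult_pos_units[OF a(2) b(2)]] square] by blast
  thus ?thesis using squarefree_product_square[OF sqf_dvd[OF g(2)] _ sqf_dvd[OF h(2)]] g(1) h(1) by simp
qed

end

end

section \<open>The 4-rank and the 8-rank\<close>

lemma prime_square_not_dvd_prime:
  fixes l q :: nat assumes l: "prime l" and q: "prime q" shows "\<not> int l * int l dvd int q"
  using squarefreeD[OF squarefree_prime[of "int q"], of "int l"] assms by (auto simp: power2_eq_square)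

lemma cong_1_mod_8_if_Legendre_2:
  assumes l: "prime l" "[l = 1] (mod 4)" and "Legendre 2 (int l) = 1" shows "[l = 1] (mod (8::nat))"
proof -
  have "chi8 (int l) = 1" using Legendre_2[OF l(1) prime_1_mod_4_gt_2[OF l]] assms(3) by simp
  hence "int l mod 8 = 1 \<or> int l mod 8 = 7" by (simp add: chi8_def split: if_splits)
  moreover have "int l mod 4 = 1" using l(2) zmod_int[of l 4] by (simp add: Cong.cong_def)
  moreover have "n mod 8 = 1" if "n mod 8 = 1 \<or> n mod 8 = 7" "n mod 4 = 1" for n :: int
    using that by presburger
  ultimately have "int l mod 8 = 1" by blast
  thus ?thesis using zmod_int[of l 8] by (simp add: Cong.cong_def)
qed

abbreviation rank_8_pos :: "int \<Rightarrow> bool" where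
  "rank_8_pos D \<equiv> prime_power_rank 2 2 (narrow_class_group D) = 2
    \<and> prime_power_rank 2 3 (narrow_class_group D) \<ge> 1"

locale quad_pq = quad m for m :: int +
  fixes p q :: nat and k :: int
  assumes p: "prime p" "[p = 1] (mod 4)" and q: "prime q" "[q = 1] (mod 4)" and p_neq_q: "p \<noteq> q"
    and k: "k = -1 \<or> k = 2" and m_eq: "m = k * (int p * int q)"
begin

lemma p_gt_2: "2 < p" by (rule prime_1_mod_4_gt_2[OF p])
lemma q_gt_2: "2 < q" by (rule prime_1_mod_4_gt_2[OF q])
lemma prime_int_p: "prime (int p)" using p by simp
lemma prime_int_q: "prime (int q)" using q by simp
lemma p_dvd_m: "int p dvd m" unfolding m_eq by simp
lemma q_dvd_m: "int q dvd m" unfolding m_eq by simp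
lemma odd_p: "odd p" using prime_odd_nat[OF p(1) p_gt_2] .
lemma odd_q: "odd q" using prime_odd_nat[OF q(1) q_gt_2] .
lemma coprime_p_q: "coprime (int p) (int q)" using primes_coprime[OF p(1) q(1) p_neq_q] by simp
lemma not_p_dvd_q: "\<not> int p dvd int q" using primes_dvd_imp_eq[OF p(1) q(1)] p_neq_q by auto
lemma not_q_dvd_p: "\<not> int q dvd int p" using primes_dvd_imp_eq[OF q(1) p(1)] p_neq_q by auto
lemma not_p_dvd_2: "\<not> int p dvd 2" using p_gt_2 zdvd_imp_le[of "int p" 2] by auto
lemma not_q_dvd_2: "\<not> int q dvd 2" using q_gt_2 zdvd_imp_le[of "int q" 2] by auto
lemma m_div_p: "m div int p = k * int q" unfolding m_eq using p_gt_2 by simp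
lemma m_div_q: "m div int q = k * int p" unfolding m_eq using q_gt_2 by simp

lemma abs_m_gt_1: "\<bar>m\<bar> > 1"
  using dvd_imp_le_int[OF m_nonzero p_dvd_m] p_gt_2 by simp

lemma not_dvd_if_coprime: assumes "coprime a (2 * m)" shows "\<not> int p dvd a" "\<not> int q dvd a" "odd a"
proof -
  have "coprime a m" "coprime a 2" using assms by auto
  thus "\<not> int p dvd a" "\<not> int q dvd a"
    using p_dvd_m q_dvd_m prime_int_p prime_int_q by (meson coprime_common_divisor not_prime_unit)+
  show "odd a" using \<open>coprime a 2\<close> by simp
qed

lemma square_mod_m:
  assumes "odd a" "Legendre a p = 1" "Legendre a q = 1"
  obtains t where "m dvd t * t - a"
proof -
  obtain u where u: "[u * u = a] (mod int p)" using Legendre_eq_1E assms(2) prime_int_p by blast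
  obtain v where v: "[v * v = a] (mod int q)" using Legendre_eq_1E assms(3) prime_int_q by blast
  obtain t where t: "[t = u] (mod int p)" "[t = v] (mod int q)"
    using binary_chinese_remainder_int[OF coprime_p_q] by blast
  have "[t * t = a] (mod int p)" by (rule cong_trans[OF cong_mult[OF t(1) t(1)] u])
  moreover have "[t * t = a] (mod int q)" by (rule cong_trans[OF cong_mult[OF t(2) t(2)] v])
  ultimately have pq_dvd: "int p * int q dvd t * t - a"
    using coprime_p_q unfolding cong_iff_dvd_diff by (intro divides_mult)
  show ?thesis
  proof (cases "k = 2")
    case False
    thus ?thesis using k pq_dvd that unfolding m_eq by auto
  next
    case True
    define s where "s = (if odd t then t else t + int p * int q)"
    have "s * s - a = (t * t - a) + int p * int q * (if odd t then 0 else 2 * t + int p * int q)"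
      unfolding s_def by (simp add: algebra_simps)
    hence "int p * int q dvd s * s - a" using pq_dvd by (simp only: dvd_add dvd_triv_left)
    moreover have "odd s" unfolding s_def using odd_p odd_q by simp
    hence "2 dvd s * s - a" using assms(1) by simp
    moreover have "coprime 2 (int p * int q)" using odd_p odd_q by simp
    ultimately have "2 * (int p * int q) dvd s * s - a" using divides_mult by blast
    thus ?thesis using that unfolding m_eq True by blast
  qed
qed

lemma square_if_genus_char_trivial:
  assumes X: "X \<in> carrier G" "genus_char p X = 1" "genus_char q X = 1"
  shows "\<exists>Y\<in>carrier G. X = Y \<star> Y"
proof -
  obtain I where "FI I" "X = ideal_class I" using X(1) unfolding carrier_G by auto
  then obtain a b where a: "a > 0" "a dvd b * b - m" "coprime a (2 * m)" and X_eq: "X = ideal_class (L a b)"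
    using coprime_rep by metis
  note ndvd = not_dvd_if_coprime[OF a(3)]
  have "Legendre a p = 1" "Legendre a q = 1"
    using X(2,3) unfolding X_eq genus_char_L[OF p p_dvd_m a(1,2) ndvd(1)]
      genus_char_L[OF q q_dvd_m a(1,2) ndvd(2)] .
  then obtain t where "m dvd t * t - a" using square_mod_m[OF ndvd(3)] by blast
  thus ?thesis unfolding X_eq by (rule principal_genus[OF a _ abs_m_gt_1])
qed

sublocale genus: two_genus_characters G "genus_char p" "genus_char q"
  by (intro two_genus_characters.intro two_genus_characters_axioms.intro G_comm_group G_finite
    genus_char_mult[OF p p_dvd_m] genus_char_mult[OF q q_dvd_m] genus_char_sign[OF p p_dvd_m]
      genus_char_sign[OF q q_dvd_m] square_if_genus_char_trivial)

definition b2 :: int where "b2 = (if k = -1 then 1 else 0)"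

lemma ambiguous_2: "ambiguous 2 b2"
proof (cases "k = -1")
  case True
  hence "odd m" unfolding m_eq using odd_p odd_q by simp
  thus ?thesis unfolding ambiguous_def b2_def using True by simp
next
  case False
  hence "2 dvd m" using k unfolding m_eq by auto
  thus ?thesis unfolding ambiguous_def b2_def using False by simp
qed
lemma ambiguous_p: "ambiguous (int p) 0" unfolding ambiguous_def using p_dvd_m p_gt_2 by simp
lemma ambiguous_q: "ambiguous (int q) 0" unfolding ambiguous_def using q_dvd_m q_gt_2 by simp

lemma genus_char_ambiguous:
  assumes "ambiguous \<beta> b"
  shows "\<not> int p dvd \<beta> \<Longrightarrow> genus_char p (ideal_class (L \<beta> b)) = Legendre \<beta> p"
    "\<not> int q dvd \<beta> \<Longrightarrow> genus_char q (ideal_class (L \<beta> b)) = Legendre \<beta> q"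
  using genus_char_L[OF p p_dvd_m ambiguous_dvd(1,2)[OF assms]]
    genus_char_L[OF q q_dvd_m ambiguous_dvd(1,2)[OF assms]] by auto

lemma rank_4_eq_2_imp_cong_Legendre:
  assumes "prime_power_rank 2 2 G = 2"
  shows "[p = 1] (mod 8)" "[q = 1] (mod 8)" "Legendre (int q) (int p) = 1"
proof -
  have trivial: "genus_char p (ideal_class (L \<beta> b)) = 1" "genus_char q (ideal_class (L \<beta> b)) = 1"
    if "ambiguous \<beta> b" for \<beta> b
    using genus.characters_two_torsion[OF assms] ambiguous_two_torsion[OF that]
    unfolding genus.two_torsion_def by auto
  have "Legendre 2 (int p) = 1"
    using trivial(1)[OF ambiguous_2] genus_char_ambiguous(1)[OF ambiguous_2 not_p_dvd_2] by simp
  thus "[p = 1] (mod 8)" using cong_1_mod_8_if_Legendre_2 p by blast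
  have "Legendre 2 (int q) = 1"
    using trivial(2)[OF ambiguous_2] genus_char_ambiguous(2)[OF ambiguous_2 not_q_dvd_2] by simp
  thus "[q = 1] (mod 8)" using cong_1_mod_8_if_Legendre_2 q by blast
  show "Legendre (int q) (int p) = 1"
    using trivial(1)[OF ambiguous_q] genus_char_ambiguous(1)[OF ambiguous_q not_p_dvd_q] by simp
qed

end

locale quad_pq8 = quad_pq +
  assumes p_mod_8: "[p = 1] (mod 8)" and q_mod_8: "[q = 1] (mod 8)"
    and Legendre_q_p: "Legendre (int q) (int p) = 1"
begin

lemma Legendre_p_q: "Legendre (int p) (int q) = 1"
  using Legendre_reciprocity[OF p(1) p_gt_2 q(1) q_gt_2 p(2)] Legendre_q_p by simp

lemma Legendre_k: "Legendre k (int p) = 1" "Legendre k (int q) = 1"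
  using k Legendre_1_mod_8[OF p(1) p_mod_8] Legendre_1_mod_8[OF q(1) q_mod_8] by auto

lemma ramified_class_is_square:
  "\<exists>c\<in>carrier G. ideal_class (L 2 b2) = c \<star> c" "\<exists>c\<in>carrier G. ideal_class (L (int p) 0) = c \<star> c"
    "\<exists>c\<in>carrier G. ideal_class (L (int q) 0) = c \<star> c"
proof -
  show "\<exists>c\<in>carrier G. ideal_class (L 2 b2) = c \<star> c"
    using genus_char_ambiguous[OF ambiguous_2] not_p_dvd_2 not_q_dvd_2 Legendre_1_mod_8[OF p(1) p_mod_8]
      Legendre_1_mod_8[OF q(1) q_mod_8]
    by (intro square_if_genus_char_trivial ambiguous_two_torsion(2)[OF ambiguous_2]) auto
  have "genus_char p (ideal_class (L (int p) 0)) = 1" "genus_char q (ideal_class (L (int q) 0)) = 1"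
    unfolding genus_char_L_ramified[OF p p_dvd_m] genus_char_L_ramified[OF q q_dvd_m] m_div_p m_div_q
    using Legendre_k Legendre_q_p Legendre_p_q
    by (simp_all add: Legendre_mult[OF p(1) p_gt_2] Legendre_mult[OF q(1) q_gt_2])
  thus "\<exists>c\<in>carrier G. ideal_class (L (int p) 0) = c \<star> c" "\<exists>c\<in>carrier G. ideal_class (L (int q) 0) = c \<star> c"
    using genus_char_ambiguous(2)[OF ambiguous_p not_q_dvd_p] genus_char_ambiguous(1)[OF ambiguous_q
      not_p_dvd_q] Legendre_q_p Legendre_p_q
    by (simp_all add: square_if_genus_char_trivial ambiguous_two_torsion(2)[OF ambiguous_p]
      ambiguous_two_torsion(2)[OF ambiguous_q])
qed

subsection \<open>Genus characters of the classes of order four\<close>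

lemma genus_char_four_torsion:
  assumes "c \<in> carrier G" "ambiguous \<beta> b" "c \<star> c = ideal_class (L \<beta> b)"
  obtains a X Y where "a > 0" "coprime a (2 * m)" "genus_char p c = Legendre a (int p)" "\<not> int p dvd a"
    "X * X - m * (Y * Y) = \<beta> * (a * a)" "coprime X Y"
proof -
  obtain a b X Y where a: "a > 0" "a dvd b * b - m" "coprime a (2 * m)" "c = ideal_class (L a b)"
    "X * X - m * (Y * Y) = \<beta> * (a * a)" "coprime X Y" using four_torsion[OF assms] .
  note ndvd = not_dvd_if_coprime(1)[OF a(3)]
  show ?thesis using that[OF a(1,3) _ ndvd a(5,6)] genus_char_L[OF p p_dvd_m a(1,2) ndvd] a(4) by simp
qed

lemma four_torsion_divide:
  assumes norm: "X * X - m * (Y * Y) = \<beta> * (a * a)" "coprime X Y" and "\<beta> dvd X" and m: "m = \<beta> * n"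
    and \<beta>: "\<beta> \<noteq> 0"
  obtains x where "\<beta> * (x * x) - n * (Y * Y) = a * a" "coprime x Y" "coprime (\<beta> * x) Y"
proof -
  obtain x where x: "X = \<beta> * x" using assms(3) by (elim dvdE)
  have "\<beta> * (\<beta> * (x * x) - n * (Y * Y)) = \<beta> * (a * a)"
    using norm(1) unfolding x m by (simp add: algebra_simps)
  hence "\<beta> * (x * x) - n * (Y * Y) = a * a" using \<beta> by simp
  moreover have "coprime (\<beta> * x) Y" using norm(2) unfolding x .
  moreover from this have "coprime x Y" by simp
  ultimately show ?thesis using that by blast
qed

lemma prime_dvd_norm_root:
  assumes norm: "X * X - m * (Y * Y) = \<beta> * (a * a)" and l: "prime l" "l dvd m" "l dvd \<beta>"
  shows "l dvd X"
proof -
  have "X * X = m * (Y * Y) + \<beta> * (a * a)" using norm by simp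
  hence "l dvd X * X" using l(2,3) by (simp only: dvd_add dvd_mult2)
  thus ?thesis using l(1) by (simp add: prime_dvd_mult_iff)
qed

lemma coprime_norm_root:
  assumes norm: "g * (X * X) - h * (a * a) = n * (Y * Y)" and n: "n dvd 2 * m"
    and a: "a \<noteq> 0" "coprime a (2 * m)" and coprime: "coprime X Y"
  shows "coprime X a"
proof (rule coprimeI_prime)
  fix l assume l: "prime l" "l dvd X" "l dvd a"
  have "l dvd g * (X * X) - h * (a * a)" using l by (intro dvd_diff dvd_mult) auto
  hence "l dvd n * (Y * Y)" unfolding norm .
  moreover have "\<not> l dvd 2 * m" using a(2) l by (metis coprime_common_divisor not_prime_unit)
  hence "\<not> l dvd n" using n dvd_trans by blast
  ultimately have "l dvd Y" using l(1) by (simp add: prime_dvd_mult_iff)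
  thus False using coprime l by (meson coprime_common_divisor not_prime_unit)
qed (use a(1) in simp)

lemma genus_char_sqrt_2_imaginary:
  assumes k_eq: "k = -1" and c: "c \<in> carrier G" "c \<star> c = ideal_class (L 2 b2)"
    and rep: "int q = C * C - 2 * (D * D)" and r: "[r * r = 2] (mod int p)"
  shows "genus_char p c = quartic p 2 * (sign16 p * Legendre (C + D * r) (int p))"
proof -
  obtain a X Y where a: "a > 0" "coprime a (2 * m)" "genus_char p c = Legendre a (int p)" "\<not> int p dvd a"
    and XY: "X * X - m * (Y * Y) = 2 * (a * a)" "coprime X Y"
      using genus_char_four_torsion[OF c(1) ambiguous_2 c(2)] .
  note mod_8 = Legendre_1_mod_8[OF p(1) p_mod_8]
  have norm: "X * X - 2 * (a * a) = - (int p * int q * (Y * Y))" using XY(1) unfolding m_eq k_eq by simp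
  hence cong: "[X * X = (a * a) * 2] (mod int p)" unfolding cong_iff_dvd_diff by (simp add: mult.commute)
  have X: "\<not> int p dvd X"
  proof
    assume "int p dvd X"
    hence "int p dvd (a * a) * 2" using cong cong_dvd_iff by (metis dvd_mult2)
    thus False using prime_int_p not_p_dvd_2 a(4) by (simp add: prime_dvd_mult_iff)
  qed
  have "1 * (X * X) - 2 * (a * a) = m * (Y * Y)" using XY(1) by simp
  hence "coprime X a" by (rule coprime_norm_root) (use a XY(2) in auto)
  hence "Legendre X p = sign16 p * Legendre (C + D * r) p"
    by (rule Legendre_eq_sign16_split[OF p(1) p_mod_8 q(1) Legendre_q_p norm _ X rep r])
  moreover have "Legendre X p = Legendre a p * quartic p 2"
    using quartic_cong[OF cong] quartic_square[OF p X] quartic_square_mult[OF p a(4)] by simp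
  ultimately show ?thesis unfolding a(3) using quartic_sign[OF mod_8(1)] by auto
qed

lemma genus_char_sqrt_p:
  assumes c: "c \<in> carrier G" "c \<star> c = ideal_class (L (int p) 0)"
  shows "genus_char p c = quartic p (- (k * int q))"
proof -
  obtain a X Y where a: "a > 0" "coprime a (2 * m)" "genus_char p c = Legendre a (int p)" "\<not> int p dvd a"
    and XY: "X * X - m * (Y * Y) = int p * (a * a)" "coprime X Y"
      using genus_char_four_torsion[OF c(1) ambiguous_p c(2)] .
  have m_p: "m = int p * (k * int q)" unfolding m_eq by simp
  have "int p dvd X" by (rule prime_dvd_norm_root[OF XY(1) prime_int_p p_dvd_m dvd_refl])
  then obtain x where x: "int p * (x * x) - k * int q * (Y * Y) = a * a" "coprime (int p * x) Y"
    using four_torsion_divide[OF XY _ m_p] p_gt_2 by auto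
  have "Legendre ((- 1) * (k * int q)) (int p) = 1"
    unfolding Legendre_mult[OF p(1) p_gt_2] using Legendre_k Legendre_minus_1[OF p] Legendre_q_p by simp
  hence "Legendre (- (k * int q)) (int p) = 1" by simp
  thus ?thesis unfolding a(3) by (rule Legendre_eq_quartic[OF p(1) p_mod_8 x a(4)])
qed

lemma genus_char_sqrt_2_real:
  assumes k_eq: "k = 2" and c: "c \<in> carrier G" "c \<star> c = ideal_class (L 2 b2)"
    and rep: "int q = C * C - 2 * (D * D)" and r: "[r * r = 2] (mod int p)"
  shows "genus_char p c = sign16 p * Legendre (C + D * r) (int p)"
proof -
  obtain a X Y where a: "a > 0" "coprime a (2 * m)" "genus_char p c = Legendre a (int p)" "\<not> int p dvd a"
    and XY: "X * X - m * (Y * Y) = 2 * (a * a)" "coprime X Y"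
      using genus_char_four_torsion[OF c(1) ambiguous_2 c(2)] .
  have m_2: "m = 2 * (int p * int q)" unfolding m_eq k_eq by simp
  have "2 dvd X" by (rule prime_dvd_norm_root[OF XY(1)]) (simp_all add: m_2)
  then obtain x where x: "2 * (x * x) - int p * int q * (Y * Y) = a * a" "coprime x Y"
    using four_torsion_divide[OF XY _ m_2] by auto
  hence "2 * (x * x) - 1 * (a * a) = int p * int q * (Y * Y)" by simp
  hence "coprime a x" using coprime_norm_root[of 2 x 1 a "int p * int q" Y] a x(2)
    by (simp add: m_2 coprime_commute)
  moreover have "a * a - 2 * (x * x) = - (int p * int q * (Y * Y))" using x(1) by simp
  ultimately show ?thesis unfolding a(3)
    by (intro Legendre_eq_sign16_split[OF p(1) p_mod_8 q(1) Legendre_q_p _ _ a(4) rep r])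
qed

lemma genus_char_sqrt_q_real:
  assumes k_eq: "k = 2" and c: "c \<in> carrier G" "c \<star> c = ideal_class (L (int q) 0)"
    and rep: "int q = C * C + 2 * (D * D)" and r: "[r * r = - 2] (mod int p)"
  shows "genus_char p c = quartic p (int q) * Legendre (C + D * r) (int p)"
proof -
  obtain a X Y where a: "a > 0" "coprime a (2 * m)" "genus_char p c = Legendre a (int p)" "\<not> int p dvd a"
    and XY: "X * X - m * (Y * Y) = int q * (a * a)" "coprime X Y"
      using genus_char_four_torsion[OF c(1) ambiguous_q c(2)] .
  have m_q: "m = int q * (2 * int p)" unfolding m_eq k_eq by simp
  have "int q dvd X" by (rule prime_dvd_norm_root[OF XY(1) prime_int_q q_dvd_m dvd_refl])
  then obtain x where x: "int q * (x * x) - 2 * int p * (Y * Y) = a * a" "coprime x Y"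
    using four_torsion_divide[OF XY _ m_q] q_gt_2 by auto
  show ?thesis unfolding a(3)
    by (rule Legendre_eq_quartic_split[OF p(1) p_mod_8 x(1)[symmetric] _ Legendre_q_p
      prime_square_not_dvd_prime[OF _ q(1)] x(2) a(4) r rep]) simp
qed

lemma genus_char_sqrt_2q_real:
  assumes k_eq: "k = 2" and c: "c \<in> carrier G" "c \<star> c = ideal_class (L (2 * int q) 0)"
    and rep: "2 * int q = C * C + D * D" and r: "[r * r = - 1] (mod int p)"
  shows "genus_char p c = quartic p (2 * int q) * Legendre (C + D * r) (int p)"
proof -
  have m_2q: "m = 2 * int q * (1 * int p)" unfolding m_eq k_eq by simp
  hence dvd: "2 dvd m" "2 * int q dvd m" by auto
  have ambiguous: "ambiguous (2 * int q) 0" unfolding ambiguous_def using dvd q_gt_2 by simp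
  obtain a X Y where a: "a > 0" "coprime a (2 * m)" "genus_char p c = Legendre a (int p)" "\<not> int p dvd a"
    and XY: "X * X - m * (Y * Y) = 2 * int q * (a * a)" "coprime X Y"
      using genus_char_four_torsion[OF c(1) ambiguous c(2)] .
  have "2 dvd X" "int q dvd X" using prime_dvd_norm_root[OF XY(1)] dvd(1) q_dvd_m prime_int_q by auto
  hence "2 * int q dvd X" using odd_q by (intro divides_mult) auto
  then obtain x where x: "2 * int q * (x * x) - 1 * int p * (Y * Y) = a * a" "coprime x Y"
    using four_torsion_divide[OF XY _ m_2q] q_gt_2 by auto
  have "Legendre (2 * int q) (int p) = 1"
    using Legendre_mult[OF p(1) p_gt_2] Legendre_1_mod_8[OF p(1) p_mod_8] Legendre_q_p by simp
  moreover have "\<not> int l * int l dvd 2 * int q" if l: "prime l" "2 < l" for l :: nat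
  proof
    assume "int l * int l dvd 2 * int q"
    moreover have "coprime (int l * int l) 2" using prime_odd_nat[OF l] by simp
    ultimately have "int l * int l dvd int q" by (simp add: coprime_dvd_mult_right_iff)
    thus False using prime_square_not_dvd_prime[OF l(1) q(1)] by blast
  qed
  moreover have "2 * int q = C * C + 1 * (D * D)" using rep by simp
  ultimately show ?thesis unfolding a(3)
    using Legendre_eq_quartic_split[OF p(1) p_mod_8 x(1)[symmetric] _ _ _ x(2) a(4) r] by simp
qed

subsection \<open>Positive 8-rank\<close>

lemma product_principal:
  assumes "ambiguous \<beta> b" "ambiguous \<beta>' b'" "ideal_class (L \<beta> b) = ideal_class (L \<beta>' b')"
  shows "ideal_class (ideal_mult (L \<beta> b) (L \<beta>' b')) = G_one"
  using ideal_class_mult[OF FI_ambiguous[OF assms(1)] FI_ambiguous[OF assms(2)]]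
    ambiguous_two_torsion(1)[OF assms(2)] assms(3) by simp

lemma small_norm_not_principal:
  assumes k_eq: "k = -1" and I: "FI I" "I \<subseteq> quad_ints" "ideal_norm I = of_int n"
    and n: "squarefree n" "1 < n" "n < int p * int q"
  shows "ideal_class I \<noteq> G_one"
proof
  assume "ideal_class I = G_one"
  then obtain X Y where "X * X - m * (Y * Y) = n" using principal_norm[OF I(1,2) _ I(3)] by metis
  hence norm: "X * X + int p * int q * (Y * Y) = n" unfolding m_eq k_eq by simp
  have "Y = 0"
  proof (rule ccontr)
    assume "Y \<noteq> 0"
    hence "Y * Y \<ge> 1" using zero_less_mult_iff[of Y Y] by linarith
    hence "int p * int q * 1 \<le> int p * int q * (Y * Y)" by (intro mult_left_mono) auto
    thus False using norm n(3) zero_le_square[of X] by linarith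
  qed
  hence "X * X = n * 1" using norm by simp
  thus False using squarefree_product_square[of n 1 X] n by simp
qed

lemma rank_8_pos_imaginary:
  assumes k_eq: "k = -1" and rep: "int q = C * C - 2 * (D * D)" and r: "[r * r = 2] (mod int p)"
    and sign_2: "quartic p 2 * (sign16 p * Legendre (C + D * r) (int p)) = 1"
      and sign_p: "quartic p (int q) = 1"
  shows "rank_8_pos (4 * m)"
proof -
  obtain u where u: "u \<in> carrier G" "ideal_class (L 2 b2) = u \<star> u" using ramified_class_is_square(1) by blast
  obtain v where v: "v \<in> carrier G" "ideal_class (L (int p) 0) = v \<star> v"
    using ramified_class_is_square(2) by blast
  have genus_char: "genus_char p u = 1" "genus_char p v = 1"
    using genus_char_sqrt_2_imaginary[OF k_eq u(1) u(2)[symmetric] rep r] sign_2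
      genus_char_sqrt_p[OF v(1) v(2)[symmetric]] sign_p k_eq by simp_all
  have "int p * 2 < int p * int q" using p_gt_2 q_gt_2 by (intro mult_strict_left_mono) auto
  hence sizes: "2 < int p * int q" "int p < int p * int q" "2 * int p < int p * int q"
    using p_gt_2 by linarith+
  have "squarefree (2 * int p)" using squarefree_prime[OF prime_int_p] squarefree_prime[of "2::int"] odd_p
    by (intro squarefree_mult_coprime) auto
  note not_principal = small_norm_not_principal[OF k_eq FI_ambiguous L_subset_quad_ints ideal_norm_ambiguous]
  have neq: "ideal_class (L 2 b2) \<noteq> ideal_class (L (int p) 0)"
  proof
    assume "ideal_class (L 2 b2) = ideal_class (L (int p) 0)"
    hence "ideal_class (ideal_mult (L 2 b2) (L (int p) 0)) = G_one"
      by (rule product_principal[OF ambiguous_2 ambiguous_p])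
    moreover have "ideal_class (ideal_mult (L 2 b2) (L (int p) 0)) \<noteq> G_one"
      using small_norm_not_principal[OF k_eq FI_mult[OF FI_ambiguous[OF ambiguous_2] FI_ambiguous[OF
        ambiguous_p]], of "2 * int p"]
        ideal_norm_mult[OF FI_ambiguous[OF ambiguous_2] FI_ambiguous[OF ambiguous_p]]
          ideal_norm_ambiguous[OF ambiguous_2] ideal_norm_ambiguous[OF ambiguous_p] sizes p_gt_2
          \<open>squarefree (2 * int p)\<close>
      by (simp add: ideal_mult_subset_quad_ints L_subset_quad_ints)
    ultimately show False by contradiction
  qed
  show ?thesis
  proof (rule genus.rank_8_criterion[OF u(1) genus_char(1) v(1) genus_char(2) u(2) _ _ v(2) _ _ neq])
    show "ideal_class (L 2 b2) \<noteq> G_one" "ideal_class (L (int p) 0) \<noteq> G_one"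
      using not_principal[OF ambiguous_2 ambiguous_2] not_principal[OF ambiguous_p ambiguous_p] sizes p_gt_2
        squarefree_prime[OF prime_int_p] squarefree_prime[of "2::int"]
      by simp_all
  qed (rule ambiguous_two_torsion(1)[OF ambiguous_2], rule ambiguous_two_torsion(1)[OF ambiguous_p])
qed

context
  assumes k_eq: "k = 2"
begin

lemma real_parameters: "b2 = 0" "m > 0" "m = 2 * (int p * int q)" "ambiguous 2 0"
  using k_eq p_gt_2 q_gt_2 ambiguous_2 unfolding b2_def m_eq by auto

lemma equal_classes_principal:
  assumes "ambiguous \<beta> 0" "ambiguous \<beta>' 0" "coprime \<beta> \<beta>'" "\<beta> * \<beta>' dvd m"
    "ideal_class (L \<beta> 0) = ideal_class (L \<beta>' 0)"
  shows "ideal_class (L (\<beta> * \<beta>') 0) = G_one"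
  using product_principal[OF assms(1,2,5)] unfolding L_mult_coprime[OF assms(3,4)] .

lemma rank_8_pos_if_lifted_pair:
  assumes "ambiguous \<beta> 0" "ambiguous \<beta>' 0"
    and neq: "ideal_class (L \<beta> 0) \<noteq> G_one" "ideal_class (L \<beta>' 0) \<noteq> G_one"
    "ideal_class (L \<beta> 0) \<noteq> ideal_class (L \<beta>' 0)"
    and lift: "u \<in> carrier G" "ideal_class (L \<beta> 0) = u \<star> u" "genus_char p u = 1" "v \<in> carrier G"
      "ideal_class (L \<beta>' 0) = v \<star> v" "genus_char p v = 1"
  shows "rank_8_pos (4 * m)"
  by (rule genus.rank_8_criterion[OF lift(1,3,4,6,2) ambiguous_two_torsion(1)[OF assms(1)] neq(1) lift(5)
    ambiguous_two_torsion(1)[OF assms(2)] neq(2,3)])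

lemma rank_8_pos_real:
  assumes rep: "int q = C * C - 2 * (D * D)" and r: "[r * r = 2] (mod int p)"
    and rep1: "int q = C1 * C1 + 2 * (D1 * D1)" and r1: "[r1 * r1 = - 2] (mod int p)"
    and sign_2: "sign16 p * Legendre (C + D * r) (int p) = 1" and sign_p: "quartic p (- (2 * int q)) = 1"
    and sign_q: "quartic p (int q) * Legendre (C1 + D1 * r1) (int p) = 1"
  shows "rank_8_pos (4 * m)"
proof -
  note real = real_parameters
  obtain u where u: "u \<in> carrier G" "ideal_class (L 2 0) = u \<star> u" "genus_char p u = 1"
    using ramified_class_is_square(1) genus_char_sqrt_2_real[OF k_eq _ _ rep r] sign_2
    unfolding real(1) by metis
  obtain v where v: "v \<in> carrier G" "ideal_class (L (int p) 0) = v \<star> v" "genus_char p v = 1"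
    using ramified_class_is_square(2) genus_char_sqrt_p sign_p unfolding k_eq by metis
  obtain t where t: "t \<in> carrier G" "ideal_class (L (int q) 0) = t \<star> t" "genus_char p t = 1"
    using ramified_class_is_square(3) genus_char_sqrt_q_real[OF k_eq _ _ rep1 r1] sign_q by metis
  let ?principal = "\<lambda>g. ideal_class (L g 0) = G_one"
    and ?S = "{2, int p, int q, 2 * int p, 2 * int q, int p * int q}"
  have "int p * int q > 1" using p_gt_2 q_gt_2 less_1_mult[of "int p" "int q"] by simp
  hence unique: "g = h" if "?principal g" "?principal h" "g \<in> ?S" "h \<in> ?S" for g h
    using that p_gt_2 q_gt_2 by (intro unique_principal_ramified[OF real(2)]) (auto simp: real(3))
  have "2 \<noteq> int p * int q" "int p \<noteq> 2 * int q" "int q \<noteq> 2 * int p"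
    using odd_p odd_q even_mult_iff[of "int p" "int q"] by (metis dvd_triv_left even_of_nat even_numeral)+
  hence distinct: "(2::int) \<noteq> int p" "(2::int) \<noteq> int q" "int p \<noteq> int q" "2 \<noteq> int p * int q"
    "int p \<noteq> 2 * int q" "int q \<noteq> 2 * int p" "2 * int p \<noteq> 2 * int q"
    using p_gt_2 q_gt_2 p_neq_q by auto
  have equal: "ideal_class (L 2 0) = ideal_class (L (int p) 0) \<Longrightarrow> ?principal (2 * int p)"
    "ideal_class (L 2 0) = ideal_class (L (int q) 0) \<Longrightarrow> ?principal (2 * int q)"
    "ideal_class (L (int p) 0) = ideal_class (L (int q) 0) \<Longrightarrow> ?principal (int p * int q)"
    using equal_classes_principal[OF real(4) ambiguous_p] equal_classes_principal[OF real(4) ambiguous_q]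
      equal_classes_principal[OF ambiguous_p ambiguous_q coprime_p_q] odd_p odd_q by (simp_all add: real(3))
  consider "\<not> ?principal (int p) \<and> \<not> ?principal (int q)
    \<and> ideal_class (L (int p) 0) \<noteq> ideal_class (L (int q) 0)"
    | "\<not> ?principal 2 \<and> \<not> ?principal (int q) \<and> ideal_class (L 2 0) \<noteq> ideal_class (L (int q) 0)"
    | "\<not> ?principal 2 \<and> \<not> ?principal (int p) \<and> ideal_class (L 2 0) \<noteq> ideal_class (L (int p) 0)"
    using unique equal distinct by (metis insertI1 insertI2)
  thus ?thesis
    using rank_8_pos_if_lifted_pair[OF ambiguous_p ambiguous_q _ _ _ v t] rank_8_pos_if_lifted_pair[OF real(4)
      ambiguous_q _ _ _ u t]
      rank_8_pos_if_lifted_pair[OF real(4) ambiguous_p _ _ _ u v] by cases simp_all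
qed

lemma sign_product_real:
  assumes rep: "int q = C * C - 2 * (D * D)" and r: "[r * r = 2] (mod int p)"
    and rep1: "int q = C1 * C1 + 2 * (D1 * D1)" and r1: "[r1 * r1 = - 2] (mod int p)"
    and rep2: "2 * int q = C2 * C2 + D2 * D2" and r2: "[r2 * r2 = - 1] (mod int p)"
  shows "(sign16 p * Legendre (C + D * r) (int p)) * (quartic p (int q) * Legendre (C1 + D1 * r1) (int p))
    = quartic p (2 * int q) * Legendre (C2 + D2 * r2) (int p)"
proof -
  note real = real_parameters
  obtain u where u: "u \<in> carrier G" "ideal_class (L 2 b2) = u \<star> u" using ramified_class_is_square(1) by blast
  obtain t where t: "t \<in> carrier G" "ideal_class (L (int q) 0) = t \<star> t"
    using ramified_class_is_square(3) by blast
  have "ideal_mult (L 2 0) (L (int q) 0) = L (2 * int q) 0"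
    using odd_q by (intro L_mult_coprime) (auto simp: real(3))
  hence "ideal_class (L (2 * int q) 0) = ideal_class (L 2 0) \<star> ideal_class (L (int q) 0)"
    using ideal_class_mult[OF FI_ambiguous[OF real(4)] FI_ambiguous[OF ambiguous_q]] by simp
  also have "... = (u \<star> t) \<star> (u \<star> t)" using u t unfolding real(1) by (simp add: genus.m_ac)
  finally have "genus_char p (u \<star> t) = quartic p (2 * int q) * Legendre (C2 + D2 * r2) (int p)"
    using u(1) t(1) by (intro genus_char_sqrt_2q_real[OF k_eq _ _ rep2 r2]) auto
  thus ?thesis unfolding genus.chi_mult[OF u(1) t(1)] genus_char_sqrt_2_real[OF k_eq u(1) u(2)[symmetric] rep
    r]
      genus_char_sqrt_q_real[OF k_eq t(1) t(2)[symmetric] rep1 r1] .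
qed

end

end

lemma quad_pqI:
  assumes p: "prime p" "[p = 1] (mod 4)" and q: "prime q" "[q = 1] (mod 4)" and p_neq_q: "p \<noteq> q"
    and k: "k = -1 \<or> k = 2"
  shows "quad_pq (k * (int p * int q)) p q k"
proof
  have odd: "odd p" "odd q" using prime_odd_nat prime_1_mod_4_gt_2 p q by auto
  have sqf: "squarefree (int p * int q)"
    using primes_coprime[OF p(1) q(1) p_neq_q] p q by (intro squarefree_mult_coprime squarefree_prime) auto
  hence "squarefree (2 * (int p * int q))"
    using odd by (intro squarefree_mult_coprime[OF _ squarefree_prime sqf]) auto
  thus "squarefree (k * (int p * int q))" using k sqf by auto
  have "[p * q = 1 * 1] (mod 4)" using p q by (intro cong_mult)
  hence "p * q mod 4 = 1" by (simp add: Cong.cong_def)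
  hence "int (p * q) mod 4 = 1" by (metis of_nat_1 of_nat_mod of_nat_numeral)
  hence "(int p * int q) mod 4 = 1" by simp
  moreover have "k * n mod 4 = 2 \<or> k * n mod 4 = 3" if "n mod 4 = 1" for n
    using k that by (elim disjE) (simp, presburger)+
  ultimately show "k * (int p * int q) mod 4 = 2 \<or> k * (int p * int q) mod 4 = 3" by blast
qed (use assms in auto)

theorem rank_4_eq_2_imp:
  assumes p: "prime p" "[p = 1] (mod 4)" and q: "prime q" "[q = 1] (mod 4)" and p_neq_q: "p \<noteq> q"
    and d: "d \<in> {-4, 8}"
    and rank: "prime_power_rank 2 2 (narrow_class_group (d * int (p * q))) = 2"
  shows "[p = 1] (mod 8)" "[q = 1] (mod 8)" "Legendre (int q) (int p) = 1"
proof -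
  define k where "k = d div 4"
  have k: "k = -1 \<or> k = 2" and d_eq: "d * int (p * q) = 4 * (k * (int p * int q))"
    using d unfolding k_def by auto
  interpret quad_pq "k * (int p * int q)" p q k by (rule quad_pqI[OF p q p_neq_q k])
  show "[p = 1] (mod 8)" "[q = 1] (mod 8)" "Legendre (int q) (int p) = 1"
    using rank_4_eq_2_imp_cong_Legendre rank unfolding d_eq by auto
qed

context
  fixes p q :: nat and C D r :: int
  assumes p: "prime p" "[p = 1] (mod 8)" and q: "prime q" "[q = 1] (mod 8)" and p_neq_q: "p \<noteq> q"
    and Legendre_q_p: "Legendre (int q) (int p) = 1"
    and rep: "int q = C * C - 2 * (D * D)" and r: "[r * r = 2] (mod int p)"
begin

lemma quad_pq8I: assumes "k = -1 \<or> k = 2" shows "quad_pq8 (k * (int p * int q)) p q k"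
  by (intro quad_pq8.intro quad_pq8_axioms.intro quad_pqI cong_1_mod_8_imp_mod_4 p q p_neq_q Legendre_q_p
    assms)

theorem rank_8_imaginary:
  assumes "quartic p 2 * (sign16 p * Legendre (C + D * r) (int p)) = 1" "quartic p (int q) = 1"
  shows "rank_8_pos (- 4 * int (p * q))"
proof -
  interpret quad_pq8 "-1 * (int p * int q)" p q "-1" by (rule quad_pq8I) simp
  have "- 4 * int (p * q) = 4 * (-1 * (int p * int q))" by simp
  thus ?thesis using rank_8_pos_imaginary[OF refl rep r assms] by simp
qed

context
  fixes C1 D1 r1 :: int
  assumes rep1: "int q = C1 * C1 + 2 * (D1 * D1)" and r1: "[r1 * r1 = - 2] (mod int p)"
begin

theorem rank_8_real:
  assumes "sign16 p * Legendre (C + D * r) (int p) = 1" "quartic p (- (2 * int q)) = 1"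
    "quartic p (int q) * Legendre (C1 + D1 * r1) (int p) = 1"
  shows "rank_8_pos (8 * int (p * q))"
proof -
  interpret quad_pq8 "2 * (int p * int q)" p q 2 by (rule quad_pq8I) simp
  have "8 * int (p * q) = 4 * (2 * (int p * int q))" by simp
  thus ?thesis using rank_8_pos_real[OF refl rep r rep1 r1 assms] by simp
qed

theorem real_sign_product:
  assumes "2 * int q = C2 * C2 + D2 * D2" "[r2 * r2 = - 1] (mod int p)"
  shows "(sign16 p * Legendre (C + D * r) (int p)) * (quartic p (int q) * Legendre (C1 + D1 * r1) (int p))
    = quartic p (2 * int q) * Legendre (C2 + D2 * r2) (int p)"
proof -
  interpret quad_pq8 "2 * (int p * int q)" p q 2 by (rule quad_pq8I) simp
  show ?thesis by (rule sign_product_real[OF refl rep r rep1 r1 assms])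
qed

end

end

section \<open>Bilinear sums\<close>

subsection \<open>Complete sums of quadratic and quartic symbols\<close>

lemma bij_affine_mod:
  fixes N a b :: int
  assumes N: "N > 0" and a: "coprime a N"
  shows "bij_betw (\<lambda>x. (a * x + b) mod N) {0..<N} {0..<N}"
proof -
  have inj: "inj_on (\<lambda>x. (a * x + b) mod N) {0..<N}"
  proof (rule inj_onI)
    fix x y assume x: "x \<in> {0..<N}" and y: "y \<in> {0..<N}" and eq: "(a * x + b) mod N = (a * y + b) mod N"
    have "N dvd (a * x + b) - (a * y + b)" using eq by (simp only: mod_eq_dvd_iff)
    hence "N dvd a * (x - y)" by (simp add: algebra_simps)
    hence "N dvd x - y" using a by (simp add: coprime_commute coprime_dvd_mult_right_iff)
    hence "x mod N = y mod N" by (simp only: mod_eq_dvd_iff)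
    thus "x = y" using x y by simp
  qed
  moreover have "(\<lambda>x. (a * x + b) mod N) ` {0..<N} \<subseteq> {0..<N}" using N by auto
  ultimately have "(\<lambda>x. (a * x + b) mod N) ` {0..<N} = {0..<N}" by (intro endo_inj_surj) auto
  thus ?thesis using inj unfolding bij_betw_def by blast
qed

lemma sum_affine_mod:
  fixes f :: "int \<Rightarrow> 'a::comm_monoid_add"
  assumes "N > 0" "coprime a N" and periodic: "\<And>x. f (x mod N) = f x"
  shows "(\<Sum>x\<in>{0..<N}. f (a * x + b)) = (\<Sum>x\<in>{0..<N}. f x)"
  using sum.reindex_bij_betw[OF bij_affine_mod[OF assms(1,2)], of f b] unfolding periodic .

lemma sum_eq_0_if_antisymmetric:
  fixes f :: "int \<Rightarrow> int"
  assumes "N > 0" "coprime a N" "\<And>x. f (x mod N) = f x" and antisymmetric: "\<And>x. f (a * x) = - f x"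
  shows "(\<Sum>x\<in>{0..<N}. f x) = 0"
  using sum_affine_mod[of N a f 0, OF assms(1-3)] by (simp add: antisymmetric sum_negf)

lemma Legendre_mod: "Legendre (x mod p) p = Legendre x p"
  by (rule Legendre_cong) (simp add: Cong.cong_def)

lemma quartic_mod: "quartic p (x mod int p) = quartic p x"
  by (rule quartic_cong) (simp add: Cong.cong_def)

lemma coprime_if_not_prime_dvd: "prime p \<Longrightarrow> \<not> int p dvd x \<Longrightarrow> coprime x (int p)"
  using prime_imp_coprime[of "int p" x] by (simp add: coprime_commute)

lemma exists_nonresidue:
  assumes p: "prime p" "2 < p"
  obtains a where "Legendre a (int p) = -1" "coprime a (int p)"
proof -
  let ?A = "{1..<int p}" and ?square = "\<lambda>x. (x * x) mod int p"
  have prime_p: "prime (int p)" using p by simp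
  have "(int p - 1) * (int p - 1) = 1 + int p * (int p - 2)" by (simp add: algebra_simps)
  hence "?square 1 = ?square (int p - 1)" by (simp only:) (simp only: mod_mult_self2 mult_1)
  moreover have "1 \<in> ?A" "int p - 1 \<in> ?A" "1 \<noteq> int p - 1" using p by auto
  ultimately have "\<not> inj_on ?square ?A" by (meson inj_onD)
  hence "\<not> ?A \<subseteq> ?square ` ?A" using finite_surj_inj[of ?A ?square] by blast
  then obtain a where a: "a \<in> ?A" "a \<notin> ?square ` ?A" by blast
  hence ndvd: "\<not> int p dvd a" using zdvd_not_zless by auto
  have "Legendre a (int p) \<noteq> 1"
  proof
    assume "Legendre a (int p) = 1"
    then obtain u where u: "[u * u = a] (mod int p)" "\<not> int p dvd u" using Legendre_eq_1E prime_p by blast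
    have "?square (u mod int p) = a mod int p" using u(1) by (simp add: Cong.cong_def mod_mult_eq)
    hence "a = ?square (u mod int p)" using a(1) by simp
    moreover have "u mod int p \<noteq> 0" using u(2) by (simp add: dvd_eq_mod_eq_0)
    moreover have "0 \<le> u mod int p" "u mod int p < int p" using p by simp_all
    ultimately have "a = ?square (u mod int p)" "u mod int p \<in> ?A" by auto
    thus False using a(2) by blast
  qed
  hence "Legendre a (int p) = -1" using Legendre_sign[OF ndvd] by auto
  thus ?thesis using coprime_if_not_prime_dvd[OF p(1) ndvd] by (rule that)
qed

lemma sum_Legendre:
  assumes p: "prime p" "2 < p"
  shows "(\<Sum>x\<in>{0..<int p}. Legendre x (int p)) = 0"
proof -
  obtain a where a: "Legendre a (int p) = -1" "coprime a (int p)" using exists_nonresidue[OF p] .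
  show ?thesis using p
    by (intro sum_eq_0_if_antisymmetric[OF _ a(2)]) (simp_all add: Legendre_mod Legendre_mult[OF p] a(1))
qed

lemma sum_quartic:
  assumes p: "prime p" "[p = 1] (mod 4)"
  shows "(\<Sum>x\<in>{0..<int p}. quartic p x) = 0"
proof -
  have p_gt_2: "2 < p" by (rule prime_1_mod_4_gt_2[OF p])
  obtain a where a: "Legendre a (int p) = -1" "coprime a (int p)" using exists_nonresidue[OF p(1) p_gt_2] .
  hence "\<not> int p dvd a" using Legendre_eq_0_iff[of a "int p"] by auto
  thus ?thesis using p_gt_2 a
    by (intro sum_eq_0_if_antisymmetric[of _ "a * a"]) (simp_all add: quartic_mod quartic_square_mult[OF p])
qed

definition split_symbol :: "bool \<Rightarrow> nat \<Rightarrow> int \<Rightarrow> int \<Rightarrow> int" where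
  "split_symbol j p u v = (if Legendre (u * v) (int p)
    = 1 then Legendre u (int p) * (if j then quartic p (u * v) else 1) else 0)"

lemma split_symbol_cong:
  assumes "[u = u'] (mod int p)" "[v = v'] (mod int p)"
  shows "split_symbol j p u v = split_symbol j p u' v'"
proof -
  have product: "[u * v = u' * v'] (mod int p)" using assms by (rule cong_mult)
  show ?thesis unfolding split_symbol_def Legendre_cong[OF product] Legendre_cong[OF assms(1)]
    quartic_cong[OF product] ..
qed

lemma split_symbol_bound: "\<bar>split_symbol j p u v\<bar> \<le> 1"
  using Legendre_values[of u "int p"] quartic_values[of p "u * v"] unfolding split_symbol_def by auto

lemma two_split_symbol:
  assumes p: "prime p" "2 < p" and "\<not> (int p dvd u \<and> int p dvd v)"
  shows "2 * split_symbol False p u v = Legendre u p + Legendre v p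
    - (if int p dvd u then Legendre v p else 0) - (if int p dvd v then Legendre u p else 0)"
  using assms(3) Legendre_values[of u "int p"] Legendre_values[of v "int p"] Legendre_eq_0_iff[of u "int p"]
    Legendre_eq_0_iff[of v "int p"]
  unfolding split_symbol_def Legendre_mult[OF p] by auto

lemma sum_if_dvd:
  fixes p :: nat and f :: "int \<Rightarrow> int"
  assumes "p > 0"
  shows "(\<Sum>x\<in>{0..<int p}. if int p dvd x - y then f x else 0) = f (y mod int p)"
proof -
  have "int p dvd x - y \<longleftrightarrow> x = y mod int p" if "x \<in> {0..<int p}" for x
    using that by (simp flip: mod_eq_dvd_iff)
  hence "(\<Sum>x\<in>{0..<int p}. if int p dvd x - y then f x else 0)
    = (\<Sum>x\<in>{0..<int p}. if x = y mod int p then f x else 0)"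
    by (intro sum.cong refl if_cong)
  thus ?thesis using assms by simp
qed

lemma sum_split_symbol_linear:
  assumes p: "prime p" "[p = 1] (mod 4)" and t: "\<not> int p dvd t"
  shows "\<bar>\<Sum>x\<in>{0..<int p}. split_symbol False p x (x - t)\<bar> \<le> 1"
proof -
  have p_gt_2: "2 < p" by (rule prime_1_mod_4_gt_2[OF p])
  have "\<not> (int p dvd x \<and> int p dvd x - t)" for x using t dvd_diff[of "int p" x "x - t"] by auto
  hence "2 * (\<Sum>x\<in>{0..<int p}. split_symbol False p x (x - t))
    = (\<Sum>x\<in>{0..<int p}. Legendre x p + Legendre (x - t) p
    - (if int p dvd x - 0 then Legendre (x - t) p else 0) - (if int p dvd x - t then Legendre x p else 0))"
    unfolding sum_distrib_left by (intro sum.cong refl) (simp add: two_split_symbol[OF p(1) p_gt_2])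
  also have "... = (\<Sum>x\<in>{0..<int p}. Legendre x p) + (\<Sum>x\<in>{0..<int p}. Legendre (x - t) p)
    - Legendre (0 mod int p - t) p - Legendre (t mod int p) p"
    using p_gt_2 unfolding sum_subtractf sum.distrib by (simp only: sum_if_dvd)
  also have "(\<Sum>x\<in>{0..<int p}. Legendre (x - t) p) = (\<Sum>x\<in>{0..<int p}. Legendre x p)"
    using p_gt_2 sum_affine_mod[of "int p" 1 "\<lambda>x. Legendre x p" "- t"] by (simp add: Legendre_mod)
  finally have "2 * (\<Sum>x\<in>{0..<int p}. split_symbol False p x (x - t))
    = - Legendre (0 mod int p - t) p - Legendre (t mod int p) p"
    using sum_Legendre[OF p(1) p_gt_2] by simp
  thus ?thesis using Legendre_values[of "0 mod int p - t" "int p"] Legendre_values[of "t mod int p" "int p"]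
    by auto
qed

text \<open>With \<open>y = 1/x\<close> one has \<open>x (x - t) = x\<^sup>2 (1 - t y)\<close>.\<close>

lemma split_symbol_quartic:
  assumes p: "prime p" "[p = 1] (mod 4)" and y: "[x * y = 1] (mod int p)"
  shows "split_symbol True p x (x - t) = quartic p (1 - t * y)"
proof -
  have prime_p: "prime (int p)" using p by simp
  have x: "\<not> int p dvd x"
  proof
    assume "int p dvd x"
    hence "int p dvd x * y" by simp
    hence "int p dvd 1" using y cong_dvd_iff by blast
    thus False using prime_p not_prime_unit by blast
  qed
  have "[x * x - t * (x * 1) = x * x - t * (x * (x * y))] (mod int p)"
    by (intro cong_diff cong_mult cong_refl cong_sym[OF y])
  hence cong: "[x * (x - t) = (x * x) * (1 - t * y)] (mod int p)" by (simp add: algebra_simps)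
  have "Legendre (x * (x - t)) p = Legendre (1 - t * y) p"
    unfolding Legendre_cong[OF cong] Legendre_mult[OF p(1) prime_1_mod_4_gt_2[OF p], of "x * x"]
      Legendre_square[OF x prime_p] by simp
  moreover have "quartic p (x * (x - t)) = Legendre x p * quartic p (1 - t * y)"
    unfolding quartic_cong[OF cong] by (rule quartic_square_mult[OF p x])
  moreover have "quartic p (1 - t * y) = 0" if "Legendre (1 - t * y) p \<noteq> 1"
    using that by (simp add: quartic_def)
  ultimately show ?thesis using Legendre_sign[OF x] unfolding split_symbol_def by auto
qed

lemma coprime_prime_residue:
  assumes "prime p" "x \<in> {1..<int p}"
  shows "coprime x (int p)"
  using assms zdvd_not_zless[of x "int p"] by (intro coprime_if_not_prime_dvd) auto

lemma sum_modular_inverse: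
  fixes f :: "int \<Rightarrow> int"
  assumes p: "prime p"
  shows "(\<Sum>x\<in>{1..<int p}. f (modular_inverse (int p) x)) = (\<Sum>x\<in>{1..<int p}. f x)"
proof -
  have p_gt_1: "int p > 1" using prime_gt_1_nat[OF p] by simp
  note coprime = coprime_prime_residue[OF p]
  have mem: "modular_inverse (int p) x \<in> {1..<int p}" if "x \<in> {1..<int p}" for x
    using mult_modular_inverse_int_pos[OF p_gt_1 coprime[OF that]] modular_inverse_int_less[of "int p" x]
      p_gt_1 by auto
  have involution: "modular_inverse (int p) (modular_inverse (int p) x) = x" if "x \<in> {1..<int p}" for x
    using that cong_modular_inverse2[OF coprime[OF that]] by (intro modular_inverse_int_eqI) auto
  show ?thesis
    by (rule sum.reindex_bij_witness[of _ "modular_inverse (int p)" "modular_inverse (int p)"])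
      (use mem involution in auto)
qed

lemma sum_split_symbol_quartic:
  assumes p: "prime p" "[p = 1] (mod 4)" and t: "\<not> int p dvd t"
  shows "\<bar>\<Sum>x\<in>{0..<int p}. split_symbol True p x (x - t)\<bar> \<le> 1"
proof -
  have p_pos: "int p > 0" using prime_gt_0_nat[OF p(1)] by simp
  have split: "(\<Sum>x\<in>{0..<int p}. f x) = f 0 + (\<Sum>x\<in>{1..<int p}. f x)" for f :: "int \<Rightarrow> int"
  proof -
    have "{0..<int p} = insert 0 {1..<int p}" using p_pos by auto
    thus ?thesis by simp
  qed
  have "(\<Sum>x\<in>{1..<int p}. split_symbol True p x (x - t))
    = (\<Sum>x\<in>{1..<int p}. quartic p (1 - t * modular_inverse (int p) x))"
    by (intro sum.cong refl split_symbol_quartic[OF p] cong_modular_inverse1 coprime_prime_residue[OF p(1)])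
  also have "... = (\<Sum>y\<in>{1..<int p}. quartic p (1 - t * y))" by (rule sum_modular_inverse[OF p(1)])
  also have "... = (\<Sum>y\<in>{0..<int p}. quartic p ((- t) * y + 1)) - quartic p 1" unfolding split by simp
  also have "(\<Sum>y\<in>{0..<int p}. quartic p ((- t) * y + 1)) = (\<Sum>y\<in>{0..<int p}. quartic p y)"
  proof (rule sum_affine_mod[OF p_pos])
    show "coprime (- t) (int p)" using coprime_if_not_prime_dvd[OF p(1) t] by simp
  qed (rule quartic_mod)
  also have "... = 0" by (rule sum_quartic[OF p])
  finally have "(\<Sum>x\<in>{1..<int p}. split_symbol True p x (x - t)) = - quartic p 1" by simp
  moreover have "split_symbol True p 0 (0 - t) = 0"
    unfolding split_symbol_def using Legendre_eq_0_iff[of 0 "int p"] by simp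
  ultimately show ?thesis unfolding split using quartic_values[of p 1] by auto
qed

lemma sum_split_symbol_row:
  assumes p: "prime p" "[p = 1] (mod 4)" and s: "\<not> int p dvd s" and D: "\<not> int p dvd D"
  shows "\<bar>\<Sum>C\<in>{0..<int p}. split_symbol j p (C + D * s) (C - D * s)\<bar> \<le> 1"
proof -
  have p_gt_2: "2 < p" by (rule prime_1_mod_4_gt_2[OF p])
  have prime_p: "prime (int p)" using p by simp
  define t where "t = 2 * (D * s)"
  have "\<not> int p dvd 2" using p_gt_2 zdvd_imp_le[of "int p" 2] by auto
  hence t: "\<not> int p dvd t" unfolding t_def using s D prime_p by (simp add: prime_dvd_mult_iff)
  have "split_symbol j p (x mod int p) (x mod int p - t) = split_symbol j p x (x - t)" for x
    by (rule split_symbol_cong) (simp_all add: Cong.cong_def mod_diff_left_eq)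
  hence "(\<Sum>C\<in>{0..<int p}. split_symbol j p (1 * C + D * s) ((1 * C + D * s) - t))
    = (\<Sum>x\<in>{0..<int p}. split_symbol j p x (x - t))"
    using p_gt_2 by (intro sum_affine_mod) auto
  moreover have "(C + D * s) - t = C - D * s" for C unfolding t_def by simp
  ultimately have "(\<Sum>C\<in>{0..<int p}. split_symbol j p (C + D * s) (C - D * s))
    = (\<Sum>x\<in>{0..<int p}. split_symbol j p x (x - t))"
    by (simp only: mult_1)
  thus ?thesis using sum_split_symbol_linear[OF p t] sum_split_symbol_quartic[OF p t] by (cases j) simp_all
qed

subsection \<open>Incomplete sums of products of periodic functions\<close>

lemma sum_crt:
  fixes f g :: "int \<Rightarrow> real" and M N :: int
  assumes M: "M > 0" and N: "N > 0" and coprime: "coprime M N" and f: "\<And>x. f (x mod M) = f x"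
    and g: "\<And>x. g (x mod N) = g x"
  shows "(\<Sum>x\<in>{0..<M * N}. f x * g x) = (\<Sum>x\<in>{0..<M}. f x) * (\<Sum>x\<in>{0..<N}. g x)"
proof -
  let ?h = "\<lambda>x. (x mod M, x mod N)"
  have inj: "inj_on ?h {0..<M * N}"
  proof (rule inj_onI)
    fix x y assume x: "x \<in> {0..<M * N}" and y: "y \<in> {0..<M * N}" and eq: "?h x = ?h y"
    have "M dvd x - y" "N dvd x - y" using eq by (simp_all add: mod_eq_dvd_iff)
    hence "M * N dvd x - y" using coprime by (rule divides_mult)
    hence "x mod (M * N) = y mod (M * N)" by (simp only: mod_eq_dvd_iff)
    thus "x = y" using x y by simp
  qed
  have subset: "?h ` {0..<M * N} \<subseteq> {0..<M} \<times> {0..<N}" using M N by auto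
  have "card ({0..<M} \<times> {0..<N}) = card (?h ` {0..<M * N})"
    unfolding card_image[OF inj] using M N by (simp add: card_cartesian_product nat_mult_distrib)
  hence "?h ` {0..<M * N} = {0..<M} \<times> {0..<N}" using card_subset_eq[OF _ subset] by simp
  hence bij: "bij_betw ?h {0..<M * N} ({0..<M} \<times> {0..<N})" using inj unfolding bij_betw_def by blast
  have "(\<Sum>x\<in>{0..<M * N}. f x * g x) = (\<Sum>x\<in>{0..<M * N}. (\<lambda>(r, s). f r * g s) (?h x))" by (simp add: f g)
  also have "... = (\<Sum>(r, s)\<in>{0..<M} \<times> {0..<N}. f r * g s)" by (rule sum.reindex_bij_betw[OF bij])
  also have "... = (\<Sum>x\<in>{0..<M}. f x) * (\<Sum>x\<in>{0..<N}. g x)" unfolding sum_product sum.cartesian_product ..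
  finally show ?thesis .
qed

lemma sum_int_interval_split:
  fixes f :: "int \<Rightarrow> real"
  assumes "a \<le> b" "b \<le> c"
  shows "(\<Sum>x\<in>{a..<c}. f x) = (\<Sum>x\<in>{a..<b}. f x) + (\<Sum>x\<in>{b..<c}. f x)"
  unfolding ivl_disj_un_two(3)[OF assms, symmetric] by (rule sum.union_disjoint) auto

context
  fixes h :: "int \<Rightarrow> real" and N :: int
  assumes N: "N > 0" and periodic: "\<And>x. h (x mod N) = h x"
begin

lemma periodic_sum_blocks: "(\<Sum>x\<in>{a..<a + int k * N}. h x) = real k * (\<Sum>x\<in>{0..<N}. h x)"
proof (induction k)
  case (Suc k)
  have "(\<Sum>x\<in>{b..<b + N}. h x) = (\<Sum>x\<in>{0..<N}. h x)" for b
  proof -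
    have "(\<Sum>x\<in>{b..<b + N}. h x) = (\<Sum>x\<in>{0..<N}. h (1 * x + b))"
      by (rule sum.reindex_bij_witness[of _ "\<lambda>x. x + b" "\<lambda>x. x - b"]) auto
    also have "... = (\<Sum>x\<in>{0..<N}. h x)" by (rule sum_affine_mod[where f = h, OF N _ periodic]) simp
    finally show ?thesis .
  qed
  moreover have endpoint: "a + int (Suc k) * N = (a + int k * N) + N" by (simp add: algebra_simps)
  moreover have "int k * N \<ge> 0" using N by simp
  ultimately have "(\<Sum>x\<in>{a..<a + int (Suc k) * N}. h x) = (\<Sum>x\<in>{a..<a + int k * N}. h x) + (\<Sum>x\<in>{0..<N}. h x)"
    unfolding endpoint using N sum_int_interval_split[of a "a + int k * N" "(a + int k * N) + N" h] by simp
  thus ?case unfolding Suc by (simp add: distrib_right)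
qed simp

lemma periodic_interval_sum:
  assumes bounded: "\<And>x. \<bar>h x\<bar> \<le> 1" and complete: "\<bar>\<Sum>x\<in>{0..<N}. h x\<bar> \<le> 1"
  shows "\<bar>\<Sum>x\<in>{a..<a + int n}. h x\<bar> \<le> real n / of_int N + of_int N"
proof -
  define k r where "k = n div nat N" and "r = n mod nat N"
  have "int n = int (k * nat N + r)" unfolding k_def r_def by simp
  hence n: "int n = int k * N + int r" using N by simp
  have "r < nat N" unfolding r_def using N by simp
  hence r: "int r < N" using N by linarith
  have "int k * N \<ge> 0" using N by simp
  hence sum: "(\<Sum>x\<in>{a..<a + int n}. h x) = real k * (\<Sum>x\<in>{0..<N}. h x) + (\<Sum>x\<in>{a + int k * N..<a + int n}. h x)"
    using sum_int_interval_split[of a "a + int k * N" "a + int n" h] n by (simp add: periodic_sum_blocks)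
  have "\<bar>\<Sum>x\<in>{a + int k * N..<a + int n}. h x\<bar> \<le> (\<Sum>x\<in>{a + int k * N..<a + int n}. 1)"
    by (rule order_trans[OF sum_abs]) (intro sum_mono bounded)
  also have "... \<le> of_int N" using n r by simp
  finally have remainder: "\<bar>\<Sum>x\<in>{a + int k * N..<a + int n}. h x\<bar> \<le> of_int N" .
  have "\<bar>real k * (\<Sum>x\<in>{0..<N}. h x)\<bar> \<le> real k"
    using mult_left_mono[OF complete, of "real k"] by (simp add: abs_mult)
  also have "real_of_int (int k * N) \<le> real_of_int (int n)" using n by (simp only: of_int_le_iff)
  hence "real k \<le> real n / of_int N" using N by (simp add: field_simps)
  finally show ?thesis unfolding sum using remainder by linarith
qed

end

lemma correlation_bound:
  fixes f g :: "int \<Rightarrow> real" and M N :: int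
  assumes M: "M > 0" and N: "N > 0" and coprime: "coprime M N"
    and f: "\<And>x. f (x mod M) = f x" "\<And>x. \<bar>f x\<bar> \<le> 1" "\<bar>\<Sum>x\<in>{0..<M}. f x\<bar> \<le> 1"
    and g: "\<And>x. g (x mod N) = g x" "\<And>x. \<bar>g x\<bar> \<le> 1" "\<bar>\<Sum>x\<in>{0..<N}. g x\<bar> \<le> 1"
  shows "\<bar>\<Sum>x\<in>{a..b}. f x * g x\<bar> \<le> real (card {a..b}) / of_int (M * N) + of_int (M * N)"
proof -
  have "{a..b} = {a..<a + int (card {a..b})}" by auto
  moreover have "\<bar>\<Sum>x\<in>{a..<a + int n}. f x * g x\<bar> \<le> real n / of_int (M * N) + of_int (M * N)" for n
  proof (rule periodic_interval_sum)
    show "M * N > 0" using M N by simp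
    show "f (x mod (M * N)) * g (x mod (M * N)) = f x * g x" for x
      using f(1)[of "x mod (M * N)"] f(1)[of x] g(1)[of "x mod (M * N)"] g(1)[of x]
      by (simp add: mod_mod_cancel)
    show "\<bar>f x * g x\<bar> \<le> 1" for x using mult_mono[OF f(2)[of x] g(2)[of x]] by (simp add: abs_mult)
    show "\<bar>\<Sum>x\<in>{0..<M * N}. f x * g x\<bar> \<le> 1"
      unfolding sum_crt[where f = f and g = g, OF M N coprime f(1) g(1)]
      using mult_mono[OF f(3) g(3)] by (simp add: abs_mult)
  qed
  ultimately show ?thesis by metis
qed

subsection \<open>The bilinear estimate\<close>

lemma sum_square_sum:
  fixes f :: "'a \<Rightarrow> 'b \<Rightarrow> real"
  shows "(\<Sum>z\<in>Z. (\<Sum>p\<in>S. f p z)^2) = (\<Sum>p\<in>S. \<Sum>q\<in>S. \<Sum>z\<in>Z. f p z * f q z)"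
proof -
  have "(\<Sum>z\<in>Z. (\<Sum>p\<in>S. f p z)^2) = (\<Sum>z\<in>Z. \<Sum>p\<in>S. \<Sum>q\<in>S. f p z * f q z)"
    unfolding power2_eq_square sum_product ..
  also have "... = (\<Sum>p\<in>S. \<Sum>z\<in>Z. \<Sum>q\<in>S. f p z * f q z)" by (rule sum.swap)
  also have "... = (\<Sum>p\<in>S. \<Sum>q\<in>S. \<Sum>z\<in>Z. f p z * f q z)" by (intro sum.cong refl sum.swap)
  finally show ?thesis .
qed

text \<open>A double sum of \<open>F p C D\<close> with \<open>q = nf C D\<close>, where \<open>F p C D\<close> is a symbol modulo \<open>p\<close> in \<open>C\<close>.\<close>

locale bilinear_family =
  fixes F :: "nat \<Rightarrow> int \<Rightarrow> int \<Rightarrow> real" and nf :: "int \<Rightarrow> int \<Rightarrow> real" and Ps :: "nat set" and Ds :: "int set"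
    and P :: real and B :: int
  assumes finite: "finite Ps" "finite Ds" and P: "P \<ge> 1" "real (card Ps) \<le> P"
    and dyadic: "\<And>p. p \<in> Ps \<Longrightarrow> prime p \<and> P < real p \<and> real p \<le> 2 * P"
    and bounded: "\<And>p C D. \<bar>F p C D\<bar> \<le> 1" and periodic: "\<And>p C D. p \<in> Ps \<Longrightarrow> F p (C mod int p) D = F p C D"
    and row: "\<And>p D. p \<in> Ps \<Longrightarrow> \<not> int p dvd D \<Longrightarrow> \<bar>\<Sum>C\<in>{0..<int p}. F p C D\<bar> \<le> 1"
    and multiples: "\<And>p. p \<in> Ps \<Longrightarrow> real (card {D \<in> Ds. int p dvd D}) * P \<le> 2 * real (card Ds)"
    and level: "\<And>D t. \<exists>a b. {C \<in> {-B..B}. nf C D \<le> t} = {a..b}"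
    and B: "B \<ge> 0" "P^3 \<le> of_int (2 * B + 1)"
begin

definition correlation :: "real \<Rightarrow> nat \<Rightarrow> nat \<Rightarrow> int \<Rightarrow> real" where
  "correlation X p q D = (\<Sum>C\<in>{C\<in>{-B..B}. nf C D \<le> min (X / real p) (X / real q)}. F p C D * F q C D)"

lemma prime_pos: "p \<in> Ps \<Longrightarrow> real p > 0"
  using dyadic[of p] P(1) by linarith

lemma sum_squares_eq_correlations:
  "(\<Sum>D\<in>Ds. \<Sum>C\<in>{-B..B}. (\<Sum>p\<in>{p\<in>Ps. real p * nf C D \<le> X}. F p C D)^2)
    = (\<Sum>p\<in>Ps. \<Sum>q\<in>Ps. \<Sum>D\<in>Ds. correlation X p q D)"
proof -
  let ?f = "\<lambda>p (D, C). if nf C D \<le> X / real p then F p C D else 0"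
  have correlation: "(\<Sum>C\<in>{-B..B}. ?f p (D, C) * ?f q (D, C)) = correlation X p q D" for p q D
    unfolding correlation_def by (subst sum.inter_filter) (auto intro!: sum.cong)
  have "(\<Sum>p\<in>{p\<in>Ps. real p * nf C D \<le> X}. F p C D) = (\<Sum>p\<in>Ps. ?f p (D, C))" for C D
    unfolding sum.inter_filter[OF finite(1)] using prime_pos by (intro sum.cong refl) (auto simp: field_simps)
  hence "(\<Sum>D\<in>Ds. \<Sum>C\<in>{-B..B}. (\<Sum>p\<in>{p\<in>Ps. real p * nf C D \<le> X}. F p C D)^2)
    = (\<Sum>z\<in>Ds \<times> {-B..B}. (\<Sum>p\<in>Ps. ?f p z)^2)" by (simp add: sum.cartesian_product')
  also have "... = (\<Sum>p\<in>Ps. \<Sum>q\<in>Ps. \<Sum>D\<in>Ds. \<Sum>C\<in>{-B..B}. ?f p (D, C) * ?f q (D, C))"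
    unfolding sum_square_sum sum.cartesian_product' ..
  finally show ?thesis unfolding correlation .
qed

lemma card_level_le: "real (card {C \<in> {-B..B}. nf C D \<le> t}) \<le> of_int (2 * B + 1)"
proof -
  have "card {C \<in> {-B..B}. nf C D \<le> t} \<le> card {-B..B}" by (intro card_mono) auto
  thus ?thesis using B(1) by simp
qed

lemma correlation_trivial: "\<bar>correlation X p q D\<bar> \<le> of_int (2 * B + 1)"
proof -
  have "\<bar>F p C D * F q C D\<bar> \<le> 1" for C
    using mult_mono[OF bounded[of p C D] bounded[of q C D]] by (simp add: abs_mult)
  hence "\<bar>correlation X p q D\<bar> \<le> real (card {C \<in> {-B..B}. nf C D \<le> min (X / real p) (X / real q)})"
    unfolding correlation_def real_of_card by (intro order_trans[OF sum_abs] sum_mono)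
  thus ?thesis using card_level_le by (rule order_trans)
qed

lemma correlation_distinct:
  assumes p: "p \<in> Ps" "\<not> int p dvd D" and q: "q \<in> Ps" "\<not> int q dvd D" and "p \<noteq> q"
  shows "\<bar>correlation X p q D\<bar> \<le> of_int (2 * B + 1) / P^2 + 4 * P^2"
proof -
  have pq: "prime p" "prime q" "P < real p" "P < real q" "real p \<le> 2 * P" "real q \<le> 2 * P"
    using dyadic p(1) q(1) by auto
  have coprime: "coprime (int p) (int q)" using primes_coprime[OF pq(1,2) \<open>p \<noteq> q\<close>] by simp
  have lower: "P^2 \<le> real p * real q" unfolding power2_eq_square using pq P by (intro mult_mono) auto
  have "real p * real q \<le> (2 * P) * (2 * P)" using pq P by (intro mult_mono) auto
  hence upper: "of_int (int p * int q) \<le> 4 * P^2" by (simp add: power2_eq_square)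
  obtain a b where ab: "{C \<in> {-B..B}. nf C D \<le> min (X / real p) (X / real q)} = {a..b}" using level by blast
  have "\<bar>\<Sum>C\<in>{a..b}. F p C D * F q C D\<bar> \<le> real (card {a..b}) / of_int (int p * int q) + of_int (int p * int q)"
    using prime_pos[OF p(1)] prime_pos[OF q(1)] coprime periodic p q bounded row
    by (intro correlation_bound[where f = "\<lambda>C. F p C D" and g = "\<lambda>C. F q C D"]) auto
  also have "real (card {a..b}) / of_int (int p * int q) \<le> of_int (2 * B + 1) / P^2"
    using card_level_le[of D "min (X / real p) (X / real q)"] lower P B(1)
    unfolding ab by (intro frac_le) auto
  finally show ?thesis unfolding correlation_def ab using upper by linarith
qed

lemma sum_correlation_distinct:
  assumes p: "p \<in> Ps" and q: "q \<in> Ps" and "p \<noteq> q"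
  shows "\<bar>\<Sum>D\<in>Ds. correlation X p q D\<bar> \<le> real (card Ds) * (of_int (2 * B + 1) / P^2 + 4 * P^2)
    + 4 * real (card Ds) * of_int (2 * B + 1) / P"
proof -
  define n where "n = real_of_int (2 * B + 1)"
  define R where "R = n / P^2 + 4 * P^2"
  have n: "n \<ge> 0" unfolding n_def using B(1) by simp
  hence R: "R \<ge> 0" unfolding R_def by simp
  have "\<bar>correlation X p q D\<bar> \<le> R + (if int p dvd D then n else 0) + (if int q dvd D then n else 0)" for D
  proof (cases "int p dvd D \<or> int q dvd D")
    case True
    thus ?thesis using correlation_trivial[of X p q D] n R unfolding n_def[symmetric] by auto
  next
    case False
    thus ?thesis using correlation_distinct[of p D q X] p q \<open>p \<noteq> q\<close> unfolding R_def n_def by simp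
  qed
  hence "\<bar>\<Sum>D\<in>Ds. correlation X p q D\<bar>
    \<le> (\<Sum>D\<in>Ds. R + (if int p dvd D then n else 0) + (if int q dvd D then n else 0))"
    by (intro order_trans[OF sum_abs] sum_mono)
  also have "... = real (card Ds) * R + real (card {D \<in> Ds. int p dvd D}) * n
    + real (card {D \<in> Ds. int q dvd D}) * n"
    unfolding sum.distrib sum.inter_filter[OF finite(2), symmetric] by (simp add: distrib_left)
  also have "real (card {D \<in> Ds. int l dvd D}) * n \<le> 2 * real (card Ds) / P * n" if "l \<in> Ps" for l
    using multiples[OF that] P n by (intro mult_right_mono) (auto simp: field_simps)
  note this[OF p]
  also note \<open>\<And>l. l \<in> Ps \<Longrightarrow> real (card {D \<in> Ds. int l dvd D}) * n \<le> 2 * real (card Ds) / P * n\<close>[OF q]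
  finally show ?thesis unfolding R_def n_def by simp
qed

theorem large_sieve:
  "(\<Sum>D\<in>Ds. \<Sum>C\<in>{-B..B}. (\<Sum>p\<in>{p\<in>Ps. real p * nf C D \<le> X}. F p C D)^2)
    \<le> 10 * P * real (card Ds) * of_int (2 * B + 1)"
proof -
  define n T where "n = real_of_int (2 * B + 1)" and "T = real (card Ds)"
  define M where "M = T * (n / P^2 + 4 * P^2) + 4 * T * n / P"
  have n: "n \<ge> 1" and T: "T \<ge> 0" unfolding n_def T_def using B(1) by simp_all
  have M: "M \<ge> 0" unfolding M_def
    using T n P by (intro add_nonneg_nonneg mult_nonneg_nonneg divide_nonneg_nonneg) auto
  have "(\<Sum>D\<in>Ds. correlation X p q D) \<le> M + (if p = q then T * n else 0)" if pq: "p \<in> Ps" "q \<in> Ps" for p q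
  proof (cases "p = q")
    case True
    have "\<bar>\<Sum>D\<in>Ds. correlation X p q D\<bar> \<le> (\<Sum>D\<in>Ds. n)"
      unfolding n_def by (intro order_trans[OF sum_abs] sum_mono correlation_trivial)
    thus ?thesis using True M unfolding T_def by simp
  next
    case False
    thus ?thesis using sum_correlation_distinct[OF pq False, of X] unfolding M_def n_def T_def by simp
  qed
  hence "(\<Sum>p\<in>Ps. \<Sum>q\<in>Ps. \<Sum>D\<in>Ds. correlation X p q D) \<le> (\<Sum>p\<in>Ps. \<Sum>q\<in>Ps. M + (if p = q then T * n else 0))"
    by (intro sum_mono)
  also have "... = real (card Ps) * (real (card Ps) * M) + real (card Ps) * (T * n)"
    using finite(1) by (simp add: sum.distrib distrib_left)
  also have "... \<le> P * (P * M) + P * (T * n)"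
    using P M T n by (intro add_mono mult_mono mult_nonneg_nonneg mult_right_mono) auto
  also have "P * (P * M) = T * n + 4 * (P * P^3) * T + 4 * P * T * n"
    unfolding M_def using P by (simp add: field_simps power2_eq_square power3_eq_cube)
  also have "4 * (P * P^3) * T \<le> 4 * (P * n) * T"
    using B(2) P T unfolding n_def by (intro mult_right_mono mult_left_mono) auto
  also have "T * n \<le> P * (T * n)" using P T n mult_right_mono[of 1 P "T * n"] by simp
  hence "T * n + 4 * (P * n) * T + 4 * P * T * n + P * (T * n) \<le> 10 * P * T * n" by (simp add: algebra_simps)
  finally show ?thesis unfolding sum_squares_eq_correlations T_def n_def by simp
qed

theorem bilinear_bound:
  fixes Qs :: "nat set" and c d :: "nat \<Rightarrow> int"
  assumes Qs: "finite Qs" and rep: "\<And>q. q \<in> Qs \<Longrightarrow> c q \<in> {-B..B} \<and> d q \<in> Ds \<and> nf (c q) (d q) = real q"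
  shows "(\<Sum>p\<in>Ps. \<Sum>q\<in>{q\<in>Qs. real p * real q \<le> X}. F p (c q) (d q))^2
    \<le> real (card Qs) * (10 * P * real (card Ds) * of_int (2 * B + 1))"
proof -
  let ?inner = "\<lambda>C D. \<Sum>p\<in>{p\<in>Ps. real p * nf C D \<le> X}. F p C D"
  have "(\<Sum>p\<in>Ps. \<Sum>q\<in>{q\<in>Qs. real p * real q \<le> X}. F p (c q) (d q))
    = (\<Sum>p\<in>Ps. \<Sum>q\<in>Qs. if real p * real q \<le> X then F p (c q) (d q) else 0)"
    by (simp only: sum.inter_filter[OF Qs])
  also have "... = (\<Sum>q\<in>Qs. \<Sum>p\<in>Ps. if real p * real q \<le> X then F p (c q) (d q) else 0)" by (rule sum.swap)
  also have "... = (\<Sum>q\<in>Qs. ?inner (c q) (d q))"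
    unfolding sum.inter_filter[OF finite(1)] using rep by (intro sum.cong refl) simp
  finally have double_sum: "(\<Sum>p\<in>Ps. \<Sum>q\<in>{q\<in>Qs. real p * real q \<le> X}. F p (c q) (d q))
    = (\<Sum>q\<in>Qs. ?inner (c q) (d q))" .
  have inj: "inj_on (\<lambda>q. (d q, c q)) Qs"
    using rep by (intro inj_onI) (metis of_nat_eq_iff prod.inject)
  have "(\<Sum>q\<in>Qs. (?inner (c q) (d q))^2) = (\<Sum>(D, C)\<in>(\<lambda>q. (d q, c q)) ` Qs. (?inner C D)^2)"
    by (subst sum.reindex[OF inj]) simp
  also have "... \<le> (\<Sum>(D, C)\<in>Ds \<times> {-B..B}. (?inner C D)^2)"
    using finite(2) rep by (intro sum_mono2) auto
  also have "... = (\<Sum>D\<in>Ds. \<Sum>C\<in>{-B..B}. (?inner C D)^2)" by (simp add: sum.cartesian_product)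
  finally have "(\<Sum>q\<in>Qs. (?inner (c q) (d q))^2) \<le> 10 * P * real (card Ds) * of_int (2 * B + 1)"
    using large_sieve order_trans by blast
  hence "real (card Qs) * (\<Sum>q\<in>Qs. (?inner (c q) (d q))^2)
    \<le> real (card Qs) * (10 * P * real (card Ds) * of_int (2 * B + 1))"
    by (rule mult_left_mono) simp
  moreover have "(\<Sum>q\<in>Qs. ?inner (c q) (d q))^2 \<le> (\<Sum>q\<in>Qs. (?inner (c q) (d q))^2) * real (card Qs)"
    by (rule sum_squared_le_sum_of_squares)
  ultimately show ?thesis unfolding double_sum by (simp add: mult.commute)
qed

end

definition dyadic_small :: "(nat \<Rightarrow> nat \<Rightarrow> real) \<Rightarrow> bool" where
  "dyadic_small f \<longleftrightarrow> (\<forall>P Ps Qs X. P \<ge> 1 \<longrightarrow> real P^7 \<le> X \<longrightarrow> finite Qs \<longrightarrow>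
    (\<forall>p\<in>Ps. prime p \<and> [p = 1] (mod 8) \<and> P < p \<and> p \<le> 2 * P) \<longrightarrow>
    (\<forall>q\<in>Qs. prime q \<and> [q = 1] (mod 8) \<and> real q \<le> X / real P) \<longrightarrow>
    (\<Sum>p\<in>Ps. \<Sum>q\<in>{q\<in>Qs. real p * real q \<le> X}. f p q)^2 \<le> 490 * real P * (X / real P)^2)"

lemma card_primes_le:
  assumes "finite Qs" "\<And>q. q \<in> Qs \<Longrightarrow> prime q \<and> real q \<le> Y" "Y \<ge> 0"
  shows "real (card Qs) \<le> Y"
proof -
  have "Qs \<subseteq> {1..nat \<lfloor>Y\<rfloor>}"
    using assms(2) prime_ge_1_nat by (auto simp: le_nat_floor)
  hence "card Qs \<le> nat \<lfloor>Y\<rfloor>" using card_mono[of "{1..nat \<lfloor>Y\<rfloor>}" Qs] by simp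
  hence "real (card Qs) \<le> real (nat \<lfloor>Y\<rfloor>)" by simp
  also have "... \<le> Y" using assms(3) by simp
  finally show ?thesis .
qed

theorem dyadic_smallI:
  fixes g :: "nat \<Rightarrow> int \<Rightarrow> int \<Rightarrow> int" and e :: "nat \<Rightarrow> real" and nf :: "int \<Rightarrow> int \<Rightarrow> real"
    and Ds :: "real \<Rightarrow> int set" and B :: "real \<Rightarrow> int"
  assumes e: "\<And>p. \<bar>e p\<bar> \<le> 1"
    and bounded: "\<And>p C D. \<bar>g p C D\<bar> \<le> 1" and periodic: "\<And>p C D. g p (C mod int p) D = g p C D"
    and row: "\<And>p D. prime p \<Longrightarrow> [p = 1] (mod 8) \<Longrightarrow> \<not> int p dvd D \<Longrightarrow> \<bar>\<Sum>C\<in>{0..<int p}. g p C D\<bar> \<le> 1"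
    and level: "\<And>B D t. \<exists>a b. {C \<in> {-B..B}. nf C D \<le> t} = {a..b}"
    and box: "\<And>Y. Y \<ge> 1 \<Longrightarrow> finite (Ds Y) \<and> B Y \<ge> 0 \<and> real (card (Ds Y)) * of_int (2 * B Y + 1) \<le> 49 * Y"
    and range: "\<And>P Y. P \<ge> 1 \<Longrightarrow> real P^6 \<le> Y \<Longrightarrow> real P^3 \<le> of_int (2 * B Y + 1)"
    and multiples: "\<And>P Y p. P \<ge> 1 \<Longrightarrow> real P^6 \<le> Y \<Longrightarrow> prime p \<Longrightarrow> P < p \<Longrightarrow> p \<le> 2 * P \<Longrightarrow>
      real (card {D \<in> Ds Y. int p dvd D}) * real P \<le> 2 * real (card (Ds Y))"
    and rep: "\<And>Y q. prime q \<Longrightarrow> [q = 1] (mod 8) \<Longrightarrow> real q \<le> Y \<Longrightarrow> c q \<in> {-B Y..B Y} \<and> d q \<in> Ds Y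
      \<and> nf (c q) (d q) = real q"
  shows "dyadic_small (\<lambda>p q. e p * of_int (g p (c q) (d q)))"
  unfolding dyadic_small_def
proof (intro allI impI)
  fix P :: nat and Ps Qs :: "nat set" and X :: real
  assume P: "P \<ge> 1" "real P^7 \<le> X"
    and Qs: "finite Qs" "\<forall>q\<in>Qs. prime q \<and> [q = 1] (mod 8) \<and> real q \<le> X / real P"
    and Ps: "\<forall>p\<in>Ps. prime p \<and> [p = 1] (mod 8) \<and> P < p \<and> p \<le> 2 * P"
  define Y where "Y = X / real P"
  have "real P * real P^6 \<le> X" using P(2) by (simp add: numeral_eq_Suc)
  hence P6: "real P^6 \<le> Y" unfolding Y_def using P by (simp add: field_simps)
  moreover have "real P^6 \<ge> 1" using P by (intro one_le_power) simp
  ultimately have Y: "Y \<ge> 1" by linarith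
  have Ps_subset: "Ps \<subseteq> {P<..2 * P}" using Ps by auto
  interpret bilinear_family "\<lambda>p C D. e p * of_int (g p C D)" nf Ps "Ds Y" "real P" "B Y"
  proof
    show "finite Ps" by (rule finite_subset[OF Ps_subset]) simp
    show "real (card Ps) \<le> real P" using card_mono[OF _ Ps_subset] by simp
    show "prime p \<and> real P < real p \<and> real p \<le> 2 * real P" if "p \<in> Ps" for p
      using Ps that of_nat_le_iff[of p "2 * P"] by auto
    show "\<bar>e p * of_int (g p C D)\<bar> \<le> 1" for p C D
      using mult_mono[OF e[of p], of "\<bar>of_int (g p C D)\<bar>" 1] bounded[of p C D] by (simp add: abs_mult)
    show "\<bar>\<Sum>C\<in>{0..<int p}. e p * of_int (g p C D)\<bar> \<le> 1" if "p \<in> Ps" "\<not> int p dvd D" for p D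
      using mult_mono[OF e[of p], of "\<bar>of_int (\<Sum>C\<in>{0..<int p}. g p C D)\<bar>" 1] row[of p D] Ps that
      by (simp add: abs_mult flip: sum_distrib_left of_int_sum)
  qed (use P P6 Y box[OF Y] range periodic level multiples Ps in auto)
  have "(\<Sum>p\<in>Ps. \<Sum>q\<in>{q\<in>Qs. real p * real q \<le> X}. e p * of_int (g p (c q) (d q)))^2
    \<le> real (card Qs) * (10 * real P * real (card (Ds Y)) * of_int (2 * B Y + 1))"
    by (rule bilinear_bound[OF Qs(1)]) (use Qs(2) rep Y_def in auto)
  also have "... = real (card Qs) * (10 * real P * (real (card (Ds Y)) * of_int (2 * B Y + 1)))"
    by (simp only: mult.assoc)
  also have "... \<le> Y * (10 * real P * (49 * Y))"
  proof (rule mult_mono)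
    show "real (card Qs) \<le> Y" by (rule card_primes_le[OF Qs(1)]) (use Qs(2) Y Y_def in auto)
    show "10 * real P * (real (card (Ds Y)) * of_int (2 * B Y + 1)) \<le> 10 * real P * (49 * Y)"
      using box[OF Y] by (intro mult_left_mono) auto
  qed (use Y box[OF Y] in auto)
  also have "... = 490 * real P * (X / real P)^2" unfolding Y_def[symmetric] by (simp add: power2_eq_square)
  finally show "(\<Sum>p\<in>Ps. \<Sum>q\<in>{q\<in>Qs. real p * real q \<le> X}. e p * of_int (g p (c q) (d q)))^2
    \<le> 490 * real P * (X / real P)^2" .
qed

subsection \<open>Representations by norm forms\<close>

lemma thue:
  fixes q :: nat and t :: int
  assumes q: "prime q"
  obtains x y :: int where "x \<noteq> 0 \<or> y \<noteq> 0" "int q dvd x - t * y" "x * x < int q" "y * y < int q"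
proof -
  define s where "s = floor_sqrt q"
  have "s * s \<le> q" unfolding s_def using floor_sqrt_power2_le[of q] by (simp add: power2_eq_square)
  moreover have "s * s \<noteq> q" using q prime_product[of s s] by (metis mult_1 not_prime_1)
  ultimately have lower: "s * s < q" by simp
  have upper: "q < (s + 1) * (s + 1)"
    unfolding s_def using Suc_floor_sqrt_power2_gt[of q] by (simp add: power2_eq_square)
  let ?D = "{0..int s} \<times> {0..int s}" and ?f = "\<lambda>(x, y). (x - t * y) mod int q"
  have "card (?f ` ?D) \<le> card {0..<int q}" using prime_gt_0_nat[OF q] by (intro card_mono) auto
  also have "... < (s + 1) * (s + 1)" using upper by simp
  also have "... = card ?D" by (simp add: card_cartesian_product nat_add_distrib)
  finally have "\<not> inj_on ?f ?D" by (rule pigeonhole)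
  then obtain x1 y1 x2 y2 where mem: "(x1, y1) \<in> ?D" "(x2, y2) \<in> ?D" and neq: "(x1, y1) \<noteq> (x2, y2)"
    and eq: "?f (x1, y1) = ?f (x2, y2)" unfolding inj_on_def by (metis surj_pair)
  have small: "z * z < int q" if "\<bar>z\<bar> \<le> int s" for z
  proof -
    have "z * z \<le> int (s * s)" using mult_mono[OF that that] by (simp add: abs_mult_self_eq)
    also have "... < int q" using lower by (simp only: of_nat_less_iff)
    finally show ?thesis .
  qed
  have "(x1 - t * y1) mod int q = (x2 - t * y2) mod int q" using eq by simp
  hence "int q dvd (x1 - t * y1) - (x2 - t * y2)" by (simp only: mod_eq_dvd_iff)
  hence "int q dvd (x1 - x2) - t * (y1 - y2)" by (simp add: algebra_simps)
  moreover have "\<bar>x1 - x2\<bar> \<le> int s" "\<bar>y1 - y2\<bar> \<le> int s" "x1 - x2 \<noteq> 0 \<or> y1 - y2 \<noteq> 0" using mem neq by auto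
  ultimately show ?thesis using that small by blast
qed

lemma thue_norm:
  fixes q :: nat and M :: int
  assumes q: "prime q" and M: "Legendre M (int q) = 1"
  obtains x y k :: int where "x \<noteq> 0 \<or> y \<noteq> 0" "x * x - M * (y * y) = int q * k" "x * x < int q" "y * y < int q"
proof -
  obtain t where t: "[t * t = M] (mod int q)" using Legendre_eq_1E[OF M] q by auto
  obtain x y where xy: "x \<noteq> 0 \<or> y \<noteq> 0" "int q dvd x - t * y" "x * x < int q" "y * y < int q"
    using thue[OF q] .
  have "x * x - M * (y * y) = (x - t * y) * (x + t * y) + (t * t - M) * (y * y)" by (simp add: algebra_simps)
  also have "int q dvd ..."
    using t unfolding cong_iff_dvd_diff by (rule dvd_add[OF dvd_mult2[OF xy(2)] dvd_mult2])
  finally obtain k where "x * x - M * (y * y) = int q * k" by (elim dvdE)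
  thus ?thesis using that xy by blast
qed

lemma Legendre_sqrt_unity_8:
  fixes q :: nat
  assumes q: "prime q" "[q = 1] (mod 8)" and M: "M \<in> {2, -2, -1}"
  shows "Legendre M q = 1"
proof -
  note mod_8 = Legendre_1_mod_8[OF q]
  have "Legendre (- 1 * 2) q = 1" unfolding Legendre_mult[OF q(1) mod_8(3), of "- 1" 2] using mod_8 by simp
  thus ?thesis using M mod_8 by auto
qed

definition norm_factor :: "int \<Rightarrow> int" where "norm_factor M = (if M = -1 then 2 else 1)"

context
  fixes q :: nat
  assumes q: "prime q" "[q = 1] (mod 8)"
begin

lemma q_pos: "int q > 0" using prime_gt_0_nat[OF q(1)] by simp

lemma quotient_between:
  assumes "int q * a < int q * k" "int q * k < int q * b" shows "a < k" "k < b"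
  using assms q_pos by (simp_all only: mult_less_cancel_left_pos)

lemma representation_sqrt_2: "\<exists>C D. C * C - 2 * (D * D) = int q \<and> C * C \<le> 9 * int q \<and> D * D \<le> 9 * int q"
proof -
  obtain x y k where xy: "x \<noteq> 0 \<or> y \<noteq> 0" "x * x - 2 * (y * y) = int q * k" "x * x < int q" "y * y < int q"
    using thue_norm[OF q(1) Legendre_sqrt_unity_8[OF q, of 2]] by auto
  interpret quad 2 by unfold_locales (simp_all add: squarefree_prime)
  have "norm_form (of_int x) (of_int y) \<noteq> 0" using xy(1) norm_form_eq_0_iff by auto
  hence "k \<noteq> 0" using xy(2) unfolding norm_form_def by (auto simp flip: of_int_mult of_int_diff)
  moreover have "-2 < k" "k < 1"
    using quotient_between[of "-2" k 1] xy zero_le_square[of x] zero_le_square[of y] by linarith+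
  ultimately have "k = -1" by auto
  hence norm: "2 * (y * y) - x * x = int q" using xy(2) by simp
  have "2 * (x * y) \<le> x * x + y * y" using zero_le_square[of "x - y"] by (simp add: algebra_simps)
  hence "x * x + 2 * (2 * (x * y)) + 4 * (y * y) \<le> 9 * int q" "x * x + 2 * (x * y) + y * y \<le> 9 * int q"
    using xy(3,4) q_pos by linarith+
  moreover have "(x + 2 * y) * (x + 2 * y) - 2 * ((x + y) * (x + y)) = int q"
    unfolding norm[symmetric] by (simp add: algebra_simps)
  ultimately show ?thesis by (intro exI[of _ "x + 2 * y"] exI[of _ "x + y"]) (simp add: algebra_simps)
qed

lemma representation_sqrt_minus_2: "\<exists>C D. C * C + 2 * (D * D) = int q \<and> C * C \<le> 9 * int q \<and> D * D \<le> 9 * int q"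
proof -
  obtain x y k where xy: "x \<noteq> 0 \<or> y \<noteq> 0" "x * x + 2 * (y * y) = int q * k" "x * x < int q" "y * y < int q"
    using thue_norm[OF q(1) Legendre_sqrt_unity_8[OF q, of "-2"]] by auto
  note nonneg = zero_le_square[of x] zero_le_square[of y]
  have "x * x > 0 \<or> y * y > 0" using xy(1) by (auto simp: zero_less_mult_iff)
  hence "0 < k" "k < 3" using quotient_between[of 0 k 3] xy nonneg by linarith+
  then consider "k = 1" | "k = 2" by linarith
  thus ?thesis
  proof cases
    case 1
    hence "x * x + 2 * (y * y) = int q" using xy(2) by simp
    moreover have "x * x \<le> 9 * int q" "y * y \<le> 9 * int q" using xy(3,4) q_pos by linarith+
    ultimately show ?thesis by blast
  next
    case 2
    hence "x * x = 2 * (int q - y * y)" using xy(2) by simp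
    hence "even (x * x)" by simp
    then obtain z where z: "x = 2 * z" by (auto elim!: evenE)
    hence "y * y + 2 * (z * z) = int q" using xy(2) 2 by simp
    moreover from this have "y * y \<le> 9 * int q" "z * z \<le> 9 * int q"
      using zero_le_square[of z] nonneg q_pos by linarith+
    ultimately show ?thesis by blast
  qed
qed

lemma representation_i: "\<exists>C D. C * C + D * D = 2 * int q \<and> C * C \<le> 9 * int q \<and> D * D \<le> 9 * int q"
proof -
  obtain x y k where xy: "x \<noteq> 0 \<or> y \<noteq> 0" "x * x + y * y = int q * k" "x * x < int q" "y * y < int q"
    using thue_norm[OF q(1) Legendre_sqrt_unity_8[OF q, of "-1"]] by auto
  have "x * x > 0 \<or> y * y > 0" using xy(1) by (auto simp: zero_less_mult_iff)
  hence "0 < k" "k < 2" using quotient_between[of 0 k 2] xy zero_le_square[of x] zero_le_square[of y]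
    by linarith+
  hence "k = 1" by linarith
  hence norm: "x * x + y * y = int q" using xy(2) by simp
  have sum: "(x + y) * (x + y) + (x - y) * (x - y) = 2 * int q"
    unfolding norm[symmetric] by (simp add: algebra_simps)
  moreover from this have "(x + y) * (x + y) \<le> 9 * int q" "(x - y) * (x - y) \<le> 9 * int q"
    using zero_le_square[of "x + y"] zero_le_square[of "x - y"] q_pos by linarith+
  ultimately show ?thesis by blast
qed

lemma representation:
  assumes "M \<in> {2, -2, -1}"
  shows "\<exists>z. fst z * fst z - M * (snd z * snd z) = norm_factor M * int q \<and> fst z * fst z \<le> 9 * int q
    \<and> snd z * snd z \<le> 9 * int q"
  unfolding split_paired_Ex fst_conv snd_conv norm_factor_def
  using assms representation_sqrt_2 representation_sqrt_minus_2 representation_i by (elim insertE) simp_all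

end

definition norm_rep :: "int \<Rightarrow> nat \<Rightarrow> int \<times> int" where
  "norm_rep M q = (SOME z. fst z * fst z - M * (snd z * snd z) = norm_factor M * int q
    \<and> fst z * fst z \<le> 9 * int q \<and> snd z * snd z \<le> 9 * int q)"

abbreviation rep_fst :: "int \<Rightarrow> nat \<Rightarrow> int" where "rep_fst M q \<equiv> fst (norm_rep M q)"
abbreviation rep_snd :: "int \<Rightarrow> nat \<Rightarrow> int" where "rep_snd M q \<equiv> snd (norm_rep M q)"

lemma norm_rep:
  assumes "prime q" "[q = 1] (mod 8)" "M \<in> {2, -2, -1}"
  shows "rep_fst M q * rep_fst M q - M * (rep_snd M q * rep_snd M q) = norm_factor M * int q"
    "rep_fst M q * rep_fst M q \<le> 9 * int q" "rep_snd M q * rep_snd M q \<le> 9 * int q"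
  using someI_ex[OF representation[OF assms]] unfolding norm_rep_def by auto

definition sqrt_mod :: "int \<Rightarrow> nat \<Rightarrow> int" where "sqrt_mod M p = (SOME s. [s * s = M] (mod int p))"

lemma sqrt_mod:
  assumes p: "prime p" "[p = 1] (mod 8)" and M: "M \<in> {2, -2, -1}"
  shows "[sqrt_mod M p * sqrt_mod M p = M] (mod int p)" "\<not> int p dvd sqrt_mod M p"
proof -
  have Legendre_M: "Legendre M (int p) = 1" by (rule Legendre_sqrt_unity_8[OF p M])
  moreover have "prime (int p)" using p by simp
  ultimately obtain s where "[s * s = M] (mod int p)" by (rule Legendre_eq_1E)
  thus square: "[sqrt_mod M p * sqrt_mod M p = M] (mod int p)" unfolding sqrt_mod_def by (rule someI)
  show "\<not> int p dvd sqrt_mod M p"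
  proof
    assume "int p dvd sqrt_mod M p"
    hence "int p dvd M" using square cong_dvd_iff dvd_mult by blast
    thus False using Legendre_M Legendre_eq_0_iff[of M "int p"] by simp
  qed
qed

definition norm_symbol :: "int \<Rightarrow> bool \<Rightarrow> nat \<Rightarrow> nat \<Rightarrow> int" where
  "norm_symbol M j p q = split_symbol j p (rep_fst M q + rep_snd M q * sqrt_mod M p) (rep_fst M q
    - rep_snd M q * sqrt_mod M p)"

lemma norm_symbol_eq:
  assumes p: "prime p" "[p = 1] (mod 8)" and q: "prime q" "[q = 1] (mod 8)" and M: "M \<in> {2, -2, -1}"
  shows "norm_symbol M j p q = (if Legendre (int q) (int p) = 1
    then Legendre (rep_fst M q + rep_snd M q * sqrt_mod M p) (int p) * (if j
    then quartic p (norm_factor M * int q) else 1) else 0)"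
proof -
  note mod_8 = Legendre_1_mod_8[OF p]
  have cong: "[(rep_fst M q + rep_snd M q * sqrt_mod M p) * (rep_fst M q - rep_snd M q * sqrt_mod M p)
    = norm_factor M * int q] (mod int p)"
    using norm_form_factors_cong[OF sqrt_mod(1)[OF p M], of "rep_fst M q" "rep_snd M q"]
    unfolding norm_rep(1)[OF q M] .
  have "Legendre (norm_factor M * int q) (int p) = Legendre (int q) (int p)"
    unfolding Legendre_mult[OF p(1) mod_8(3)] norm_factor_def using mod_8(1) p by simp
  thus ?thesis unfolding norm_symbol_def split_symbol_def Legendre_cong[OF cong] quartic_cong[OF cong] by simp
qed

subsection \<open>Dyadic bilinear sums of symbols\<close>

lemma square_le_iff_abs_le_floor_sqrt:
  fixes C :: int
  shows "real_of_int (C * C) \<le> T \<longleftrightarrow> \<bar>C\<bar> \<le> \<lfloor>sqrt T\<rfloor>"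
proof -
  have "real_of_int (C * C) \<le> T \<longleftrightarrow> sqrt (real_of_int (C * C)) \<le> sqrt T" by (simp only: real_sqrt_le_iff)
  also have "sqrt (real_of_int (C * C)) = real_of_int \<bar>C\<bar>" by (simp flip: power2_eq_square)
  finally show ?thesis by (simp only: le_floor_iff)
qed

lemma square_interval: "\<exists>a b. {C \<in> {-B..B}. real_of_int (C * C) \<le> T} = {a..b}"
proof -
  have "{C \<in> {-B..B}. real_of_int (C * C) \<le> T} = {- min B \<lfloor>sqrt T\<rfloor>..min B \<lfloor>sqrt T\<rfloor>}"
    unfolding square_le_iff_abs_le_floor_sqrt by auto
  thus ?thesis by blast
qed

lemma card_multiples:
  fixes B :: int and p :: nat
  assumes p: "p > 0" and B: "B \<ge> 0"
  shows "real (card {D \<in> {-B..B}. int p dvd D}) * real p \<le> 2 * of_int B + real p"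
proof -
  have "{D \<in> {-B..B}. int p dvd D} \<subseteq> (\<lambda>k. int p * k) ` {-(B div int p)..B div int p}"
  proof
    fix D assume "D \<in> {D \<in> {-B..B}. int p dvd D}"
    then obtain k where k: "D = int p * k" and "-B \<le> int p * k" "int p * k \<le> B" by (auto elim: dvdE)
    hence "k * int p \<le> B" "(- k) * int p \<le> B" by (simp_all add: mult.commute)
    moreover have "z \<le> B div int p" if "z * int p \<le> B" for z using zdiv_mono1[OF that, of "int p"] p by simp
    ultimately have "k \<le> B div int p" "- k \<le> B div int p" by blast+
    thus "D \<in> (\<lambda>k. int p * k) ` {-(B div int p)..B div int p}" using k by auto
  qed
  hence "card {D \<in> {-B..B}. int p dvd D} \<le> card {-(B div int p)..B div int p}"
    using surj_card_le by blast
  hence "int (card {D \<in> {-B..B}. int p dvd D}) \<le> 2 * (B div int p) + 1"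
    using p B by (simp add: le_nat_iff pos_imp_zdiv_nonneg_iff)
  hence "int (card {D \<in> {-B..B}. int p dvd D}) * int p \<le> (2 * (B div int p) + 1) * int p"
    by (intro mult_right_mono) auto
  also have "int p * (B div int p) \<le> B"
    using p mult_div_mod_eq[of "int p" B] pos_mod_sign[of "int p" B] by linarith
  hence "(2 * (B div int p) + 1) * int p \<le> 2 * B + int p" by (simp add: algebra_simps)
  finally have "real_of_int (int (card {D \<in> {-B..B}. int p dvd D}) * int p) \<le> of_int (2 * B + int p)"
    by (simp only: of_int_le_iff)
  thus ?thesis by simp
qed

definition norm_box :: "real \<Rightarrow> int" where "norm_box Y = \<lfloor>3 * sqrt Y\<rfloor>"

lemma norm_box: "of_int (norm_box Y) \<le> 3 * sqrt Y" "3 * sqrt Y < of_int (norm_box Y) + 1"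
  unfolding norm_box_def by linarith+

lemma norm_box_nonneg: "Y \<ge> 0 \<Longrightarrow> norm_box Y \<ge> 0"
  unfolding norm_box_def by simp

lemma card_norm_box_le:
  assumes "Y \<ge> 1"
  shows "real (card {-norm_box Y..norm_box Y}) * of_int (2 * norm_box Y + 1) \<le> 49 * Y"
proof -
  have nonneg: "norm_box Y \<ge> 0" using assms by (simp add: norm_box_nonneg)
  have "real_of_int (2 * norm_box Y + 1) \<le> 7 * sqrt Y"
    using norm_box(1)[of Y] real_sqrt_ge_one[OF assms] by linarith
  hence "real_of_int (2 * norm_box Y + 1) * of_int (2 * norm_box Y + 1) \<le> (7 * sqrt Y) * (7 * sqrt Y)"
    using nonneg assms by (intro mult_mono) auto
  thus ?thesis using nonneg assms by simp
qed

lemma powers_le_sqrt: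
  fixes P :: nat
  assumes "P \<ge> 1" "real P^6 \<le> Y"
  shows "real P^3 \<le> sqrt Y" "real P \<le> sqrt Y" "1 \<le> sqrt Y"
proof -
  show cube: "real P^3 \<le> sqrt Y" using assms(2) by (intro real_le_rsqrt) (simp flip: power_mult)
  show "real P \<le> sqrt Y" by (rule order_trans[OF self_le_power cube]) (use assms(1) in auto)
  thus "1 \<le> sqrt Y" by (rule order_trans[rotated]) (use assms(1) in simp)
qed

lemma card_norm_box_multiples_le:
  fixes P p :: nat
  assumes P: "P \<ge> 1" "real P^6 \<le> Y" and p: "P < p" "p \<le> 2 * P"
  shows "real (card {D \<in> {-norm_box Y..norm_box Y}. int p dvd D}) * real P
    \<le> 2 * real (card {-norm_box Y..norm_box Y})"
proof -
  note sqrt_ge = powers_le_sqrt[OF P]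
  hence nonneg: "norm_box Y \<ge> 0" by (intro norm_box_nonneg) simp
  have "real (card {D \<in> {-norm_box Y..norm_box Y}. int p dvd D}) * real P
    \<le> real (card {D \<in> {-norm_box Y..norm_box Y}. int p dvd D}) * real p" using p(1)
    by (intro mult_left_mono) auto
  also have "... \<le> 2 * of_int (norm_box Y) + real p" by (rule card_multiples) (use p nonneg in auto)
  also have "real p \<le> 2 * (of_int (norm_box Y) + 1)"
  proof -
    have le_box: "real P \<le> of_int (norm_box Y) + 1" using norm_box(2)[of Y] sqrt_ge by linarith
    have "real p \<le> 2 * real P" using of_nat_mono[OF p(2), where 'a = real] by simp
    also have "... \<le> 2 * (of_int (norm_box Y) + 1)" using le_box by (rule mult_left_mono) simp
    finally show ?thesis .
  qed
  finally show ?thesis using nonneg by simp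
qed

lemma mem_norm_box:
  assumes "z * z \<le> 9 * int q" "real q \<le> Y"
  shows "z \<in> {-norm_box Y..norm_box Y}"
proof -
  have "real_of_int (z * z) \<le> real_of_int (9 * int q)" using assms(1) by (simp only: of_int_le_iff)
  hence "real_of_int (z * z) \<le> 9 * Y" using assms(2) by simp
  hence "\<bar>z\<bar> \<le> \<lfloor>sqrt (9 * Y)\<rfloor>" by (simp only: square_le_iff_abs_le_floor_sqrt)
  moreover have "sqrt (9 * Y) = 3 * sqrt Y" using real_sqrt_mult[of "3^2" Y] by simp
  ultimately show ?thesis unfolding norm_box_def by auto
qed

theorem norm_symbol_dyadic_small:
  assumes M: "M \<in> {2, -2, -1}" and e: "\<And>p. \<bar>e p\<bar> \<le> (1::real)"
  shows "dyadic_small (\<lambda>p q. e p * of_int (norm_symbol M j p q))"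
proof -
  define nf where "nf C D = real_of_int (C * C - M * (D * D)) / of_int (norm_factor M)" for C D
  have factor_pos: "norm_factor M > 0" unfolding norm_factor_def by simp
  show ?thesis unfolding norm_symbol_def
  proof (rule dyadic_smallI[where nf = nf and B = norm_box and Ds = "\<lambda>Y. {-norm_box Y..norm_box Y}"])
    show "\<bar>split_symbol j p (C + D * sqrt_mod M p) (C - D * sqrt_mod M p)\<bar> \<le> 1" for p C D
      by (rule split_symbol_bound)
    show "split_symbol j p (C mod int p + D * sqrt_mod M p) (C mod int p - D * sqrt_mod M p)
      = split_symbol j p (C + D * sqrt_mod M p) (C - D * sqrt_mod M p)" for p C D
      by (rule split_symbol_cong; intro cong_add cong_diff cong_refl) (simp_all add: Cong.cong_def)
    show "\<bar>\<Sum>C\<in>{0..<int p}. split_symbol j p (C + D * sqrt_mod M p) (C - D * sqrt_mod M p)\<bar> \<le> 1"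
      if "prime p" "[p = 1] (mod 8)" "\<not> int p dvd D" for p D
      by (rule sum_split_symbol_row[OF that(1) cong_1_mod_8_imp_mod_4[OF that(2)] sqrt_mod(2)[OF that(1,2) M]
        that(3)])
    show "\<exists>a b. {C \<in> {-B..B}. nf C D \<le> t} = {a..b}" for B D t
    proof -
      have "nf C D \<le> t \<longleftrightarrow> real_of_int (C * C) \<le> t * of_int (norm_factor M) + of_int (M * (D * D))" for C
        unfolding nf_def using factor_pos by (simp add: field_simps)
      thus ?thesis using square_interval[of B "t * of_int (norm_factor M) + of_int (M * (D * D))"] by simp
    qed
    show "finite {-norm_box Y..norm_box Y} \<and> norm_box Y \<ge> 0
      \<and> real (card {-norm_box Y..norm_box Y}) * of_int (2 * norm_box Y + 1) \<le> 49 * Y" if "Y \<ge> 1" for Y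
      using card_norm_box_le[OF that] norm_box_nonneg[of Y] that by simp
    show "real P^3 \<le> of_int (2 * norm_box Y + 1)" if "P \<ge> 1" "real P^6 \<le> Y" for P Y
      using powers_le_sqrt[OF that] norm_box(2)[of Y] by linarith
    show "rep_fst M q \<in> {-norm_box Y..norm_box Y} \<and> rep_snd M q \<in> {-norm_box Y..norm_box Y}
      \<and> nf (rep_fst M q) (rep_snd M q) = real q"
      if q: "prime q" "[q = 1] (mod 8)" "real q \<le> Y" for q Y
      using norm_rep[OF q(1,2) M] mem_norm_box[OF _ q(3)] factor_pos unfolding nf_def by simp
    show "real (card {D \<in> {-norm_box Y..norm_box Y}. int p dvd D}) * real P
      \<le> 2 * real (card {-norm_box Y..norm_box Y})"
      if "P \<ge> 1" "real P^6 \<le> Y" "P < p" "p \<le> 2 * P" for P Y p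
      by (rule card_norm_box_multiples_le[OF that])
  qed (use e in auto)
qed

theorem character_dyadic_small:
  fixes g :: "nat \<Rightarrow> int \<Rightarrow> int"
  assumes bounded: "\<And>p x. \<bar>g p x\<bar> \<le> 1" and periodic: "\<And>p x. g p (x mod int p) = g p x"
    and sum_0: "\<And>p. prime p \<Longrightarrow> [p = 1] (mod 8) \<Longrightarrow> (\<Sum>x\<in>{0..<int p}. g p x) = 0"
    and e: "\<And>p. \<bar>e p\<bar> \<le> (1::real)"
  shows "dyadic_small (\<lambda>p q. e p * of_int (g p (int q)))"
proof (rule dyadic_smallI[where nf = "\<lambda>C D. real_of_int C" and B = floor and Ds = "\<lambda>_. {1}" and d = "\<lambda>_. 1"
  and g = "\<lambda>p C D. g p C"])
  show "\<exists>a b. {C \<in> {-B..B}. real_of_int C \<le> t} = {a..b}" for B D :: int and t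
    by (intro exI[of _ "-B"] exI[of _ "min B \<lfloor>t\<rfloor>"]) (auto simp: le_floor_iff)
  show "finite {1::int} \<and> \<lfloor>Y\<rfloor> \<ge> 0 \<and> real (card {1::int}) * of_int (2 * \<lfloor>Y\<rfloor> + 1) \<le> 49 * Y" if "Y \<ge> 1"
    for Y :: real
    using that of_int_floor_le[of Y] by simp linarith
  show "real P^3 \<le> of_int (2 * \<lfloor>Y\<rfloor> + 1)" if "P \<ge> 1" "real P^6 \<le> Y" for P :: nat and Y
  proof -
    have "real P^3 \<le> real P^6" "1 \<le> real P^3" using that(1) by (auto intro: power_increasing one_le_power)
    hence "real P^3 \<le> Y" "Y \<ge> 1" using that(2) by linarith+
    thus ?thesis using real_of_int_floor_add_one_gt[of Y] by linarith
  qed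
  show "real (card {D \<in> {1::int}. int p dvd D}) * real P \<le> 2 * real (card {1::int})" if "prime p" for p P
  proof -
    have "{D \<in> {1::int}. int p dvd D} = {}" using prime_gt_1_nat[OF that] by auto
    thus ?thesis by (simp only: card.empty)
  qed
  show "int q \<in> {-\<lfloor>Y\<rfloor>..\<lfloor>Y\<rfloor>} \<and> 1 \<in> {1::int} \<and> real_of_int (int q) = real q" if "real q \<le> Y" for q Y
    using that by (simp add: le_floor_iff order_trans[of _ 0])
qed (use assms in auto)

section \<open>Primes congruent to 1 modulo 8\<close>

subsection \<open>Chebyshev's and Mertens' estimates\<close>

lemma sum_divisors_swap:
  fixes g :: "nat \<Rightarrow> nat \<Rightarrow> real"
  shows "(\<Sum>n\<in>{1..N}. \<Sum>d | d dvd n. g d (n div d)) = (\<Sum>d\<in>{1..N}. \<Sum>k\<in>{1..N div d}. g d k)"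
proof -
  have "(\<Sum>n\<in>{1..N}. \<Sum>d | d dvd n. g d (n div d)) = (\<Sum>(n, d)\<in>Sigma {1..N} (\<lambda>n. {d. d dvd n}). g d (n div d))"
    by (rule sum.Sigma) auto
  also have "... = (\<Sum>(d, k)\<in>Sigma {1..N} (\<lambda>d. {1..N div d}). g d k)"
  proof (rule sum.reindex_bij_witness[of _ "\<lambda>(d, k). (d * k, d)" "\<lambda>(n, d). (d, n div d)"])
    fix z assume "z \<in> Sigma {1..N} (\<lambda>n. {d. d dvd n})"
    then obtain d k where z: "z = (d * k, d)" "1 \<le> d * k" "d * k \<le> N" by (auto elim!: dvdE)
    hence "d > 0" "k > 0" by auto
    moreover have "k \<le> N div d" using z \<open>d > 0\<close> by (simp add: less_eq_div_iff_mult_less_eq mult.commute)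
    moreover have "d \<le> d * k" using \<open>k > 0\<close> by simp
    hence "d \<le> N" using z(3) by linarith
    ultimately show "(case z of (n, d) \<Rightarrow> (d, n div d)) \<in> Sigma {1..N} (\<lambda>d. {1..N div d})"
      and "(case case z of (n, d) \<Rightarrow> (d, n div d) of (d, k) \<Rightarrow> (d * k, d)) = z"
      and "(case case z of (n, d) \<Rightarrow> (d, n div d) of (d, k) \<Rightarrow> g d k) = (case z of (n, d) \<Rightarrow> g d (n div d))"
      using z by simp_all
  next
    fix z assume "z \<in> Sigma {1..N} (\<lambda>d. {1..N div d})"
    then obtain d k where z: "z = (d, k)" "1 \<le> d" "1 \<le> k" "k \<le> N div d" by auto
    hence "d * k \<le> N" by (simp add: less_eq_div_iff_mult_less_eq mult.commute)
    thus "(case z of (d, k) \<Rightarrow> (d * k, d)) \<in> Sigma {1..N} (\<lambda>n. {d. d dvd n})"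
      and "(case case z of (d, k) \<Rightarrow> (d * k, d) of (n, d) \<Rightarrow> (d, n div d)) = z" using z by simp_all
  qed
  also have "... = (\<Sum>d\<in>{1..N}. \<Sum>k\<in>{1..N div d}. g d k)" by (rule sum.Sigma[symmetric]) auto
  finally show ?thesis .
qed

lemma ln_fact_mangoldt: "ln (fact N) = (\<Sum>d\<in>{1..N}. mangoldt d * real (N div d))"
proof -
  have "ln (fact N :: real) = ln (\<Prod>n\<in>{1..N}. real n)" by (simp add: fact_prod)
  also have "... = (\<Sum>n\<in>{1..N}. ln (real n))" by (rule ln_prod) auto
  also have "... = (\<Sum>n\<in>{1..N}. \<Sum>d | d dvd n. mangoldt d)" by (rule sum.cong) (auto simp: mangoldt_sum)
  also have "... = (\<Sum>d\<in>{1..N}. \<Sum>k\<in>{1..N div d}. mangoldt d)"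
    by (rule sum_divisors_swap[of "\<lambda>d k. mangoldt d"])
  finally show ?thesis by (simp add: mult.commute)
qed

definition chebyshev_psi :: "nat \<Rightarrow> real" where "chebyshev_psi N = (\<Sum>d\<in>{1..N}. mangoldt d)"

lemma chebyshev_psi_mono: "M \<le> N \<Longrightarrow> chebyshev_psi M \<le> chebyshev_psi N"
  unfolding chebyshev_psi_def by (rule sum_mono2) (auto simp: mangoldt_nonneg)

lemma ln_central_binomial: "ln (real (2 * M choose M)) = ln (fact (2 * M)) - 2 * ln (fact M)"
proof -
  have "ln (real (2 * M choose M)) = ln (fact (2 * M) / (fact M * fact M))"
    by (simp add: binomial_fact mult_2)
  also have "... = ln (fact (2 * M)) - ln (fact M * fact M)" by (simp add: ln_div)
  also have "ln (fact M * fact M :: real) = 2 * ln (fact M)" by (simp add: ln_mult)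
  finally show ?thesis .
qed

lemma chebyshev_psi_double_le_ln_central_binomial:
  "chebyshev_psi (2 * M) - chebyshev_psi M \<le> ln (real (2 * M choose M))"
proof -
  have "{1..2 * M} = {1..M} \<union> {M + 1..2 * M}" by auto
  hence "chebyshev_psi (2 * M) = chebyshev_psi M + (\<Sum>d\<in>{M + 1..2 * M}. mangoldt d)"
    unfolding chebyshev_psi_def by (simp only:) (rule sum.union_disjoint, auto)
  moreover have "(\<Sum>d\<in>{M + 1..2 * M}. mangoldt d)
    \<le> (\<Sum>d\<in>{M + 1..2 * M}. mangoldt d * (real (2 * M div d) - 2 * real (M div d)))"
  proof (rule sum_mono)
    fix d assume d: "d \<in> {M + 1..2 * M}"
    hence "1 \<le> 2 * M div d" by (simp add: less_eq_div_iff_mult_less_eq)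
    hence "1 \<le> real (2 * M div d)" by linarith
    thus "mangoldt d \<le> mangoldt d * (real (2 * M div d) - 2 * real (M div d))"
      using d mult_left_mono[of 1 "real (2 * M div d)" "mangoldt d"] mangoldt_nonneg[of d] by simp
  qed
  moreover have "... \<le> (\<Sum>d\<in>{1..2 * M}. mangoldt d * (real (2 * M div d) - 2 * real (M div d)))"
  proof (rule sum_mono2)
    fix d
    have "2 * (M div d) \<le> 2 * M div d"
      by (cases "d = 0") (simp_all add: less_eq_div_iff_mult_less_eq mult.assoc)
    hence "real (2 * (M div d)) \<le> real (2 * M div d)" by (simp only: of_nat_le_iff)
    thus "0 \<le> mangoldt d * (real (2 * M div d) - 2 * real (M div d))"
      by (intro mult_nonneg_nonneg mangoldt_nonneg) simp
  qed auto
  moreover have "... = (\<Sum>d\<in>{1..2 * M}. mangoldt d * real (2 * M div d))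
    - 2 * (\<Sum>d\<in>{1..2 * M}. mangoldt d * real (M div d))"
    by (simp add: sum_subtractf sum_distrib_left algebra_simps)
  moreover have "(\<Sum>d\<in>{1..2 * M}. mangoldt d * real (M div d)) = (\<Sum>d\<in>{1..M}. mangoldt d * real (M div d))"
    by (rule sum.mono_neutral_right) auto
  ultimately show ?thesis unfolding ln_central_binomial ln_fact_mangoldt by linarith
qed

lemma chebyshev_psi_double: "chebyshev_psi (2 * M) - chebyshev_psi M \<le> 2 * ln 2 * real M"
proof -
  have "real (2 * M choose M) \<le> real (2^(2 * M))"
    using binomial_le_pow2[of "2 * M" M] by (simp only: of_nat_le_iff)
  hence "ln (real (2 * M choose M)) \<le> ln (2^(2 * M))" by (intro ln_mono) auto
  also have "... = 2 * ln 2 * real M" by (simp add: ln_realpow)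
  finally show ?thesis using chebyshev_psi_double_le_ln_central_binomial[of M] by linarith
qed

lemma chebyshev_psi_le: "chebyshev_psi N \<le> 4 * real N"
proof -
  have "chebyshev_psi N \<le> 4 * ln 2 * real N"
  proof (induction N rule: less_induct)
    case (less N)
    show ?case
    proof (cases "N \<le> 1")
      case True
      hence "N = 0 \<or> N = 1" by auto
      thus ?thesis by (auto simp: chebyshev_psi_def)
    next
      case False
      define M where "M = (N + 1) div 2"
      have M: "M < N" "N \<le> 2 * M" using False unfolding M_def by linarith+
      have "6 * M \<le> 4 * N" using False unfolding M_def by presburger
      note M = M this
      have "chebyshev_psi N \<le> chebyshev_psi (2 * M)" by (rule chebyshev_psi_mono[OF M(2)])
      also have "... \<le> 4 * ln 2 * real M + 2 * ln 2 * real M"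
        using chebyshev_psi_double[of M] less.IH[OF M(1)] by linarith
      also have "... = ln 2 * real (6 * M)" by simp
      also have "... \<le> ln 2 * real (4 * N)" by (intro mult_left_mono of_nat_mono M(3)) simp
      finally show ?thesis by simp
    qed
  qed
  also have "... \<le> 4 * real N" using ln_2_less_1 by (intro mult_right_mono) auto
  finally show ?thesis .
qed

lemma real_div_le_Suc_div: assumes "d > 0" shows "real N / real d \<le> real (Suc (N div d))"
proof -
  have "N = d * (N div d) + N mod d" by simp
  hence "N \<le> d * Suc (N div d)" using mod_less_divisor[OF assms, of N] unfolding mult_Suc_right by linarith
  hence "real N \<le> real d * real (Suc (N div d))" by (metis of_nat_le_iff of_nat_mult)
  thus ?thesis using assms by (simp add: field_simps)
qed

lemma n_ln_Suc_le: assumes "n \<ge> 1" shows "real n * ln (real (Suc n)) \<le> real n * ln (real n) + 1"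
proof -
  have n: "real n > 0" using assms by simp
  have "real (Suc n) = real n * (1 + 1 / real n)" using n by (simp add: field_simps)
  hence "ln (real (Suc n)) = ln (real n * (1 + 1 / real n))" by (rule arg_cong)
  also have "... = ln (real n) + ln (1 + 1 / real n)"
    by (rule ln_mult_pos) (use n in \<open>auto simp: add_pos_pos\<close>)
  also have "ln (1 + 1 / real n) \<le> 1 / real n" using n by (intro ln_add_one_self_le_self) auto
  finally have "real n * ln (real (Suc n)) \<le> real n * (ln (real n) + 1 / real n)" using n by simp
  thus ?thesis using n by (simp add: algebra_simps)
qed

lemma ln_fact_le: "ln (fact N) \<le> real N * ln (real N)"
proof (cases "N = 0")
  case False
  have "(fact N :: real) \<le> real N^N" using fact_le_power[of N, where 'a = real] by simp
  hence "ln (fact N :: real) \<le> ln (real N^N)" by (intro ln_mono) auto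
  thus ?thesis using False by (simp add: ln_realpow)
qed simp

lemma ln_fact_ge: assumes "N \<ge> 1" shows "real N * ln (real N) - real N \<le> ln (fact N)"
  using assms
proof (induction N rule: nat_induct_at_least)
  case (Suc n)
  have "real (Suc n) * ln (real (Suc n)) - real (Suc n) \<le> ln (real (Suc n)) + (real n * ln (real n) - real n)"
    using n_ln_Suc_le[OF Suc.hyps] by (simp add: algebra_simps)
  also have "... \<le> ln (real (Suc n)) + ln (fact n)" using Suc by simp
  also have "... = ln (fact (Suc n))" by (simp add: ln_mult)
  finally show ?case .
qed simp

lemma mertens_mangoldt:
  assumes "N \<ge> 1"
  shows "\<bar>(\<Sum>d\<in>{1..N}. mangoldt d / real d) - ln (real N)\<bar> \<le> 4"
proof -
  let ?S = "\<Sum>d\<in>{1..N}. mangoldt d / real d"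
  have N: "real N > 0" using assms by simp
  have "ln (fact N) \<le> real N * ?S"
    unfolding ln_fact_mangoldt sum_distrib_left
  proof (rule sum_mono)
    fix d
    have "mangoldt d * real (N div d) \<le> mangoldt d * (real N / real d)"
      by (intro mult_left_mono of_nat_div_le_of_nat mangoldt_nonneg)
    thus "mangoldt d * real (N div d) \<le> real N * (mangoldt d / real d)" by (simp add: mult.commute)
  qed
  hence "real N * (ln (real N) - 1) \<le> real N * ?S" using ln_fact_ge[OF assms] by (simp add: algebra_simps)
  hence lower: "ln (real N) - 1 \<le> ?S" using N mult_le_cancel_left_pos by blast
  have "real N * ?S - chebyshev_psi N \<le> ln (fact N)"
    unfolding ln_fact_mangoldt sum_distrib_left chebyshev_psi_def sum_subtractf[symmetric]
  proof (rule sum_mono)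
    fix d assume "d \<in> {1..N}"
    hence "mangoldt d * (real N / real d - 1) \<le> mangoldt d * real (N div d)"
      using real_div_le_Suc_div[of d N] by (intro mult_left_mono mangoldt_nonneg) simp
    thus "real N * (mangoldt d / real d) - mangoldt d \<le> mangoldt d * real (N div d)"
      by (simp add: algebra_simps)
  qed
  hence "real N * ?S \<le> real N * (ln (real N) + 4)"
    using ln_fact_le[of N] chebyshev_psi_le[of N] by (simp add: algebra_simps)
  hence "?S \<le> ln (real N) + 4" using N mult_le_cancel_left_pos by blast
  thus ?thesis using lower by linarith
qed

subsection \<open>Real characters\<close>

lemma abel_summation_bound:
  fixes f a :: "nat \<Rightarrow> real"
  assumes partial: "\<And>n. \<bar>\<Sum>k<n. f k\<bar> \<le> B" and decreasing: "\<And>k. k \<ge> M \<Longrightarrow> a (Suc k) \<le> a k"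
    and pos: "\<And>k. k \<ge> M \<Longrightarrow> a k \<ge> 0"
  shows "\<bar>\<Sum>k=M..<N. f k * a k\<bar> \<le> 2 * B * a M"
proof (cases "M < N")
  case False
  have "B \<ge> 0" using partial[of 0] by simp
  thus ?thesis using False pos[of M] by simp
next
  case True
  define D where "D n = (\<Sum>k=M..<n. f k)" for n
  have D: "\<bar>D n\<bar> \<le> 2 * B" if "n \<ge> M" for n
  proof -
    have "D n = (\<Sum>k<n. f k) - (\<Sum>k<M. f k)"
      unfolding D_def using that by (simp add: sum_diff_nat_ivl lessThan_atLeast0)
    thus ?thesis using partial[of n] partial[of M] by linarith
  qed
  have parts: "(\<Sum>k=M..<Suc n. f k * a k) = D (Suc n) * a n + (\<Sum>k=M..<n. D (Suc k) * (a k - a (Suc k)))"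
    if "n \<ge> M" for n
    using that
  proof (induction n rule: nat_induct_at_least)
    case (Suc n)
    have "D (Suc (Suc n)) = D (Suc n) + f (Suc n)" using Suc.hyps by (simp add: D_def)
    thus ?case using Suc by (simp add: algebra_simps)
  qed (simp add: D_def)
  obtain n where n: "N = Suc n" "n \<ge> M" using True by (cases N) auto
  have "\<bar>\<Sum>k=M..<N. f k * a k\<bar> \<le> \<bar>D (Suc n) * a n\<bar>+(\<Sum>k=M..<n. \<bar>D (Suc k) * (a k - a (Suc k))\<bar>)"
    unfolding n(1) parts[OF n(2)] by (rule order_trans[OF abs_triangle_ineq add_left_mono[OF sum_abs]])
  also have "... \<le> 2 * B * a n + (\<Sum>k=M..<n. 2 * B * (a k - a (Suc k)))"
    using D[of "Suc n"] D[of "Suc _"] pos[OF n(2)] n(2) decreasing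
    by (intro add_mono sum_mono) (simp_all add: abs_mult mult_right_mono)
  also have "(\<Sum>k=M..<n. 2 * B * (a k - a (Suc k))) = 2 * B * (a M - a n)"
    unfolding sum_distrib_left[symmetric] using n(2) by (induction n rule: nat_induct_at_least) auto
  finally show ?thesis by (simp add: algebra_simps)
qed

lemma ln_over_self_decreasing: assumes "n \<ge> 3" shows "ln (real (Suc n)) / real (Suc n) \<le> ln (real n) / real n"
proof -
  have n: "real n > 0" using assms by simp
  have "exp 1 \<le> real n" using exp_le assms by linarith
  hence "1 \<le> ln (real n)" using n by (simp add: ln_ge_iff)
  hence "real n * ln (real (Suc n)) \<le> real (Suc n) * ln (real n)"
    using n_ln_Suc_le[of n] assms by (simp add: algebra_simps)
  thus ?thesis using n by (simp add: field_simps)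
qed

text \<open>Mertens' argument for a real character \<open>f\<close> with \<open>L(1, f) > 0\<close>: the sum of \<open>f n ln n / n\<close> is bounded, and it
  is the convolution of \<open>f d mangoldt d / d\<close> with the partial sums of \<open>L(1, f)\<close>.\<close>

context
  fixes f :: "nat \<Rightarrow> real"
  assumes mult: "\<And>m n. f (m * n) = f m * f n" and partial: "\<And>n. \<bar>\<Sum>k<n. f k\<bar> \<le> 2" and bounded: "\<And>n. \<bar>f n\<bar> \<le> 1"
begin

definition L_partial :: "nat \<Rightarrow> real" where "L_partial K = (\<Sum>k\<in>{1..K}. f k / real k)"

lemma L_partial_diff: assumes "K \<le> K'" shows "\<bar>L_partial K' - L_partial K\<bar> \<le> 4 / real (Suc K)"
proof -
  have "L_partial K' - L_partial K = (\<Sum>k=Suc K..<Suc K'. f k * (1 / real k))"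
    unfolding L_partial_def atLeastLessThanSuc_atLeastAtMost[symmetric] times_divide_eq_right mult_1_right
    by (rule sum_diff_nat_ivl) (use assms in auto)
  also have "\<bar>...\<bar> \<le> 2 * 2 * (1 / real (Suc K))"
    by (rule abel_summation_bound[OF partial]) (auto simp: field_simps)
  finally show ?thesis by simp
qed

lemma L_partial_limit:
  obtains L where "\<And>K. \<bar>L_partial K - L\<bar> \<le> 4 / real (Suc K)"
proof -
  have "Cauchy L_partial"
  proof (rule CauchyI')
    fix e :: real assume e: "e > 0"
    obtain M where M: "4 / e < real M" using reals_Archimedean2 by blast
    have "dist (L_partial K) (L_partial K') < e" if "K \<ge> M" "K' > K" for K K'
    proof -
      have "4 < e * real M" using M e by (simp add: field_simps)
      also have "... \<le> e * real (Suc K)" using that e by simp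
      finally have "4 / real (Suc K) < e" by (simp add: field_simps)
      thus ?thesis using L_partial_diff[of K K'] that by (simp add: dist_real_def abs_minus_commute)
    qed
    thus "\<exists>M. \<forall>m\<ge>M. \<forall>n>m. dist (L_partial m) (L_partial n) < e" by blast
  qed
  then obtain L where L: "L_partial \<longlonglongrightarrow> L" using Cauchy_convergent convergent_def by blast
  have "\<bar>L_partial K - L\<bar> \<le> 4 / real (Suc K)" for K
  proof (rule LIMSEQ_le_const2)
    show "(\<lambda>K'. \<bar>L_partial K - L_partial K'\<bar>) \<longlonglongrightarrow> \<bar>L_partial K - L\<bar>" by (intro tendsto_intros L)
    show "\<exists>N. \<forall>n\<ge>N. \<bar>L_partial K - L_partial n\<bar> \<le> 4 / real (Suc K)"
      using L_partial_diff[of K] by (metis abs_minus_commute)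
  qed
  thus ?thesis by (rule that)
qed

lemma log_sum_bounded:
  obtains C where "\<And>N. \<bar>\<Sum>n\<in>{1..N}. f n * (ln (real n) / real n)\<bar> \<le> C"
proof -
  define C where "C = \<bar>\<Sum>k=1..<3. f k * (ln (real k) / real k)\<bar>+4 * (ln 3 / 3)"
  have "\<bar>\<Sum>n\<in>{1..N}. f n * (ln (real n) / real n)\<bar> \<le> C + 3" for N
  proof (cases "N \<ge> 3")
    case True
    hence "(\<Sum>n\<in>{1..N}. f n * (ln (real n) / real n))
      = (\<Sum>k=1..<3. f k * (ln (real k) / real k)) + (\<Sum>k=3..<Suc N. f k * (ln (real k) / real k))"
      unfolding atLeastLessThanSuc_atLeastAtMost[symmetric]
      by (intro sum.atLeastLessThan_concat[symmetric]) auto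
    moreover have "\<bar>\<Sum>k=3..<Suc N. f k * (ln (real k) / real k)\<bar> \<le> 2 * 2 * (ln (real 3) / real 3)"
      by (rule abel_summation_bound[OF partial]) (auto simp: ln_over_self_decreasing simp del: of_nat_Suc)
    ultimately show ?thesis unfolding C_def by simp
  next
    case False
    have "\<bar>f n * (ln (real n) / real n)\<bar> \<le> 1" if "n \<in> {1..N}" for n
    proof -
      have "\<bar>ln (real n) / real n\<bar> \<le> 1" using that ln_le_minus_one[of "real n"] by simp
      hence "\<bar>f n\<bar> * \<bar>ln (real n) / real n\<bar> \<le> 1 * 1" by (intro mult_mono bounded) auto
      thus ?thesis by (simp add: abs_mult)
    qed
    hence "(\<Sum>n\<in>{1..N}. \<bar>f n * (ln (real n) / real n)\<bar>) \<le> real N"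
      using sum_bounded_above[of "{1..N}" "\<lambda>n. \<bar>f n * (ln (real n) / real n)\<bar>" 1] by simp
    hence "\<bar>\<Sum>n\<in>{1..N}. f n * (ln (real n) / real n)\<bar> \<le> real N" by (rule order_trans[OF sum_abs])
    also have "... \<le> C + 3"
    proof -
      have "C \<ge> 0" unfolding C_def by (intro add_nonneg_nonneg) auto
      thus ?thesis using False by simp
    qed
    finally show ?thesis .
  qed
  thus ?thesis by (rule that)
qed

lemma log_sum_eq_convolution:
  "(\<Sum>n\<in>{1..N}. f n * (ln (real n) / real n)) = (\<Sum>d\<in>{1..N}. f d * mangoldt d / real d * L_partial (N div d))"
proof -
  have "f n * (ln (real n) / real n)
    = (\<Sum>d | d dvd n. f d * mangoldt d / real d * (f (n div d) / real (n div d)))" if n: "n \<in> {1..N}" for n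
  proof -
    have "f n * (ln (real n) / real n) = (\<Sum>d | d dvd n. (f n / real n) * mangoldt d)"
      unfolding sum_distrib_left[symmetric] using n by (simp add: mangoldt_sum)
    also have "(f n / real n) * mangoldt d = f d * mangoldt d / real d * (f (n div d) / real (n div d))"
      if "d dvd n" for d
      using that n by (auto elim!: dvdE simp: mult)
    hence "(\<Sum>d | d dvd n. (f n / real n) * mangoldt d)
      = (\<Sum>d | d dvd n. f d * mangoldt d / real d * (f (n div d) / real (n div d)))"
      by (intro sum.cong refl) auto
    finally show ?thesis .
  qed
  hence "(\<Sum>n\<in>{1..N}. f n * (ln (real n) / real n))
    = (\<Sum>n\<in>{1..N}. \<Sum>d | d dvd n. f d * mangoldt d / real d * (f (n div d) / real (n div d)))"
    by (rule sum.cong[OF refl])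
  also have "... = (\<Sum>d\<in>{1..N}. \<Sum>k\<in>{1..N div d}. f d * mangoldt d / real d * (f k / real k))"
    by (rule sum_divisors_swap)
  finally show ?thesis unfolding L_partial_def sum_distrib_left .
qed

lemma convolution_error:
  assumes L: "\<And>K. \<bar>L_partial K - L\<bar> \<le> 4 / real (Suc K)"
  shows "\<bar>\<Sum>d\<in>{1..N}. f d * mangoldt d / real d * (L_partial (N div d) - L)\<bar> \<le> 16"
proof -
  have "\<bar>f d * mangoldt d / real d * (L_partial (N div d) - L)\<bar> \<le> 4 / real N * mangoldt d" if d: "d \<in> {1..N}"
    for d
  proof -
    have "4 / real (Suc (N div d)) \<le> 4 / (real N / real d)"
      using d real_div_le_Suc_div[of d N] by (intro divide_left_mono) auto
    hence error: "\<bar>L_partial (N div d) - L\<bar> \<le> 4 * real d / real N" using L[of "N div d"] by simp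
    have "\<bar>f d * mangoldt d / real d * (L_partial (N div d) - L)\<bar>
      = \<bar>f d\<bar> * (mangoldt d / real d) * \<bar>L_partial (N div d) - L\<bar>"
      by (simp add: abs_mult mangoldt_nonneg)
    also have "... \<le> 1 * (mangoldt d / real d) * (4 * real d / real N)"
      by (intro mult_mono bounded error) (auto simp: mangoldt_nonneg)
    also have "... = 4 / real N * mangoldt d" using d by simp
    finally show ?thesis .
  qed
  hence "\<bar>\<Sum>d\<in>{1..N}. f d * mangoldt d / real d * (L_partial (N div d) - L)\<bar> \<le> 4 / real N * chebyshev_psi N"
    unfolding chebyshev_psi_def sum_distrib_left by (intro order_trans[OF sum_abs] sum_mono)
  also have "... \<le> 4 / real N * (4 * real N)" by (intro mult_left_mono chebyshev_psi_le) simp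
  finally show ?thesis by (cases "N = 0") simp_all
qed

theorem mertens_character:
  assumes pos: "L_partial 8 > 4 / 9"
  shows "\<exists>C. \<forall>N. \<bar>\<Sum>d\<in>{1..N}. f d * mangoldt d / real d\<bar> \<le> C"
proof -
  obtain L where L: "\<And>K. \<bar>L_partial K - L\<bar> \<le> 4 / real (Suc K)" using L_partial_limit by blast
  have L_pos: "L > 0" using abs_le_D1[OF L[of 8]] pos by simp
  obtain C where C: "\<And>N. \<bar>\<Sum>n\<in>{1..N}. f n * (ln (real n) / real n)\<bar> \<le> C" using log_sum_bounded by blast
  have "\<bar>\<Sum>d\<in>{1..N}. f d * mangoldt d / real d\<bar> \<le> (C + 16) / L" for N
  proof -
    have "L * (\<Sum>d\<in>{1..N}. f d * mangoldt d / real d)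
      = (\<Sum>d\<in>{1..N}. f d * mangoldt d / real d * L_partial (N div d))
      - (\<Sum>d\<in>{1..N}. f d * mangoldt d / real d * (L_partial (N div d) - L))"
      by (simp only: right_diff_distrib sum_subtractf sum_distrib_left mult.commute[of L])
    hence "\<bar>L * (\<Sum>d\<in>{1..N}. f d * mangoldt d / real d)\<bar> \<le> C + 16"
      using C[of N] convolution_error[OF L, of N] unfolding log_sum_eq_convolution by linarith
    thus ?thesis using L_pos by (simp add: abs_mult field_simps)
  qed
  thus ?thesis by blast
qed

end

lemma less_8_cases: assumes "list_all P [0, 1, 2, 3, 4, 5, 6, 7]" "i < (8::nat)" shows "P i"
proof -
  have "i \<in> {0, 1, 2, 3, 4, 5, 6, 7}" using assms(2) by auto
  thus ?thesis using assms(1) by (elim insertE) auto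
qed

text \<open>A character modulo 8 is given by the list \<open>ts\<close> of its values and \<open>us\<close> of its partial sums.\<close>

lemma periodic_partial_sum:
  fixes f :: "nat \<Rightarrow> real" and ts us :: "real list"
  assumes f: "\<And>n. f n = ts ! (n mod 8)" and us: "\<And>i. i < 8 \<Longrightarrow> us ! (Suc i mod 8) = us ! i + ts ! i"
    and "us ! 0 = 0"
  shows "(\<Sum>k<n. f k) = us ! (n mod 8)"
proof (induction n)
  case (Suc n)
  have "Suc n mod 8 = Suc (n mod 8) mod 8" by (simp add: mod_Suc_eq)
  thus ?case using Suc us[of "n mod 8"] f[of n] by simp
qed (simp add: assms(3))

lemma mertens_mod_8_character:
  fixes ts us :: "real list"
  assumes us: "list_all (\<lambda>i. us ! (Suc i mod 8) = us ! i + ts ! i) [0, 1, 2, 3, 4, 5, 6, 7]"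
    and us_0: "us ! 0 = 0"
    and us_bound: "list_all (\<lambda>i. \<bar>us ! i\<bar> \<le> 2) [0, 1, 2, 3, 4, 5, 6, 7]"
    and ts_bound: "list_all (\<lambda>i. \<bar>ts ! i\<bar> \<le> 1) [0, 1, 2, 3, 4, 5, 6, 7]"
    and mult: "list_all (\<lambda>i. list_all (\<lambda>j. ts ! (i * j mod 8) = ts ! i * ts ! j) [0, 1, 2, 3, 4, 5, 6, 7])
      [0, 1, 2, 3, 4, 5, 6, 7]"
    and pos: "ts ! 1 + ts ! 2 / 2 + ts ! 3 / 3 + ts ! 4 / 4 + ts ! 5 / 5 + ts ! 6 / 6 + ts ! 7 / 7
      + ts ! 0 / 8 > 4 / 9"
  shows "\<exists>C. \<forall>N. \<bar>\<Sum>d\<in>{1..N}. ts ! (d mod 8) * mangoldt d / real d\<bar> \<le> C"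
proof (rule mertens_character[of "\<lambda>n. ts ! (n mod 8)"])
  show mult: "ts ! (m * n mod 8) = ts ! (m mod 8) * ts ! (n mod 8)" for m n
  proof -
    have "list_all (\<lambda>j. ts ! ((m mod 8) * j mod 8) = ts ! (m mod 8) * ts ! j) [0, 1, 2, 3, 4, 5, 6, 7]"
      by (rule less_8_cases[OF mult]) simp
    from less_8_cases[OF this, of "n mod 8"] show ?thesis by (simp add: mod_mult_eq)
  qed
  show partial: "\<bar>\<Sum>k<n. ts ! (k mod 8)\<bar> \<le> 2" for n
    using periodic_partial_sum[OF refl less_8_cases[OF us] us_0, of n] less_8_cases[OF us_bound, of "n mod 8"]
    by simp
  show bounded: "\<bar>ts ! (n mod 8)\<bar> \<le> 1" for n using less_8_cases[OF ts_bound, of "n mod 8"] by simp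
  have "{1..8} = {1, 2, 3, 4, 5, 6, 7, 8 :: nat}" by auto
  thus "L_partial (\<lambda>n. ts ! (n mod 8)) 8 > 4 / 9"
    unfolding L_partial_def[of "\<lambda>n. ts ! (n mod 8)", OF mult partial bounded]
    using pos by simp
qed

definition chi_minus_4_values :: "real list" where "chi_minus_4_values = [0, 1, 0, -1, 0, 1, 0, -1]"
definition chi_8_values :: "real list" where "chi_8_values = [0, 1, 0, -1, 0, -1, 0, 1]"
definition chi_minus_8_values :: "real list" where "chi_minus_8_values = [0, 1, 0, 1, 0, -1, 0, -1]"

lemma mertens_chi_minus_4: "\<exists>C. \<forall>N. \<bar>\<Sum>d\<in>{1..N}. chi_minus_4_values ! (d mod 8) * mangoldt d / real d\<bar> \<le> C"
  by (rule mertens_mod_8_character[of "[0, 0, 1, 1, 0, 0, 1, 1]"]) (simp_all add: chi_minus_4_values_def)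

lemma mertens_chi_8: "\<exists>C. \<forall>N. \<bar>\<Sum>d\<in>{1..N}. chi_8_values ! (d mod 8) * mangoldt d / real d\<bar> \<le> C"
  by (rule mertens_mod_8_character[of "[0, 0, 1, 1, 0, 0, -1, -1]"]) (simp_all add: chi_8_values_def)

lemma mertens_chi_minus_8: "\<exists>C. \<forall>N. \<bar>\<Sum>d\<in>{1..N}. chi_minus_8_values ! (d mod 8) * mangoldt d / real d\<bar> \<le> C"
  by (rule mertens_mod_8_character[of "[0, 0, 1, 1, 2, 2, 1, 1]"]) (simp_all add: chi_minus_8_values_def)

lemma indicator_1_mod_8:
  "(if d mod 8 = 1 then 1 else 0) = ((if odd d then 1 else 0) + chi_minus_4_values ! (d mod 8)
    + chi_8_values ! (d mod 8) + chi_minus_8_values ! (d mod 8)) / (4::real)" for d :: nat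
proof -
  have parity: "odd d \<longleftrightarrow> odd (d mod 8)" by presburger
  show ?thesis unfolding parity
    by (rule less_8_cases[where i = "d mod 8" and P = "\<lambda>r. (if r = 1 then 1 else 0) =
    ((if odd r then 1 else 0) + chi_minus_4_values ! r + chi_8_values ! r
    + chi_minus_8_values ! r) / (4::real)"])
      (simp_all add: chi_minus_4_values_def chi_8_values_def chi_minus_8_values_def)
qed

subsection \<open>Mertens' estimate for primes\<close>

lemma sum_inverse_powers_le:
  assumes "p \<ge> 2"
  shows "(\<Sum>k\<in>{2..N}. 1 / real p^k) \<le> 2 / real p^2"
proof -
  have "(\<Sum>k\<in>{2..j}. 1 / real p^k) \<le> 2 / real p^2 - 2 / real p^Suc j" if "j \<ge> 1" for j
    using that
  proof (induction j rule: nat_induct_at_least)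
    case (Suc j)
    have "(2 / real p) * (1 / real p^Suc j) \<le> 1 * (1 / real p^Suc j)"
      using assms by (intro mult_right_mono) auto
    hence "1 / real p^Suc j - 2 / real p^Suc j \<le> - (2 / real p^Suc (Suc j))"
      by (simp add: diff_divide_distrib[symmetric])
    moreover have "(\<Sum>k\<in>{2..Suc j}. 1 / real p^k) = (\<Sum>k\<in>{2..j}. 1 / real p^k) + 1 / real p^Suc j"
      using Suc.hyps by simp
    ultimately show ?case using Suc.IH by linarith
  qed (simp add: power2_eq_square)
  from this[of N] show ?thesis
  proof (cases "N \<ge> 1")
    case True
    have "2 / real p^Suc N \<ge> 0" by simp
    thus ?thesis using \<open>1 \<le> N \<Longrightarrow> _\<close> True by linarith
  qed simp
qed

lemma sum_ln_over_powers_le: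
  assumes "p \<ge> 2"
  shows "(\<Sum>k\<in>{2..N}. ln (real p) / real p^k) \<le> 4 * (real p powr (- 3 / 2))"
proof -
  have "ln (real p) \<le> 2 * real p powr (1 / 2)" using ln_powr_bound[of "real p" "1 / 2"] assms by simp
  hence "ln (real p) * (\<Sum>k\<in>{2..N}. 1 / real p^k) \<le> (2 * real p powr (1 / 2)) * (2 / real p^2)"
    using assms by (intro mult_mono sum_inverse_powers_le) (auto intro: sum_nonneg)
  also have "... = 4 * real p powr (- 3 / 2)"
    using powr_diff[of "real p" "1 / 2" 2] assms by (simp add: powr_numeral)
  finally show ?thesis by (simp add: sum_distrib_left)
qed

lemma nonprime_primepow_subset:
  "{d \<in> {1..N}. \<not> prime d \<and> primepow d} \<subseteq> (\<lambda>(p, k). p^k) ` ({p \<in> {2..N}. prime p} \<times> {2..N})"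
proof
  fix d assume d: "d \<in> {d \<in> {1..N}. \<not> prime d \<and> primepow d}"
  then obtain p k where pk: "prime p" "k > 0" "d = p^k" unfolding primepow_def by auto
  have p: "p \<ge> 2" using prime_ge_2_nat[OF pk(1)] .
  have "k \<noteq> 1" using d pk by auto
  moreover have "p^1 \<le> p^k" using pk(2) p by (intro power_increasing) auto
  moreover have "k < p^k" using p by (metis less_exp order_less_le_trans power_mono zero_le_numeral)
  ultimately have "(p, k) \<in> {p \<in> {2..N}. prime p} \<times> {2..N}" using d pk p by auto
  thus "d \<in> (\<lambda>(p, k). p^k) ` ({p \<in> {2..N}. prime p} \<times> {2..N})" using pk(3) by force
qed

lemma mangoldt_nonprime_bounded:
  "\<exists>C. \<forall>N. (\<Sum>d\<in>{d\<in>{1..N}. \<not> prime d}. mangoldt d / real d) \<le> C"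
proof -
  define g where "g p = 4 * (real p powr (- 3 / 2))" for p :: nat
  have summable: "summable g" unfolding g_def by (intro summable_mult) (simp add: summable_real_powr_iff)
  have "(\<Sum>d\<in>{d\<in>{1..N}. \<not> prime d}. mangoldt d / real d) \<le> suminf g" for N
  proof -
    let ?P = "{p \<in> {2..N}. prime p}"
    have "(\<Sum>d\<in>{d\<in>{1..N}. \<not> prime d}. mangoldt d / real d)
      = (\<Sum>d\<in>{d\<in>{1..N}. \<not> prime d \<and> primepow d}. mangoldt d / real d)"
      by (rule sum.mono_neutral_right) (auto simp: mangoldt_def)
    also have "... \<le> (\<Sum>d\<in>(\<lambda>(p, k). p^k) ` (?P \<times> {2..N}). mangoldt d / real d)"
      by (rule sum_mono2[OF _ nonprime_primepow_subset]) (auto simp: mangoldt_nonneg)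
    also have "... \<le> (\<Sum>(p, k)\<in>?P \<times> {2..N}. mangoldt (p^k) / real (p^k))"
      by (rule order_trans[OF sum_image_le]) (auto simp: mangoldt_nonneg case_prod_beta o_def)
    also have "... = (\<Sum>(p, k)\<in>?P \<times> {2..N}. ln (real p) / real p^k)"
      by (rule sum.cong) (auto simp: mangoldt_primepow')
    also have "... = (\<Sum>p\<in>?P. \<Sum>k\<in>{2..N}. ln (real p) / real p^k)" by (rule sum.cartesian_product[symmetric])
    also have "... \<le> (\<Sum>p\<in>?P. g p)" unfolding g_def by (intro sum_mono sum_ln_over_powers_le) auto
    also have "... \<le> suminf g" by (rule sum_le_suminf[OF summable]) (auto simp: g_def)
    finally show ?thesis .
  qed
  thus ?thesis by blast
qed

lemma nonprime_part_bounded: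
  obtains C where "\<And>N h. 0 \<le> (\<Sum>d\<in>{d\<in>{1..N}. \<not> prime d \<and> h d}. mangoldt d / real d)"
    "\<And>N h. (\<Sum>d\<in>{d\<in>{1..N}. \<not> prime d \<and> h d}. mangoldt d / real d) \<le> C"
proof -
  obtain C where C: "\<And>N. (\<Sum>d\<in>{d\<in>{1..N}. \<not> prime d}. mangoldt d / real d) \<le> C"
    using mangoldt_nonprime_bounded by blast
  have "(\<Sum>d\<in>{d\<in>{1..N}. \<not> prime d \<and> h d}. mangoldt d / real d) \<le> C" for N h
    by (rule order_trans[OF sum_mono2 C[of N]]) (auto simp: mangoldt_nonneg)
  moreover have "0 \<le> (\<Sum>d\<in>{d\<in>{1..N}. \<not> prime d \<and> h d}. mangoldt d / real d)" for N h
    by (rule sum_nonneg) (auto simp: mangoldt_nonneg)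
  ultimately show ?thesis using that by blast
qed

lemma sum_prime_split:
  fixes h :: "nat \<Rightarrow> bool"
  shows "(\<Sum>d\<in>{d\<in>{1..N}. h d}. mangoldt d / real d) = (\<Sum>p\<in>{p\<in>{1..N}. prime p \<and> h p}. ln (real p) / real p)
    + (\<Sum>d\<in>{d\<in>{1..N}. \<not> prime d \<and> h d}. mangoldt d / real d)"
proof -
  have "{d \<in> {1..N}. h d} = {p \<in> {1..N}. prime p \<and> h p} \<union> {d \<in> {1..N}. \<not> prime d \<and> h d}" by auto
  hence "(\<Sum>d\<in>{d\<in>{1..N}. h d}. mangoldt d / real d) = (\<Sum>p\<in>{p\<in>{1..N}. prime p \<and> h p}. mangoldt p / real p)
    + (\<Sum>d\<in>{d\<in>{1..N}. \<not> prime d \<and> h d}. mangoldt d / real d)"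
    by (simp only:) (rule sum.union_disjoint, auto)
  moreover have "(\<Sum>p\<in>{p\<in>{1..N}. prime p \<and> h p}. mangoldt p / real p)
    = (\<Sum>p\<in>{p\<in>{1..N}. prime p \<and> h p}. ln (real p) / real p)"
    by (rule sum.cong) (auto simp: mangoldt_prime)
  ultimately show ?thesis by simp
qed

theorem mertens_primes:
  "\<exists>C. \<forall>N\<ge>1. \<bar>(\<Sum>p\<in>{p\<in>{1..N}. prime p}. ln (real p) / real p) - ln (real N)\<bar> \<le> C"
proof -
  obtain C where C: "\<And>N h. 0 \<le> (\<Sum>d\<in>{d\<in>{1..N}. \<not> prime d \<and> h d}. mangoldt d / real d)"
    "\<And>N h. (\<Sum>d\<in>{d\<in>{1..N}. \<not> prime d \<and> h d}. mangoldt d / real d) \<le> C" using nonprime_part_bounded by blast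
  have "\<bar>(\<Sum>p\<in>{p\<in>{1..N}. prime p}. ln (real p) / real p) - ln (real N)\<bar> \<le> 4 + C" if "N \<ge> 1" for N
    using mertens_mangoldt[OF that] sum_prime_split[of N "\<lambda>_. True", unfolded simp_thms Collect_mem_eq]
      C[of N "\<lambda>_. True", unfolded simp_thms] by linarith
  thus ?thesis by blast
qed

lemma mangoldt_even_bounded:
  obtains C where "\<And>N. (\<Sum>d\<in>{d\<in>{1..N}. even d}. mangoldt d / real d) \<le> C"
proof -
  obtain C where C: "\<And>N h. 0 \<le> (\<Sum>d\<in>{d\<in>{1..N}. \<not> prime d \<and> h d}. mangoldt d / real d)"
    "\<And>N h. (\<Sum>d\<in>{d\<in>{1..N}. \<not> prime d \<and> h d}. mangoldt d / real d) \<le> C" using nonprime_part_bounded by blast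
  have "(\<Sum>d\<in>{d\<in>{1..N}. even d}. mangoldt d / real d) \<le> C + 1" for N
  proof -
    have "p = 2" if "prime p" "even p" for p :: nat
      using that prime_odd_nat[of p] prime_ge_2_nat[of p] by (cases "p = 2") auto
    hence "(\<Sum>p\<in>{p\<in>{1..N}. prime p \<and> even p}. ln (real p) / real p) \<le> (\<Sum>p\<in>{2::nat}. ln (real p) / real p)"
      by (intro sum_mono2) auto
    also have "... \<le> 1" using ln_2_less_1 by simp
    finally show ?thesis using sum_prime_split[of N even] C(2)[of N even] by linarith
  qed
  thus ?thesis by (rule that)
qed

lemma mertens_mangoldt_1_mod_8:
  "\<exists>C. \<forall>N\<ge>1. \<bar>(\<Sum>d\<in>{d\<in>{1..N}. d mod 8 = 1}. mangoldt d / real d) - ln (real N) / 4\<bar> \<le> C"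
proof -
  obtain C where C: "\<And>N. (\<Sum>d\<in>{d\<in>{1..N}. even d}. mangoldt d / real d) \<le> C"
    using mangoldt_even_bounded by blast
  let ?S = "\<lambda>N c. \<Sum>d\<in>{1..N}. c d * (mangoldt d / real d)"
  obtain C1 where C1: "\<And>N. \<bar>?S N (\<lambda>d. chi_minus_4_values ! (d mod 8))\<bar> \<le> C1" using mertens_chi_minus_4 by auto
  obtain C2 where C2: "\<And>N. \<bar>?S N (\<lambda>d. chi_8_values ! (d mod 8))\<bar> \<le> C2" using mertens_chi_8 by auto
  obtain C3 where C3: "\<And>N. \<bar>?S N (\<lambda>d. chi_minus_8_values ! (d mod 8))\<bar> \<le> C3" using mertens_chi_minus_8 by auto
  have "\<bar>(\<Sum>d\<in>{d\<in>{1..N}. d mod 8 = 1}. mangoldt d / real d) - ln (real N) / 4\<bar> \<le> 4 + C + C1 + C2 + C3"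
    if N: "N \<ge> 1" for N
  proof -
    have "(\<Sum>d\<in>{d\<in>{1..N}. d mod 8 = 1}. mangoldt d / real d) = ?S N (\<lambda>d. if d mod 8 = 1 then 1 else 0)"
      by (subst sum.inter_filter) (auto intro: sum.cong)
    also have "... = (?S N (\<lambda>d. if odd d then 1 else 0) + ?S N (\<lambda>d. chi_minus_4_values ! (d mod 8))
      + ?S N (\<lambda>d. chi_8_values ! (d mod 8)) + ?S N (\<lambda>d. chi_minus_8_values ! (d mod 8))) / 4"
      unfolding indicator_1_mod_8 sum.distrib[symmetric] sum_divide_distrib
      by (rule sum.cong) (auto simp: field_simps)
    also have "?S N (\<lambda>d. if odd d then 1 else 0)
      = (\<Sum>d\<in>{1..N}. mangoldt d / real d) - (\<Sum>d\<in>{d\<in>{1..N}. even d}. mangoldt d / real d)"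
      by (subst sum.inter_filter) (auto simp: sum_subtractf[symmetric] intro!: sum.cong)
    finally have "4 * (\<Sum>d\<in>{d\<in>{1..N}. d mod 8 = 1}. mangoldt d / real d)
      = (\<Sum>d\<in>{1..N}. mangoldt d / real d) - (\<Sum>d\<in>{d\<in>{1..N}. even d}. mangoldt d / real d)
      + ?S N (\<lambda>d. chi_minus_4_values ! (d mod 8)) + ?S N (\<lambda>d. chi_8_values ! (d mod 8))
      + ?S N (\<lambda>d. chi_minus_8_values ! (d mod 8))"
      by simp
    moreover have "0 \<le> (\<Sum>d\<in>{d\<in>{1..N}. even d}. mangoldt d / real d)"
      by (rule sum_nonneg) (auto simp: mangoldt_nonneg)
    ultimately show ?thesis using mertens_mangoldt[OF N] C[of N] C1[of N] C2[of N] C3[of N] by linarith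
  qed
  thus ?thesis by blast
qed

theorem mertens_1_mod_8:
  "\<exists>C. \<forall>N\<ge>1. \<bar>(\<Sum>p\<in>{p\<in>{1..N}. prime p \<and> p mod 8 = 1}. ln (real p) / real p) - ln (real N) / 4\<bar> \<le> C"
proof -
  obtain C where C: "\<And>N h. 0 \<le> (\<Sum>d\<in>{d\<in>{1..N}. \<not> prime d \<and> h d}. mangoldt d / real d)"
    "\<And>N h. (\<Sum>d\<in>{d\<in>{1..N}. \<not> prime d \<and> h d}. mangoldt d / real d) \<le> C" using nonprime_part_bounded by blast
  obtain C' where C': "\<And>N. N \<ge> 1 \<Longrightarrow> \<bar>(\<Sum>d\<in>{d\<in>{1..N}. d mod 8 = 1}. mangoldt d / real d) - ln (real N) / 4\<bar> \<le> C'"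
    using mertens_mangoldt_1_mod_8 by blast
  have "\<bar>(\<Sum>p\<in>{p\<in>{1..N}. prime p \<and> p mod 8 = 1}. ln (real p) / real p) - ln (real N) / 4\<bar> \<le> C' + C" if "N \<ge> 1"
    for N
    using C'[OF that] sum_prime_split[of N "\<lambda>d. d mod 8 = 1"] C[of N "\<lambda>d. d mod 8 = 1"] by linarith
  thus ?thesis by blast
qed

section \<open>Counting pairs of primes\<close>

definition primes_1_mod_8 :: "nat set" where "primes_1_mod_8 = {p. prime p \<and> [p = 1] (mod 8)}"

lemma primes_1_mod_8D: assumes "p \<in> primes_1_mod_8" shows "prime p" "[p = 1] (mod 8)" "p > 0"
  using assms unfolding primes_1_mod_8_def by (auto simp: prime_gt_0_nat)

lemma finite_if_le_real: assumes "\<And>n::nat. n \<in> A \<Longrightarrow> real n \<le> x" shows "finite A"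
proof (rule finite_subset)
  show "A \<subseteq> {..nat \<lfloor>x\<rfloor>}" using assms by (auto simp: le_nat_floor)
qed simp

lemma sum_interval_split:
  fixes a b c :: real
  assumes "a \<le> b" "b \<le> c"
  shows "(\<Sum>p\<in>{p\<in>A::nat set. a < real p \<and> real p \<le> c}. h p)
    = (\<Sum>p\<in>{p\<in>A. a < real p \<and> real p \<le> b}. h p) + (\<Sum>p\<in>{p\<in>A. b < real p \<and> real p \<le> c}. h p)"
proof -
  have "{p \<in> A. a < real p \<and> real p \<le> c} = {p \<in> A. a < real p \<and> real p \<le> b} \<union> {p \<in> A. b < real p
    \<and> real p \<le> c}" using assms by auto
  moreover have "finite {p \<in> A. a < real p \<and> real p \<le> b}" "finite {p \<in> A. b < real p \<and> real p \<le> c}"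
    by (rule finite_if_le_real[of _ b], simp) (rule finite_if_le_real[of _ c], simp)
  moreover have "{p \<in> A. a < real p \<and> real p \<le> b} \<inter> {p \<in> A. b < real p \<and> real p \<le> c} = {}" by auto
  ultimately show ?thesis by (simp only: sum.union_disjoint)
qed

subsection \<open>Sums over primes up to a real number\<close>

lemma sum_le_real_ln_bound:
  fixes A :: "nat set"
  assumes bound: "\<And>N. N \<ge> 1 \<Longrightarrow> \<bar>(\<Sum>p\<in>{p\<in>{1..N}. p \<in> A}. g p) - c * ln (real N)\<bar> \<le> C" and A: "0 \<notin> A"
    and x: "x \<ge> 1"
  shows "\<bar>(\<Sum>p\<in>{p\<in>A. real p \<le> x}. g p) - c * ln x\<bar> \<le> C + \<bar>c\<bar>"
proof -
  define N where "N = nat \<lfloor>x\<rfloor>"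
  have N: "N \<ge> 1" "real N \<le> x" "x < real N + 1" unfolding N_def using x by linarith+
  have "real p \<le> x \<longleftrightarrow> p \<le> N" for p unfolding N_def using x by (simp add: le_nat_iff le_floor_iff)
  hence set_eq: "{p \<in> A. real p \<le> x} = {p \<in> {1..N}. p \<in> A}" using A by (auto simp: Suc_le_eq intro!: gr0I)
  have "\<bar>c * ln (real N) - c * ln x\<bar> \<le> \<bar>c\<bar>"
  proof -
    have "x / real N \<le> 2" using N by (simp add: field_simps)
    hence "ln (x / real N) \<le> ln 2" using N x by (intro ln_mono) auto
    moreover have "ln (real N) \<le> ln x" using N by simp
    ultimately have "\<bar>ln (real N) - ln x\<bar> \<le> 1" using N x ln_2_less_1 by (simp add: ln_div)
    hence "\<bar>c\<bar> * \<bar>ln (real N) - ln x\<bar> \<le> \<bar>c\<bar> * 1" by (intro mult_left_mono) auto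
    thus ?thesis by (simp add: abs_mult[symmetric] right_diff_distrib)
  qed
  thus ?thesis unfolding set_eq using bound[OF N(1)] by linarith
qed

lemma sum_ln_primes_le:
  obtains C where "C \<ge> 0" "\<And>x. x \<ge> 1 \<Longrightarrow> (\<Sum>p\<in>{p. prime p \<and> real p \<le> x}. ln (real p) / real p) \<le> ln x + C"
proof -
  obtain C where C: "\<And>N. N \<ge> 1 \<Longrightarrow> \<bar>(\<Sum>p\<in>{p\<in>{1..N}. prime p}. ln (real p) / real p) - ln (real N)\<bar> \<le> C"
    using mertens_primes by blast
  have bound: "\<bar>(\<Sum>p\<in>{p. prime p \<and> real p \<le> x}. ln (real p) / real p) - ln x\<bar> \<le> C + 1" if "x \<ge> 1" for x
    using sum_le_real_ln_bound[where A = "{p. prime p}" and c = 1, OF _ _ that] C by simp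
  have "(\<Sum>p\<in>{p. prime p \<and> real p \<le> x}. ln (real p) / real p) \<le> ln x + (C + 1)" if "x \<ge> 1" for x
    using bound[OF that] by linarith
  moreover have "C + 1 \<ge> 0" using bound[of 1] by linarith
  ultimately show ?thesis using that by blast
qed

lemma sum_ln_primes_1_mod_8_ge:
  obtains C where "C \<ge> 0" "\<And>x y. 1 \<le> x \<Longrightarrow> x \<le> y \<Longrightarrow>
    (\<Sum>p\<in>{p\<in>primes_1_mod_8. x < real p \<and> real p \<le> y}. ln (real p) / real p) \<ge> (ln y - ln x) / 4 - C"
proof -
  obtain C where "\<And>N. N \<ge> 1 \<Longrightarrow> \<bar>(\<Sum>p\<in>{p\<in>{1..N}. prime p \<and> p mod 8 = 1}. ln (real p) / real p) - ln (real N) / 4\<bar>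
    \<le> C"
    using mertens_1_mod_8 by blast
  hence C: "\<bar>(\<Sum>p\<in>{p\<in>{1..N}. p \<in> primes_1_mod_8}. ln (real p) / real p) - 1 / 4 * ln (real N)\<bar> \<le> C" if "N \<ge> 1"
    for N
    using that by (simp add: primes_1_mod_8_def Cong.cong_def)
  have bound: "\<bar>(\<Sum>p\<in>{p\<in>primes_1_mod_8. real p \<le> x}. ln (real p) / real p) - 1 / 4 * ln x\<bar> \<le> C + 1 / 4"
    if "x \<ge> 1" for x
    using sum_le_real_ln_bound[OF C _ that] primes_1_mod_8D(3) by fastforce
  have "(\<Sum>p\<in>{p\<in>primes_1_mod_8. x < real p \<and> real p \<le> y}. ln (real p) / real p)
    \<ge> (ln y - ln x) / 4 - 2 * (C + 1 / 4)"
    if x: "1 \<le> x" and y: "x \<le> y" for x y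
  proof -
    have positive: "{p \<in> primes_1_mod_8. 0 < real p \<and> real p \<le> z} = {p \<in> primes_1_mod_8. real p \<le> z}" for z
      using primes_1_mod_8D(3) by auto
    show ?thesis
      using sum_interval_split[of 0 x y "\<lambda>p. ln (real p) / real p" primes_1_mod_8] bound[of x] bound[of y] x y
      unfolding positive by (simp add: abs_le_iff diff_divide_distrib)
  qed
  moreover have "2 * (C + 1 / 4) \<ge> 0" using bound[of 1] by simp
  ultimately show ?thesis using that by blast
qed

lemma count_primes_1_mod_8_ge:
  obtains c y0 where "c > 0" "y0 \<ge> 2" "\<And>y. y \<ge> y0 \<Longrightarrow> real (card {q \<in> primes_1_mod_8. real q \<le> y})
    \<ge> c * y / ln y"
proof -
  obtain C where C: "C \<ge> 0" "\<And>x y. 1 \<le> x \<Longrightarrow> x \<le> y \<Longrightarrow>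
    (\<Sum>p\<in>{p\<in>primes_1_mod_8. x < real p \<and> real p \<le> y}. ln (real p) / real p) \<ge> (ln y - ln x) / 4 - C"
    using sum_ln_primes_1_mod_8_ge by blast
  define K where "K = exp (4 * (C + 1))"
  have K: "K \<ge> 1" unfolding K_def using C(1) by simp
  have "real (card {q \<in> primes_1_mod_8. real q \<le> y}) \<ge> 1 / K * y / ln y" if y: "y \<ge> max 2 K" for y
  proof -
    let ?I = "{q \<in> primes_1_mod_8. y / K < real q \<and> real q \<le> y}"
    have y_pos: "y > 0" "ln y > 0" "1 \<le> y / K" "y / K \<le> y" using y K by (auto simp: field_simps)
    hence weight_nonneg: "0 \<le> ln y / (y / K)"
      by (meson divide_nonneg_nonneg less_imp_le order_trans zero_le_one)
    have "1 = (ln y - ln (y / K)) / 4 - C"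
      using y_pos unfolding K_def by (simp add: ln_div add_divide_distrib)
    also have "... \<le> (\<Sum>p\<in>?I. ln (real p) / real p)" using C(2) y_pos by simp
    also have "... \<le> real (card ?I) * (ln y / (y / K))"
    proof (rule sum_bounded_above)
      fix p assume "p \<in> ?I"
      thus "ln (real p) / real p \<le> ln y / (y / K)" using y_pos by (intro frac_le) auto
    qed
    also have "... \<le> real (card {q \<in> primes_1_mod_8. real q \<le> y}) * (ln y / (y / K))"
      by (intro mult_right_mono of_nat_mono card_mono finite_if_le_real[of _ y] weight_nonneg) auto
    finally show ?thesis using y_pos K by (simp add: field_simps)
  qed
  thus ?thesis using that[of "1 / K" "max 2 K"] K by simp
qed

lemma sum_inverse_primes_1_mod_8_square:
  obtains z0 where "z0 \<ge> 2" "\<And>z. z \<ge> z0 \<Longrightarrow> (\<Sum>p\<in>{p\<in>primes_1_mod_8. z < real p \<and> real p \<le> z^2}. 1 / real p)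
    \<ge> 1 / 16"
proof -
  obtain C where C: "C \<ge> 0" "\<And>x y. 1 \<le> x \<Longrightarrow> x \<le> y \<Longrightarrow>
    (\<Sum>p\<in>{p\<in>primes_1_mod_8. x < real p \<and> real p \<le> y}. ln (real p) / real p) \<ge> (ln y - ln x) / 4 - C"
    using sum_ln_primes_1_mod_8_ge by blast
  have "(\<Sum>p\<in>{p\<in>primes_1_mod_8. z < real p \<and> real p \<le> z^2}. 1 / real p) \<ge> 1 / 16"
    if z: "z \<ge> max 2 (exp (8 * C))" for z
  proof -
    let ?I = "{p \<in> primes_1_mod_8. z < real p \<and> real p \<le> z^2}"
    have ln_z: "ln z \<ge> 8 * C" "ln z > 0" using z by (auto simp: ln_ge_iff)
    have "ln z / 8 \<le> (ln (z^2) - ln z) / 4 - C" using ln_z z by (simp add: ln_realpow)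
    also have "... \<le> (\<Sum>p\<in>?I. ln (real p) / real p)" using z by (intro C(2)) (auto intro: self_le_power)
    also have "... \<le> (\<Sum>p\<in>?I. 2 * ln z * (1 / real p))"
    proof (rule sum_mono)
      fix p assume p: "p \<in> ?I"
      hence "ln (real p) \<le> ln (z^2)" using z by (intro ln_mono) auto
      thus "ln (real p) / real p \<le> 2 * ln z * (1 / real p)"
        using z by (simp add: ln_realpow divide_right_mono)
    qed
    also have "... = 2 * ln z * (\<Sum>p\<in>?I. 1 / real p)" by (rule sum_distrib_left[symmetric])
    finally show ?thesis using ln_z(2) by (simp add: field_simps)
  qed
  thus ?thesis using that[of "max 2 (exp (8 * C))"] by simp
qed

lemma sum_inverse_primes_1_mod_8_ge:
  obtains z0 where "z0 \<ge> 2"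
    "\<And>x y. z0 \<le> x \<Longrightarrow> x \<le> y \<Longrightarrow> (\<Sum>p\<in>{p\<in>primes_1_mod_8. x < real p \<and> real p \<le> y}. 1 / real p)
      \<ge> (ln (ln y / ln x) - 1) / 16"
proof -
  obtain z0 where z0: "z0 \<ge> 2" "\<And>z. z \<ge> z0 \<Longrightarrow> (\<Sum>p\<in>{p\<in>primes_1_mod_8. z < real p \<and> real p \<le> z^2}. 1 / real p)
    \<ge> 1 / 16"
    using sum_inverse_primes_1_mod_8_square by blast
  have tower: "(\<Sum>p\<in>{p\<in>primes_1_mod_8. z < real p \<and> real p \<le> z^(2^n)}. 1 / real p) \<ge> real n / 16"
    if z: "z \<ge> z0" for z n
  proof (induction n)
    case (Suc n)
    have "z \<le> z^(2^n)" "z^(2^n) \<le> (z^(2^n))^2" using z z0(1) by (auto intro!: self_le_power one_le_power)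
    thus ?case using sum_interval_split[of z "z^(2^n)" "(z^(2^n))^2" "\<lambda>p. 1 / real p" primes_1_mod_8]
        z0(2)[of "z^(2^n)"] Suc z by (simp add: power_mult[symmetric] mult.commute)
  qed (simp add: sum_nonneg)
  have "(\<Sum>p\<in>{p\<in>primes_1_mod_8. x < real p \<and> real p \<le> y}. 1 / real p) \<ge> (ln (ln y / ln x) - 1) / 16"
    if x: "z0 \<le> x" and y: "x \<le> y" for x y
  proof -
    define t n where "t = ln y / ln x" and "n = nat \<lfloor>log 2 t\<rfloor>"
    have ln_x: "ln x > 0" using x z0(1) by simp
    have t: "t \<ge> 1" unfolding t_def using ln_x x y z0(1) by simp
    hence "ln t / 1 \<le> ln t / ln 2" using ln_2_less_1 by (intro divide_left_mono) auto
    moreover have "log 2 t \<ge> 0" using t by simp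
    ultimately have n: "real n \<le> log 2 t" "ln t - 1 \<le> real n" unfolding n_def log_def by linarith+
    have "2^n \<le> t" using n(1) t by (simp add: le_log_iff powr_realpow)
    hence "2^n * ln x \<le> ln y" unfolding t_def using ln_x by (simp add: field_simps)
    hence "ln (x^(2^n)) \<le> ln y" using x z0(1) by (simp add: ln_realpow)
    hence "x^(2^n) \<le> y" using x y z0(1) by (subst (asm) ln_le_cancel_iff) auto
    hence "(\<Sum>p\<in>{p\<in>primes_1_mod_8. x < real p \<and> real p \<le> x^(2^n)}. 1 / real p)
      \<le> (\<Sum>p\<in>{p\<in>primes_1_mod_8. x < real p \<and> real p \<le> y}. 1 / real p)"
      by (intro sum_mono2 finite_if_le_real[of _ y]) auto
    thus ?thesis using tower[OF x, of n] n(2) unfolding t_def by simp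
  qed
  thus ?thesis using that[OF z0(1)] by blast
qed

lemma sqrt_le_div_ln: assumes "x > 1" shows "sqrt x \<le> 2 * x / ln x"
proof -
  have "ln (sqrt x) \<le> sqrt x" using ln_le_minus_one[of "sqrt x"] assms by simp
  hence "sqrt x * ln x \<le> sqrt x * (2 * sqrt x)" using assms by (intro mult_left_mono) (auto simp: ln_sqrt)
  also have "... = 2 * x" using assms by simp
  finally show ?thesis using assms by (simp add: pos_le_divide_eq)
qed

theorem prime_count_le:
  assumes x: "x \<ge> 2"
  shows "real (card {p. prime p \<and> real p \<le> x}) \<le> 10 * x / ln x"
proof -
  define N S where "N = nat \<lfloor>x\<rfloor>" and "S = {p. prime p \<and> sqrt x < real p \<and> real p \<le> x}"
  have N: "real N \<le> x" unfolding N_def using x by simp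
  have ln_x: "ln x > 0" using x by simp
  have S: "S \<subseteq> {1..N}" unfolding N_def S_def by (auto simp: le_nat_floor Suc_le_eq prime_gt_0_nat)
  have "real (card S) * (ln x / 2) \<le> (\<Sum>p\<in>S. mangoldt p)"
  proof (rule sum_bounded_below)
    fix p assume p: "p \<in> S"
    hence "ln (sqrt x) \<le> ln (real p)" unfolding S_def using x by (intro ln_mono) auto
    thus "ln x / 2 \<le> mangoldt p" using p x unfolding S_def by (simp add: ln_sqrt mangoldt_prime)
  qed
  also have "... \<le> chebyshev_psi N"
    unfolding chebyshev_psi_def by (rule sum_mono2) (use S mangoldt_nonneg in auto)
  also have "... \<le> 4 * x" using chebyshev_psi_le[of N] N by linarith
  finally have card_S: "real (card S) \<le> 8 * x / ln x" using ln_x by (simp add: field_simps)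
  let ?T = "{p. prime p \<and> real p \<le> sqrt x}"
  have "{p. prime p \<and> real p \<le> x} \<subseteq> S \<union> ?T" unfolding S_def by auto
  moreover have "finite S" "finite ?T" using S finite_subset by (blast, intro finite_if_le_real) auto
  ultimately have "card {p. prime p \<and> real p \<le> x} \<le> card S + card ?T"
    by (intro order_trans[OF card_mono card_Un_le]) auto
  moreover have "real (card ?T) \<le> sqrt x"
    using x by (intro card_primes_le finite_if_le_real[of _ "sqrt x"]) auto
  ultimately have "real (card {p. prime p \<and> real p \<le> x}) \<le> 8 * x / ln x + 2 * x / ln x"
    using card_S sqrt_le_div_ln[of x] x by linarith
  thus ?thesis by (simp add: add_divide_distrib[symmetric])
qed

lemma sum_inverse_primes_le:
  obtains C where "C \<ge> 0"
    "\<And>x y. 1 < y \<Longrightarrow> 1 \<le> x \<Longrightarrow> (\<Sum>p\<in>{p. prime p \<and> y \<le> real p \<and> real p \<le> x}. 1 / real p) \<le> (ln x + C) / ln y"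
proof -
  obtain C where C: "C \<ge> 0" "\<And>x. x \<ge> 1 \<Longrightarrow> (\<Sum>p\<in>{p. prime p \<and> real p \<le> x}. ln (real p) / real p) \<le> ln x + C"
    using sum_ln_primes_le by blast
  have "(\<Sum>p\<in>{p. prime p \<and> y \<le> real p \<and> real p \<le> x}. 1 / real p) \<le> (ln x + C) / ln y" if y: "1 < y"
    and x: "1 \<le> x" for x y
  proof -
    let ?A = "{p. prime p \<and> y \<le> real p \<and> real p \<le> x}"
    have "(\<Sum>p\<in>?A. 1 / real p) \<le> (\<Sum>p\<in>?A. ln (real p) / real p / ln y)"
    proof (rule sum_mono)
      fix p assume "p \<in> ?A"
      hence "ln y \<le> ln (real p)" "real p > 0" using y by auto
      thus "1 / real p \<le> ln (real p) / real p / ln y" using y by (simp add: field_simps)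
    qed
    also have "... = (\<Sum>p\<in>?A. ln (real p) / real p) / ln y" by (rule sum_divide_distrib[symmetric])
    also have "... \<le> (\<Sum>p\<in>{p. prime p \<and> real p \<le> x}. ln (real p) / real p) / ln y"
      using y by (intro divide_right_mono sum_mono2 finite_if_le_real[of _ x])
        (auto intro!: divide_nonneg_nonneg ln_ge_zero dest: prime_ge_1_nat)
    also have "... \<le> (ln x + C) / ln y" using C(2)[OF x] y by (intro divide_right_mono) auto
    finally show ?thesis .
  qed
  thus ?thesis using that C(1) by blast
qed

text \<open>Cutting the sum at \<open>exp (sqrt (ln x))\<close> gives a cheap substitute for Mertens' second theorem.\<close>
lemma sum_inverse_primes_bigo: "(\<lambda>x. \<Sum>p\<in>{p. prime p \<and> real p \<le> x}. 1 / real p) \<in> O(\<lambda>x. sqrt (ln x))"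
proof -
  obtain C where C: "C \<ge> 0"
    "\<And>x y. 1 < y \<Longrightarrow> 1 \<le> x \<Longrightarrow> (\<Sum>p\<in>{p. prime p \<and> y \<le> real p \<and> real p \<le> x}. 1 / real p) \<le> (ln x + C) / ln y"
    using sum_inverse_primes_le by blast
  define g where "g x = (sqrt (ln x) + C) / ln 2 + (ln x + C) / sqrt (ln x)" for x
  have "(\<Sum>p\<in>{p. prime p \<and> real p \<le> x}. 1 / real p) \<le> g x" if x: "x \<ge> 2" for x
  proof -
    let ?A = "{p. prime p \<and> 2 \<le> real p \<and> real p \<le> exp (sqrt (ln x))}"
      and ?B = "{p. prime p \<and> exp (sqrt (ln x)) \<le> real p \<and> real p \<le> x}"
    have finite: "finite ?A" "finite ?B"
      by (rule finite_if_le_real[of _ "exp (sqrt (ln x))"], simp) (rule finite_if_le_real[of _ x], simp)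
    have "(\<Sum>p\<in>{p. prime p \<and> real p \<le> x}. 1 / real p) \<le> (\<Sum>p\<in>?A \<union> ?B. 1 / real p)"
      by (rule sum_mono2) (use finite in \<open>auto simp: prime_ge_2_nat\<close>)
    also have "... \<le> (\<Sum>p\<in>?A. 1 / real p) + (\<Sum>p\<in>?B. 1 / real p)"
      using finite by (subst sum.union_inter[symmetric]) (auto intro: sum_nonneg)
    also have "... \<le> g x" using C(2)[of 2 "exp (sqrt (ln x))"] C(2)[of "exp (sqrt (ln x))" x] x
      unfolding g_def by simp
    finally show ?thesis .
  qed
  hence "(\<lambda>x. \<Sum>p\<in>{p. prime p \<and> real p \<le> x}. 1 / real p) \<in> O(g)"
    by (intro bigoI[of _ 1] eventually_mono[OF eventually_ge_at_top[of 2]])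
      (auto simp: sum_nonneg intro: order_trans[OF _ abs_ge_self])
  also have "g \<in> O(\<lambda>x. sqrt (ln x))" unfolding g_def by real_asymp
  finally show ?thesis .
qed

subsection \<open>The main region of pairs\<close>

lemma power2_nat_ceiling_log: assumes "t \<ge> 1" shows "t \<le> 2^nat \<lceil>log 2 t\<rceil>" "2^nat \<lceil>log 2 t\<rceil> \<le> 2 * t"
proof -
  define n where "n = nat \<lceil>log 2 t\<rceil>"
  have "log 2 t \<ge> 0" using assms by simp
  hence "log 2 t \<le> real n" "real n \<le> log 2 t + 1" unfolding n_def by linarith+
  hence "2 powr log 2 t \<le> 2 powr real n" "2 powr real n \<le> 2 powr (log 2 t + 1)" by simp_all
  thus "t \<le> 2^nat \<lceil>log 2 t\<rceil>" "2^nat \<lceil>log 2 t\<rceil> \<le> 2 * t"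
    unfolding n_def[symmetric] using assms by (simp_all add: powr_realpow powr_add)
qed

lemma power2_nat_floor_log: assumes "t \<ge> 1" shows "2^nat \<lfloor>log 2 t\<rfloor> \<le> t" "t \<le> 2 * 2^nat \<lfloor>log 2 t\<rfloor>"
proof -
  define n where "n = nat \<lfloor>log 2 t\<rfloor>"
  have "log 2 t \<ge> 0" using assms by simp
  hence "real n \<le> log 2 t" "log 2 t \<le> real n + 1" unfolding n_def by linarith+
  hence "2 powr real n \<le> 2 powr log 2 t" "2 powr log 2 t \<le> 2 powr (real n + 1)" by simp_all
  thus "2^nat \<lfloor>log 2 t\<rfloor> \<le> t" "t \<le> 2 * 2^nat \<lfloor>log 2 t\<rfloor>"
    unfolding n_def[symmetric] using assms by (simp_all add: powr_realpow powr_add)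
qed

definition low_cut :: "real \<Rightarrow> real" where "low_cut X = 2^nat \<lceil>log 2 ((ln X)^2)\<rceil>"
definition high_cut :: "real \<Rightarrow> real" where "high_cut X = 2^nat \<lfloor>log 2 (X powr (1 / 7))\<rfloor>"

definition region_fst :: "real \<Rightarrow> nat set" where
  "region_fst X = {p \<in> primes_1_mod_8. low_cut X < real p \<and> real p \<le> high_cut X}"
definition region_snd :: "real \<Rightarrow> nat \<Rightarrow> nat set" where
  "region_snd X p = {q \<in> primes_1_mod_8. high_cut X < real q \<and> real p * real q \<le> X}"
definition region :: "real \<Rightarrow> (nat \<times> nat) set" where "region X = Sigma (region_fst X) (region_snd X)"

definition pq_scale :: "real \<Rightarrow> real" where "pq_scale X = X * ln (ln X) / ln X"

lemma low_cut: assumes "X \<ge> 3" shows "(ln X)^2 \<le> low_cut X" "low_cut X \<le> 2 * (ln X)^2"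
proof -
  have "ln X \<ge> 1" using assms exp_le by (subst ln_ge_iff) linarith+
  thus "(ln X)^2 \<le> low_cut X" "low_cut X \<le> 2 * (ln X)^2"
    unfolding low_cut_def by (simp_all add: power2_nat_ceiling_log)
qed

lemma high_cut: assumes "X \<ge> 1"
  shows "high_cut X \<ge> 1" "high_cut X \<le> X powr (1 / 7)" "X powr (1 / 7) / 2 \<le> high_cut X" "high_cut X^7 \<le> X"
proof -
  have "X powr (1 / 7) \<ge> 1" using assms by (simp add: ge_one_powr_ge_zero)
  thus le: "high_cut X \<le> X powr (1 / 7)" and "X powr (1 / 7) / 2 \<le> high_cut X"
    unfolding high_cut_def using power2_nat_floor_log[of "X powr (1 / 7)"] by simp_all
  show "high_cut X \<ge> 1" unfolding high_cut_def by simp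
  hence "high_cut X^7 \<le> (X powr (1 / 7))^7" using le by (intro power_mono) auto
  also have "... = X" using assms by (simp add: powr_power)
  finally show "high_cut X^7 \<le> X" .
qed

lemma eventually_low_cut_le_high_cut: "eventually (\<lambda>X. low_cut X \<le> high_cut X) at_top"
proof -
  have "eventually (\<lambda>X::real. 2 * (ln X)^2 \<le> X powr (1 / 7) / 2) at_top" by real_asymp
  thus ?thesis using eventually_ge_at_top[of 3]
  proof eventually_elim
    case (elim X)
    thus ?case using low_cut(2)[of X] high_cut(3)[of X] by linarith
  qed
qed

lemma finite_region: "finite (region_fst X)" "p \<in> region_fst X \<Longrightarrow> finite (region_snd X p)" "finite (region X)"
proof -
  show fst: "finite (region_fst X)" by (rule finite_if_le_real[of _ "high_cut X"]) (simp add: region_fst_def)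
  show snd: "finite (region_snd X p)" if "p \<in> region_fst X" for p
  proof (rule finite_if_le_real)
    fix q assume q: "q \<in> region_snd X p"
    have "real q * 1 \<le> real q * real p"
      using that primes_1_mod_8D(3) by (intro mult_left_mono) (auto simp: region_fst_def Suc_le_eq)
    thus "real q \<le> X" using q unfolding region_snd_def by (simp add: mult.commute)
  qed
  show "finite (region X)" unfolding region_def using fst snd by (rule finite_SigmaI)
qed

lemma sum_region: "(\<Sum>(p, q)\<in>region X. f p q) = (\<Sum>p\<in>region_fst X. \<Sum>q\<in>region_snd X p. f p q)"
  unfolding region_def by (rule sum.Sigma[symmetric]) (simp_all add: finite_region)

lemma dyadic_block_le:
  assumes f: "dyadic_small f" and P: "P \<ge> 1" "real P \<le> b" and b: "b^7 \<le> X"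
  shows "\<bar>\<Sum>p\<in>{p\<in>primes_1_mod_8. real P < real p \<and> real p \<le> 2 * real P}.
    \<Sum>q\<in>{q\<in>primes_1_mod_8. b < real q \<and> real p * real q \<le> X}. f p q\<bar> \<le> 23 * X * (1 / sqrt (real P))"
proof -
  let ?P = "{p \<in> primes_1_mod_8. real P < real p \<and> real p \<le> 2 * real P}"
    and ?Q = "{q \<in> primes_1_mod_8. b < real q \<and> real q \<le> X / real P}"
  let ?S = "\<Sum>p\<in>?P. \<Sum>q\<in>{q\<in>primes_1_mod_8. b < real q \<and> real p * real q \<le> X}. f p q"
  have P_X: "real P^7 \<le> X" using order_trans[OF power_mono[OF P(2)] b] by simp
  hence X: "X \<ge> 0" using order_trans[of 0 "real P^7" X] by simp
  have inner: "{q \<in> ?Q. real p * real q \<le> X} = {q \<in> primes_1_mod_8. b < real q \<and> real p * real q \<le> X}"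
    if "p \<in> ?P" for p
  proof -
    have "real q \<le> X / real P" if q: "real p * real q \<le> X" for q
    proof -
      have "real P * real q \<le> real p * real q" using \<open>p \<in> ?P\<close> by (intro mult_right_mono) auto
      thus ?thesis using q P by (simp add: field_simps)
    qed
    thus ?thesis by blast
  qed
  have "?S = (\<Sum>p\<in>?P. \<Sum>q\<in>{q\<in>?Q. real p * real q \<le> X}. f p q)" by (intro sum.cong refl) (simp only: inner)
  also have "...^2 \<le> 490 * real P * (X / real P)^2"
  proof (rule f[unfolded dyadic_small_def, rule_format, OF P(1) P_X])
    show "finite ?Q" by (rule finite_if_le_real[of _ "X / real P"]) simp
    show "prime p \<and> [p = 1] (mod 8) \<and> P < p \<and> p \<le> 2 * P" if "p \<in> ?P" for p
      using that primes_1_mod_8D of_nat_le_iff[of p "2 * P", where 'a = real] by auto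
    show "prime q \<and> [q = 1] (mod 8) \<and> real q \<le> X / real P" if "q \<in> ?Q" for q
      using that primes_1_mod_8D by auto
  qed
  also have "... \<le> (23 * X * (1 / sqrt (real P)))^2" using P by (simp add: power2_eq_square field_simps)
  finally show ?thesis using X by (simp only: abs_le_square_iff[symmetric]) simp
qed

lemma dyadic_sum_le:
  assumes f: "dyadic_small f" and k: "k0 \<le> k1" and X: "(2^k1)^7 \<le> X"
  shows "\<bar>\<Sum>p\<in>{p\<in>primes_1_mod_8. 2^k0 < real p \<and> real p \<le> 2^k1}.
    \<Sum>q\<in>{q\<in>primes_1_mod_8. 2^k1 < real q \<and> real p * real q \<le> X}. f p q\<bar> \<le> 92 * X / sqrt (2^k0)"
proof -
  define h where "h p = (\<Sum>q\<in>{q\<in>primes_1_mod_8. 2^k1 < real q \<and> real p * real q \<le> X}. f p q)" for p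
  define r where "r = 1 / sqrt (2::real)"
  have "4 / 3 \<le> sqrt (2::real)" by (rule real_le_rsqrt) (simp add: power2_eq_square)
  hence r: "0 < r" "r \<le> 3 / 4" unfolding r_def by (simp_all add: field_simps)
  have r_power: "r^j = 1 / sqrt (2^j)" for j unfolding r_def by (simp add: power_divide real_sqrt_power)
  have X_nonneg: "X \<ge> 0" using X order_trans[of 0 "((2::real)^k1)^7" X] by simp
  have "\<bar>\<Sum>p\<in>{p\<in>primes_1_mod_8. 2^k0 < real p \<and> real p \<le> 2^k}. h p\<bar> \<le> 92 * X * (r^k0 - r^k)"
    if "k0 \<le> k" "k \<le> k1" for k
    using that
  proof (induction k rule: dec_induct)
    case base
    have "{p \<in> primes_1_mod_8. 2^k0 < real p \<and> real p \<le> 2^k0} = {}" by auto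
    thus ?case by (simp only: sum.empty) simp
  next
    case (step k)
    let ?new = "\<Sum>p\<in>{p\<in>primes_1_mod_8. 2^k < real p \<and> real p \<le> 2^Suc k}. h p"
    have "\<bar>?new\<bar> \<le> 23 * X * r^k"
      using dyadic_block_le[OF f _ _ X, of "2^k"] step.prems unfolding h_def r_power by simp
    also have "... \<le> 23 * X * (r^k * (4 * (1 - r)))" using r X_nonneg by (intro mult_left_mono) auto
    also have "... = 92 * X * (r^k0 - r^Suc k) - 92 * X * (r^k0 - r^k)" by (simp add: algebra_simps)
    finally show ?case
      using sum_interval_split[of "2^k0" "2^k" "2^Suc k" h primes_1_mod_8] step.IH step.prems step.hyps
      by simp
  qed
  from this[OF k order_refl] have "\<bar>\<Sum>p\<in>{p\<in>primes_1_mod_8. 2^k0 < real p \<and> real p \<le> 2^k1}. h p\<bar>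
    \<le> 92 * X * (r^k0 - r^k1)" .
  also have "... \<le> 92 * X * r^k0" using X_nonneg r by (intro mult_left_mono) auto
  finally show ?thesis unfolding r_power h_def by simp
qed

definition negligible :: "(nat \<Rightarrow> nat \<Rightarrow> real) \<Rightarrow> bool" where
  "negligible f \<longleftrightarrow> (\<lambda>X. \<Sum>(p, q)\<in>region X. f p q) \<in> o(pq_scale)"

lemma negligible_add: "negligible f \<Longrightarrow> negligible g \<Longrightarrow> negligible (\<lambda>p q. f p q + g p q)"
  unfolding negligible_def case_prod_unfold sum.distrib by (rule sum_in_smallo)

theorem dyadic_small_imp_negligible: assumes "dyadic_small f" shows "negligible f"
proof -
  have "eventually (\<lambda>X. norm (\<Sum>(p, q)\<in>region X. f p q) \<le> 92 * norm (X / ln X)) at_top"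
    using eventually_low_cut_le_high_cut eventually_ge_at_top[of 3]
  proof eventually_elim
    case (elim X)
    have "norm (\<Sum>(p, q)\<in>region X. f p q) \<le> 92 * X / sqrt (low_cut X)"
      using dyadic_sum_le[OF assms, of "nat \<lceil>log 2 ((ln X)^2)\<rceil>" "nat \<lfloor>log 2 (X powr (1 / 7))\<rfloor>" X] elim
        high_cut(4)[of X]
      unfolding sum_region region_fst_def region_snd_def low_cut_def high_cut_def by simp
    also have "... \<le> 92 * X / ln X"
      using low_cut(1)[of X] elim
      by (intro divide_left_mono real_le_rsqrt mult_pos_pos) (auto simp: low_cut_def)
    finally show ?case using elim by simp
  qed
  hence "(\<lambda>X. \<Sum>(p, q)\<in>region X. f p q) \<in> O(\<lambda>X. X / ln X)" by (rule bigoI)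
  also have "(\<lambda>X. X / ln X) \<in> o(pq_scale)" unfolding pq_scale_def by real_asymp
  finally show ?thesis unfolding negligible_def .
qed

lemma card_region_snd_ge:
  assumes c: "c > 0" "y0 \<ge> 2" "\<And>y. y \<ge> y0 \<Longrightarrow> real (card {q \<in> primes_1_mod_8. real q \<le> y}) \<ge> c * y / ln y"
    and X: "X / high_cut X \<ge> y0" "X \<ge> 2" and p: "p \<in> region_fst X"
  shows "c * X / ln X * (1 / real p) - high_cut X \<le> real (card (region_snd X p))"
proof -
  have p_bounds: "real p \<ge> 1" "real p \<le> high_cut X"
    using p primes_1_mod_8D(3) unfolding region_fst_def by (auto simp: Suc_le_eq)
  define y where "y = X / real p"
  have "X / high_cut X \<le> y" unfolding y_def using p_bounds X by (intro divide_left_mono) auto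
  hence y: "y \<ge> y0" "y \<ge> 2" using X c(2) by linarith+
  have "y \<le> X" unfolding y_def using p_bounds X by (simp add: field_simps)
  hence "c * y / ln X \<le> c * y / ln y" using y c(1) by (intro divide_left_mono mult_pos_pos) auto
  also have "... \<le> real (card {q \<in> primes_1_mod_8. real q \<le> y})" by (rule c(3)[OF y(1)])
  also have "... \<le> real (card (region_snd X p)) + real (card {q. prime q \<and> real q \<le> high_cut X})"
    unfolding of_nat_add[symmetric]
  proof (rule of_nat_mono, rule order_trans[OF card_mono card_Un_le])
    have "real p * real q \<le> X \<longleftrightarrow> real q \<le> y" for q unfolding y_def using p_bounds by (simp add: field_simps)
    thus "{q \<in> primes_1_mod_8. real q \<le> y} \<subseteq> region_snd X p \<union> {q. prime q \<and> real q \<le> high_cut X}"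
      unfolding region_snd_def using primes_1_mod_8D(1) by auto
    show "finite (region_snd X p \<union> {q. prime q \<and> real q \<le> high_cut X})"
      using finite_region(2)[OF p] finite_if_le_real[of "{q. prime q \<and> real q \<le> high_cut X}"] by auto
  qed
  also have "real (card {q. prime q \<and> real q \<le> high_cut X}) \<le> high_cut X"
    by (rule card_primes_le, rule finite_if_le_real[of _ "high_cut X"]) (auto simp: high_cut_def)
  finally show ?thesis unfolding y_def by (simp add: mult.commute)
qed

lemma sum_inverse_region_fst_ge: "eventually (\<lambda>X. ln (ln X) / 32 \<le> (\<Sum>p\<in>region_fst X. 1 / real p)) at_top"
proof -
  obtain z0 where z0: "z0 \<ge> 2"
    "\<And>x y. z0 \<le> x \<Longrightarrow> x \<le> y \<Longrightarrow> (\<Sum>p\<in>{p\<in>primes_1_mod_8. x < real p \<and> real p \<le> y}. 1 / real p)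
      \<ge> (ln (ln y / ln x) - 1) / 16"
    using sum_inverse_primes_1_mod_8_ge by blast
  have "eventually (\<lambda>X::real. (ln X)^2 \<ge> z0) at_top" "eventually (\<lambda>X::real. X powr (1 / 7) / 2 \<ge> z0) at_top"
    "eventually (\<lambda>X::real. ln (ln X) / 2 \<le> ln (ln (X powr (1 / 7) / 2) / ln (2 * (ln X)^2)) - 1) at_top"
      by real_asymp+
  thus ?thesis using eventually_low_cut_le_high_cut eventually_ge_at_top[of 3]
  proof eventually_elim
    case (elim X)
    have low: "z0 \<le> low_cut X" "low_cut X \<le> 2 * (ln X)^2" using low_cut[of X] elim by linarith+
    have high: "X powr (1 / 7) / 2 \<le> high_cut X" using high_cut(3)[of X] elim by linarith
    have "ln (X powr (1 / 7) / 2) \<le> ln (high_cut X)" "ln (low_cut X) \<le> ln (2 * (ln X)^2)"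
      using low high elim z0(1) by (intro ln_mono; linarith)+
    moreover have "ln (low_cut X) > 0" "ln (X powr (1 / 7) / 2) > 0"
      using low elim z0(1) by (intro ln_gt_zero; linarith)+
    ultimately have "ln (X powr (1 / 7) / 2) / ln (2 * (ln X)^2) \<le> ln (high_cut X) / ln (low_cut X)"
      "0 < ln (X powr (1 / 7) / 2) / ln (2 * (ln X)^2)" by (auto intro: frac_le)
    hence "ln (ln (X powr (1 / 7) / 2) / ln (2 * (ln X)^2)) \<le> ln (ln (high_cut X) / ln (low_cut X))"
      by (intro ln_mono) auto
    thus ?case using z0(2)[OF low(1)] elim unfolding region_fst_def by force
  qed
qed

lemma card_region_ge:
  obtains c where "c > 0" "eventually (\<lambda>X. c * pq_scale X \<le> real (card (region X))) at_top"
proof -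
  obtain c y0 where c: "c > 0" "y0 \<ge> 2" "\<And>y. y \<ge> y0 \<Longrightarrow> real (card {q \<in> primes_1_mod_8. real q \<le> y})
    \<ge> c * y / ln y"
    using count_primes_1_mod_8_ge by blast
  have "eventually (\<lambda>X::real. X / X powr (1 / 7) \<ge> y0) at_top"
    "eventually (\<lambda>X. (X powr (1 / 7))^2 \<le> c / 64 * pq_scale X) at_top"
    unfolding pq_scale_def using c(1) by real_asymp+
  hence "eventually (\<lambda>X. c / 64 * pq_scale X \<le> real (card (region X))) at_top"
    using sum_inverse_region_fst_ge eventually_ge_at_top[of 3]
  proof eventually_elim
    case (elim X)
    have high: "high_cut X \<ge> 1" "high_cut X \<le> X powr (1 / 7)" using high_cut[of X] elim by auto
    have "X / X powr (1 / 7) \<le> X / high_cut X" using high elim by (intro divide_left_mono) auto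
    hence X: "X / high_cut X \<ge> y0" "X \<ge> 2" using elim by linarith+
    have "region_fst X \<subseteq> {p. prime p \<and> real p \<le> high_cut X}"
      unfolding region_fst_def using primes_1_mod_8D(1) by auto
    hence "real (card (region_fst X)) \<le> high_cut X" using high finite_region(1) by (intro card_primes_le) auto
    hence "real (card (region_fst X)) * high_cut X \<le> (X powr (1 / 7))^2"
      unfolding power2_eq_square using high by (intro mult_mono) auto
    moreover have "c * X / ln X * (ln (ln X) / 32) \<le> c * X / ln X * (\<Sum>p\<in>region_fst X. 1 / real p)"
      using elim c(1) by (intro mult_left_mono) auto
    moreover have "c * X / ln X * (\<Sum>p\<in>region_fst X. 1 / real p) - real (card (region_fst X)) * high_cut X
      = (\<Sum>p\<in>region_fst X. c * X / ln X * (1 / real p) - high_cut X)"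
      by (simp only: sum_subtractf sum_distrib_left sum_constant)
    moreover have "... \<le> (\<Sum>p\<in>region_fst X. real (card (region_snd X p)))"
      by (intro sum_mono card_region_snd_ge[OF c X])
    moreover have "... = real (card (region X))"
      unfolding region_def using finite_region by (simp add: card_SigmaI)
    moreover have "c * X / ln X * (ln (ln X) / 32) - c / 64 * pq_scale X = c / 64 * pq_scale X"
      unfolding pq_scale_def by simp
    ultimately show ?case using elim(2) by linarith
  qed
  thus ?thesis using that[of "c / 64"] c(1) by simp
qed

definition split_region :: "real \<Rightarrow> (nat \<times> nat) set" where
  "split_region X = {(p, q) \<in> region X. Legendre (int q) (int p) = 1}"

lemma Legendre_negligible: "negligible (\<lambda>p q. of_int (Legendre (int q) (int p)))"
proof -
  have "dyadic_small (\<lambda>p q. 1 * of_int (Legendre (int q) (int p)))"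
  proof (rule character_dyadic_small)
    show "\<bar>Legendre x (int p)\<bar> \<le> 1" for p x using Legendre_values[of x "int p"] by auto
    show "(\<Sum>x\<in>{0..<int p}. Legendre x (int p)) = 0" if "prime p" "[p = 1] (mod 8)" for p
      by (rule sum_Legendre[OF that(1) Legendre_1_mod_8(3)[OF that]])
  qed (auto simp: Legendre_mod)
  thus ?thesis using dyadic_small_imp_negligible by simp
qed

lemma card_split_region:
  "2 * real (card (split_region X))
    = real (card (region X)) + (\<Sum>(p, q)\<in>region X. of_int (Legendre (int q) (int p)))"
proof -
  have "2 * (if Legendre (int q) (int p) = 1 then 1 else 0) = 1 + real_of_int (Legendre (int q) (int p))"
    if "(p, q) \<in> region X" for p q
  proof -
    have "prime p" "prime q" "p \<noteq> q"
      using that primes_1_mod_8D unfolding region_def region_fst_def region_snd_def by auto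
    hence "\<not> int p dvd int q" using primes_dvd_imp_eq by auto
    thus ?thesis using Legendre_values[of "int q" "int p"] Legendre_eq_0_iff[of "int q" "int p"] by auto
  qed
  hence "(\<Sum>(p, q)\<in>region X. 2 * (if Legendre (int q) (int p) = 1 then 1 else 0))
    = (\<Sum>(p, q)\<in>region X. 1 + real_of_int (Legendre (int q) (int p)))" by (intro sum.cong) auto
  moreover have "real (card (split_region X)) = (\<Sum>(p, q)\<in>region X. if Legendre (int q) (int p)
    = 1 then 1 else 0)"
    unfolding split_region_def
    using finite_region(3) by (simp add: case_prod_unfold sum.inter_filter[symmetric])
  ultimately show ?thesis by (simp add: case_prod_unfold sum.distrib sum_distrib_left[symmetric])
qed

theorem split_region_bigo: "pq_scale \<in> O(\<lambda>X. real (card (split_region X)))"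
proof -
  obtain c where c: "c > 0" "eventually (\<lambda>X. c * pq_scale X \<le> real (card (region X))) at_top"
    using card_region_ge by blast
  have "eventually (\<lambda>X. \<bar>\<Sum>(p, q)\<in>region X. of_int (Legendre (int q) (int p))\<bar> \<le> c / 2 * \<bar>pq_scale X\<bar>) at_top"
    using landau_o.smallD[OF Legendre_negligible[unfolded negligible_def], of "c / 2"] c(1) by simp
  moreover have "eventually (\<lambda>X. pq_scale X > 0) at_top" unfolding pq_scale_def by real_asymp
  ultimately have "eventually (\<lambda>X. norm (pq_scale X) \<le> 4 / c * norm (real (card (split_region X)))) at_top"
    using c(2)
  proof eventually_elim
    case (elim X)
    have "c * pq_scale X \<le> 4 * real (card (split_region X))" using elim card_split_region[of X] by simp
    thus ?case using elim(2) c(1) by (simp add: field_simps)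
  qed
  thus ?thesis by (rule bigoI)
qed

subsection \<open>Pairs outside the main region\<close>

lemma card_prime_pairs_le:
  assumes X: "X \<ge> 4" and P: "finite P" "\<And>p. p \<in> P \<Longrightarrow> prime p \<and> real p * real p \<le> X"
  shows "finite (SIGMA p:P. {q. prime q \<and> real p * real q \<le> X})"
    "real (card (SIGMA p:P. {q. prime q \<and> real p * real q \<le> X})) \<le> 20 * X / ln X * (\<Sum>p\<in>P. 1 / real p)"
proof -
  let ?Q = "\<lambda>p. {q. prime q \<and> real p * real q \<le> X}"
  have Q: "?Q p = {q. prime q \<and> real q \<le> X / real p}" if "p \<in> P" for p
    using P(2)[OF that] prime_gt_0_nat[of p] by (auto simp: field_simps)
  hence finite: "finite (?Q p)" if "p \<in> P" for p using that finite_if_le_real[of "?Q p" "X / real p"] by simp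
  thus "finite (Sigma P ?Q)" using P(1) by (intro finite_SigmaI)
  have "real (card (?Q p)) \<le> 20 * X / ln X * (1 / real p)" if p: "p \<in> P" for p
  proof -
    have p2: "real p \<ge> 2" using P(2)[OF p] prime_ge_2_nat[of p] by simp
    hence "real p < X" using P(2)[OF p] mult_right_mono[OF p2, of "real p"] by linarith
    have le: "real p \<le> X / real p" using P(2)[OF p] p2 by (simp add: field_simps)
    hence "ln (real p) \<le> ln (X / real p)" using p2 by (intro ln_mono) auto
    moreover have "ln (X / real p) = ln X - ln (real p)" using X p2 by (simp add: ln_div)
    ultimately have ln_le: "ln X / 2 \<le> ln (X / real p)" by simp
    have "real (card (?Q p)) \<le> 10 * (X / real p) / ln (X / real p)"
      unfolding Q[OF p] by (rule prime_count_le) (use le p2 in linarith)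
    also have "... \<le> 10 * (X / real p) / (ln X / 2)"
      using ln_le X p2 \<open>real p < X\<close> by (intro divide_left_mono mult_pos_pos) auto
    finally show ?thesis using p2 by (simp add: mult.commute)
  qed
  hence "(\<Sum>p\<in>P. real (card (?Q p))) \<le> (\<Sum>p\<in>P. 20 * X / ln X * (1 / real p))" by (rule sum_mono)
  thus "real (card (Sigma P ?Q)) \<le> 20 * X / ln X * (\<Sum>p\<in>P. 1 / real p)"
    using P(1) finite by (simp add: card_SigmaI sum_distrib_left)
qed

definition exceptional_pairs :: "real \<Rightarrow> (nat \<times> nat) set" where
  "exceptional_pairs X = {(p, q). prime p \<and> prime q \<and> p < q \<and> real p * real q \<le> X
    \<and> \<not> (low_cut X < real p \<and> real p \<le> high_cut X \<and> high_cut X < real q)}"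

lemma card_exceptional_pairs_le:
  assumes X: "X \<ge> 4"
  shows "finite (exceptional_pairs X)" and "real (card (exceptional_pairs X)) \<le> 20 * X / ln X *
    ((\<Sum>p\<in>{p. prime p \<and> real p \<le> 2 * (ln X)^2}. 1 / real p) + (\<Sum>p\<in>{p. prime p \<and> high_cut X \<le> real p
    \<and> real p \<le> X}. 1 / real p)) + high_cut X^2"
proof -
  define A B where "A = {p. prime p \<and> real p \<le> 2 * (ln X)^2}"
    and "B = {p. prime p \<and> high_cut X \<le> real p \<and> real p \<le> X}"
  define P T where "P = {p \<in> A \<union> B. real p * real p \<le> X}" and "T = {p. prime p \<and> real p \<le> high_cut X}"
  let ?S = "SIGMA p:P. {q. prime q \<and> real p * real q \<le> X}"
  have finite: "finite A" "finite B" "finite T" "finite P"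
    using finite_if_le_real[of A "2 * (ln X)^2"] finite_if_le_real[of B X]
      finite_if_le_real[of T "high_cut X"]
    by (auto simp: A_def B_def T_def P_def)
  have P: "prime p \<and> real p * real p \<le> X" if "p \<in> P" for p using that unfolding P_def A_def B_def by auto
  note S = card_prime_pairs_le[OF X finite(4) P]
  have subset: "exceptional_pairs X \<subseteq> ?S \<union> T \<times> T"
  proof (rule subrelI)
    fix p q assume "(p, q) \<in> exceptional_pairs X"
    hence pq: "prime p" "prime q" "p < q" "real p * real q \<le> X"
      and outside: "\<not> (low_cut X < real p \<and> real p \<le> high_cut X \<and> high_cut X < real q)"
        unfolding exceptional_pairs_def by auto
    have square: "real p * real p \<le> X" using mult_left_mono[of "real p" "real q" "real p"] pq(3,4) by simp
    have "real p \<le> real p * real p" using prime_ge_1_nat[OF pq(1)] by simp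
    hence "real p \<le> X" using square by linarith
    thus "(p, q) \<in> ?S \<union> T \<times> T"
      using outside square pq low_cut(2)[of X] X unfolding P_def T_def A_def B_def by auto
  qed
  thus "finite (exceptional_pairs X)" by (rule finite_subset) (use S(1) finite(3) in auto)
  have "card (exceptional_pairs X) \<le> card ?S + card (T \<times> T)"
    by (rule order_trans[OF card_mono[OF _ subset] card_Un_le]) (use S(1) finite(3) in auto)
  hence "real (card (exceptional_pairs X)) \<le> real (card ?S) + real (card T) * real (card T)"
    unfolding card_cartesian_product of_nat_mult[symmetric] of_nat_add[symmetric] by (rule of_nat_mono)
  moreover have "real (card T) \<le> high_cut X" unfolding T_def
    by (rule card_primes_le, rule finite_if_le_real[of _ "high_cut X"]) (auto simp: high_cut_def)
  hence "real (card T) * real (card T) \<le> high_cut X^2"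
    unfolding power2_eq_square by (intro mult_mono) (auto simp: high_cut_def)
  moreover have "(\<Sum>p\<in>P. 1 / real p) \<le> (\<Sum>p\<in>A \<union> B. 1 / real p)"
    using finite by (intro sum_mono2) (auto simp: P_def)
  hence "(\<Sum>p\<in>P. 1 / real p) \<le> (\<Sum>p\<in>A. 1 / real p) + (\<Sum>p\<in>B. 1 / real p)"
    using finite sum.union_inter[of A B "\<lambda>p. 1 / real p"] sum_nonneg[of "A \<inter> B" "\<lambda>p. 1 / real p"] by simp
  hence "20 * X / ln X * (\<Sum>p\<in>P. 1 / real p) \<le> 20 * X / ln X * ((\<Sum>p\<in>A. 1 / real p) + (\<Sum>p\<in>B. 1 / real p))"
    using X by (intro mult_left_mono) auto
  ultimately show "real (card (exceptional_pairs X)) \<le> 20 * X / ln X *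
    ((\<Sum>p\<in>{p. prime p \<and> real p \<le> 2 * (ln X)^2}. 1 / real p) + (\<Sum>p\<in>{p. prime p \<and> high_cut X \<le> real p
    \<and> real p \<le> X}. 1 / real p)) + high_cut X^2"
    using S(2) unfolding A_def B_def by linarith
qed

theorem exceptional_pairs_smallo: "(\<lambda>X. real (card (exceptional_pairs X))) \<in> o(pq_scale)"
proof -
  obtain C where C: "C \<ge> 0"
    "\<And>x y. 1 < y \<Longrightarrow> 1 \<le> x \<Longrightarrow> (\<Sum>p\<in>{p. prime p \<and> y \<le> real p \<and> real p \<le> x}. 1 / real p) \<le> (ln x + C) / ln y"
    using sum_inverse_primes_le by blast
  define small where "small X = (\<Sum>p\<in>{p. prime p \<and> real p \<le> 2 * (ln X)^2}. 1 / real p)" for X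
  define bound where "bound X = 20 * (X / ln X * (small X + (ln X + C) / ln (X powr (1 / 7) / 2)))
    + (X powr (1 / 7))^2" for X
  have "filterlim (\<lambda>X::real. 2 * (ln X)^2) at_top at_top" by real_asymp
  from landau_o.big.compose[OF sum_inverse_primes_bigo this] have "small \<in> O(\<lambda>X. sqrt (ln (2 * (ln X)^2)))"
    unfolding small_def .
  also have "(\<lambda>X. sqrt (ln (2 * (ln X)^2))) \<in> o(\<lambda>X. ln (ln X))" by real_asymp
  finally have "(\<lambda>X. small X + (ln X + C) / ln (X powr (1 / 7) / 2)) \<in> o(\<lambda>X. ln (ln X))"
    by (rule sum_in_smallo) real_asymp
  hence "(\<lambda>X. X / ln X * (small X + (ln X + C) / ln (X powr (1 / 7) / 2))) \<in> o(\<lambda>X. X / ln X * ln (ln X))"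
    by (rule landau_o.small.mult_left)
  moreover have "(\<lambda>X::real. (X powr (1 / 7))^2) \<in> o(\<lambda>X. X / ln X * ln (ln X))" by real_asymp
  ultimately have "bound \<in> o(\<lambda>X. X / ln X * ln (ln X))" unfolding bound_def
    by (intro sum_in_smallo(1) iffD2[OF landau_o.small.cmult_in_iff]) simp_all
  hence bound: "bound \<in> o(pq_scale)" unfolding pq_scale_def by simp
  have "eventually (\<lambda>X::real. X powr (1 / 7) / 2 > 1) at_top" by real_asymp
  hence "eventually (\<lambda>X. norm (real (card (exceptional_pairs X))) \<le> 1 * norm (bound X)) at_top"
    using eventually_ge_at_top[of 4]
  proof eventually_elim
    case (elim X)
    have high: "high_cut X > 1" "X powr (1 / 7) / 2 \<le> high_cut X" "high_cut X \<le> X powr (1 / 7)"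
      using high_cut[of X] elim by linarith+
    have "(\<Sum>p\<in>{p. prime p \<and> high_cut X \<le> real p \<and> real p \<le> X}. 1 / real p) \<le> (ln X + C) / ln (high_cut X)"
      using C(2)[OF high(1), of X] elim by simp
    also have "... \<le> (ln X + C) / ln (X powr (1 / 7) / 2)"
      using high elim C(1) by (intro divide_left_mono mult_pos_pos ln_mono add_nonneg_nonneg) auto
    finally have "20 * X / ln X * (small X + (\<Sum>p\<in>{p. prime p \<and> high_cut X \<le> real p \<and> real p \<le> X}. 1 / real p))
      \<le> 20 * X / ln X * (small X + (ln X + C) / ln (X powr (1 / 7) / 2))" using elim
      by (intro mult_left_mono add_left_mono) auto
    moreover have "high_cut X^2 \<le> (X powr (1 / 7))^2" using high by (intro power_mono) auto
    ultimately have "real (card (exceptional_pairs X)) \<le> bound X"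
      using card_exceptional_pairs_le(2)[OF elim(2)] unfolding bound_def small_def by simp
    thus ?case by simp
  qed
  from landau_o.big_small_trans[OF bigoI[OF this] bound] show ?thesis .
qed

subsection \<open>Lower density\<close>

lemma Liminf_ratio_ge:
  fixes N M S e e' :: "real \<Rightarrow> real"
  assumes N: "eventually (\<lambda>X. S X + e X \<le> D * N X) at_top" and M: "eventually (\<lambda>X. M X \<le> S X + e' X) at_top"
    and N_le_M: "\<And>X. N X \<le> M X" and D: "D > 0" and e: "e \<in> o(S)" "e' \<in> o(S)"
      and S: "eventually (\<lambda>X. S X > 0) at_top"
  shows "Liminf at_top (\<lambda>X. ereal (N X / M X)) \<ge> ereal (1 / D)"
proof -
  define h where "h X = (1 + e X / S X) / (1 + e' X / S X) / D" for X
  have "(h \<longlongrightarrow> (1 + 0) / (1 + 0) / D) at_top" unfolding h_def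
    using D by (intro tendsto_intros smalloD_tendsto e) auto
  hence "Liminf at_top (\<lambda>X. ereal (h X)) = ereal (1 / D)" by (intro lim_imp_Liminf) auto
  moreover have "eventually (\<lambda>X. \<bar>e X\<bar> \<le> 1 / 2 * \<bar>S X\<bar>) at_top"
    "eventually (\<lambda>X. \<bar>e' X\<bar> \<le> 1 / 2 * \<bar>S X\<bar>) at_top"
    using landau_o.smallD[OF e(1), of "1 / 2"] landau_o.smallD[OF e(2), of "1 / 2"] by simp_all
  hence "eventually (\<lambda>X. ereal (h X) \<le> ereal (N X / M X)) at_top" using N M S
  proof eventually_elim
    case (elim X)
    have pos: "S X + e X > 0" "S X + e' X > 0" using elim by linarith+
    hence "D * N X > 0" using elim by linarith
    hence N_pos: "N X > 0" using D by (simp add: zero_less_mult_iff)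
    hence M_pos: "M X > 0" using N_le_M[of X] by linarith
    have "1 + e X / S X = (S X + e X) / S X" "1 + e' X / S X = (S X + e' X) / S X"
      using elim(5) by (simp_all add: add_divide_distrib)
    hence "h X = (S X + e X) / D / (S X + e' X)" unfolding h_def using elim(5) by (simp add: mult.commute)
    also have "... \<le> N X / (S X + e' X)"
      using elim(3) D pos by (intro divide_right_mono) (auto simp: field_simps)
    also have "... \<le> N X / M X" using elim(4) pos N_pos M_pos by (intro divide_left_mono) auto
    finally show ?case by simp
  qed
  ultimately show ?thesis using Liminf_mono by metis
qed

lemma inj_on_prime_products: "inj_on (\<lambda>(p, q). p * q) {(p, q). prime p \<and> prime q \<and> p < (q::nat)}"
proof (rule inj_onI, clarify)
  fix p q p' q' :: nat
  assume pq: "prime p" "prime q" "p < q" and pq': "prime p'" "prime q'" "p' < q'"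
    and product: "p * q = p' * q'"
  have "p dvd p' * q'" "q dvd p' * q'" using product by (metis dvd_triv_left, metis dvd_triv_right)
  hence "p = p' \<or> p = q'" "q = p' \<or> q = q'" using pq pq' by (auto simp: prime_dvd_mult_iff primes_dvd_imp_eq)
  thus "p = p' \<and> q = q'" using pq(3) pq'(3) product prime_gt_0_nat[OF pq(1)] by auto
qed

lemma card_numerator_ge:
  assumes D: "D > 0" and num: "\<And>p q. p \<in> primes_1_mod_8 \<Longrightarrow> q \<in> primes_1_mod_8 \<Longrightarrow> p < q \<Longrightarrow>
    (if Legendre (int q) (int p) = 1 then 1 else 0) + F p q \<le> D * (if p * q \<in> N then 1 else 0)"
  shows "real (card (split_region X)) + (\<Sum>(p, q)\<in>region X. F p q) \<le> D * real (card {n \<in> N. real n \<le> X})"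
proof -
  let ?H = "{(p, q) \<in> region X. p * q \<in> N}"
  have region: "p \<in> primes_1_mod_8 \<and> q \<in> primes_1_mod_8 \<and> p < q \<and> real p * real q \<le> X" if "(p, q) \<in> region X"
    for p q
    using that unfolding region_def region_fst_def region_snd_def by auto
  have "real (card (split_region X)) + (\<Sum>(p, q)\<in>region X. F p q)
    = (\<Sum>(p, q)\<in>region X. (if Legendre (int q) (int p) = 1 then 1 else 0) + F p q)"
    unfolding split_region_def
    using finite_region(3) by (simp add: case_prod_unfold sum.inter_filter[symmetric] sum.distrib)
  also have "... \<le> (\<Sum>(p, q)\<in>region X. D * (if p * q \<in> N then 1 else 0))"
    using region num by (intro sum_mono) auto
  also have "... = D * real (card ?H)"
    using finite_region(3) by (simp add: case_prod_unfold sum.inter_filter[symmetric]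
      sum_distrib_left[symmetric])
  also have "card ?H = card ((\<lambda>(p, q). p * q) ` ?H)"
    using region primes_1_mod_8D(1)
    by (intro card_image[symmetric] inj_on_subset[OF inj_on_prime_products]) auto
  also have "D * real (card ((\<lambda>(p, q). p * q) ` ?H)) \<le> D * real (card {n \<in> N. real n \<le> X})"
    using D region by (intro mult_left_mono of_nat_mono card_mono finite_if_le_real[of _ X]) auto
  finally show ?thesis .
qed

lemma card_denominator_le:
  assumes den: "\<And>n. n \<in> M \<Longrightarrow> \<exists>p q. p \<in> primes_1_mod_8 \<and> q \<in> primes_1_mod_8 \<and> p < q \<and> n = p * q
    \<and> Legendre (int q) (int p) = 1" and X: "X \<ge> 4"
  shows "real (card {n \<in> M. real n \<le> X}) \<le> real (card (split_region X)) + real (card (exceptional_pairs X))"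
proof -
  have subset: "{n \<in> M. real n \<le> X} \<subseteq> (\<lambda>(p, q). p * q) ` (split_region X \<union> exceptional_pairs X)"
  proof
    fix n assume n: "n \<in> {n \<in> M. real n \<le> X}"
    then obtain p q where pq: "p \<in> primes_1_mod_8" "q \<in> primes_1_mod_8" "p < q" "n = p * q"
      "Legendre (int q) (int p) = 1" using den by blast
    hence "(p, q) \<in> split_region X \<union> exceptional_pairs X" using n primes_1_mod_8D(1)
      unfolding split_region_def exceptional_pairs_def region_def region_fst_def region_snd_def by auto
    thus "n \<in> (\<lambda>(p, q). p * q) ` (split_region X \<union> exceptional_pairs X)" using pq(4) by force
  qed
  have "finite (split_region X)"
    by (rule finite_subset[OF _ finite_region(3)[of X]]) (auto simp: split_region_def)
  hence finite: "finite (split_region X \<union> exceptional_pairs X)"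
    using card_exceptional_pairs_le(1)[OF X] by simp
  have "card {n \<in> M. real n \<le> X} \<le> card (split_region X \<union> exceptional_pairs X)"
    by (rule order_trans[OF card_mono[OF finite_imageI[OF finite] subset] card_image_le[OF finite]])
  also have "... \<le> card (split_region X) + card (exceptional_pairs X)" by (rule card_Un_le)
  finally show ?thesis by linarith
qed

theorem Liminf_prime_products_ge:
  assumes D: "D > 0" and F: "negligible F"
    and num: "\<And>p q. p \<in> primes_1_mod_8 \<Longrightarrow> q \<in> primes_1_mod_8 \<Longrightarrow> p < q \<Longrightarrow>
    (if Legendre (int q) (int p) = 1 then 1 else 0) + F p q \<le> D * (if p * q \<in> N then 1 else 0)"
    and den: "\<And>n. n \<in> M \<Longrightarrow> \<exists>p q. p \<in> primes_1_mod_8 \<and> q \<in> primes_1_mod_8 \<and> p < q \<and> n = p * q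
      \<and> Legendre (int q) (int p) = 1"
    and N_M: "N \<subseteq> M"
  shows "Liminf at_top (\<lambda>X. ereal (real (card {n \<in> N. real n \<le> X}) / real (card {n \<in> M. real n \<le> X})))
    \<ge> ereal (1 / D)"
proof (rule Liminf_ratio_ge[OF always_eventually _ _ D])
  show "\<forall>X. real (card (split_region X)) + (\<Sum>(p, q)\<in>region X. F p q) \<le> D * real (card {n \<in> N. real n \<le> X})"
    using card_numerator_ge[OF D num] by blast
  show "eventually (\<lambda>X. real (card {n \<in> M. real n \<le> X})
    \<le> real (card (split_region X)) + real (card (exceptional_pairs X))) at_top"
    using eventually_ge_at_top[of 4] by eventually_elim (rule card_denominator_le[OF den])
  show "real (card {n \<in> N. real n \<le> X}) \<le> real (card {n \<in> M. real n \<le> X})" for X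
    using N_M by (intro of_nat_mono card_mono finite_if_le_real[of _ X]) auto
  show "(\<lambda>X. \<Sum>(p, q)\<in>region X. F p q) \<in> o(\<lambda>X. real (card (split_region X)))"
    by (rule landau_o.small_big_trans[OF F[unfolded negligible_def] split_region_bigo])
  show "(\<lambda>X. real (card (exceptional_pairs X))) \<in> o(\<lambda>X. real (card (split_region X)))"
    by (rule landau_o.small_big_trans[OF exceptional_pairs_smallo split_region_bigo])
  obtain c where c: "c > 0" "eventually (\<lambda>X. \<bar>pq_scale X\<bar> \<le> c * \<bar>real (card (split_region X))\<bar>) at_top"
    using landau_o.bigE[OF split_region_bigo] by auto
  have "eventually (\<lambda>X. pq_scale X > 0) at_top" unfolding pq_scale_def by real_asymp
  with c(2) show "eventually (\<lambda>X. real (card (split_region X)) > 0) at_top"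
    by eventually_elim (use c(1) in \<open>auto simp: zero_less_mult_iff intro!: gr0I\<close>)
qed

section \<open>Detecting a positive 8-rank by negligible symbols\<close>

definition norm_sign :: "int \<Rightarrow> nat \<Rightarrow> nat \<Rightarrow> int" where
  "norm_sign M p q = Legendre (rep_fst M q + rep_snd M q * sqrt_mod M p) (int p)"

lemma norm_sign:
  assumes p: "p \<in> primes_1_mod_8" and q: "q \<in> primes_1_mod_8" and Legendre_q_p: "Legendre (int q) (int p) = 1"
    and M: "M \<in> {2, -2, -1}"
  shows "norm_sign M p q \<in> {-1, 1}"
    "norm_symbol M j p q = norm_sign M p q * (if j then quartic p (norm_factor M * int q) else 1)"
proof -
  note p = primes_1_mod_8D(1,2)[OF p] and q = primes_1_mod_8D(1,2)[OF q]
  note p_gt_2 = Legendre_1_mod_8(3)[OF p]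
  show "norm_symbol M j p q = norm_sign M p q * (if j then quartic p (norm_factor M * int q) else 1)"
    unfolding norm_sign_def using norm_symbol_eq[OF p q M, of j] Legendre_q_p by simp
  have "Legendre (norm_factor M * int q) (int p) = 1"
    unfolding Legendre_mult[OF p(1) p_gt_2] norm_factor_def
    using Legendre_q_p Legendre_1_mod_8(1)[OF p] p by simp
  thus "norm_sign M p q \<in> {-1, 1}" unfolding norm_sign_def
    using Legendre_norm_form_factors(1)[OF p(1) p_gt_2 sqrt_mod(1)[OF p M], of "rep_fst M q" "rep_snd M q"]
    unfolding norm_rep(1)[OF q M] by blast
qed

lemma symbols_eq_0:
  assumes "p \<in> primes_1_mod_8" "q \<in> primes_1_mod_8" "Legendre (int q) (int p) \<noteq> 1"
  shows "M \<in> {2, -2, -1} \<Longrightarrow> norm_symbol M j p q = 0" "quartic p (int q) = 0"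
  using assms norm_symbol_eq[of p q M j] primes_1_mod_8D by (simp_all add: quartic_def)

lemma quartic_dyadic_small:
  assumes "\<And>p. \<bar>e p\<bar> \<le> (1::real)" shows "dyadic_small (\<lambda>p q. e p * of_int (quartic p (int q)))"
proof (rule character_dyadic_small[where g = quartic])
  show "\<bar>quartic p x\<bar> \<le> 1" for p x using quartic_values[of p x] by auto
  show "(\<Sum>x\<in>{0..<int p}. quartic p x) = 0" if "prime p" "[p = 1] (mod 8)" for p
    by (rule sum_quartic[OF that(1) cong_1_mod_8_imp_mod_4[OF that(2)]])
qed (use assms in \<open>auto simp: quartic_mod\<close>)

lemma sign_coefficients_le:
  "\<bar>real_of_int (sign16 p)\<bar> \<le> 1" "\<bar>real_of_int (quartic p 2)\<bar> \<le> 1"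
    "\<bar>real_of_int (quartic p 2 * sign16 p)\<bar> \<le> 1"
  using quartic_values[of p 2] unfolding sign16_def by auto

text \<open>If \<open>q\<close> is a square modulo \<open>p\<close>, the sums of symbols below, increased by 1, expand products of two or three
  factors \<open>1 + s\<close>, one for each sign \<open>s\<close> that has to be 1.\<close>

definition symbol_sum_imaginary :: "nat \<Rightarrow> nat \<Rightarrow> real" where
  "symbol_sum_imaginary p q = of_int (quartic p 2 * sign16 p) * of_int (norm_symbol 2 False p q)
    + 1 * of_int (quartic p (int q)) + of_int (quartic p 2 * sign16 p) * of_int (norm_symbol 2 True p q)"

definition symbol_sum_real :: "nat \<Rightarrow> nat \<Rightarrow> real" where
  "symbol_sum_real p q = of_int (sign16 p) * of_int (norm_symbol 2 False p q)
    + of_int (quartic p 2) * of_int (quartic p (int q)) + 1 * of_int (norm_symbol (-2) True p q)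
    + of_int (quartic p 2 * sign16 p) * of_int (norm_symbol 2 True p q)
    + 1 * of_int (norm_symbol (-1) True p q)
    + of_int (quartic p 2) * of_int (norm_symbol (-2) False p q) + 1 * of_int (norm_symbol (-1) False p q)"

lemma symbol_sums_negligible: "negligible symbol_sum_imaginary" "negligible symbol_sum_real"
  unfolding symbol_sum_imaginary_def symbol_sum_real_def
  by (intro negligible_add dyadic_small_imp_negligible norm_symbol_dyadic_small quartic_dyadic_small
    sign_coefficients_le; simp)+

context
  fixes p q :: nat
  assumes p: "p \<in> primes_1_mod_8" and q: "q \<in> primes_1_mod_8" and p_less_q: "p < q"
begin

lemma symbol_sum_imaginary_le:
  "(if Legendre (int q) (int p) = 1 then 1 else 0) + symbol_sum_imaginary p q
    \<le> 4 * (if rank_8_pos (- 4 * int (p * q)) then 1 else 0)"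
proof (cases "Legendre (int q) (int p) = 1")
  case False
  thus ?thesis unfolding symbol_sum_imaginary_def using symbols_eq_0[OF p q False] by simp
next
  case True
  note prime_p = primes_1_mod_8D(1,2)[OF p] and prime_q = primes_1_mod_8D(1,2)[OF q]
  define s t where "s = quartic p 2 * (sign16 p * norm_sign 2 p q)" and "t = quartic p (int q)"
  have signs: "s \<in> {-1, 1}" "t \<in> {-1, 1}"
    using quartic_sign[OF Legendre_1_mod_8(1)[OF prime_p]] norm_sign(1)[OF p q True, of 2]
      quartic_sign[OF True]
    unfolding s_def t_def sign16_def by auto
  have rep: "int q = rep_fst 2 q * rep_fst 2 q - 2 * (rep_snd 2 q * rep_snd 2 q)"
    using norm_rep(1)[OF prime_q, of 2] by (simp add: norm_factor_def)
  have "rank_8_pos (- 4 * int (p * q))" if "s = 1" "t = 1"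
    by (rule rank_8_imaginary[OF prime_p prime_q less_imp_neq[OF p_less_q] True rep sqrt_mod(1)[OF prime_p]])
      (use that in \<open>auto simp: s_def t_def norm_sign_def\<close>)
  hence "real_of_int ((1 + s) * (1 + t)) \<le> 4 * (if rank_8_pos (- 4 * int (p * q)) then 1 else 0)"
    using signs by auto
  moreover have "1 + symbol_sum_imaginary p q = real_of_int ((1 + s) * (1 + t))"
    using norm_sign(2)[OF p q True, of 2] unfolding symbol_sum_imaginary_def s_def t_def
    by (simp add: norm_factor_def algebra_simps)
  ultimately show ?thesis using True by simp
qed

lemma symbol_sum_real_eq:
  assumes Legendre_q_p: "Legendre (int q) (int p) = 1"
  defines "a \<equiv> quartic p 2" and "t \<equiv> quartic p (int q)" and "s \<equiv> sign16 p * norm_sign 2 p q"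
    and "y \<equiv> quartic p (int q) * norm_sign (-2) p q" and "z \<equiv> norm_sign (-1) p q"
  shows "quartic p (2 * int q) = a * t" "a \<in> {-1, 1}" "t \<in> {-1, 1}" "s \<in> {-1, 1}" "y \<in> {-1, 1}" "z \<in> {-1, 1}"
    "1 + symbol_sum_real p q = real_of_int (1 + s + a * t + y + a * t * s + a * t * z + a * t * y + z)"
proof -
  note prime_p = primes_1_mod_8D(1,2)[OF p]
  note norm_signs = norm_sign[OF p q Legendre_q_p]
  show quartic_2q: "quartic p (2 * int q) = a * t" unfolding a_def t_def
    by (rule quartic_mult[OF prime_p(1) cong_1_mod_8_imp_mod_4[OF prime_p(2)] Legendre_1_mod_8(1)[OF
      prime_p]])
  show signs: "a \<in> {-1, 1}" "t \<in> {-1, 1}" "s \<in> {-1, 1}" "y \<in> {-1, 1}" "z \<in> {-1, 1}"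
    using quartic_sign[OF Legendre_1_mod_8(1)[OF prime_p]] quartic_sign[OF Legendre_q_p]
      norm_signs(1)[of 2] norm_signs(1)[of "-2"] norm_signs(1)[of "-1"]
    unfolding a_def t_def s_def y_def z_def sign16_def by auto
  show "1 + symbol_sum_real p q = real_of_int (1 + s + a * t + y + a * t * s + a * t * z + a * t * y + z)"
    using norm_signs(2)[of 2 True] norm_signs(2)[of 2 False] norm_signs(2)[of "-2" True]
      norm_signs(2)[of "-2" False]
      norm_signs(2)[of "-1" True] norm_signs(2)[of "-1" False] quartic_2q signs(2)
    unfolding symbol_sum_real_def a_def s_def y_def z_def t_def by (auto simp: norm_factor_def algebra_simps)
qed

lemma symbol_sum_real_le:
  "(if Legendre (int q) (int p) = 1 then 1 else 0) + symbol_sum_real p q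
    \<le> 8 * (if rank_8_pos (8 * int (p * q)) then 1 else 0)"
proof (cases "Legendre (int q) (int p) = 1")
  case False
  thus ?thesis unfolding symbol_sum_real_def using symbols_eq_0[OF p q False] by simp
next
  case True
  note prime_p = primes_1_mod_8D(1,2)[OF p] and prime_q = primes_1_mod_8D(1,2)[OF q]
  define a t s y z where "a = quartic p 2" and "t = quartic p (int q)" and "s = sign16 p * norm_sign 2 p q"
    and "y = quartic p (int q) * norm_sign (-2) p q" and "z = norm_sign (-1) p q"
  note expansion = symbol_sum_real_eq[OF True, folded a_def t_def s_def y_def z_def]
  have quartic_neg_2q: "quartic p (- (2 * int q)) = a * t"
    using quartic_mult[OF prime_p(1) cong_1_mod_8_imp_mod_4[OF prime_p(2)] Legendre_1_mod_8(2)[OF prime_p], of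
      "2 * int q"]
      quartic_minus_1[OF prime_p] expansion(1) by simp
  have rep: "int q = rep_fst 2 q * rep_fst 2 q - 2 * (rep_snd 2 q * rep_snd 2 q)"
    "int q = rep_fst (-2) q * rep_fst (-2) q + 2 * (rep_snd (-2) q * rep_snd (-2) q)"
    "2 * int q = rep_fst (-1) q * rep_fst (-1) q + rep_snd (-1) q * rep_snd (-1) q"
    using norm_rep(1)[OF prime_q, of 2] norm_rep(1)[OF prime_q, of "-2"] norm_rep(1)[OF prime_q, of "-1"]
    by (simp_all add: norm_factor_def)
  note roots = sqrt_mod(1)[OF prime_p, of 2, simplified] sqrt_mod(1)[OF prime_p, of "-2", simplified]
      sqrt_mod(1)[OF prime_p, of "-1", simplified]
  note hyps = prime_p prime_q less_imp_neq[OF p_less_q] True rep(1) roots(1) rep(2) roots(2)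
  have product: "s * y = a * t * z"
    using real_sign_product[OF hyps rep(3) roots(3)] unfolding expansion(1) s_def y_def z_def norm_sign_def .
  have "rank_8_pos (8 * int (p * q))" if "s = 1" "a * t = 1" "y = 1"
    by (rule rank_8_real[OF hyps]) (use that quartic_neg_2q in \<open>auto simp: s_def t_def y_def norm_sign_def\<close>)
  hence "real_of_int ((1 + s) * (1 + a * t) * (1 + y)) \<le> 8 * (if rank_8_pos (8 * int (p * q)) then 1 else 0)"
    using expansion(2-6) by auto
  moreover have "1 + symbol_sum_real p q = real_of_int ((1 + s) * (1 + a * t) * (1 + y))"
  proof -
    have "1 + s + a * t + y + a * t * s + a * t * z + a * t * y + z = 1 + s + a * t + y + a * t * s + s * y
      + a * t * y + s * y * (a * t)"
      unfolding product using expansion(2-6) by auto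
    also have "... = (1 + s) * (1 + a * t) * (1 + y)" by (simp add: algebra_simps)
    finally show ?thesis unfolding expansion(7) by (rule arg_cong)
  qed
  ultimately show ?thesis using True by simp
qed

lemma prime_product_mem: "p * q \<in> products_two_primes_1_mod_4"
  unfolding products_two_primes_1_mod_4_def
  using primes_1_mod_8D[OF p] primes_1_mod_8D[OF q] cong_1_mod_8_imp_mod_4 p_less_q
  by (intro CollectI exI[of _ p] exI[of _ q]) auto

end

lemma rank_8_pos_symbol_sum:
  assumes "d \<in> {-4, 8}"
  obtains F where "negligible F" "\<And>p q. p \<in> primes_1_mod_8 \<Longrightarrow> q \<in> primes_1_mod_8 \<Longrightarrow> p < q \<Longrightarrow>
    (if Legendre (int q) (int p) = 1 then 1 else 0) + F p q
    \<le> real_of_int \<bar>d\<bar> * (if p * q \<in> {n \<in> products_two_primes_1_mod_4. rank_8_pos (d * int n)} then 1 else 0)"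
  using assms
proof (elim insertE emptyE)
  assume "d = -4"
  thus thesis using that[OF symbol_sums_negligible(1)] symbol_sum_imaginary_le prime_product_mem by simp
next
  assume "d = 8"
  thus thesis using that[OF symbol_sums_negligible(2)] symbol_sum_real_le prime_product_mem by simp
qed

lemma rank_4_eq_2_imp_ordered_primes:
  assumes d: "d \<in> {-4, 8}"
    and n: "n \<in> {n \<in> products_two_primes_1_mod_4. prime_power_rank 2 2 (narrow_class_group (d * int n)) = 2}"
  shows "\<exists>p q. p \<in> primes_1_mod_8 \<and> q \<in> primes_1_mod_8 \<and> p < q \<and> n = p * q \<and> Legendre (int q) (int p) = 1"
proof -
  obtain p q where pq: "prime p" "prime q" "p \<noteq> q" "[p = 1] (mod 4)" "[q = 1] (mod 4)" "n = p * q"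
    using n unfolding products_two_primes_1_mod_4_def by auto
  have "\<exists>p q. p < q \<and> prime p \<and> prime q \<and> [p = 1] (mod 4) \<and> [q = 1] (mod 4) \<and> n = p * q"
    using pq by (cases "p < q") (metis, metis mult.commute nat_neq_iff)
  then obtain p q where pq: "p < q" "prime p" "prime q" "[p = 1] (mod 4)" "[q = 1] (mod 4)" "n = p * q"
    by blast
  have "p \<noteq> q" "prime_power_rank 2 2 (narrow_class_group (d * int (p * q))) = 2" using n pq by auto
  thus ?thesis using rank_4_eq_2_imp[OF pq(2,4,3,5) _ d] pq unfolding primes_1_mod_8_def by blast
qed

theorem mainTheorem1:
  fixes d :: int
  assumes "d \<in> {-4, 8}"
  shows "Liminf at_top (\<lambda>X :: real. ereal (
      real (card {n \<in> products_two_primes_1_mod_4. real n \<le> X \<and>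
        prime_power_rank 2 2 (narrow_class_group (d * int n)) = 2 \<and>
        prime_power_rank 2 3 (narrow_class_group (d * int n)) \<ge> 1}) /
      real (card {n \<in> products_two_primes_1_mod_4. real n \<le> X \<and>
        prime_power_rank 2 2 (narrow_class_group (d * int n)) = 2})))
    \<ge> ereal (1 / real_of_int \<bar>d\<bar>)"
proof -
  define N where "N = {n \<in> products_two_primes_1_mod_4. rank_8_pos (d * int n)}"
  define M where "M = {n \<in> products_two_primes_1_mod_4. prime_power_rank 2 2 (narrow_class_group (d * int n))
    = 2}"
  obtain F where F: "negligible F" "\<And>p q. p \<in> primes_1_mod_8 \<Longrightarrow> q \<in> primes_1_mod_8 \<Longrightarrow> p < q \<Longrightarrow>
    (if Legendre (int q) (int p) = 1 then 1 else 0) + F p q \<le> real_of_int \<bar>d\<bar> * (if p * q \<in> N then 1 else 0)"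
    using rank_8_pos_symbol_sum[OF assms, folded N_def] by blast
  have "Liminf at_top (\<lambda>X. ereal (real (card {n \<in> N. real n \<le> X}) / real (card {n \<in> M. real n \<le> X})))
    \<ge> ereal (1 / real_of_int \<bar>d\<bar>)"
    by (rule Liminf_prime_products_ge[OF _ F rank_4_eq_2_imp_ordered_primes[OF assms, folded M_def]])
      (use assms in \<open>auto simp: N_def M_def\<close>)
  moreover have "{n \<in> N. real n \<le> X} = {n \<in> products_two_primes_1_mod_4. real n \<le> X \<and> rank_8_pos (d * int n)}"
    "{n \<in> M. real n \<le> X} = {n \<in> products_two_primes_1_mod_4. real n \<le> X
      \<and> prime_power_rank 2 2 (narrow_class_group (d * int n)) = 2}" for X
    unfolding N_def M_def by auto
  ultimately show ?thesis by simp
qed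

end
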